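(* Let $(M,\omega)$ be a closed symplectic manifold. Let $\|\cdot\|$ be any $\mathrm{Ham}(M,\omega)$-invariant pseudo norm on $\mathcal{A}=C^\infty_0(M)$ that is continuous in the $C^\infty$-topology. Then $\|\cdot\|$ is dominated from above by the $L_\infty$-norm, i.e. there is a constant $C$ such that $\|f\|\leq C\|f\|_\infty$ for all $f\in\mathcal{A}$.
   Context: $(M,\omega)$ is a closed (compact, without boundary) $2n$-dimensional symplectic manifold. For a smooth time-dependent function $H:M\times[0,1]\to\mathbb{R}$, $H_t(x)=H(x,t)$, the vector field $X_{H_t}$ is defined by $i_{X_{H_t}}\omega=-dH_t$, and $\phi^t_H$ denotes its flow. $\mathrm{Ham}(M,\omega)=\{\phi^1_H\}$ is the group of all time-one maps of such Hamiltonian flows. $\mathcal{A}=C^\infty_0(M)$ is the space of smooth functions $f:M\to\mathbb{R}$ with $\int_M f\,\omega^n=0$; it is identified with the Lie algebra of $\mathrm{Ham}(M,\omega)$, with adjoint action $\mathrm{Ad}_\phi f=f\circ\phi^{-1}$. A pseudo norm is a seminorm (possibly degenerate). A pseudo norm $\|\cdot\|$ on $\mathcal{A}$ is $\mathrm{Ham}(M,\omega)$-invariant if $\|f\circ\phi^{-1}\|=\|f\|$ for all $f\in\mathcal{A}$, $\phi\in\mathrm{Ham}(M,\omega)$. $\|f\|_\infty=\max_M|f|$. *)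

theory Defs
  imports "HOL-Analysis.Analysis"
begin

section \<open>Smooth maps between Euclidean spaces\<close>

text \<open>\<open>iter_deriv [v1, ..., vk] f\<close> is the iterated directional derivative
  \<open>D_v1 (... (D_vk f))\<close>.\<close>

fun iter_deriv ::
  "'e list \<Rightarrow> ('e::euclidean_space \<Rightarrow> 'f::euclidean_space) \<Rightarrow> 'e \<Rightarrow> 'f" where
  "iter_deriv [] f = f"
| "iter_deriv (v # vs) f = (\<lambda>x. frechet_derivative (iter_deriv vs f) (at x) v)"

text \<open>For open \<open>U\<close>, a map all of whose iterated directional derivatives exist and are
  (Frechet) differentiable on \<open>U\<close> is exactly a map of class \<open>C\<^sup>\<infinity>\<close> on \<open>U\<close>.\<close>

definition smooth_on_open ::
  "'e set \<Rightarrow> ('e::euclidean_space \<Rightarrow> 'f::euclidean_space) \<Rightarrow> bool" where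
  "smooth_on_open U f \<longleftrightarrow>
     open U \<and> (\<forall>vs. \<forall>x\<in>U. iter_deriv vs f differentiable (at x))"

text \<open>Smoothness on an arbitrary subset means local extendability to smooth maps on open sets;
  it is needed for functions on \<open>M \<times> [0,1]\<close>.  On open sets it agrees with the above.\<close>

definition smooth_on ::
  "'e set \<Rightarrow> ('e::euclidean_space \<Rightarrow> 'f::euclidean_space) \<Rightarrow> bool" where
  "smooth_on S f \<longleftrightarrow>
     (\<forall>x\<in>S. \<exists>U g. x \<in> U \<and> smooth_on_open U g \<and> (\<forall>y\<in>U \<inter> S. g y = f y))"


section \<open>Closed smooth manifolds\<close>

text \<open>The manifold is the whole type \<open>'a\<close>; the model space is \<open>'e\<close>.  A chart is a pair of a
  domain and a coordinate map, the values of the latter outside of the domain being irrelevant.\<close>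

type_synonym ('a, 'e) chart = "'a set \<times> ('a \<Rightarrow> 'e)"

definition chart_image :: "('a, 'e) chart \<Rightarrow> 'e set" where
  "chart_image c = snd c ` fst c"

definition chart_inv :: "('a, 'e) chart \<Rightarrow> 'e \<Rightarrow> 'a" where
  "chart_inv c = inv_into (fst c) (snd c)"

definition is_chart :: "('a::topological_space, 'e::euclidean_space) chart \<Rightarrow> bool" where
  "is_chart c \<longleftrightarrow> open (fst c) \<and> open (chart_image c) \<and>
     homeomorphism (fst c) (chart_image c) (snd c) (chart_inv c)"

definition transition :: "('a, 'e) chart \<Rightarrow> ('a, 'e) chart \<Rightarrow> 'e \<Rightarrow> 'e" where
  "transition c d = snd d \<circ> chart_inv c"

definition smooth_atlas ::
  "('a::topological_space, 'e::euclidean_space) chart set \<Rightarrow> bool" where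
  "smooth_atlas \<A> \<longleftrightarrow>
     (\<forall>c\<in>\<A>. is_chart c) \<and> (\<Union>c\<in>\<A>. fst c) = UNIV \<and>
     (\<forall>c\<in>\<A>. \<forall>d\<in>\<A>. smooth_on (snd c ` (fst c \<inter> fst d)) (transition c d))"

text \<open>Second countability follows from compactness.\<close>

definition closed_manifold :: "('a::t2_space, 'e::euclidean_space) chart set \<Rightarrow> bool" where
  "closed_manifold \<A> \<longleftrightarrow> compact (UNIV :: 'a set) \<and> smooth_atlas \<A>"

definition smooth_fun ::
  "('a::topological_space, 'e::euclidean_space) chart set \<Rightarrow> ('a \<Rightarrow> real) \<Rightarrow> bool" where
  "smooth_fun \<A> f \<longleftrightarrow> (\<forall>c\<in>\<A>. smooth_on (chart_image c) (f \<circ> chart_inv c))"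

text \<open>Smooth functions \<open>H\<close> on \<open>M \<times> [0,1]\<close>; \<open>H t\<close> is relevant for \<open>t \<in> [0,1]\<close> only.\<close>

definition smooth_time_fun ::
  "('a::topological_space, 'e::euclidean_space) chart set \<Rightarrow> (real \<Rightarrow> 'a \<Rightarrow> real) \<Rightarrow> bool" where
  "smooth_time_fun \<A> H \<longleftrightarrow>
     (\<forall>c\<in>\<A>. smooth_on (chart_image c \<times> {0..1}) (\<lambda>(y, t). H t (chart_inv c y)))"


section \<open>Symplectic forms\<close>

text \<open>A 2-form is given by its local representatives: \<open>\<omega> c y u v\<close> is the value, at the point
  with coordinates \<open>y\<close> in the chart \<open>c\<close>, on the tangent vectors with coordinates \<open>u\<close>, \<open>v\<close>.\<close>

type_synonym ('a, 'e) two_form = "('a, 'e) chart \<Rightarrow> 'e \<Rightarrow> 'e \<Rightarrow> 'e \<Rightarrow> real"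

definition smooth_two_form ::
  "('a::topological_space, 'e::euclidean_space) chart set \<Rightarrow> ('a, 'e) two_form \<Rightarrow> bool" where
  "smooth_two_form \<A> \<omega> \<longleftrightarrow>
     (\<forall>c\<in>\<A>. \<forall>y\<in>chart_image c. bilinear (\<omega> c y) \<and> (\<forall>v. \<omega> c y v v = 0)) \<and>
     (\<forall>c\<in>\<A>. \<forall>u v. smooth_on (chart_image c) (\<lambda>y. \<omega> c y u v)) \<and>
     (\<forall>c\<in>\<A>. \<forall>d\<in>\<A>. \<forall>x\<in>fst c \<inter> fst d. \<forall>u v.
        \<omega> c (snd c x) u v =
        \<omega> d (snd d x) (frechet_derivative (transition c d) (at (snd c x)) u)
                       (frechet_derivative (transition c d) (at (snd c x)) v))"

definition closed_two_form ::
  "('a, 'e::euclidean_space) chart set \<Rightarrow> ('a, 'e) two_form \<Rightarrow> bool" where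
  "closed_two_form \<A> \<omega> \<longleftrightarrow>
     (\<forall>c\<in>\<A>. \<forall>y\<in>chart_image c. \<forall>u v w.
        frechet_derivative (\<lambda>z. \<omega> c z v w) (at y) u
        - frechet_derivative (\<lambda>z. \<omega> c z u w) (at y) v
        + frechet_derivative (\<lambda>z. \<omega> c z u v) (at y) w = 0)"

definition nondegenerate_two_form ::
  "('a, 'e::euclidean_space) chart set \<Rightarrow> ('a, 'e) two_form \<Rightarrow> bool" where
  "nondegenerate_two_form \<A> \<omega> \<longleftrightarrow>
     (\<forall>c\<in>\<A>. \<forall>y\<in>chart_image c. \<forall>u. (\<forall>v. \<omega> c y u v = 0) \<longrightarrow> u = 0)"

definition closed_symplectic_manifold ::
  "('a::t2_space, 'e::euclidean_space) chart set \<Rightarrow> ('a, 'e) two_form \<Rightarrow> bool" where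
  "closed_symplectic_manifold \<A> \<omega> \<longleftrightarrow>
     closed_manifold \<A> \<and> even DIM('e) \<and>
     smooth_two_form \<A> \<omega> \<and> closed_two_form \<A> \<omega> \<and> nondegenerate_two_form \<A> \<omega>"


section \<open>Hamiltonian flows\<close>

text \<open>The local representative in the chart \<open>c\<close> of the vector field \<open>X\<close> with
  \<open>\<omega>(X, \<cdot>) = - dh\<close>.\<close>

definition ham_vector_field ::
  "('a, 'e::euclidean_space) two_form \<Rightarrow> ('a \<Rightarrow> real) \<Rightarrow> ('a, 'e) chart \<Rightarrow> 'e \<Rightarrow> 'e" where
  "ham_vector_field \<omega> h c y =
     (THE u. \<forall>v. \<omega> c y u v = - frechet_derivative (h \<circ> chart_inv c) (at y) v)"

text \<open>The coordinate expression of a trajectory is only meaningful while the trajectory stays in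
  the chart domain; continuity in \<open>M\<close> ensures that it does so for times near \<open>t\<close>.\<close>

definition is_ham_flow ::
  "('a::topological_space, 'e::euclidean_space) chart set \<Rightarrow> ('a, 'e) two_form \<Rightarrow>
   (real \<Rightarrow> 'a \<Rightarrow> real) \<Rightarrow> (real \<Rightarrow> 'a \<Rightarrow> 'a) \<Rightarrow> bool" where
  "is_ham_flow \<A> \<omega> H \<phi> \<longleftrightarrow>
     (\<forall>x. \<phi> 0 x = x \<and> continuous_on {0..1} (\<lambda>t. \<phi> t x) \<and>
        (\<forall>t\<in>{0..1}. \<forall>c\<in>\<A>. \<phi> t x \<in> fst c \<longrightarrow>
           ((\<lambda>s. snd c (\<phi> s x)) has_vector_derivative
              ham_vector_field \<omega> (H t) c (snd c (\<phi> t x))) (at t within {0..1})))"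

definition Ham ::
  "('a::topological_space, 'e::euclidean_space) chart set \<Rightarrow> ('a, 'e) two_form \<Rightarrow>
   ('a \<Rightarrow> 'a) set" where
  "Ham \<A> \<omega> = {\<phi> 1 | H \<phi>. smooth_time_fun \<A> H \<and> is_ham_flow \<A> \<omega> H \<phi>}"


section \<open>Integration against the Liouville volume form\<close>

text \<open>The absolute value of \<open>\<omega>\<^sup>n(e_0, ..., e_(2n-1))\<close> at the point with coordinates \<open>y\<close>, where
  \<open>2n\<close> is the dimension and \<open>e\<close> enumerates the standard basis: the \<open>n\<close>-fold wedge power evaluates
  to \<open>1/2\<^sup>n\<close> times the alternating sum below.  The absolute value accounts for \<open>M\<close> being oriented
  by \<open>\<omega>\<^sup>n\<close>, and makes the choice of the enumeration immaterial.\<close>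

definition liouville_density ::
  "('a, 'e::euclidean_space) two_form \<Rightarrow> ('a, 'e) chart \<Rightarrow> 'e \<Rightarrow> real" where
  "liouville_density \<omega> c y =
     (let n = DIM('e) div 2; e = (SOME e. bij_betw e {..<DIM('e)} (Basis :: 'e set)) in
      \<bar>(\<Sum>p | p permutes {..<DIM('e)}.
          of_int (sign p) * (\<Prod>i<n. \<omega> c y (e (p (2 * i))) (e (p (2 * i + 1))))) / 2 ^ n\<bar>)"

definition partition_of_unity ::
  "('a::topological_space, 'e::euclidean_space) chart set \<Rightarrow>
   ('a, 'e) chart set \<Rightarrow> (('a, 'e) chart \<Rightarrow> 'a \<Rightarrow> real) \<Rightarrow> bool" where
  "partition_of_unity \<A> F \<rho> \<longleftrightarrow>
     finite F \<and> F \<subseteq> \<A> \<and>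
     (\<forall>c\<in>F. smooth_fun \<A> (\<rho> c) \<and> (\<forall>x. 0 \<le> \<rho> c x) \<and> closure {x. \<rho> c x \<noteq> 0} \<subseteq> fst c) \<and>
     (\<forall>x. (\<Sum>c\<in>F. \<rho> c x) = 1)"

text \<open>The integral of \<open>f \<omega>\<^sup>n\<close> over \<open>M\<close>; it does not depend on the chosen partition of unity.\<close>

definition liouville_integral ::
  "('a::topological_space, 'e::euclidean_space) chart set \<Rightarrow> ('a, 'e) two_form \<Rightarrow>
   ('a \<Rightarrow> real) \<Rightarrow> real" where
  "liouville_integral \<A> \<omega> f =
     (let (F, \<rho>) = (SOME (F, \<rho>). partition_of_unity \<A> F \<rho>) in
      \<Sum>c\<in>F. integral (chart_image c)
        (\<lambda>y. \<rho> c (chart_inv c y) * f (chart_inv c y) * liouville_density \<omega> c y))"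

definition zero_mean_functions ::
  "('a::topological_space, 'e::euclidean_space) chart set \<Rightarrow> ('a, 'e) two_form \<Rightarrow>
   ('a \<Rightarrow> real) set" where
  "zero_mean_functions \<A> \<omega> = {f. smooth_fun \<A> f \<and> liouville_integral \<A> \<omega> f = 0}"


section \<open>Pseudo norms on function spaces\<close>

definition pseudo_norm_on :: "('a \<Rightarrow> real) set \<Rightarrow> (('a \<Rightarrow> real) \<Rightarrow> real) \<Rightarrow> bool" where
  "pseudo_norm_on V N \<longleftrightarrow>
     (\<forall>f\<in>V. 0 \<le> N f) \<and>
     (\<forall>f\<in>V. \<forall>r. N (\<lambda>x. r * f x) = \<bar>r\<bar> * N f) \<and>
     (\<forall>f\<in>V. \<forall>g\<in>V. N (\<lambda>x. f x + g x) \<le> N f + N g)"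

text \<open>The \<open>C\<^sup>\<infinity>\<close>-topology on the space of smooth functions is generated by the balls of the
  seminorms measuring, in some chart, an iterated derivative uniformly on a compact set.\<close>

definition smooth_ball ::
  "('a::topological_space, 'e::euclidean_space) chart set \<Rightarrow> ('a, 'e) chart \<Rightarrow> 'e set \<Rightarrow>
   'e list \<Rightarrow> ('a \<Rightarrow> real) \<Rightarrow> real \<Rightarrow> ('a \<Rightarrow> real) set" where
  "smooth_ball \<A> c K vs f \<epsilon> =
     {g. smooth_fun \<A> g \<and>
         (\<forall>y\<in>K. \<bar>iter_deriv vs (\<lambda>z. g (chart_inv c z) - f (chart_inv c z)) y\<bar> < \<epsilon>)}"

definition smooth_topology ::
  "('a::topological_space, 'e::euclidean_space) chart set \<Rightarrow> ('a \<Rightarrow> real) topology" where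
  "smooth_topology \<A> = topology_generated_by
     {smooth_ball \<A> c K vs f \<epsilon> | c K vs f \<epsilon>.
        c \<in> \<A> \<and> compact K \<and> K \<subseteq> chart_image c \<and> smooth_fun \<A> f \<and> 0 < \<epsilon>}"

definition sup_norm :: "('a \<Rightarrow> real) \<Rightarrow> real" where
  "sup_norm f = (SUP x. \<bar>f x\<bar>)"

end

theory Submission imports Defs begin

text \<open>
Fix a Darboux chart, normalised so that the standard basis is symplectic up to scaling. Subtracting the mean turns the pseudo
norm into a seminorm \<open>n\<close> on the test functions of a cube that is controlled by finitely many derivatives and invariant under
the Hamiltonian flows of a larger cube. By a partition of unity it suffices to show \<open>n f \<le> C sup |f|\<close> for such an \<open>n\<close>.

For a conjugate pair of coordinates x, y let F be y times a cutoff. A flow changes any g by at most \<open>2 n g\<close>, however strong it is.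
Shearing F in the direction y yields functions \<open>k(x) w(z)\<close> with \<open>n\<close> bounded independently of k and w, in particular sums
of bumps of width \<delta> on a lattice of cells. A second flow rescales the x-width of these bumps by \<open>1 + v\<close>, where v is any small test
function whose integrals along the y-lines vanish. The changes, averaged over the offset of the lattice, tend to a constant
multiple of v as \<delta> tends to 0, so \<open>n v\<close> is bounded by a constant, and by homogeneity by \<open>C sup |v|\<close>. Replacing f successively
by its averages along the coordinate directions writes f as a sum of such v and a multiple of one fixed function.
\<close>

section \<open>Calculus of smooth maps\<close>

text \<open>The obstacle: continuity bounds n only through derivatives, while the estimate may use
  only values. Bumps of width \<delta> have derivatives that explode, but as differences of the form
  F o \<psi> - F they inherit a bound from the single function F; continuity then enters in passing
  to limits. After averaging over the offsets, the change of the bumps is a smooth function of (q,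
  \<delta>) down to \<delta> = 0, so it converges with all derivatives. Its limit is a multiple of v
  because the integral of bump (x / (1 + v)) - bump x is v times the integral of bump.

  Inside a cell with centre s, the inverse of the rescaling flow at time t is the area preserving
  map from (x - s, y) to ((x - s) / (1 + t v(y)), y + t V(y)), where V' = v. It has compact support
  in y only if V vanishes at both ends, which is why v must have vanishing integrals along the
  y-lines.

  An explicit formula for a flow holds only where all cutoffs are 1. Hence every trajectory in
  question has to be shown never to leave such a region, by a continuity argument.\<close>

abbreviation "smooth \<equiv> smooth_on_open"
abbreviation "Df f x \<equiv> frechet_derivative f (at x)"

text \<open>Smoothness is handled one order at a time: closure under products and composition is an
  induction on the order. The derivative is existentially quantified, so a proof may supply its own
  formula, and it is tested in fixed directions only, so that every class consists of maps between
  Euclidean spaces.\<close>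

fun Ck :: "nat => 'a::euclidean_space set => ('a => 'b::euclidean_space) => bool" where
 "Ck 0 U f = continuous_on U f"
| "Ck (Suc k) U f = (\<exists>f'. (\<forall>x\<in>U. (f has_derivative f' x) (at x)) \<and> (\<forall>v. Ck k U (%x. f' x v)))"

lemma Ck_SucI:
 assumes "!!x. x \<in> U ==> (f has_derivative f' x) (at x)" "!!v. Ck k U (%x. f' x v)"
 shows "Ck (Suc k) U f" using assms by auto

lemma Ck_Suc_imp: "Ck (Suc k) U f ==> Ck k U f"
proof (induction k arbitrary: f)
 case 0
 thus ?case by (metis Ck.simps has_derivative_continuous continuous_at_imp_continuous_on)
next
 case (Suc k)
 thus ?case by (metis Ck.simps(2))
qed

lemma Ck_mono: "Ck k U f ==> j \<le> k ==> Ck j U f"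
proof (induction k arbitrary: f)
 case 0 thus ?case by simp
next
 case (Suc k) thus ?case using Ck_Suc_imp[of k U f] by (cases "j = Suc k") auto
qed

lemma Ck_continuous: "Ck k U f ==> continuous_on U f" using Ck_mono[of k U f 0] by simp

lemma Ck_subset: "Ck k U f ==> V \<subseteq> U ==> Ck k V f"
proof (induction k arbitrary: f)
 case 0 thus ?case by (auto intro: continuous_on_subset)
next
 case (Suc k)
 then obtain f' where "\<forall>x\<in>U. (f has_derivative f' x) (at x)" "\<forall>v. Ck k U (%x. f' x v)" by auto
 thus ?case using Suc.IH[OF _ Suc.prems(2)] Suc.prems(2) by (intro Ck_SucI[of V f f']) auto
qed

lemma Ck_cong:
 assumes "open U" "!!x. x \<in> U ==> f x = g x" "Ck k U f"
 shows "Ck k U g"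
proof (cases k)
 case 0 thus ?thesis using assms by (auto cong: continuous_on_cong)
next
 case (Suc j)
 with assms obtain f' where f': "\<forall>x\<in>U. (f has_derivative f' x) (at x)" "\<forall>v. Ck j U (%x. f' x v)" by auto
 have "(g has_derivative f' x) (at x)" if "x \<in> U" for x using has_derivative_transform_within_open[of f "f' x" x UNIV U g] that assms f' by auto
 thus ?thesis using f' Suc by auto
qed

text \<open>The derivatives found on the various neighbourhoods agree because a Frechet derivative
  at a point is unique; \<open>Df\<close> serves as the common one.\<close>

lemma Ck_local:
 assumes "!!x. x \<in> U ==> \<exists>V. open V \<and> x \<in> V \<and> Ck k V f"
 shows "Ck k U f" using assms
proof (induction k arbitrary: f)
 case 0
 have "continuous (at x) f" if "x \<in> U" for x using 0 that by (metis Ck.simps(1) continuous_on_eq_continuous_at)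
 thus ?case by (simp add: continuous_at_imp_continuous_on)
next
 case (Suc k)
 have d: "(f has_derivative Df f x) (at x)" if x: "x \<in> U" for x
 proof -
  obtain V where "open V" "x \<in> V" "Ck (Suc k) V f" using Suc.prems x by blast
  then obtain f' where "(f has_derivative f' x) (at x)" by auto
  thus ?thesis using differentiableI frechet_derivative_works by blast
 qed
 have "Ck k U (%x. Df f x v)" for v
 proof (rule Suc.IH)
  fix x assume "x \<in> U"
  then obtain V where V: "open V" "x \<in> V" "Ck (Suc k) V f" using Suc.prems by blast
  then obtain f' where f': "\<forall>x\<in>V. (f has_derivative f' x) (at x)" "\<forall>v. Ck k V (%x. f' x v)" by auto
  have "Ck k V (%x. Df f x v)" by (rule Ck_cong[OF V(1) _ f'(2)[rule_format, of v]]) (use f'(1) frechet_derivative_at in metis)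
  thus "\<exists>V. open V \<and> x \<in> V \<and> Ck k V (%x. Df f x v)" using V by blast
 qed
 thus ?case using d Ck_SucI by metis
qed

lemma Ck_const: "Ck k U (%x. c)"
proof (induction k arbitrary: c)
 case (Suc k)
 show ?case by (rule Ck_SucI[where f'="%x v. 0"]) (use Suc in auto)
qed simp

lemma Ck_bounded_linear:
 assumes "bounded_linear L" "Ck k U f"
 shows "Ck k U (%x. L (f x))" using assms(2)
proof (induction k arbitrary: f)
 case 0 thus ?case using assms(1) by (simp add: bounded_linear.continuous_on)
next
 case (Suc k)
 then obtain f' where f': "\<forall>x\<in>U. (f has_derivative f' x) (at x)" "\<forall>v. Ck k U (%x. f' x v)" by auto
 show ?case by (rule Ck_SucI[where f'="%x v. L (f' x v)"])
   (use f' Suc.IH in \<open>auto intro!: bounded_linear.has_derivative[OF assms(1)]\<close>)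
qed

lemma Ck_id: "Ck k U (%x. x)"
proof (cases k)
 case (Suc j)
 thus ?thesis by (simp, intro exI[of _ "%x v. v"]) (auto simp: Ck_const)
qed simp

lemma Ck_linear: "bounded_linear L ==> Ck k U L" using Ck_bounded_linear[OF _ Ck_id] by blast

lemma Ck_add:
 assumes "Ck k U f" "Ck k U g"
 shows "Ck k U (%x. f x + g x)" using assms
proof (induction k arbitrary: f g)
 case 0 thus ?case by (simp add: continuous_on_add)
next
 case (Suc k)
 then obtain f' g' where f': "\<forall>x\<in>U. (f has_derivative f' x) (at x)" "\<forall>v. Ck k U (%x. f' x v)"
  and g': "\<forall>x\<in>U. (g has_derivative g' x) (at x)" "\<forall>v. Ck k U (%x. g' x v)" by auto
 show ?case by (rule Ck_SucI[where f'="%x v. f' x v + g' x v"])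
   (use f' g' Suc.IH in \<open>auto intro!: has_derivative_add\<close>)
qed

lemma Ck_sum: "(!!i. i \<in> I ==> Ck k U (f i)) ==> Ck k U (%x. \<Sum>i\<in>I. f i x)" by (induction I rule: infinite_finite_induct) (auto simp: Ck_const Ck_add)

lemma Ck_bilinear:
 assumes "bounded_bilinear pr" "Ck k U f" "Ck k U g"
 shows "Ck k U (%x. pr (f x) (g x))" using assms(2,3)
proof (induction k arbitrary: f g)
 case 0 thus ?case using bounded_bilinear.continuous_on[OF assms(1)] by auto
next
 case (Suc k)
 then obtain f' g' where f': "\<forall>x\<in>U. (f has_derivative f' x) (at x)" "\<forall>v. Ck k U (%x. f' x v)"
  and g': "\<forall>x\<in>U. (g has_derivative g' x) (at x)" "\<forall>v. Ck k U (%x. g' x v)" by auto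
 have "Ck k U f" "Ck k U g" using Suc.prems Ck_Suc_imp by blast+
 thus ?case by (intro Ck_SucI[where f'="%x v. pr (f x) (g' x v) + pr (f' x v) (g x)"])
   (use f' g' Suc.IH in \<open>auto intro!: Ck_add bounded_bilinear.FDERIV[OF assms(1)]\<close>)
qed

lemmas Ck_scaleR = Ck_bilinear[OF bounded_bilinear_scaleR]
lemmas Ck_mult = Ck_bilinear[OF bounded_bilinear_mult[where 'a=real]]
lemmas Ck_inner = Ck_bilinear[OF bounded_bilinear_inner]

lemma linear_expand:
 assumes "linear L"
 shows "L v = (\<Sum>b\<in>Basis. (v \<bullet> b) *\<^sub>R L b)"
proof -
 have "L v = L (\<Sum>b\<in>Basis. (v \<bullet> b) *\<^sub>R b)" by (simp add: euclidean_representation)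
 also have "... = (\<Sum>b\<in>Basis. (v \<bullet> b) *\<^sub>R L b)" using assms by (simp add: linear_sum linear_scale)
 finally show ?thesis .
qed

lemma Ck_compose:
 assumes "Ck k V f" "Ck k U g" "g ` U \<subseteq> V"
 shows "Ck k U (%x. f (g x))" using assms(1,2)
proof (induction k arbitrary: f)
 case 0
 thus ?case using assms(3) by (auto intro: continuous_on_compose2)
next
 case (Suc k)
 then obtain f' g' where f': "\<forall>x\<in>V. (f has_derivative f' x) (at x)" "\<forall>v. Ck k V (%x. f' x v)"
  and g': "\<forall>x\<in>U. (g has_derivative g' x) (at x)" "\<forall>v. Ck k U (%x. g' x v)" by auto
 have gk: "Ck k U g" using Suc.prems Ck_Suc_imp by blast
 show ?case
 \<comment> \<open>The hypotheses control f' only in fixed directions, so the moving direction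
   \<open>g' x v\<close> is expanded in the basis and moved into scalar coefficients.\<close>
 proof (rule Ck_SucI[where f'="%x v. \<Sum>b\<in>Basis. (g' x v \<bullet> b) *\<^sub>R f' (g x) b"])
  fix x assume x: "x \<in> U"
  have "((%x. f (g x)) has_derivative (%v. f' (g x) (g' x v))) (at x)" using has_derivative_compose[of g "g' x" x UNIV f "f' (g x)"] f' g' x assms(3) by auto
  moreover have "f' (g x) (g' x v) = (\<Sum>b\<in>Basis. (g' x v \<bullet> b) *\<^sub>R f' (g x) b)" for v
   using f'(1) x assms(3) by (intro linear_expand) (auto dest: has_derivative_linear)
  ultimately show "((%x. f (g x)) has_derivative (%v. \<Sum>b\<in>Basis. (g' x v \<bullet> b) *\<^sub>R f' (g x) b)) (at x)" by simp
 next
  fix v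
  show "Ck k U (%x. \<Sum>b\<in>Basis. (g' x v \<bullet> b) *\<^sub>R f' (g x) b)" by (intro Ck_sum Ck_scaleR Ck_inner Ck_const Suc.IH gk) (use f' g' in auto)
 qed
qed

lemma Ck_Pair:
 assumes "Ck k U f" "Ck k U g"
 shows "Ck k U (%x. (f x, g x))"
proof -
 have "Ck k U (%x. (f x, 0) + (0, g x))" by (intro Ck_add Ck_bounded_linear[of "%x. (x, 0)"] Ck_bounded_linear[of "%x. (0, x)"] assms
    bounded_linear_Pair bounded_linear_ident bounded_linear_zero)
 thus ?thesis by simp
qed

lemma Ck_inverse_real: "Ck k (- {0}) (inverse :: real => real)"
proof (induction k)
 case 0 thus ?case by (auto intro!: continuous_intros)
next
 case (Suc k)
 show ?case
 proof (rule Ck_SucI[where f'="%x v. (- v) * (inverse x * inverse x)"])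
  fix x :: real assume "x \<in> - {0}"
  thus "(inverse has_derivative (%v. (- v) * (inverse x * inverse x))) (at x)" by (auto intro!: derivative_eq_intros simp: field_simps)
 qed (intro Ck_mult Ck_const Suc)
qed

lemma Ck_inverse:
 fixes f :: "'a::euclidean_space => real"
 assumes "Ck k U f" "!!x. x \<in> U ==> f x ~= 0"
 shows "Ck k U (%x. inverse (f x))" by (rule Ck_compose[OF Ck_inverse_real assms(1)]) (use assms(2) in auto)

text \<open>Both directions are proved for all iterated derivatives at once, since one more
  derivative lengthens the list by one and lowers the order by one.\<close>

lemma smooth_Ck: "smooth U f \<longleftrightarrow> open U \<and> (\<forall>k. Ck k U f)"
proof safe
 fix k assume sm: "smooth U f"
 thus "open U" by (simp add: smooth_on_open_def)
 have *: "Ck k U (iter_deriv vs f)" for vs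
 proof (induction k arbitrary: vs)
  case 0
  have "continuous (at x) (iter_deriv vs f)" if "x \<in> U" for x using sm that by (auto simp: smooth_on_open_def intro: differentiable_imp_continuous_within)
  thus ?case by (simp add: continuous_at_imp_continuous_on)
 next
  case (Suc k)
  show ?case
  proof (rule Ck_SucI[where f'="%x. Df (iter_deriv vs f) x"])
   fix x assume "x \<in> U"
   thus "(iter_deriv vs f has_derivative Df (iter_deriv vs f) x) (at x)" using sm by (simp add: smooth_on_open_def frechet_derivative_works[symmetric])
  next
   fix v show "Ck k U (%x. Df (iter_deriv vs f) x v)" using Suc[of "v # vs"] by simp
  qed
 qed
 show "Ck k U f" using *[of "[]"] by simp
next
 assume U: "open U" and C: "\<forall>k. Ck k U f"
 have *: "\<forall>k. Ck k U (iter_deriv vs f)" for vs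
 proof (induction vs)
  case Nil thus ?case using C by simp
 next
  case (Cons v vs)
  have "Ck k U (%x. Df (iter_deriv vs f) x v)" for k
  proof -
   obtain f' where f': "\<forall>x\<in>U. (iter_deriv vs f has_derivative f' x) (at x)" "\<forall>v. Ck k U (%x. f' x v)" using Cons Ck.simps(2) by metis
   show ?thesis by (rule Ck_cong[OF U _ f'(2)[rule_format, of v]])
     (use f'(1) frechet_derivative_at in metis)
  qed
  thus ?case by simp
 qed
 have "iter_deriv vs f differentiable (at x)" if "x \<in> U" for x vs using *[of vs, rule_format, of "Suc 0"] that by (auto simp: differentiable_def)
 thus "smooth U f" using U by (simp add: smooth_on_open_def)
qed

named_theorems smooth_intros

lemma smooth_open: "smooth U f ==> open U" by (simp add: smooth_on_open_def)

lemma smooth_const [smooth_intros]: "open U ==> smooth U (%x. c)" by (simp add: smooth_Ck Ck_const)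
lemma smooth_id [smooth_intros]: "open U ==> smooth U (%x. x)" by (simp add: smooth_Ck Ck_id)
lemma smooth_bounded_linear: "bounded_linear L ==> smooth U f ==> smooth U (%x. L (f x))" by (simp add: smooth_Ck Ck_bounded_linear)
lemma smooth_add [smooth_intros]: "smooth U f ==> smooth U g ==> smooth U (%x. f x + g x)" by (simp add: smooth_Ck Ck_add)
lemma smooth_minus [smooth_intros]: "smooth U f ==> smooth U (%x. - f x)"
 by (rule smooth_bounded_linear[of uminus]) (auto intro: bounded_linear_minus bounded_linear_ident)
lemma smooth_diff [smooth_intros]: "smooth U f ==> smooth U g ==> smooth U (%x. f x - g x)" using smooth_add[OF _ smooth_minus, of U f g] by simp
lemma smooth_sum [smooth_intros]: "open U ==> (!!i. i \<in> I ==> smooth U (f i)) ==> smooth U (%x. \<Sum>i\<in>I. f i x)" by (simp add: smooth_Ck Ck_sum)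
lemma smooth_scaleR [smooth_intros]: "smooth U f ==> smooth U g ==> smooth U (%x. f x *\<^sub>R g x)" by (simp add: smooth_Ck Ck_scaleR)
lemma smooth_mult [smooth_intros]: "smooth U f ==> smooth U g ==> smooth U (%x. f x * g x :: real)" by (simp add: smooth_Ck Ck_mult)
lemma smooth_prod [smooth_intros]: "open U ==> (!!i. i \<in> I ==> smooth U (f i)) ==> smooth U (%x. \<Prod>i\<in>I. f i x :: real)"
proof (induction I rule: infinite_finite_induct)
 case (insert i I)
 thus ?case by (simp add: smooth_mult)
qed (simp_all add: smooth_const)
lemma smooth_inner [smooth_intros]: "smooth U f ==> smooth U g ==> smooth U (%x. f x \<bullet> g x)" by (simp add: smooth_Ck Ck_inner)
lemma smooth_Pair [smooth_intros]: "smooth U f ==> smooth U g ==> smooth U (%x. (f x, g x))" by (simp add: smooth_Ck Ck_Pair)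
lemma smooth_fst [smooth_intros]: "smooth U f ==> smooth U (%x. fst (f x))" by (rule smooth_bounded_linear[OF bounded_linear_fst])
lemma smooth_snd [smooth_intros]: "smooth U f ==> smooth U (%x. snd (f x))" by (rule smooth_bounded_linear[OF bounded_linear_snd])
lemma smooth_inverse [smooth_intros]:
 "smooth U f ==> (!!x. x \<in> U ==> f x ~= 0) ==> smooth U (%x. inverse (f x :: real))" by (simp add: smooth_Ck Ck_inverse)
lemma smooth_divide [smooth_intros]:
 "smooth U f ==> smooth U g ==> (!!x. x \<in> U ==> g x ~= 0) ==> smooth U (%x. f x / g x :: real)"
 unfolding divide_inverse by (intro smooth_intros)
lemma smooth_compose: "smooth V f ==> smooth U g ==> g ` U \<subseteq> V ==> smooth U (%x. f (g x))"
 unfolding smooth_Ck using Ck_compose[of _ V f U g] by blast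
lemma smooth_comp: "smooth UNIV f ==> smooth U g ==> smooth U (%x. f (g x))" by (rule smooth_compose) auto
lemma smooth_cong: "(!!x. x \<in> U ==> f x = g x) ==> smooth U f ==> smooth U g" unfolding smooth_Ck using Ck_cong[of U f g] by blast
lemma smooth_subset: "smooth U f ==> V \<subseteq> U ==> open V ==> smooth V f" unfolding smooth_Ck using Ck_subset[of _ U f V] by blast
lemma smooth_local: "(!!x. x \<in> U ==> \<exists>V. x \<in> V \<and> smooth V f) ==> open U ==> smooth U f"
 unfolding smooth_Ck using Ck_local[of U _ f] by metis
lemma smooth_cont: "smooth U f ==> continuous_on U f" unfolding smooth_Ck using Ck_continuous[of 0 U f] by blast

lemma smooth_deriv:
 "smooth U f ==> x \<in> U ==> (f has_derivative Df f x) (at x)" unfolding smooth_on_open_def using frechet_derivative_works iter_deriv.simps(1) by metis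

lemma iter_deriv_append: "iter_deriv (vs @ ws) f = iter_deriv vs (iter_deriv ws f)" by (induction vs) auto

lemma smooth_iter_deriv: "smooth U f ==> smooth U (iter_deriv ws f)" unfolding smooth_on_open_def by (simp flip: iter_deriv_append)

lemma smooth_frechet: "smooth U f ==> smooth U (%x. Df f x v)" using smooth_iter_deriv[of U f "[v]"] by simp

lemma smooth_derivI:
 assumes "open U" "!!x. x \<in> U ==> (f has_derivative f' x) (at x)" "!!v. smooth U (%x. f' x v)"
 shows "smooth U f"
proof -
 have "Ck k U f" for k
 proof (cases k)
  case 0
  show ?thesis unfolding 0 by (rule Ck_Suc_imp[OF Ck_SucI[of U f f']]) (use assms smooth_Ck in blast)+
 next
  case (Suc j)
  show ?thesis unfolding Suc by (rule Ck_SucI[of U f f']) (use assms smooth_Ck in blast)+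
 qed
 thus ?thesis using assms by (simp add: smooth_Ck)
qed

lemma smooth_on_open_set: "open S ==> smooth_on S f \<longleftrightarrow> smooth S f"
proof
 assume S: "open S" and f: "smooth_on S f"
 show "smooth S f"
 proof (rule smooth_local[OF _ S])
  fix x assume "x \<in> S"
  then obtain U g where U: "x \<in> U" "smooth U g" "\<forall>y\<in>U \<inter> S. g y = f y" using f unfolding smooth_on_def by blast
  have "smooth (U \<inter> S) f" by (rule smooth_cong[of _ g]) (use U S in \<open>auto intro: smooth_subset dest: smooth_open\<close>)
  thus "\<exists>V. x \<in> V \<and> smooth V f" using U \<open>x \<in> S\<close> by blast
 qed
qed (unfold smooth_on_def, blast)

lemma iter_deriv_cong:
 assumes "open U" "!!x. x \<in> U ==> f x = g x" "x \<in> U"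
 shows "iter_deriv vs f x = iter_deriv vs g x" using assms(3)
proof (induction vs arbitrary: x)
 case Nil thus ?case using assms by simp
next
 case (Cons v vs)
 have eq: "iter_deriv vs f y = iter_deriv vs g y" if "y \<in> U" for y using Cons.IH that .
 \<comment> \<open>\<open>frechet_derivative\<close> is a choice from the set of derivatives at x.
   Functions that agree near x have the same set, so the choices agree even where no derivative
   exists.\<close>
 have "(iter_deriv vs f has_derivative D) (at x) \<longleftrightarrow> (iter_deriv vs g has_derivative D) (at x)" for D
  by (rule iffI; erule has_derivative_transform_within_open[OF _ assms(1) Cons.prems]) (simp_all add: eq)
 thus ?case by (simp add: frechet_derivative_def)
qed

lemma Df_cong:
 fixes f g :: "'a::euclidean_space => 'b::euclidean_space"
 assumes "open U" "!!x. x \<in> U ==> f x = g x" "x \<in> U"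
 shows "Df f x = Df g x"
proof
 fix v show "Df f x v = Df g x v" using iter_deriv_cong[of U f g x "[v]"] assms by simp
qed

lemma iter_deriv_add:
 assumes "smooth U f" "smooth U g" "x \<in> U"
 shows "iter_deriv vs (%x. f x + g x) x = iter_deriv vs f x + iter_deriv vs g x" using assms(3)
proof (induction vs arbitrary: x)
 case (Cons v vs)
 have "Df (iter_deriv vs (%x. f x + g x)) x =
    Df (%x. iter_deriv vs f x + iter_deriv vs g x) x" by (rule Df_cong[OF smooth_open[OF assms(1)] Cons.IH Cons.prems])
 also have "... = (%v. Df (iter_deriv vs f) x v + Df (iter_deriv vs g) x v)" using has_derivative_add[OF smooth_deriv[OF smooth_iter_deriv[OF assms(1)] Cons.prems]
   smooth_deriv[OF smooth_iter_deriv[OF assms(2)] Cons.prems]] by (rule frechet_derivative_at[symmetric])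
 finally show ?case by simp
qed simp

lemma iter_deriv_linear:
 assumes "bounded_linear L" "smooth U f" "x \<in> U"
 shows "iter_deriv vs (%x. L (f x)) x = L (iter_deriv vs f x)" using assms(3)
proof (induction vs arbitrary: x)
 case (Cons v vs)
 have "Df (iter_deriv vs (%x. L (f x))) x =
    Df (%x. L (iter_deriv vs f x)) x" by (rule Df_cong[OF smooth_open[OF assms(2)] Cons.IH Cons.prems])
 also have "... = (%v. L (Df (iter_deriv vs f) x v))" using bounded_linear.has_derivative[OF assms(1) smooth_deriv[OF smooth_iter_deriv[OF assms(2)] Cons.prems]]
  by (rule frechet_derivative_at[symmetric])
 finally show ?case by simp
qed simp

lemma iter_deriv_diff:
 assumes "smooth U f" "smooth U g" "x \<in> U"
 shows "iter_deriv vs (%x. f x - g x) x = iter_deriv vs f x - iter_deriv vs g x"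
proof -
 have "iter_deriv vs (%x. f x + - g x) x = iter_deriv vs f x + iter_deriv vs (%x. - g x) x" by (rule iter_deriv_add[OF assms(1) smooth_minus[OF assms(2)] assms(3)])
 also have "iter_deriv vs (%x. - g x) x = - iter_deriv vs g x" by (rule iter_deriv_linear[OF bounded_linear_minus[OF bounded_linear_ident] assms(2,3)])
 finally show ?thesis by simp
qed

section \<open>Cutoff functions and parametric integrals\<close>

text \<open>The powers close the family under differentiation: the derivative of a member is a
  combination of the members m + 1 and m + 2.\<close>

definition flat_fun :: "nat => real => real" where
 "flat_fun m x = (if x > 0 then inverse x ^ m * exp (- inverse x) else 0)"

lemma flat_fun_tendsto: "(flat_fun m \<longlongrightarrow> 0) (at 0)"
proof (rule filterlim_split_at)
 show "(flat_fun m \<longlongrightarrow> 0) (at_left 0)"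
 proof (rule tendsto_eventually)
  show "\<forall>\<^sub>F x in at_left 0. flat_fun m x = 0" unfolding eventually_at_left_field by (auto simp: flat_fun_def intro: exI[of _ "-1"])
 qed
 have "((%x::real. inverse x ^ m / exp (inverse x)) \<longlongrightarrow> 0) (at_right 0)"
  by (rule filterlim_compose[OF tendsto_power_div_exp_0 filterlim_inverse_at_top_right])
 thus "(flat_fun m \<longlongrightarrow> 0) (at_right 0)"
 proof (rule Lim_transform_eventually)
  show "\<forall>\<^sub>F x in at_right 0. inverse x ^ m / exp (inverse x) = flat_fun m x" unfolding eventually_at_right_field
   by (auto simp: flat_fun_def exp_minus divide_inverse intro!: exI[of _ 1])
 qed
qed

lemma flat_fun_deriv:
 "(flat_fun m has_real_derivative (flat_fun (m + 2) x - real m * flat_fun (m + 1) x)) (at x)"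
proof -
 consider "x > 0" | "x < 0" | "x = 0" by linarith
 thus ?thesis
 proof cases
  case 1
  have "((%x. inverse x ^ m * exp (- inverse x)) has_real_derivative
    (flat_fun (m + 2) x - real m * flat_fun (m + 1) x)) (at x)" using 1 by (auto intro!: derivative_eq_intros simp: flat_fun_def)
    (cases m; auto simp: field_simps power_add power2_eq_square)
  thus ?thesis by (rule DERIV_cong_ev[OF refl _ refl, THEN iffD1, rotated])
    (use 1 eventually_nhds_in_open[of "{0<..}" x] in \<open>auto elim!: eventually_mono simp: flat_fun_def\<close>)
 next
  case 2
  have "((%x. 0) has_real_derivative (flat_fun (m + 2) x - real m * flat_fun (m + 1) x)) (at x)" using 2 by (auto simp: flat_fun_def)
  thus ?thesis by (rule DERIV_cong_ev[OF refl _ refl, THEN iffD1, rotated])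
    (use 2 eventually_nhds_in_open[of "{..<0}" x] in \<open>auto elim!: eventually_mono simp: flat_fun_def\<close>)
 next
  case 3
  \<comment> \<open>At 0 the difference quotient of \<open>flat_fun m\<close> is
    \<open>flat_fun (Suc m)\<close>, which tends to 0.\<close>
  have "((%h. (flat_fun m (0 + h) - flat_fun m 0) / h) \<longlongrightarrow> 0) (at 0)" by (rule Lim_transform_eventually[OF flat_fun_tendsto[of "Suc m"]])
    (auto simp: eventually_at_filter flat_fun_def field_simps)
  thus ?thesis using 3 by (simp add: DERIV_def flat_fun_def)
 qed
qed

lemma Ck_flat_fun: "Ck k UNIV (flat_fun m)"
proof (induction k arbitrary: m)
 case 0
 have "isCont (flat_fun m) x" for x using flat_fun_deriv DERIV_isCont by blast
 thus ?case by (simp add: continuous_at_imp_continuous_on)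
next
 case (Suc k)
 show ?case
 proof (rule Ck_SucI[where f'="%x v. (flat_fun (m + 2) x + (- real m) * flat_fun (m + 1) x) * v"])
  show "Ck k UNIV (%x. (flat_fun (m + 2) x + (- real m) * flat_fun (m + 1) x) * v)" for v by (intro Ck_mult Ck_add Ck_const Suc)
 qed (use flat_fun_deriv[of m] in \<open>auto simp: has_field_derivative_def\<close>)
qed

definition smooth_step :: "real => real" where
 "smooth_step x = flat_fun 0 x / (flat_fun 0 x + flat_fun 0 (1 - x))"

lemma flat_fun_nonneg: "0 \<le> flat_fun m x" by (simp add: flat_fun_def)
lemma flat_fun_pos: "0 < x ==> 0 < flat_fun m x" by (simp add: flat_fun_def)

lemma flat_fun_denominator: "0 < flat_fun 0 x + flat_fun 0 (1 - x)"
proof (cases "0 < x")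
 case True thus ?thesis using flat_fun_pos flat_fun_nonneg add_pos_nonneg by blast
next
 case False hence "0 < 1 - x" by linarith
 thus ?thesis using flat_fun_pos flat_fun_nonneg add_nonneg_pos by blast
qed

lemma smooth_smooth_step: "smooth UNIV smooth_step"
proof -
 have f: "smooth UNIV (flat_fun 0)" by (simp add: smooth_Ck Ck_flat_fun)
 have "smooth UNIV (%x. flat_fun 0 x / (flat_fun 0 x + flat_fun 0 (1 - x)))" by (intro smooth_intros f smooth_comp[OF f] open_UNIV)
   (use flat_fun_denominator in \<open>metis less_irrefl\<close>)
 thus ?thesis by (simp add: smooth_step_def[abs_def])
qed

lemma smooth_step_0: "x \<le> 0 ==> smooth_step x = 0" by (simp add: smooth_step_def flat_fun_def)
lemma smooth_step_1: "1 \<le> x ==> smooth_step x = 1" by (simp add: smooth_step_def flat_fun_def)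
lemma smooth_step_pos: "0 < x ==> 0 < smooth_step x" unfolding smooth_step_def using flat_fun_pos flat_fun_denominator by (metis divide_pos_pos)
lemma smooth_step_nonneg: "0 \<le> smooth_step x" using smooth_step_0[of x] smooth_step_pos[of x] by (cases "x \<le> 0") auto
lemma smooth_step_le_1: "smooth_step x \<le> 1" unfolding smooth_step_def using flat_fun_denominator[of x] flat_fun_nonneg[of 0 "1 - x"] by (auto simp: divide_le_eq)

text \<open>For a < b an even plateau function: 1 on [-a, a] and positive exactly on (-b,
  b).\<close>

definition cut :: "real => real => real => real" where
 "cut a b x = smooth_step ((b - x) / (b - a)) * smooth_step ((b + x) / (b - a))"

lemma smooth_cut: "smooth UNIV (cut a b)"
proof -
 have "smooth UNIV (%x. smooth_step ((b - x) * inverse (b - a)) * smooth_step ((b + x) * inverse (b - a)))"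
  by (intro smooth_mult smooth_comp[OF smooth_smooth_step] smooth_diff smooth_add smooth_const smooth_id open_UNIV)
 thus ?thesis by (simp add: cut_def[abs_def] divide_inverse)
qed

lemma smooth_cut_compose [smooth_intros]: "smooth U f ==> smooth U (%x. cut a b (f x))" by (rule smooth_comp[OF smooth_cut])

lemma cut_nonneg: "0 \<le> cut a b x" by (simp add: cut_def smooth_step_nonneg)
lemma cut_le_1: "cut a b x \<le> 1" unfolding cut_def using mult_mono[OF smooth_step_le_1 smooth_step_le_1 zero_le_one smooth_step_nonneg] by simp
lemma cut_eq_1: "a < b ==> \<bar>x\<bar> \<le> a ==> cut a b x = 1" unfolding cut_def by (subst (1 2) smooth_step_1) (auto simp: le_divide_eq)
lemma cut_eq_0: "a < b ==> b \<le> \<bar>x\<bar> ==> cut a b x = 0" unfolding cut_def by (cases "x \<ge> 0") (auto simp: smooth_step_0 divide_le_0_iff)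
lemma cut_pos: "a < b ==> \<bar>x\<bar> < b ==> 0 < cut a b x" unfolding cut_def by (intro mult_pos_pos smooth_step_pos) auto

section \<open>Differentiation under the integral sign\<close>

lemma has_derivative_param_integral:
 fixes g :: "'e::euclidean_space \<times> 'p::euclidean_space => 'f::euclidean_space"
 assumes g: "smooth W g" and U: "open U" "U \<times> cbox a b \<subseteq> W" and x: "x \<in> U"
 shows "((%x. integral (cbox a b) (%t. g (x, t))) has_derivative
   (%v. integral (cbox a b) (%t. Df g (x, t) (v, 0)))) (at x)"
proof -
 \<comment> \<open>\<open>leibniz_rule\<close> works on a convex parameter set and with derivatives
   in the normed space of bounded linear maps; hence the ball and \<open>Blinfun\<close>.\<close>
 obtain r where r: "r > 0" "ball x r \<subseteq> U" using U(1) x openE by blast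
 define gx where "gx y t = Blinfun (%v. Df g (y, t) (v, 0))" for y t
 have sub: "(y, t) \<in> W" if "y \<in> ball x r" "t \<in> cbox a b" for y t using that r U by blast
 have bl: "bounded_linear (%v. Df g (y, t) (v, 0))" if "y \<in> ball x r" "t \<in> cbox a b" for y t
 proof -
  have "bounded_linear (Df g (y, t))" using smooth_deriv[OF g sub[OF that]] has_derivative_bounded_linear by blast
  from bounded_linear_compose[OF this, of "%v. (v, 0)"] show ?thesis by (simp add: bounded_linear_Pair bounded_linear_ident bounded_linear_zero)
 qed
 have gxa: "blinfun_apply (gx y t) v = Df g (y, t) (v, 0)"
  if "y \<in> ball x r" "t \<in> cbox a b" for y t v unfolding gx_def using bl[OF that] by (simp add: bounded_linear_Blinfun_apply)
 have d: "((%y. g (y, t)) has_derivative blinfun_apply (gx y t)) (at y within ball x r)"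
  if "y \<in> ball x r" "t \<in> cbox a b" for y t
 proof -
  have "((%y. (y, t)) has_derivative (%v. (v, 0))) (at y within ball x r)" by (auto intro!: derivative_eq_intros)
  from has_derivative_compose[OF this smooth_deriv[OF g sub[OF that]]]
  moreover have "blinfun_apply (gx y t) = (%v. Df g (y, t) (v, 0))" using gxa[OF that] by blast
  ultimately show ?thesis by simp
 qed
 have cont: "continuous_on (ball x r \<times> cbox a b) (%(y, t). gx y t)"
 proof (rule continuous_on_blinfun_componentwise)
  fix i :: 'e
  have "continuous_on (ball x r \<times> cbox a b) (%z. Df g z (i, 0))" by (rule continuous_on_subset[OF smooth_cont[OF smooth_frechet[OF g]]]) (use sub in auto)
  thus "continuous_on (ball x r \<times> cbox a b) (%z. blinfun_apply (case z of (y, t) => gx y t) i)"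
   by (rule continuous_on_cong[THEN iffD1, rotated -1]) (auto simp: gxa)
 qed
 have int: "(%t. g (y, t)) integrable_on cbox a b" if "y \<in> ball x r" for y
  by (intro integrable_continuous continuous_on_compose2[OF smooth_cont[OF g]] continuous_intros)
   (use sub that in auto)
 have "((%y. integral (cbox a b) (%t. g (y, t))) has_derivative integral (cbox a b) (gx x)) (at x within ball x r)"
  by (rule leibniz_rule[where f="%y t. g (y, t)", OF d int cont]) (use r in auto)
 moreover have "blinfun_apply (integral (cbox a b) (gx x))
    = (%v. integral (cbox a b) (%t. Df g (x, t) (v, 0)))"
 proof
  fix v
  have "continuous_on (cbox a b) (%t. (%(y, t). gx y t) (x, t))" by (rule continuous_on_compose2[OF cont]) (use r in \<open>auto intro!: continuous_intros\<close>)
  hence "gx x integrable_on cbox a b" by (simp add: integrable_continuous)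
  hence "blinfun_apply (integral (cbox a b) (gx x)) v = integral (cbox a b) (%t. blinfun_apply (gx x t) v)" by (rule blinfun_apply_integral)
  also have "... = integral (cbox a b) (%t. Df g (x, t) (v, 0))" by (rule Henstock_Kurzweil_Integration.integral_cong) (use gxa r in auto)
  finally show "blinfun_apply (integral (cbox a b) (gx x)) v
    = integral (cbox a b) (%t. Df g (x, t) (v, 0))" .
 qed
 ultimately show ?thesis using r by (simp add: at_within_open[of x "ball x r"])
qed

text \<open>Each derivative is again the parameter integral of a smooth function, so the induction
  runs over all integrands g.\<close>

lemma smooth_param_integral:
 fixes g :: "'e::euclidean_space \<times> 'p::euclidean_space => 'f::euclidean_space"
 assumes g: "smooth W g" and U: "open U" "U \<times> cbox a b \<subseteq> W"
 shows "smooth U (%x. integral (cbox a b) (%t. g (x, t)))"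
proof -
 have "Ck k U (%x. integral (cbox a b) (%t. g (x, t)))" for k using g
 proof (induction k arbitrary: g)
  case 0
  have "continuous (at x) (%x. integral (cbox a b) (%t. g (x, t)))" if "x \<in> U" for x using has_derivative_continuous[OF has_derivative_param_integral[OF 0 U that]] .
  thus ?case by (simp add: continuous_at_imp_continuous_on)
 next
  case (Suc k)
  show ?case by (rule Ck_SucI[OF has_derivative_param_integral[OF Suc.prems U] Suc.IH[OF smooth_frechet[OF Suc.prems]]])
 qed
 thus ?thesis using U by (simp add: smooth_Ck)
qed

lemma iter_deriv_param_integral:
 fixes g :: "'e::euclidean_space \<times> 'p::euclidean_space => 'f::euclidean_space"
 assumes g: "smooth W g" and U: "open U" "U \<times> cbox a b \<subseteq> W" and x: "x \<in> U"
 shows "iter_deriv vs (%x. integral (cbox a b) (%t. g (x, t))) x =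
   integral (cbox a b) (%t. iter_deriv (map (%v. (v, 0)) vs) g (x, t))" using x
proof (induction vs arbitrary: x)
 case (Cons v vs)
 have "Df (iter_deriv vs (%x. integral (cbox a b) (%t. g (x, t)))) x
  = Df (%x. integral (cbox a b) (%t. iter_deriv (map (%v. (v, 0)) vs) g (x, t))) x" by (rule Df_cong[OF U(1) Cons.IH Cons.prems])
 also have "... = (%v. integral (cbox a b) (%t. Df (iter_deriv (map (%v. (v, 0)) vs) g) (x, t) (v, 0)))"
  by (rule frechet_derivative_at[symmetric, OF has_derivative_param_integral[OF smooth_iter_deriv[OF g] U Cons.prems]])
 finally show ?case by simp
qed simp

section \<open>Ordinary differential equations\<close>

text \<open>The squared norm is differentiable also at zeros of e. The estimate 2 c |e| \<le> |e|^2
  + c^2 absorbs the forcing term and is the origin of the 1 in 2 L + 1; adding c^2 to |e|^2 makes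
  the damped quantity h nonincreasing.\<close>

lemma gronwall_forward:
 fixes e :: "real => 'e::euclidean_space"
 assumes d: "!!t. t \<in> {a..b} ==> (e has_vector_derivative e' t) (at t within {a..b})"
  and b: "!!t. t \<in> {a..b} ==> norm (e' t) \<le> L * norm (e t) + c"
  and c: "0 \<le> c" "0 \<le> L" and t: "t0 \<in> {a..b}" "t \<in> {t0..b}"
 shows "(norm (e t))\<^sup>2 \<le> ((norm (e t0))\<^sup>2 + c\<^sup>2) * exp ((2 * L + 1) * (t - t0))"
proof -
 define h where "h s = (e s \<bullet> e s + c\<^sup>2) * exp (- (2 * L + 1) * s)" for s
 have "h t \<le> h t0"
 proof (rule DERIV_nonpos_imp_decreasing_open[of t0 t h])
  show "t0 \<le> t" using t by simp
  fix s assume s: "t0 < s" "s < t"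
  hence sab: "s \<in> {a<..<b}" using t by auto
  have "(e has_vector_derivative e' s) (at s)" using d[of s] sab at_within_Icc_at[of a s b] by auto
  hence ed: "((%s. e s \<bullet> e s) has_real_derivative (2 * (e s \<bullet> e' s))) (at s)" unfolding has_vector_derivative_def has_field_derivative_def
   by (auto intro!: derivative_eq_intros simp: inner_commute)
  have "(h has_real_derivative ((2 * (e s \<bullet> e' s)) * exp (- (2 * L + 1) * s)
    + (e s \<bullet> e s + c\<^sup>2) * (exp (- (2 * L + 1) * s) * (- (2 * L + 1))))) (at s)" unfolding h_def by (rule derivative_eq_intros ed refl | simp)+
  moreover have "2 * (e s \<bullet> e' s) \<le> (2 * L + 1) * (e s \<bullet> e s + c\<^sup>2)"
  proof -
   have "2 * (e s \<bullet> e' s) \<le> 2 * (norm (e s) * norm (e' s))" using norm_cauchy_schwarz[of "e s" "e' s"] by simp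
   also have "... \<le> 2 * (norm (e s) * (L * norm (e s) + c))" using b[of s] sab by (simp add: mult_left_mono)
   also have "... \<le> (2 * L + 1) * (norm (e s))\<^sup>2 + c\<^sup>2" using zero_le_power2[of "norm (e s) - c"] by (simp add: power2_eq_square algebra_simps)
   also have "... \<le> (2 * L + 1) * (norm (e s))\<^sup>2 + (2 * L + 1) * c\<^sup>2" using c by (simp add: mult_le_cancel_right1)
   finally show ?thesis by (simp add: power2_norm_eq_inner algebra_simps)
  qed
  hence "(2 * (e s \<bullet> e' s) - (2 * L + 1) * (e s \<bullet> e s + c\<^sup>2)) * exp (- (2 * L + 1) * s) \<le> 0" by (intro mult_nonpos_nonneg) auto
  ultimately show "\<exists>y. DERIV h s :> y \<and> y \<le> 0" by (intro exI conjI) (assumption, simp add: algebra_simps)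
 next
  have "continuous_on {a..b} e" unfolding continuous_on_eq_continuous_within using d has_vector_derivative_continuous by blast
  hence "continuous_on {t0..t} e" by (rule continuous_on_subset) (use t in auto)
  thus "continuous_on {t0..t} h" unfolding h_def by (intro continuous_intros)
 qed
 hence *: "(norm (e t))\<^sup>2 + c\<^sup>2 \<le> ((norm (e t0))\<^sup>2 + c\<^sup>2) * exp ((2 * L + 1) * (t - t0))"
 proof -
  assume h: "h t \<le> h t0"
  have "(norm (e t))\<^sup>2 + c\<^sup>2 = h t * exp ((2 * L + 1) * t)" by (simp add: h_def power2_norm_eq_inner algebra_simps flip: exp_add)
  also have "... \<le> h t0 * exp ((2 * L + 1) * t)" using h by (intro mult_right_mono) auto
  also have "... = ((norm (e t0))\<^sup>2 + c\<^sup>2) * exp ((2 * L + 1) * (t - t0))" by (simp add: h_def power2_norm_eq_inner algebra_simps flip: exp_add)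
  finally show "(norm (e t))\<^sup>2 + c\<^sup>2 \<le> ((norm (e t0))\<^sup>2 + c\<^sup>2) * exp ((2 * L + 1) * (t - t0))" .
 qed
 show ?thesis using * zero_le_power2[of c] by linarith
qed

lemma gronwall:
 fixes e :: "real => 'e::euclidean_space"
 assumes d: "!!t. t \<in> {a..b} ==> (e has_vector_derivative e' t) (at t within {a..b})"
  and b: "!!t. t \<in> {a..b} ==> norm (e' t) \<le> L * norm (e t) + c"
  and c: "0 \<le> c" "0 \<le> L" and t: "t0 \<in> {a..b}" "t \<in> {a..b}"
 shows "(norm (e t))\<^sup>2 \<le> ((norm (e t0))\<^sup>2 + c\<^sup>2) * exp ((2 * L + 1) * \<bar>t - t0\<bar>)"
proof (cases "t0 \<le> t")
 case True
 thus ?thesis using gronwall_forward[OF d b c t(1), of t] t by auto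
next
 case False
 have "((%s. e (- s)) has_vector_derivative - e' (- s)) (at s within {-b..-a})" if s: "s \<in> {-b..-a}" for s
 proof -
  have "((e \<circ> uminus) has_vector_derivative (- 1) *\<^sub>R e' (- s)) (at s within {-b..-a})"
   by (rule vector_diff_chain_within) (use d[of "- s"] s in \<open>auto intro!: derivative_eq_intros\<close>)
  thus ?thesis by (simp add: o_def)
 qed
 from gronwall_forward[OF this, of L c "- t0" "- t"] show ?thesis using b c t False by auto
qed

lemma ode_unique:
 fixes u v :: "real => 'e::euclidean_space"
 assumes u: "!!t. t \<in> {a..b} ==> (u has_vector_derivative X t (u t)) (at t within {a..b})"
  and v: "!!t. t \<in> {a..b} ==> (v has_vector_derivative X t (v t)) (at t within {a..b})"
  and L: "!!t x y. t \<in> {a..b} ==> norm (X t x - X t y) \<le> L * norm (x - y)" "0 \<le> L"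
  and t: "t0 \<in> {a..b}" "u t0 = v t0" "t \<in> {a..b}"
 shows "u t = v t"
proof -
 have "(norm (u t - v t))\<^sup>2 \<le> ((norm (u t0 - v t0))\<^sup>2 + 0\<^sup>2) * exp ((2 * L + 1) * \<bar>t - t0\<bar>)"
  by (rule gronwall[where e'="%t. X t (u t) - X t (v t)", OF has_vector_derivative_diff[OF u v]])
   (use L t in auto)
 thus ?thesis using t by simp
qed

text \<open>The unknown is exp (- K t) u(t). In this weighting the Picard map has Lipschitz constant
  at most L / K \<le> 1/2 on the whole of [0, T], so no solutions on short intervals have to be
  pieced together.\<close>

lemma ode_exists_forward:
 fixes X :: "real => 'e::euclidean_space => 'e"
 assumes cont: "continuous_on ({0..T} \<times> UNIV) (%(t, x). X t x)"
  and L: "!!t x y. t \<in> {0..T} ==> norm (X t x - X t y) \<le> L * norm (x - y)" "0 \<le> L" and T: "0 \<le> T"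
 shows "\<exists>u. u 0 = p \<and> (\<forall>t\<in>{0..T}. (u has_vector_derivative X t (u t)) (at t within {0..T}))"
proof -
 define K where "K = 2 * L + 1"
 \<comment> \<open>Clamping the time to [0, T] turns functions on the interval into bounded
   continuous functions on the line, the complete space in which the fixed point is sought.\<close>
 define cl where "cl t = min (max t 0) T" for t
 have cl: "cl t \<in> {0..T}" "t \<in> {0..T} ==> cl t = t" for t using T by (auto simp: cl_def)
 define I where "I w s = X s (exp (K * s) *\<^sub>R apply_bcontfun w s)" for w :: "real \<Rightarrow>\<^sub>C 'e" and s
 define F where "F w t = exp (- K * cl t) *\<^sub>R (p + integral {0..cl t} (I w))" for w t
 have K: "K > 0" using L by (simp add: K_def)
 have I: "continuous_on {0..T} (I w)" for w unfolding I_def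
  by (rule continuous_on_compose2[OF cont, of _ "%s. (s, exp (K * s) *\<^sub>R apply_bcontfun w s)", simplified])
   (auto intro!: continuous_intros)
 have Iint: "I w integrable_on {0..t}" if "t \<in> {0..T}" for w t by (rule integrable_continuous_interval[OF continuous_on_subset[OF I]]) (use that in auto)
 have FB: "F w \<in> bcontfun" for w
 proof -
  define G where "G t = exp (- K * t) *\<^sub>R (p + integral {0..t} (I w))" for t
  have G: "continuous_on {0..T} G" unfolding G_def by (intro continuous_intros indefinite_integral_continuous_1 Iint) (use T in auto)
  have "continuous_on UNIV cl" unfolding cl_def[abs_def] by (intro continuous_intros)
  hence "continuous_on UNIV (%t. G (cl t))" by (rule continuous_on_compose2[OF G]) (use cl in auto)
  moreover have "bounded (range (%t. G (cl t)))" by (rule bounded_subset[OF compact_imp_bounded[OF compact_continuous_image[OF G compact_Icc]]]) (use cl in auto)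
  ultimately show ?thesis by (simp add: bcontfun_def F_def G_def)
 qed
 define \<T> where "\<T> w = Bcontfun (F w)" for w
 have TF: "apply_bcontfun (\<T> w) t = F w t" for w t unfolding \<T>_def using FB by (simp add: Bcontfun_inverse)
 have "dist (\<T> w) (\<T> w') \<le> 1 / 2 * dist w w'" for w w'
 proof (rule dist_bound)
  fix t
  let ?D = "dist w w'" and ?t = "cl t"
  have t: "?t \<in> {0..T}" using cl by simp
  have "norm (integral {0..?t} (%s. I w s - I w' s)) \<le> integral {0..?t} (%s. L * ?D * exp (K * s))"
  proof (rule integral_norm_bound_integral)
   fix s assume s: "s \<in> {0..?t}"
   have "norm (I w s - I w' s) \<le> L * norm (exp (K * s) *\<^sub>R apply_bcontfun w s - exp (K * s) *\<^sub>R apply_bcontfun w' s)"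
    unfolding I_def using L(1)[of s] s t by auto
   also have "... = L * (exp (K * s) * dist (apply_bcontfun w s) (apply_bcontfun w' s))" by (simp add: dist_norm flip: scaleR_diff_right)
   also have "... \<le> L * (exp (K * s) * ?D)" by (intro mult_left_mono dist_bounded L) auto
   finally show "norm (I w s - I w' s) \<le> L * ?D * exp (K * s)" by (simp add: algebra_simps)
  qed (auto intro!: integrable_diff[OF Iint[OF t] Iint[OF t]] integrable_continuous_interval continuous_intros)
  also have "integral {0..?t} (%s. L * ?D * exp (K * s)) = L * ?D / K * exp (K * ?t) - L * ?D / K * exp (K * 0)"
   by (rule integral_unique, rule fundamental_theorem_of_calculus)
    (use t K in \<open>auto intro!: derivative_eq_intros simp: has_real_derivative_iff_has_vector_derivative[symmetric]\<close>)
  also have "... \<le> L / K * ?D * exp (K * ?t)" using K L(2) by (simp add: field_simps)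
  also have "... \<le> 1 / 2 * ?D * exp (K * ?t)" by (intro mult_right_mono) (use K L(2) in \<open>auto simp: K_def divide_le_eq\<close>)
  finally have *: "norm (integral {0..?t} (I w) - integral {0..?t} (I w')) \<le> 1 / 2 * ?D * exp (K * ?t)"
   using Iint[OF t] by (simp add: Henstock_Kurzweil_Integration.integral_diff)
  have "dist (F w t) (F w' t) = exp (- K * ?t) * norm (integral {0..?t} (I w) - integral {0..?t} (I w'))" unfolding F_def dist_norm by (simp flip: scaleR_diff_right)
  also have "... \<le> exp (- K * ?t) * (1 / 2 * ?D * exp (K * ?t))" using * by (intro mult_left_mono) auto
  also have "... = 1 / 2 * ?D" by (simp add: exp_minus field_simps)
  finally show "dist (apply_bcontfun (\<T> w) t) (apply_bcontfun (\<T> w') t) \<le> 1 / 2 * ?D" by (simp add: TF)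
 qed
 hence "\<exists>!w. \<T> w = w" by (intro banach_fix_type[of "1/2"]) auto
 then obtain w where w: "\<T> w = w" by blast
 define u where "u t = p + integral {0..t} (I w)" for t
 have uw: "exp (K * t) *\<^sub>R apply_bcontfun w t = u t" if "t \<in> {0..T}" for t
 proof -
  have "apply_bcontfun w t = F w t" using TF[of w t] w by simp
  thus ?thesis using cl(2)[OF that] by (simp add: F_def u_def flip: exp_add)
 qed
 have "(u has_vector_derivative X t (u t)) (at t within {0..T})" if t: "t \<in> {0..T}" for t
 proof -
  have "((%t. integral {0..t} (I w)) has_vector_derivative I w t) (at t within {0..T})" by (rule integral_has_vector_derivative[OF I t])
  thus ?thesis unfolding u_def[abs_def] using uw[OF t] by (auto intro!: derivative_eq_intros simp: I_def u_def)
 qed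
 moreover have "u 0 = p" by (simp add: u_def)
 ultimately show ?thesis by blast
qed

lemma ode_exists:
 fixes X :: "real => 'e::euclidean_space => 'e"
 assumes cont: "continuous_on UNIV (%(t, x). X t x)"
  and L: "!!t x y. norm (X t x - X t y) \<le> L * norm (x - y)" "0 \<le> L"
 shows "\<exists>u. u 0 = p \<and> (\<forall>t. (u has_vector_derivative X t (u t)) (at t))"
proof -
 have ex: "\<exists>u. u 0 = p \<and> (\<forall>t\<in>{-T..T}. (u has_vector_derivative X t (u t)) (at t within {-T..T}))"
  if T: "T > 0" for T
 proof -
  obtain u1 where u1: "u1 0 = p" "\<forall>t\<in>{0..T}. (u1 has_vector_derivative X t (u1 t)) (at t within {0..T})"
   using ode_exists_forward[of T X L p] continuous_on_subset[OF cont] L T by auto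
  have "continuous_on UNIV (%z. (%(t, x). X t x) (- fst z, snd z))" by (rule continuous_on_compose2[OF cont]) (auto intro!: continuous_intros)
  hence "continuous_on UNIV (%(t, x). - X (- t) x)" by (auto simp: case_prod_beta intro!: continuous_intros)
  then obtain u2 where u2: "u2 0 = p"
   "\<forall>t\<in>{0..T}. (u2 has_vector_derivative - X (- t) (u2 t)) (at t within {0..T})"
   using ode_exists_forward[of T "%t x. - X (- t) x" L p] continuous_on_subset L T by (force simp: norm_minus_commute)
  define u where "u t = (if t \<in> {0..T} then u1 t else u2 (- t))" for t
  have u2m: "((%s. u2 (- s)) has_vector_derivative X t (u2 (- t))) (at t within {-T..0})" if "t \<in> {-T..0}" for t
  proof -
   have "((u2 \<circ> uminus) has_vector_derivative (- 1) *\<^sub>R (- X (- (- t)) (u2 (- t)))) (at t within {-T..0})" by (rule vector_diff_chain_within)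
     (use u2(2)[rule_format, of "- t"] that in \<open>auto intro!: derivative_eq_intros\<close>)
   thus ?thesis by (simp add: o_def)
  qed
  have "(u has_vector_derivative (if t \<in> {0..T} then X t (u1 t) else X t (u2 (- t)))) (at t within {-T..T})"
   if t: "t \<in> {-T..T}" for t unfolding u_def
  proof (rule has_vector_derivative_If_within_closures[of _ "{0..T}" "{-T..0}"])
   show "t \<in> {0..T} \<union> {-T..0}" "{-T..T} = {0..T} \<union> {-T..0}" using t T by auto
   show "(u1 has_vector_derivative X t (u1 t)) (at t within {0..T} \<union> closure {0..T} \<inter> closure {-T..0})"
    if "t \<in> {0..T} \<union> closure {0..T} \<inter> closure {-T..0}"
   proof -
    have "{0..T} \<union> closure {0..T} \<inter> closure {-T..0} = {0..T}" using T by auto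
    thus ?thesis using u1 that by metis
   qed
   show "((%t. u2 (- t)) has_vector_derivative X t (u2 (- t))) (at t within {-T..0} \<union> closure {0..T} \<inter> closure {-T..0})"
    if "t \<in> {-T..0} \<union> closure {0..T} \<inter> closure {-T..0}"
   proof -
    have "{-T..0} \<union> closure {0..T} \<inter> closure {-T..0} = {-T..0}" using T by auto
    thus ?thesis using u2m that by metis
   qed
   show "u1 t = u2 (- t)" "X t (u1 t) = X t (u2 (- t))"
    if "t \<in> closure {0..T}" "t \<in> closure {-T..0}" using that u1(1) u2(1) by auto
  qed
  moreover have "(if t \<in> {0..T} then X t (u1 t) else X t (u2 (- t))) = X t (u t)" for t by (simp add: u_def)
  moreover have "u 0 = p" using u1 T by (simp add: u_def)
  ultimately show ?thesis by (intro exI[of _ u]) metis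
 qed
 hence "\<forall>T>0. \<exists>u. u 0 = p \<and> (\<forall>t\<in>{-T..T}. (u has_vector_derivative X t (u t)) (at t within {-T..T}))" by blast
 then obtain U where U: "!!T. T > 0 ==> U T 0 = p"
  "!!T t. T > 0 ==> t \<in> {-T..T} ==> (U T has_vector_derivative X t (U T t)) (at t within {-T..T})" by metis
 \<comment> \<open>By uniqueness every horizon beyond |t| gives the same value, so the solutions on
   the intervals [-T, T] fit together; the horizon |t| + 1 keeps t in the interior.\<close>
 define u where "u t = U (\<bar>t\<bar> + 1) t" for t
 have eq: "U T t = u t" if "T > \<bar>t\<bar>" for T t
 proof -
  define S where "S = min T (\<bar>t\<bar> + 1)"
  have S: "S > 0" "S \<le> T" "S \<le> \<bar>t\<bar> + 1" "t \<in> {-S..S}" using that by (auto simp: S_def)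
  have "(U T has_vector_derivative X t (U T t)) (at t within {-S..S})" if "t \<in> {-S..S}" for t
   by (rule has_vector_derivative_within_subset[OF U(2)]) (use S that in auto)
  moreover have "(U (\<bar>t\<bar> + 1) has_vector_derivative X s (U (\<bar>t\<bar> + 1) s)) (at s within {-S..S})" if "s \<in> {-S..S}" for s
   by (rule has_vector_derivative_within_subset[OF U(2)]) (use S that in auto)
  ultimately show ?thesis unfolding u_def by (rule ode_unique[where L=L and ?t0.0=0]) (use L S U(1) \<open>T > \<bar>t\<bar>\<close> in auto)
 qed
 have "(u has_vector_derivative X t (u t)) (at t)" for t
 proof -
  define T where "T = \<bar>t\<bar> + 2"
  have T: "T > \<bar>t\<bar>" by (simp add: T_def)
  have "(U T has_vector_derivative X t (u t)) (at t)" using U(2)[of T t] T eq[OF T] at_within_Icc_at[of "-T" t T] by (auto simp: abs_less_iff)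
  thus ?thesis by (rule has_vector_derivative_transform_within_open[of _ _ _ "{-T<..<T}"]) (use T eq in \<open>auto simp: abs_less_iff\<close>)
 qed
 moreover have "u 0 = p" using U(1)[of 1] by (simp add: u_def)
 ultimately show ?thesis by blast
qed

subsection \<open>Dependence on parameters\<close>

text \<open>Continuity in the parameter is uniform over compact times; the closed unit ball around
  p0 supplies compactness on the parameter side.\<close>

lemma compact_unif_close:
 fixes F :: "'a::metric_space \<times> 'b::euclidean_space => 'c::metric_space"
 assumes F: "continuous_on UNIV F" and A: "compact A" and e: "0 < e"
 shows "\<exists>d>0. \<forall>t\<in>A. \<forall>p. dist p p0 < d --> dist (F (t, p)) (F (t, p0)) < e"
proof -
 have "uniformly_continuous_on (A \<times> cball p0 1) F" by (intro compact_uniformly_continuous compact_Times A compact_cball continuous_on_subset[OF F]) auto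
 then obtain d where d: "d > 0" "!!z z'. z \<in> A \<times> cball p0 1 ==> z' \<in> A \<times> cball p0 1 ==> dist z' z < d ==> dist (F z') (F z) < e"
  using e unfolding uniformly_continuous_on_def by metis
 have "dist (F (t, p)) (F (t, p0)) < e" if "t \<in> A" "dist p p0 < min d 1" for t p using d(2)[of "(t, p0)" "(t, p)"] that by (auto simp: dist_Pair_Pair dist_commute)
 thus ?thesis using d(1) by (intro exI[of _ "min d 1"]) auto
qed

text \<open>Gronwall's inequality compares the solutions for p and p0. The forcing term is the
  change of g along the one known solution for p0, hence uniformly small over a compact time
  interval.\<close>

lemma ode_continuous_dependence:
 fixes g :: "real \<times> 'p::euclidean_space \<times> 'e::euclidean_space => 'e"
 assumes g: "continuous_on UNIV g"
  and L: "!!t p x y. norm (g (t, p, x) - g (t, p, y)) \<le> L * norm (x - y)" "0 \<le> L"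
  and u: "!!t p. ((%t. u (t, p)) has_vector_derivative g (t, p, u (t, p))) (at t)"
  and u0: "continuous_on UNIV (%p. u (0, p))"
 shows "continuous_on UNIV u"
proof -
 have "continuous (at z) u" for z
 proof -
  obtain t0 p0 where z: "z = (t0, p0)" by (cases z)
  define T where "T = \<bar>t0\<bar> + 1"
  define E where "E = exp ((2 * L + 1) * T)"
  have uc: "continuous_on UNIV (%t. u (t, p))" for p by (rule continuous_at_imp_continuous_on) (metis u has_vector_derivative_continuous)
  have "continuous_on UNIV (%(t, p). g (t, p, u (t, p0)))" unfolding case_prod_beta
   by (intro continuous_on_compose2[OF g] continuous_intros continuous_on_compose2[OF uc]) auto
  note gc = compact_unif_close[OF this compact_Icc]
  show ?thesis unfolding continuous_at_eps_delta z
  proof (intro allI impI)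
   fix e :: real assume e: "e > 0"
   \<comment> \<open>With this \<eta> the Gronwall bound 2 \<eta>^2 E is exactly (e / 2)^2.\<close>
   define \<eta> where "\<eta> = e / (2 * sqrt (2 * E))"
   have E: "E > 0" by (simp add: E_def)
   hence \<eta>: "\<eta> > 0" using e by (simp add: \<eta>_def)
   obtain d1 where d1: "d1 > 0" "!!t p. t \<in> {-T..T} ==> dist p p0 < d1 ==>
     dist (g (t, p, u (t, p0))) (g (t, p0, u (t, p0))) < \<eta>" using gc[OF \<eta>, of "-T" T p0] by auto
   obtain d2 where d2: "d2 > 0" "!!p. dist p p0 < d2 ==> dist (u (0, p)) (u (0, p0)) < \<eta>" using u0 \<eta> unfolding continuous_on_iff by (metis UNIV_I)
   obtain d3 where d3: "d3 > 0" "!!t. dist t t0 < d3 ==> dist (u (t, p0)) (u (t0, p0)) < e / 2"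
    using uc[of p0] e unfolding continuous_on_iff by (metis UNIV_I half_gt_zero)
   have "dist (u (t, p)) (u (t0, p0)) < e" if tp: "dist t t0 < min d3 1" "dist p p0 < min d1 d2" for t p
   proof -
    have t: "t \<in> {-T..T}" using tp by (auto simp: T_def dist_real_def)
    have "(norm (u (t, p) - u (t, p0)))\<^sup>2 \<le> ((norm (u (0, p) - u (0, p0)))\<^sup>2 + \<eta>\<^sup>2) * exp ((2 * L + 1) * \<bar>t - 0\<bar>)"
    proof (rule gronwall[where e'="%t. g (t, p, u (t, p)) - g (t, p0, u (t, p0))" and a="-T" and b=T])
     fix s assume s: "s \<in> {-T..T}"
     show "((%t. u (t, p) - u (t, p0)) has_vector_derivative g (s, p, u (s, p)) - g (s, p0, u (s, p0))) (at s within {-T..T})"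
      by (intro has_vector_derivative_diff has_vector_derivative_at_within[OF u])
     have "norm (g (s, p, u (s, p)) - g (s, p0, u (s, p0))) \<le> norm (g (s, p, u (s, p)) - g (s, p, u (s, p0)))
       + norm (g (s, p, u (s, p0)) - g (s, p0, u (s, p0)))"
      using norm_triangle_ineq[of "g (s, p, u (s, p)) - g (s, p, u (s, p0))" "g (s, p, u (s, p0)) - g (s, p0, u (s, p0))"] by simp
     also have "... \<le> L * norm (u (s, p) - u (s, p0)) + \<eta>" using L(1) d1(2)[OF s] tp by (intro add_mono) (auto simp: dist_norm less_imp_le)
     finally show "norm (g (s, p, u (s, p)) - g (s, p0, u (s, p0))) \<le> L * norm (u (s, p) - u (s, p0)) + \<eta>" .
    qed (use \<eta> L t in \<open>auto simp: T_def\<close>)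
    also have "... \<le> (\<eta>\<^sup>2 + \<eta>\<^sup>2) * E" unfolding E_def using d2(2)[of p] tp t L
     by (intro mult_mono add_mono power_mono) (use \<eta> in \<open>auto simp: dist_norm T_def mult_left_mono\<close>)
    also have "... = (e / 2)\<^sup>2"
    proof -
     have "(sqrt (2 * E))\<^sup>2 = 2 * E" using E by simp
     hence "\<eta>\<^sup>2 = (e / 2)\<^sup>2 / (2 * E)" unfolding \<eta>_def power_divide power_mult_distrib by simp
     thus ?thesis using E by simp
    qed
    finally have 1: "norm (u (t, p) - u (t, p0)) \<le> e / 2" by (rule power2_le_imp_le) (use e in simp)
    have 2: "dist (u (t, p0)) (u (t0, p0)) < e / 2" by (rule d3(2)) (use tp in simp)
    show ?thesis using dist_triangle[of "u (t, p)" "u (t0, p0)" "u (t, p0)"] 1 2 unfolding dist_norm by linarith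
   qed
   note tp = this
   have near: "dist (u x) (u (t0, p0)) < e" if x: "dist x (t0, p0) < min (min d3 1) (min d1 d2)" for x
   proof -
    have a: "dist (fst x) t0 \<le> dist x (t0, p0)" "dist (snd x) p0 \<le> dist x (t0, p0)" using dist_fst_le[of x "(t0, p0)"] dist_snd_le[of x "(t0, p0)"] by simp_all
    have "dist (fst x) t0 < min d3 1" using a(1) x by linarith
    moreover have "dist (snd x) p0 < min d1 d2" using a(2) x by linarith
    ultimately show ?thesis using tp[of "fst x" "snd x"] by simp
   qed
   show "\<exists>d>0. \<forall>x'. dist x' (t0, p0) < d --> dist (u x') (u (t0, p0)) < e" using near d1(1) d2(1) d3(1)
    by (intro exI[of _ "min (min d3 1) (min d1 d2)"] conjI allI impI near) simp_all
  qed
 qed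
 thus ?thesis by (simp add: continuous_at_imp_continuous_on)
qed

text \<open>Lets the variational equation inherit the Lipschitz constant of the original
  equation.\<close>

lemma lipschitz_derivative_bound:
 assumes f: "(f has_derivative f') (at x)" and L: "!!y. norm (f y - f x) \<le> L * norm (y - x)"
 shows "norm (f' v) \<le> L * norm v"
proof (rule field_le_epsilon)
 fix e :: real assume e: "e > 0"
 show "norm (f' v) \<le> L * norm v + e"
 proof (cases "v = 0")
  case True thus ?thesis using e linear_0[OF has_derivative_linear[OF f]] by simp
 next
  case False
  define \<eta> where "\<eta> = e / norm v"
  have \<eta>: "\<eta> > 0" using False e by (simp add: \<eta>_def)
  obtain d where d: "d > 0" "!!y. norm (y - x) < d ==> norm (f y - f x - f' (y - x)) \<le> \<eta> * norm (y - x)" using f \<eta> unfolding has_derivative_at_alt by blast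
  define h where "h = d / (2 * norm v)"
  have h: "h > 0" "norm (h *\<^sub>R v) < d" using False d by (auto simp: h_def)
  have "h * norm (f' v) = norm (f' (h *\<^sub>R v))" using h by (simp add: linear_scale[OF has_derivative_linear[OF f]])
  also have "... \<le> norm (f (x + h *\<^sub>R v) - f x) + norm (f (x + h *\<^sub>R v) - f x - f' (h *\<^sub>R v))"
   using norm_triangle_ineq4[of "f (x + h *\<^sub>R v) - f x" "f (x + h *\<^sub>R v) - f x - f' (h *\<^sub>R v)"] by simp
  also have "... \<le> L * norm (h *\<^sub>R v) + \<eta> * norm (h *\<^sub>R v)" using L[of "x + h *\<^sub>R v"] d(2)[of "x + h *\<^sub>R v"] h by auto
  also have "... = h * (L * norm v + e)" using h False by (simp add: \<eta>_def algebra_simps)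
  finally show ?thesis using h by simp
 qed
qed

lemma norm_linear_le_Basis:
 fixes f :: "'a::euclidean_space => 'b::real_normed_vector"
 assumes "linear f" "!!b. b \<in> Basis ==> norm (f b) \<le> c"
 shows "norm (f v) \<le> real DIM('a) * c * norm v"
proof -
 have "norm (f v) = norm (\<Sum>b\<in>Basis. (v \<bullet> b) *\<^sub>R f b)" using linear_expand[OF assms(1), of v] by simp
 also have "... \<le> (\<Sum>b\<in>(Basis :: 'a set). norm v * c)" by (rule order_trans[OF norm_sum], rule sum_mono, unfold norm_scaleR)
   (auto intro!: mult_mono assms Basis_le_norm)
 finally show ?thesis by (simp add: algebra_simps)
qed


text \<open>The candidate w for the parameter derivative solves the variational equation, and
  Gronwall's inequality is applied to the remainder u(t, p) - u(t, p0) - w. Continuity of g' is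
  assumed in each fixed direction, which is what \<open>Ck\<close> delivers.\<close>

lemma ode_C1_dependence:
 fixes g :: "real \<times> 'p::euclidean_space \<times> 'e::euclidean_space => 'e"
 assumes g: "!!z. (g has_derivative g' z) (at z)" "!!v. continuous_on UNIV (%z. g' z v)"
  and L: "!!t p x y. norm (g (t, p, x) - g (t, p, y)) \<le> L * norm (x - y)" "0 \<le> L"
  and u: "!!t p. ((%t. u (t, p)) has_vector_derivative g (t, p, u (t, p))) (at t)"
  and u0: "!!p. ((%p. u (0, p)) has_derivative u0' p) (at p)" "!!v. continuous_on UNIV (%p. u0' p v)"
 shows "\<exists>w. (\<forall>v p. w v (0, p) = u0' p v) \<and>
   (\<forall>v t p. ((%t. w v (t, p)) has_vector_derivative g' (t, p, u (t, p)) (0, v, w v (t, p))) (at t)) \<and>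
   (\<forall>t p. (u has_derivative (%(\<tau>, v). \<tau> *\<^sub>R g (t, p, u (t, p)) + w v (t, p))) (at (t, p)))"
proof -
 have gc: "continuous_on UNIV g" by (rule continuous_at_imp_continuous_on) (metis g(1) has_derivative_continuous)
 have u0c: "continuous_on UNIV (%p. u (0, p))" by (rule continuous_at_imp_continuous_on) (metis u0(1) has_derivative_continuous)
 have uc: "continuous_on UNIV u" by (rule ode_continuous_dependence[OF gc L u u0c])
 have lin: "linear (g' z)" for z by (rule has_derivative_linear[OF g(1)])
 have gx: "norm (g' (t, p, x) (0, 0, y)) \<le> L * norm y" for t p x y
 proof -
  have "((%x. (t, p, x)) has_derivative (%y. (0, 0, y))) (at x)" by (intro has_derivative_Pair has_derivative_const has_derivative_ident)
  from has_derivative_compose[OF this g(1)]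
  have "((%x. g (t, p, x)) has_derivative (%y. g' (t, p, x) (0, 0, y))) (at x)" .
  thus ?thesis by (rule lipschitz_derivative_bound) (use L in auto)
 qed
 have gsplit: "g' z (0, v, y) = g' z (0, v, 0) + g' z (0, 0, y)" for z v y using linear_add[OF lin, of z "(0, v, 0)" "(0, 0, y)"] by simp
 have gexp: "g' z (0, v, y) = g' z (0, v, 0) + (\<Sum>b\<in>Basis. (y \<bullet> b) *\<^sub>R g' z (0, 0, b))" for z v y
 proof -
  have "linear (%y::'e. (0::real, 0::'p, y))" by (simp add: linear_iff)
  from linear_compose[OF this lin[of z]] have "linear (%y. g' z (0, 0, y))" by (simp add: o_def)
  from linear_expand[OF this, of y] gsplit[of z v y] show ?thesis by simp
 qed
 have "\<forall>v p. \<exists>w. w 0 = u0' p v \<and> (\<forall>t. (w has_vector_derivative g' (t, p, u (t, p)) (0, v, w t)) (at t))"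
 proof (intro allI)
  fix v p
  have ut: "continuous_on UNIV (%z::real \<times> 'e. u (fst z, p))" by (rule continuous_on_compose2[OF uc]) (auto intro!: continuous_intros)
  have "continuous_on UNIV (%(t, y). g' (t, p, u (t, p)) (0, v, y))" unfolding case_prod_beta
   by (subst gexp) (intro continuous_intros continuous_on_compose2[OF g(2)] ut; simp)
  moreover have "norm (g' (t, p, u (t, p)) (0, v, x) - g' (t, p, u (t, p)) (0, v, y)) \<le> L * norm (x - y)" for t x y
   using gx[of t p "u (t, p)" "x - y"] linear_diff[OF lin, of "(t, p, u (t, p))" "(0, v, x)" "(0, v, y)"] by simp
  ultimately show "\<exists>w. w 0 = u0' p v \<and> (\<forall>t. (w has_vector_derivative g' (t, p, u (t, p)) (0, v, w t)) (at t))"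
   using ode_exists[of "%t y. g' (t, p, u (t, p)) (0, v, y)" L] L(2) by blast
 qed
 then obtain W where "\<forall>v p. W v p 0 = u0' p v \<and> (\<forall>t. (W v p has_vector_derivative g' (t, p, u (t, p)) (0, v, W v p t)) (at t))"
  unfolding choice_iff by (elim exE)
 hence W: "!!v p. W v p 0 = u0' p v"
  "!!v p t. (W v p has_vector_derivative g' (t, p, u (t, p)) (0, v, W v p t)) (at t)" by blast+
 \<comment> \<open>Defined through the basis vectors, w is linear in v by construction; W is merely
   a choice for each v.\<close>
 define w where "w v = (%(t, p). \<Sum>b\<in>Basis. (v \<bullet> b) *\<^sub>R W b p t)" for v :: 'p
 have w0: "w v (0, p) = u0' p v" for v p using linear_expand[OF has_derivative_linear[OF u0(1)], of p v] by (simp add: w_def W)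
 have wd: "((%t. w v (t, p)) has_vector_derivative g' (t, p, u (t, p)) (0, v, w v (t, p))) (at t)" for v t p
 proof -
  have "((%t. w v (t, p)) has_vector_derivative (\<Sum>b\<in>Basis. (v \<bullet> b) *\<^sub>R g' (t, p, u (t, p)) (0, b, W b p t))) (at t)"
   unfolding w_def by (auto intro!: derivative_eq_intros W(2))
  also have "(\<Sum>b\<in>Basis. (v \<bullet> b) *\<^sub>R g' (t, p, u (t, p)) (0, b, W b p t)) =
    g' (t, p, u (t, p)) (\<Sum>b\<in>Basis. (v \<bullet> b) *\<^sub>R (0, b, W b p t))" using lin by (simp add: linear_sum linear_scale del: scaleR_Pair)
  also have "(\<Sum>b\<in>Basis. (v \<bullet> b) *\<^sub>R (0::real, b, W b p t)) = (0, v, w v (t, p))"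
   by (simp add: w_def prod_eq_iff fst_sum snd_sum euclidean_representation)
  finally show ?thesis .
 qed
 have wlin: "linear (%v. w v z)" for z by (cases z) (simp add: w_def linear_iff inner_add_left scaleR_add_left sum.distrib scaleR_sum_right)
 have wc: "continuous_on UNIV (w v)" for v
 proof (rule ode_continuous_dependence[where g="%(t, p, y). g' (t, p, u (t, p)) (0, v, y)" and L=L])
  have ut: "continuous_on UNIV (%z::real \<times> 'p \<times> 'e. u (fst z, fst (snd z)))" by (rule continuous_on_compose2[OF uc]) (auto intro!: continuous_intros)
  show "continuous_on UNIV (%(t, p, y). g' (t, p, u (t, p)) (0, v, y))" unfolding case_prod_beta
   by (subst gexp) (intro continuous_intros continuous_on_compose2[OF g(2)] ut; simp)
  show "norm ((%(t, p, y). g' (t, p, u (t, p)) (0, v, y)) (t, p, x) - (%(t, p, y). g' (t, p, u (t, p)) (0, v, y)) (t, p, y))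
    \<le> L * norm (x - y)" for t p x y using gx[of t p "u (t, p)" "x - y"] linear_diff[OF lin, of "(t, p, u (t, p))" "(0, v, x)" "(0, v, y)"] by simp
  show "continuous_on UNIV (%p. w v (0, p))" using u0(2) by (simp add: w0)
 qed (use L wd in auto)
 have partial: "((%p. u (t, p)) has_derivative (%v. w v (t, p0))) (at p0)" for t p0
 proof -
  define T where "T = \<bar>t\<bar> + 1"
  define S where "S = {-T..T}"
  define E where "E = exp ((2 * L + 1) * T)"
  define \<gamma> where "\<gamma> s = (s, p0, u (s, p0))" for s
  have S: "compact S" "0 \<in> S" "t \<in> S" by (auto simp: S_def T_def)
  have E: "E > 0" by (simp add: E_def)
  have \<gamma>c: "continuous_on UNIV \<gamma>" unfolding \<gamma>_def by (intro continuous_intros continuous_on_compose2[OF uc]) auto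
  have "bounded (\<gamma> ` S)" by (intro compact_imp_bounded compact_continuous_image S continuous_on_subset[OF \<gamma>c]) auto
  then obtain R where R: "!!s. s \<in> S ==> norm (\<gamma> s) \<le> R" unfolding bounded_iff by auto
  \<comment> \<open>The Taylor remainder of g is uniformly small along the reference trajectory: the
    mean value inequality for g minus its linear part, with uniform continuity of g' tested on basis
    vectors.\<close>
  have rem: "\<exists>d>0. \<forall>s\<in>S. \<forall>p x. norm (p - p0) < d --> norm (x - u (s, p0)) < d -->
    norm (g (s, p, x) - g (\<gamma> s) - g' (\<gamma> s) (0, p - p0, x - u (s, p0))) \<le> \<epsilon> * (norm (p - p0) + norm (x - u (s, p0)))"
   if \<epsilon>: "\<epsilon> > 0" for \<epsilon>
  proof -
   let ?D = "real DIM(real \<times> 'p \<times> 'e)"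
   have D: "?D > 0" by (simp add: DIM_positive)
   have "\<exists>d>0. \<forall>z\<in>cball 0 (R + 1). \<forall>z'\<in>cball 0 (R + 1). dist z' z < d --> norm (g' z' b - g' z b) < \<epsilon> / ?D" for b
   proof -
    have "uniformly_continuous_on (cball 0 (R + 1)) (%z. g' z b)" by (intro compact_uniformly_continuous continuous_on_subset[OF g(2)]) auto
    thus ?thesis using \<epsilon> D unfolding uniformly_continuous_on_def dist_norm by (metis divide_pos_pos)
   qed
   then obtain d where d: "!!b. d b > 0" "!!b z z'. z \<in> cball 0 (R + 1) ==> z' \<in> cball 0 (R + 1) ==>
     dist z' z < d b ==> norm (g' z' b - g' z b) < \<epsilon> / ?D" by metis
   define d0 where "d0 = min 1 (Min (d ` Basis))"
   have d0: "d0 > 0" "d0 \<le> 1" "!!b. b \<in> Basis ==> d0 \<le> d b" using d(1) by (auto simp: d0_def min.coboundedI2)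
   have "norm (g (s, p, x) - g (\<gamma> s) - g' (\<gamma> s) (0, p - p0, x - u (s, p0))) \<le> \<epsilon> * (norm (p - p0) + norm (x - u (s, p0)))"
    if s: "s \<in> S" and px: "norm (p - p0) < d0 / 2" "norm (x - u (s, p0)) < d0 / 2" for s p x
   proof -
    let ?z = "(s, p, x)"
    have nz: "norm (?z - \<gamma> s) \<le> norm (p - p0) + norm (x - u (s, p0))"
     using norm_Pair_le[of "0::real" "(p - p0, x - u (s, p0))"] norm_Pair_le[of "p - p0" "x - u (s, p0)"] by (simp add: \<gamma>_def)
    have "norm ((g ?z - g' (\<gamma> s) ?z) - (g (\<gamma> s) - g' (\<gamma> s) (\<gamma> s))) \<le> \<epsilon> * norm (?z - \<gamma> s)"
    proof (rule differentiable_bound[where S="ball (\<gamma> s) d0" and f'="%z h. g' z h - g' (\<gamma> s) h"])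
     fix z assume z: "z \<in> ball (\<gamma> s) d0"
     show "((%z. g z - g' (\<gamma> s) z) has_derivative (%h. g' z h - g' (\<gamma> s) h)) (at z within ball (\<gamma> s) d0)"
      by (intro has_derivative_diff has_derivative_at_withinI[OF g(1)] linear_imp_has_derivative lin)
     have zs: "z \<in> cball 0 (R + 1)" "\<gamma> s \<in> cball 0 (R + 1)"
      using R[OF s] z d0 norm_triangle_sub[of z "\<gamma> s"] by (auto simp: dist_norm norm_minus_commute)
     have "norm (g' z b - g' (\<gamma> s) b) \<le> \<epsilon> / ?D" if "b \<in> Basis" for b using d(2)[OF zs(2,1), of b] z d0(3)[OF that] by (auto simp: dist_commute)
     hence "norm (g' z h - g' (\<gamma> s) h) \<le> ?D * (\<epsilon> / ?D) * norm h" for h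
      by (intro norm_linear_le_Basis[of "%h. g' z h - g' (\<gamma> s) h"] linear_compose_sub lin)
     thus "onorm (%h. g' z h - g' (\<gamma> s) h) \<le> \<epsilon>" using D by (intro onorm_le) simp
    next
     show "?z \<in> ball (\<gamma> s) d0" using nz px by (simp add: dist_norm norm_minus_commute)
    qed (use d0 in auto)
    also have "... \<le> \<epsilon> * (norm (p - p0) + norm (x - u (s, p0)))" using nz \<epsilon> by (intro mult_left_mono) auto
    also have "(g ?z - g' (\<gamma> s) ?z) - (g (\<gamma> s) - g' (\<gamma> s) (\<gamma> s)) = g ?z - g (\<gamma> s) - g' (\<gamma> s) (?z - \<gamma> s)"
     by (simp add: linear_diff[OF lin])
    also have "?z - \<gamma> s = (0, p - p0, x - u (s, p0))" by (simp add: \<gamma>_def)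
    finally show ?thesis .
   qed
   thus ?thesis using d0(1) by (intro exI[of _ "d0 / 2"]) auto
  qed
  have "\<exists>M. \<forall>s\<in>S. norm (g' (\<gamma> s) (0, b, 0)) \<le> M" for b
  proof -
   have "bounded ((%s. g' (\<gamma> s) (0, b, 0)) ` S)"
    by (intro compact_imp_bounded compact_continuous_image S continuous_on_compose2[OF g(2)] continuous_on_subset[OF \<gamma>c]) auto
   thus ?thesis by (auto simp: bounded_iff)
  qed
  then obtain Mb where Mb: "!!b s. s \<in> S ==> norm (g' (\<gamma> s) (0, b, 0)) \<le> Mb b" by metis
  \<comment> \<open>One more than a bound for the derivative in the parameter: the extra 1 absorbs
    the Taylor remainder taken with \<epsilon> = 1. The 1 in \<open>C0\<close> has the same
    purpose.\<close>
  define M where "M = real DIM('p) * (\<Sum>b\<in>Basis. \<bar>Mb b\<bar>) + 1"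
  have M: "norm (g' (\<gamma> s) (0, v, 0)) \<le> (M - 1) * norm v" if "s \<in> S" for s v
  proof -
   have "linear (%y::'p. (0::real, y, 0::'e))" by (simp add: linear_iff)
   from linear_compose[OF this lin[of "\<gamma> s"]] have "linear (%v. g' (\<gamma> s) (0, v, 0))" by (simp add: o_def)
   moreover have "norm (g' (\<gamma> s) (0, b, 0)) \<le> (\<Sum>b\<in>Basis. \<bar>Mb b\<bar>)" if "b \<in> Basis" for b
    using Mb[OF \<open>s \<in> S\<close>, of b] member_le_sum[of b Basis "%b. \<bar>Mb b\<bar>"] that by fastforce
   ultimately show ?thesis unfolding M_def using norm_linear_le_Basis[of "%v. g' (\<gamma> s) (0, v, 0)"] by simp
  qed
  have M0: "M \<ge> 1" by (simp add: M_def sum_nonneg)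
  obtain B0 where B0: "!!v. norm (u0' p0 v) \<le> norm v * B0" using bounded_linear.bounded[OF has_derivative_bounded_linear[OF u0(1)]] by metis
  have u0near: "\<exists>d>0. \<forall>p. norm (p - p0) < d --> norm (u (0, p) - u (0, p0) - u0' p0 (p - p0)) \<le> \<epsilon> * norm (p - p0)" if "\<epsilon> > 0" for \<epsilon>
   using u0(1)[of p0] that unfolding has_derivative_at_alt by blast
  define C0 where "C0 = \<bar>B0\<bar> + 1"
  define C where "C = sqrt ((C0\<^sup>2 + M\<^sup>2) * E)"
  have C: "C \<ge> 0" using E by (simp add: C_def)
  \<comment> \<open>An a priori Lipschitz bound at p0. It has to come first, because the Taylor
    estimate applies only once u(s, p) is known to be close to u(s, p0).\<close>
  obtain d1 where d1: "d1 > 0" "!!p s. norm (p - p0) < d1 ==> s \<in> S ==> norm (u (s, p) - u (s, p0)) \<le> C * norm (p - p0)"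
  proof -
   obtain r where r: "r > 0" "!!s p x. s \<in> S ==> norm (p - p0) < r ==> norm (x - u (s, p0)) < r ==>
    norm (g (s, p, x) - g (\<gamma> s) - g' (\<gamma> s) (0, p - p0, x - u (s, p0))) \<le> 1 * (norm (p - p0) + norm (x - u (s, p0)))" using rem[of 1] by auto
   obtain r' where r': "r' > 0" "!!p. norm (p - p0) < r' ==> norm (u (0, p) - u (0, p0) - u0' p0 (p - p0)) \<le> 1 * norm (p - p0)" using u0near[of 1] by auto
   have "norm (u (s, p) - u (s, p0)) \<le> C * norm (p - p0)" if p: "norm (p - p0) < min r r'" and s: "s \<in> S" for p s
   proof -
    have "(norm (u (s, p) - u (s, p0)))\<^sup>2 \<le> ((norm (u (0, p) - u (0, p0)))\<^sup>2 + (M * norm (p - p0))\<^sup>2) * exp ((2 * L + 1) * \<bar>s - 0\<bar>)"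
    proof (rule gronwall[where e'="%t. g (t, p, u (t, p)) - g (t, p0, u (t, p0))" and a="-T" and b=T])
     fix s assume s: "s \<in> {-T..T}"
     show "((%t. u (t, p) - u (t, p0)) has_vector_derivative g (s, p, u (s, p)) - g (s, p0, u (s, p0))) (at s within {-T..T})"
      by (intro has_vector_derivative_diff has_vector_derivative_at_within[OF u])
     have "norm (g (s, p, u (s, p0)) - g (\<gamma> s)) \<le> norm (g (s, p, u (s, p0)) - g (\<gamma> s) - g' (\<gamma> s) (0, p - p0, 0)) + norm (g' (\<gamma> s) (0, p - p0, 0))"
      using norm_triangle_ineq[of "g (s, p, u (s, p0)) - g (\<gamma> s) - g' (\<gamma> s) (0, p - p0, 0)" "g' (\<gamma> s) (0, p - p0, 0)"] by simp
     also have "... \<le> norm (p - p0) + (M - 1) * norm (p - p0)" using r(2)[of s p "u (s, p0)"] M[of s "p - p0"] p s r(1) by (intro add_mono) (auto simp: S_def)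
     finally have *: "norm (g (s, p, u (s, p0)) - g (s, p0, u (s, p0))) \<le> M * norm (p - p0)" by (simp add: \<gamma>_def algebra_simps)
     have "norm (g (s, p, u (s, p)) - g (s, p0, u (s, p0))) \<le> norm (g (s, p, u (s, p)) - g (s, p, u (s, p0)))
       + norm (g (s, p, u (s, p0)) - g (s, p0, u (s, p0)))"
      using norm_triangle_ineq[of "g (s, p, u (s, p)) - g (s, p, u (s, p0))" "g (s, p, u (s, p0)) - g (s, p0, u (s, p0))"] by simp
     thus "norm (g (s, p, u (s, p)) - g (s, p0, u (s, p0))) \<le> L * norm (u (s, p) - u (s, p0)) + M * norm (p - p0)"
      using L(1)[of s p "u (s, p)" "u (s, p0)"] * by linarith
    qed (use M0 L s in \<open>auto simp: T_def S_def\<close>)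
    also have "... \<le> ((C0 * norm (p - p0))\<^sup>2 + (M * norm (p - p0))\<^sup>2) * E"
    proof -
     have "norm (u (0, p) - u (0, p0)) \<le> norm (u (0, p) - u (0, p0) - u0' p0 (p - p0)) + norm (u0' p0 (p - p0))"
      using norm_triangle_ineq[of "u (0, p) - u (0, p0) - u0' p0 (p - p0)" "u0' p0 (p - p0)"] by simp
     also have "... \<le> norm (p - p0) + norm (p - p0) * \<bar>B0\<bar>"
     proof (rule add_mono)
      show "norm (u (0, p) - u (0, p0) - u0' p0 (p - p0)) \<le> norm (p - p0)" using r'(2)[of p] p by simp
      show "norm (u0' p0 (p - p0)) \<le> norm (p - p0) * \<bar>B0\<bar>" by (rule order_trans[OF B0]) (simp add: mult_left_mono)
     qed
     also have "... = C0 * norm (p - p0)" by (simp add: C0_def distrib_right)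
     finally show ?thesis unfolding E_def using s L M0 by (intro mult_mono add_mono power_mono) (auto simp: S_def mult_left_mono)
    qed
    also have "... = (C * norm (p - p0))\<^sup>2" using E by (simp add: C_def power_mult_distrib algebra_simps)
    finally show ?thesis by (rule power2_le_imp_le) (use C in simp)
   qed
   thus thesis using that[of "min r r'"] r(1) r'(1) by auto
  qed
  show ?thesis unfolding has_derivative_at_alt
  proof (intro conjI allI impI)
   show "bounded_linear (%v. w v (t, p0))" using wlin by (simp add: linear_conv_bounded_linear)
   fix \<epsilon> :: real assume \<epsilon>: "\<epsilon> > 0"
   \<comment> \<open>X collects the factors of the final bound \<eta>^2 X |p - p0|^2, so that \<eta>
     = \<epsilon> / sqrt X turns it into the square of \<epsilon> |p - p0|.\<close>
   define X where "X = (1 + (1 + C)\<^sup>2) * E"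
   define \<eta> where "\<eta> = \<epsilon> / sqrt X"
   have pos: "X > 0" unfolding X_def using E by (intro mult_pos_pos add_pos_nonneg) auto
   have \<eta>: "\<eta> > 0" using pos \<epsilon> by (simp add: \<eta>_def)
   obtain r where r: "r > 0" "!!s p x. s \<in> S ==> norm (p - p0) < r ==> norm (x - u (s, p0)) < r ==>
    norm (g (s, p, x) - g (\<gamma> s) - g' (\<gamma> s) (0, p - p0, x - u (s, p0))) \<le> \<eta> * (norm (p - p0) + norm (x - u (s, p0)))" using rem[OF \<eta>] by auto
   obtain r' where r': "r' > 0" "!!p. norm (p - p0) < r' ==> norm (u (0, p) - u (0, p0) - u0' p0 (p - p0)) \<le> \<eta> * norm (p - p0)" using u0near[OF \<eta>] by auto
   define d where "d = min (min r r') (min d1 (r / (C + 1)))"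
   have d: "d > 0" using r(1) r'(1) d1(1) C by (simp add: d_def)
   have "norm (u (t, p) - u (t, p0) - w (p - p0) (t, p0)) \<le> \<epsilon> * norm (p - p0)" if p: "norm (p - p0) < d" for p
   proof -
    have "(norm (u (t, p) - u (t, p0) - w (p - p0) (t, p0)))\<^sup>2 \<le>
      ((norm (u (0, p) - u (0, p0) - w (p - p0) (0, p0)))\<^sup>2 + (\<eta> * (1 + C) * norm (p - p0))\<^sup>2) * exp ((2 * L + 1) * \<bar>t - 0\<bar>)"
    proof (rule gronwall[where e'="%t. g (t, p, u (t, p)) - g (t, p0, u (t, p0)) - g' (t, p0, u (t, p0)) (0, p - p0, w (p - p0) (t, p0))" and a="-T" and b=T])
     fix s assume s: "s \<in> {-T..T}"
     show "((%t. u (t, p) - u (t, p0) - w (p - p0) (t, p0)) has_vector_derivative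
       g (s, p, u (s, p)) - g (s, p0, u (s, p0)) - g' (s, p0, u (s, p0)) (0, p - p0, w (p - p0) (s, p0))) (at s within {-T..T})"
      by (intro has_vector_derivative_diff has_vector_derivative_at_within[OF u] has_vector_derivative_at_within[OF wd])
     let ?e = "u (s, p) - u (s, p0) - w (p - p0) (s, p0)"
     let ?r = "g (s, p, u (s, p)) - g (\<gamma> s) - g' (\<gamma> s) (0, p - p0, u (s, p) - u (s, p0))"
     have ul: "norm (u (s, p) - u (s, p0)) \<le> C * norm (p - p0)" using d1(2)[of p s] p s by (simp add: d_def S_def)
     have "C * norm (p - p0) \<le> C * (r / (C + 1))" using p C by (intro mult_left_mono) (auto simp: d_def)
     also have "... < r" using C r(1) by (simp add: field_simps)
     finally have "norm (u (s, p) - u (s, p0)) < r" using ul by simp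
     hence "norm ?r \<le> \<eta> * (norm (p - p0) + norm (u (s, p) - u (s, p0)))" using r(2)[of s p "u (s, p)"] p s by (simp add: d_def S_def)
     also have "... \<le> \<eta> * (norm (p - p0) + C * norm (p - p0))" using ul \<eta> by (intro mult_left_mono) auto
     finally have rr: "norm ?r \<le> \<eta> * (1 + C) * norm (p - p0)" by (simp add: algebra_simps)
     have "g' (\<gamma> s) (0, p - p0, u (s, p) - u (s, p0)) - g' (\<gamma> s) (0, p - p0, w (p - p0) (s, p0)) = g' (\<gamma> s) (0, 0, ?e)"
      using linear_diff[OF lin, of "\<gamma> s" "(0, p - p0, u (s, p) - u (s, p0))" "(0, p - p0, w (p - p0) (s, p0))"] by simp
     hence "g (s, p, u (s, p)) - g (s, p0, u (s, p0)) - g' (s, p0, u (s, p0)) (0, p - p0, w (p - p0) (s, p0)) = ?r + g' (\<gamma> s) (0, 0, ?e)"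
      by (simp add: \<gamma>_def algebra_simps)
     hence "norm (g (s, p, u (s, p)) - g (s, p0, u (s, p0)) - g' (s, p0, u (s, p0)) (0, p - p0, w (p - p0) (s, p0)))
       \<le> norm ?r + norm (g' (\<gamma> s) (0, 0, ?e))" using norm_triangle_ineq by metis
     thus "norm (g (s, p, u (s, p)) - g (s, p0, u (s, p0)) - g' (s, p0, u (s, p0)) (0, p - p0, w (p - p0) (s, p0)))
       \<le> L * norm ?e + \<eta> * (1 + C) * norm (p - p0)" using rr gx[of s p0 "u (s, p0)" ?e] by (simp add: \<gamma>_def)
    qed (use \<eta> C L S in \<open>auto simp: S_def\<close>)
    also have "... \<le> ((\<eta> * norm (p - p0))\<^sup>2 + (\<eta> * (1 + C) * norm (p - p0))\<^sup>2) * E" unfolding E_def using S(3) L r'(2)[of p] p \<eta> C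
     by (intro mult_mono add_mono power_mono) (auto simp: S_def d_def w0 T_def mult_left_mono)
    also have "... = \<eta>\<^sup>2 * X * (norm (p - p0))\<^sup>2" unfolding X_def by algebra
    also have "... = (\<epsilon> * norm (p - p0))\<^sup>2" using pos by (simp add: \<eta>_def power_divide power_mult_distrib)
    finally show ?thesis by (rule power2_le_imp_le) (use \<epsilon> in simp)
   qed
   thus "\<exists>d>0. \<forall>p. norm (p - p0) < d --> norm (u (t, p) - u (t, p0) - w (p - p0) (t, p0)) \<le> \<epsilon> * norm (p - p0)" using d by blast
  qed
 qed
 \<comment> \<open>Joint differentiability follows from the partial derivatives because the one in p
   is continuous as a map into the bounded linear maps.\<close>
 have "(u has_derivative (%(\<tau>, v). \<tau> *\<^sub>R g (t, p, u (t, p)) + w v (t, p))) (at (t, p))" for t p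
 proof -
  have bl: "bounded_linear (%v. w v z)" for z using wlin by (simp add: linear_conv_bounded_linear)
  hence ap: "blinfun_apply (Blinfun (%v. w v z)) v = w v z" for v z by (simp add: bounded_linear_Blinfun_apply)
  have "continuous_on UNIV (%z. Blinfun (%v. w v z))" by (rule continuous_on_blinfun_componentwise) (simp add: ap wc)
  moreover have "(%z. Blinfun (%v. w v z)) = (%(t, p). Blinfun (%v. w v (t, p)))" by auto
  ultimately have c: "continuous (at (t, p) within UNIV \<times> UNIV) (%(t, p). Blinfun (%v. w v (t, p)))"
   unfolding UNIV_Times_UNIV by (metis UNIV_I continuous_on_eq_continuous_within)
  have "((%(t, p). u (t, p)) has_derivative (%(\<tau>, v). \<tau> *\<^sub>R g (t, p, u (t, p)) + blinfun_apply (Blinfun (%v. w v (t, p))) v)) (at (t, p) within UNIV \<times> UNIV)"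
  proof (rule has_derivative_partialsI[where f="%t p. u (t, p)" and X=UNIV and Y=UNIV, OF _ _ c])
   show "((%x. u (x, p)) has_derivative (%\<tau>. \<tau> *\<^sub>R g (t, p, u (t, p)))) (at t)" using u[of p t] unfolding has_vector_derivative_def .
   show "((%y. u (x, y)) has_derivative blinfun_apply (Blinfun (%v. w v (x, y)))) (at y)" for x y using partial[of x y] by (simp add: bounded_linear_Blinfun_apply[OF bl])
  qed auto
  thus ?thesis by (simp add: ap case_prod_eta)
 qed
 thus ?thesis by (intro exI[of _ w] conjI allI w0 wd)
qed

text \<open>The parameter derivatives of u solve the same linear equation with another inhomogeneity
  \<open>b2\<close>, so the coefficient A never changes and the induction on k closes.\<close>

lemma linear_ode_Ck:
 fixes A :: "real \<times> 'p::euclidean_space => 'e::euclidean_space => 'e"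
 assumes lin: "!!z. linear (A z)" and L: "!!z w. norm (A z w) \<le> L * norm w" "0 \<le> L"
  and "!!w. Ck k UNIV (%z. A z w)" "Ck k UNIV b" "Ck k UNIV (%p. u (0, p))"
  and "!!t p. ((%t. u (t, p)) has_vector_derivative A (t, p) (u (t, p)) + b (t, p)) (at t)"
 shows "Ck k UNIV u" using assms(4-)
proof (induction k arbitrary: b u)
 case (0 b u)
 have Aexp: "A z x = (\<Sum>c\<in>Basis. (x \<bullet> c) *\<^sub>R A z c)" for z x by (rule linear_expand[OF lin])
 have "continuous_on UNIV (%z. A (fst z, fst (snd z)) (snd (snd z)) + b (fst z, fst (snd z)))"
 proof (subst Aexp, intro continuous_intros)
  show "continuous_on UNIV (%z::real \<times> 'p \<times> 'e. A (fst z, fst (snd z)) c)" for c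
   by (rule continuous_on_compose2[where f="%z. (fst z, fst (snd z))" and g="%z. A z c" and t=UNIV])
    (use 0(1) in \<open>auto intro!: continuous_intros\<close>)
  show "continuous_on UNIV (%z::real \<times> 'p \<times> 'e. b (fst z, fst (snd z)))"
   by (rule continuous_on_compose2[where f="%z. (fst z, fst (snd z))" and g=b and t=UNIV])
    (use 0(2) in \<open>auto intro!: continuous_intros\<close>)
 qed
 hence "continuous_on UNIV u"
 proof (rule ode_continuous_dependence[where L=L])
  fix t :: real and p :: 'p and x y :: 'e
  show "norm (A (fst (t, p, x), fst (snd (t, p, x))) (snd (snd (t, p, x))) + b (fst (t, p, x), fst (snd (t, p, x)))
    - (A (fst (t, p, y), fst (snd (t, p, y))) (snd (snd (t, p, y))) + b (fst (t, p, y), fst (snd (t, p, y))))) \<le> L * norm (x - y)"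
   using L(1)[of "(t, p)" "x - y"] by (simp add: linear_diff[OF lin])
  show "((%t. u (t, p)) has_vector_derivative
    A (fst (t, p, u (t, p)), fst (snd (t, p, u (t, p)))) (snd (snd (t, p, u (t, p)))) + b (fst (t, p, u (t, p)), fst (snd (t, p, u (t, p))))) (at t)"
   using 0(4)[of p t] by simp
  show "continuous_on UNIV (%p. u (0, p))" using 0(3) by simp
 qed (rule L(2))
 thus ?case by simp
next
 case (Suc k b u)
 have Aexp: "A z x = (\<Sum>c\<in>Basis. (x \<bullet> c) *\<^sub>R A z c)" for z x by (rule linear_expand[OF lin])
 have uk: "Ck k UNIV u" by (rule Suc.IH[OF Ck_Suc_imp[OF Suc.prems(1)] Ck_Suc_imp[OF Suc.prems(2)] Ck_Suc_imp[OF Suc.prems(3)] Suc.prems(4)])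
 have Ak: "Ck k UNIV (%z. A z w)" for w by (rule Ck_Suc_imp[OF Suc.prems(1)])
 have "\<forall>c. \<exists>A'. (\<forall>z. ((%z. A z c) has_derivative A' z) (at z)) \<and> (\<forall>v. Ck k UNIV (%z. A' z v))" using Suc.prems(1) by simp
 then obtain A' where "\<forall>c. (\<forall>z. ((%z. A z c) has_derivative A' c z) (at z)) \<and> (\<forall>v. Ck k UNIV (%z. A' c z v))"
  unfolding choice_iff by (elim exE)
 hence A': "!!c z. ((%z. A z c) has_derivative A' c z) (at z)" "!!c v. Ck k UNIV (%z. A' c z v)" by blast+
 obtain b' where b': "!!z. (b has_derivative b' z) (at z)" "!!v. Ck k UNIV (%z. b' z v)" using Suc.prems(2) by auto
 obtain u0' where u0': "!!p. ((%p. u (0, p)) has_derivative u0' p) (at p)" "!!v. Ck k UNIV (%p. u0' p v)" using Suc.prems(3) by auto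
 define pr where "pr z = (fst z, fst (snd z))" for z :: "real \<times> 'p \<times> 'e"
 have prc: "continuous_on UNIV pr" unfolding pr_def by (intro continuous_intros)
 have prd: "(pr has_derivative pr) (at z)" for z unfolding pr_def by (intro has_derivative_Pair has_derivative_fst has_derivative_snd has_derivative_ident)
 define g where "g z = (\<Sum>c\<in>Basis. (snd (snd z) \<bullet> c) *\<^sub>R A (pr z) c) + b (pr z)" for z
 define g' where "g' z h = (\<Sum>c\<in>Basis. (snd (snd z) \<bullet> c) *\<^sub>R A' c (pr z) (pr h) + (snd (snd h) \<bullet> c) *\<^sub>R A (pr z) c) + b' (pr z) (pr h)" for z h
 have gA: "g (t, p, x) = A (t, p) x + b (t, p)" for t p x by (simp add: g_def pr_def Aexp[of _ x])
 have gd: "(g has_derivative g' z) (at z)" for z unfolding g_def[abs_def] g'_def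
  by (intro has_derivative_add has_derivative_sum has_derivative_scaleR has_derivative_compose[OF prd A'(1)]
    has_derivative_compose[OF prd b'(1)] has_derivative_inner_left has_derivative_snd has_derivative_ident)
 have g'c: "continuous_on UNIV (%z. g' z v)" for v unfolding g'_def by (intro continuous_intros continuous_on_compose2[OF Ck_continuous[OF A'(2)] prc]
    continuous_on_compose2[OF Ck_continuous[OF Ak] prc] continuous_on_compose2[OF Ck_continuous[OF b'(2)] prc]) auto
 have gL: "norm (g (t, p, x) - g (t, p, y)) \<le> L * norm (x - y)" for t p x y using L(1)[of "(t, p)" "x - y"] by (simp add: gA linear_diff[OF lin])
 have gu: "((%t. u (t, p)) has_vector_derivative g (t, p, u (t, p))) (at t)" for t p unfolding gA by (rule Suc.prems(4))
 obtain w where w0: "!!v p. w v (0, p) = u0' p v"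
  and wd: "!!v t p. ((%t. w v (t, p)) has_vector_derivative g' (t, p, u (t, p)) (0, v, w v (t, p))) (at t)"
  and ud: "!!t p. (u has_derivative (%(\<tau>, v). \<tau> *\<^sub>R g (t, p, u (t, p)) + w v (t, p))) (at (t, p))"
  using ode_C1_dependence[OF gd g'c gL L(2) gu u0'(1) Ck_continuous[OF u0'(2)]] by blast
 define b2 where "b2 v z = (\<Sum>c\<in>Basis. (u z \<bullet> c) *\<^sub>R A' c z (0, v)) + b' z (0, v)" for v z
 have wk: "Ck k UNIV (w v)" for v
 proof (rule Suc.IH[of "b2 v"])
  show "Ck k UNIV (b2 v)" unfolding b2_def by (intro Ck_add Ck_sum Ck_scaleR Ck_inner Ck_const uk A'(2) b'(2))
  show "Ck k UNIV (%p. w v (0, p))" by (simp add: w0 u0'(2))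
  show "((%t. w v (t, p)) has_vector_derivative A (t, p) (w v (t, p)) + b2 v (t, p)) (at t)" for t p
  proof -
   have "g' (t, p, u (t, p)) (0, v, w v (t, p)) = A (t, p) (w v (t, p)) + b2 v (t, p)" unfolding g'_def b2_def pr_def by (simp add: sum.distrib Aexp[of _ "w v (t, p)"])
   thus ?thesis using wd[of v p t] by simp
  qed
 qed (rule Ak)
 show ?case
 proof (rule Ck_SucI[where f'="%z h. fst h *\<^sub>R ((\<Sum>c\<in>Basis. (u z \<bullet> c) *\<^sub>R A z c) + b z) + w (snd h) z"])
  fix z :: "real \<times> 'p"
  obtain t p where z: "z = (t, p)" by (cases z)
  show "(u has_derivative (%h. fst h *\<^sub>R ((\<Sum>c\<in>Basis. (u z \<bullet> c) *\<^sub>R A z c) + b z) + w (snd h) z)) (at z)"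
   using ud[of t p] unfolding z gA Aexp[symmetric] by (simp add: case_prod_beta')
 next
  fix h :: "real \<times> 'p"
  show "Ck k UNIV (%z. fst h *\<^sub>R ((\<Sum>c\<in>Basis. (u z \<bullet> c) *\<^sub>R A z c) + b z) + w (snd h) z)"
   by (intro Ck_add Ck_scaleR Ck_sum Ck_const Ck_inner uk Ak wk Ck_Suc_imp[OF Suc.prems(2)])
 qed
qed

text \<open>Bootstrapping: if \<phi> is of class C^k, then so are the coefficients of the
  variational equation along \<phi>, hence by \<open>linear_ode_Ck\<close> its solutions, and these
  are the derivatives of \<phi>.\<close>

lemma flow_Ck:
 fixes f :: "real \<times> 'e::euclidean_space => 'e"
 assumes f: "smooth UNIV f" and L: "!!t x y. norm (f (t, x) - f (t, y)) \<le> L * norm (x - y)" "0 \<le> L"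
  and \<phi>: "!!p. \<phi> (0, p) = p" "!!t p. ((%t. \<phi> (t, p)) has_vector_derivative f (t, \<phi> (t, p))) (at t)"
 shows "Ck k UNIV \<phi>"
  and "((%t. Df \<phi> (t, p) (0, v)) has_vector_derivative
   Df f (t, \<phi> (t, p)) (0, Df \<phi> (t, p) (0, v))) (at t)"
  and "Df \<phi> (0, p) (0, v) = v"
proof -
 define D where "D z = Df f z" for z
 have D: "(f has_derivative D z) (at z)" "smooth UNIV (%z. D z v)" for z v unfolding D_def by (auto intro: smooth_deriv[OF f] smooth_frechet[OF f])
 \<comment> \<open>The initial point plays the role of the parameter; the vector field itself does
   not depend on it.\<close>
 define pr where "pr z = (fst z, snd (snd z))" for z :: "real \<times> 'e \<times> 'e"
 have prc: "continuous_on UNIV pr" unfolding pr_def by (intro continuous_intros)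
 have prd: "(pr has_derivative pr) (at z)" for z unfolding pr_def by (intro has_derivative_Pair has_derivative_fst has_derivative_snd has_derivative_ident)
 have gd: "((%z. f (pr z)) has_derivative (%h. D (pr z) (pr h))) (at z)" for z by (rule has_derivative_compose[OF prd D(1)])
 have gc: "continuous_on UNIV (%z. D (pr z) (pr v))" for v by (rule continuous_on_compose2[OF smooth_cont[OF D(2)] prc]) auto
 have gL: "norm (f (pr (t, p, x)) - f (pr (t, p, y))) \<le> L * norm (x - y)" for t p x y using L(1) by (simp add: pr_def)
 have gu: "((%t. \<phi> (t, p)) has_vector_derivative f (pr (t, p, \<phi> (t, p)))) (at t)" for t p unfolding pr_def fst_conv snd_conv by (rule \<phi>(2))
 have u0: "((%p. \<phi> (0, p)) has_derivative (%v. v)) (at p)" for p unfolding \<phi>(1) by (rule has_derivative_ident)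
 obtain w where w0: "!!v p. w v (0, p) = v"
  and wd': "!!v t p. ((%t. w v (t, p)) has_vector_derivative D (pr (t, p, \<phi> (t, p))) (pr (0, v, w v (t, p)))) (at t)"
  and ud': "!!t p. (\<phi> has_derivative (%(\<tau>, v). \<tau> *\<^sub>R f (pr (t, p, \<phi> (t, p))) + w v (t, p))) (at (t, p))"
  using ode_C1_dependence[OF gd gc gL L(2) gu u0 continuous_on_const] by blast
 have wd: "((%t. w v (t, p)) has_vector_derivative D (t, \<phi> (t, p)) (0, w v (t, p))) (at t)" for v t p using wd'[of v p t] by (simp add: pr_def)
 have ud: "(\<phi> has_derivative (%h. fst h *\<^sub>R f (fst z, \<phi> z) + w (snd h) z)) (at z)" for z
  using ud'[of "fst z" "snd z"] by (simp add: pr_def case_prod_beta')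
 have linD: "linear (D z)" for z by (rule has_derivative_linear[OF D(1)])
 have DL: "norm (D (t, x) (0, y)) \<le> L * norm y" for t x y
 proof -
  have "((%x. (t, x)) has_derivative (%y. (0, y))) (at x)" by (intro has_derivative_Pair has_derivative_const has_derivative_ident)
  from has_derivative_compose[OF this D(1)] show ?thesis by (rule lipschitz_derivative_bound) (rule L(1))
 qed
 show *: "Ck k UNIV \<phi>" for k
 proof (induction k)
  case 0
  have "continuous_on UNIV \<phi>"
  proof (rule ode_continuous_dependence[OF _ gL L(2) gu])
   show "continuous_on UNIV (%z. f (pr z))" by (rule continuous_on_compose2[OF smooth_cont[OF f] prc]) auto
  qed (simp add: \<phi>(1))
  thus ?case by simp
 next
  case (Suc k)
  have pk: "Ck k UNIV (%z. (fst z, \<phi> z))" by (intro Ck_Pair Suc Ck_linear bounded_linear_fst)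
  have Ck_comp: "Ck k UNIV (%z. F (fst z, \<phi> z))" if "smooth UNIV F" for F :: "real \<times> 'e => 'e"
   using that by (intro Ck_compose[OF _ pk, of UNIV F]) (auto simp: smooth_Ck)
  have wk: "Ck k UNIV (w v)" for v
  proof (rule linear_ode_Ck[where A="%z y. D (fst z, \<phi> z) (0, y)" and b="%z. 0" and L=L])
   show "linear (%y. D (fst z, \<phi> z) (0, y))" for z
   proof -
    have "linear (%y::'e. (0::real, y))" by (simp add: linear_iff)
    from linear_compose[OF this linD] show ?thesis by (simp add: o_def)
   qed
   show "Ck k UNIV (%z. D (fst z, \<phi> z) (0, y))" for y by (rule Ck_comp[OF D(2)])
   show "((%t. w v (t, p)) has_vector_derivative D (fst (t, p), \<phi> (t, p)) (0, w v (t, p)) + 0) (at t)" for t p using wd[of v p t] by simp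
   show "Ck k UNIV (%p. w v (0, p))" unfolding w0 by (rule Ck_const)
  qed (use DL L(2) Ck_const in blast)+
  show ?case
  proof (rule Ck_SucI[OF ud])
   show "Ck k UNIV (%z. fst h *\<^sub>R f (fst z, \<phi> z) + w (snd h) z)" for h by (intro Ck_add Ck_scaleR Ck_const wk Ck_comp f)
  qed
 qed
 have fr: "Df \<phi> (t, p) (0, v) = w v (t, p)" for t p v by (subst frechet_derivative_at[OF ud, symmetric]) simp
 show "((%t. Df \<phi> (t, p) (0, v)) has_vector_derivative
   Df f (t, \<phi> (t, p)) (0, Df \<phi> (t, p) (0, v))) (at t)" unfolding fr using wd[of v p t] by (simp add: D_def)
 show "Df \<phi> (0, p) (0, v) = v" unfolding fr by (rule w0)
qed

lemma smooth_flow_exists: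
 fixes f :: "real \<times> 'e::euclidean_space => 'e"
 assumes f: "smooth UNIV f" and L: "!!t x y. norm (f (t, x) - f (t, y)) \<le> L * norm (x - y)" "0 \<le> L"
 obtains \<phi> where "!!p. \<phi> (0, p) = p" "!!t p. ((%t. \<phi> (t, p)) has_vector_derivative f (t, \<phi> (t, p))) (at t)"
  "smooth UNIV \<phi>"
proof -
 have "continuous_on UNIV (%(t, x). f (t, x))" using smooth_cont[OF f] by (simp add: case_prod_eta)
 from ode_exists[OF this L] have "\<forall>p. \<exists>u. u 0 = p \<and> (\<forall>t. (u has_vector_derivative f (t, u t)) (at t))" by blast
 then obtain u where u: "\<forall>p. u p 0 = p \<and> (\<forall>t. (u p has_vector_derivative f (t, u p t)) (at t))" unfolding choice_iff by (elim exE)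
 define \<phi> where "\<phi> = (%(t, p). u p t)"
 have \<phi>: "\<phi> (0, p) = p" "((%t. \<phi> (t, p)) has_vector_derivative f (t, \<phi> (t, p))) (at t)" for t p using u by (auto simp: \<phi>_def)
 show thesis by (rule that[OF \<phi>]) (use flow_Ck(1)[OF f L \<phi>] in \<open>auto simp: smooth_Ck\<close>)
qed

text \<open>The inverse of the time-one map is the time-one map of the reversed field - f(1 - t, x):
  its trajectories run backwards are trajectories of f, and uniqueness identifies them.\<close>

lemma flow_inverse_exists:
 fixes f :: "real \<times> 'e::euclidean_space => 'e"
 assumes f: "smooth UNIV f" and L: "!!t x y. norm (f (t, x) - f (t, y)) \<le> L * norm (x - y)" "0 \<le> L"
  and \<phi>: "!!p. \<phi> (0, p) = p" "!!t p. t \<in> {0..1} ==> ((%t. \<phi> (t, p)) has_vector_derivative f (t, \<phi> (t, p))) (at t within {0..1})"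
 obtains \<psi> where "smooth UNIV \<psi>" "!!p. \<psi> (\<phi> (1, p)) = p" "!!q. \<phi> (1, \<psi> q) = q"
proof -
 have r: "smooth UNIV (%z. - f (1 - fst z, snd z))"
  by (intro smooth_minus smooth_comp[OF f] smooth_Pair smooth_diff smooth_const smooth_fst smooth_snd smooth_id open_UNIV)
 obtain \<eta> where \<eta>: "!!p. \<eta> (0, p) = p" "!!t p. ((%t. \<eta> (t, p)) has_vector_derivative - f (1 - t, \<eta> (t, p))) (at t)"
  and s: "smooth UNIV \<eta>" using smooth_flow_exists[OF r, of L] L by (auto simp: norm_minus_commute)
 have rev: "((%t. \<eta> (1 - t, q)) has_vector_derivative f (t, \<eta> (1 - t, q))) (at t within {0..1})" for t q
 proof -
  have "(((%t. \<eta> (t, q)) \<circ> (%t. 1 - t)) has_vector_derivative (- 1) *\<^sub>R (- f (1 - (1 - t), \<eta> (1 - t, q)))) (at t within {0..1})"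
   by (rule vector_diff_chain_within[OF _ has_vector_derivative_at_within[OF \<eta>(2)]])
    (auto intro!: derivative_eq_intros)
  thus ?thesis by (simp add: o_def)
 qed
 have "\<eta> (1, \<phi> (1, p)) = p" for p
 proof -
  have "\<eta> (1 - 0, \<phi> (1, p)) = \<phi> (0, p)"
   by (rule ode_unique[where X="%t x. f (t, x)" and a=0 and b=1 and ?t0.0=1, OF rev \<phi>(2) L]) (simp_all add: \<eta>(1))
  thus ?thesis by (simp add: \<phi>(1))
 qed
 moreover have "\<phi> (1, \<eta> (1, q)) = q" for q
 proof -
  have "\<eta> (1 - 1, q) = \<phi> (1, \<eta> (1, q))"
   by (rule ode_unique[where X="%t x. f (t, x)" and a=0 and b=1 and ?t0.0=0, OF rev \<phi>(2) L]) (simp_all add: \<phi>(1))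
  thus ?thesis by (simp add: \<eta>(1))
 qed
 ultimately show thesis by (intro that[of "%q. \<eta> (1, q)"] smooth_comp[OF s] smooth_Pair smooth_const smooth_id open_UNIV)
qed

section \<open>Linear symplectic algebra\<close>

definition alt_form :: "('e::euclidean_space => 'e => real) => bool" where
 "alt_form \<Omega> \<longleftrightarrow> bilinear \<Omega> \<and> (\<forall>v. \<Omega> v v = 0)"

definition nondeg_form :: "('e::euclidean_space => 'e => real) => bool" where
 "nondeg_form \<Omega> \<longleftrightarrow> (\<forall>u. (\<forall>v. \<Omega> u v = 0) --> u = 0)"

text \<open>The standard basis is a symplectic basis of \<open>\<Omega>\<close> up to scaling.\<close>

definition paired_basis :: "('e::euclidean_space => 'e => real) => bool" where
 "paired_basis \<Omega> \<longleftrightarrow> (\<forall>b\<in>Basis. \<exists>a\<in>Basis. \<Omega> a b ~= 0 \<and> (\<forall>c\<in>Basis - {a, b}. \<Omega> a c = 0 \<and> \<Omega> b c = 0))"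

lemma alt_linear:
 assumes "alt_form \<Omega>"
 shows "linear (\<Omega> u)" "linear (%u. \<Omega> u v)" using assms by (auto simp: alt_form_def bilinear_def)

lemma alt_form_skew: "alt_form \<Omega> ==> \<Omega> u v = - \<Omega> v u"
proof -
 assume a: "alt_form \<Omega>"
 have "\<Omega> (u + v) (u + v) = \<Omega> u u + \<Omega> u v + (\<Omega> v u + \<Omega> v v)"
  using linear_add[OF alt_linear(1)[OF a]] linear_add[OF alt_linear(2)[OF a]] by (simp add: algebra_simps)
 thus ?thesis using a by (simp add: alt_form_def)
qed

lemma alt_form_Basis:
 assumes "alt_form \<Omega>"
 shows "\<Omega> u v = (\<Sum>b\<in>Basis. \<Sum>c\<in>Basis. (u \<bullet> b) * (v \<bullet> c) * \<Omega> b c)"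
proof -
 have "\<Omega> u v = (\<Sum>b\<in>Basis. (u \<bullet> b) * \<Omega> b v)" using linear_expand[OF alt_linear(2)[OF assms, of v], of u] by simp
 also have "... = (\<Sum>b\<in>Basis. (u \<bullet> b) * (\<Sum>c\<in>Basis. (v \<bullet> c) * \<Omega> b c))"
  using linear_expand[OF alt_linear(1)[OF assms], of _ v] by simp
 finally show ?thesis by (simp add: sum_distrib_left mult.assoc)
qed

text \<open>Symplectic Gram-Schmidt. P collects the basis vectors already paired; each round takes
  an unpaired b and a partner c and makes the images of all other basis vectors orthogonal to L b
  and L c. The map L is changed instead of the basis, so that the paired directions remain those
  along which cubes are cut.\<close>

lemma paired_basis_step:
 fixes \<Omega> :: "'e::euclidean_space => 'e => real" and L :: "'e => 'e"
 assumes \<Omega>: "alt_form \<Omega>" "nondeg_form \<Omega>"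
  and "linear L" "inj L" "P \<subseteq> Basis"
  and "!!b. b \<in> P ==> \<exists>a\<in>P. \<Omega> (L a) (L b) ~= 0 \<and> (\<forall>c\<in>Basis - {a, b}. \<Omega> (L a) (L c) = 0 \<and> \<Omega> (L b) (L c) = 0)"
 shows "\<exists>L :: 'e => 'e. linear L \<and> inj L \<and> paired_basis (%u v. \<Omega> (L u) (L v))" using assms(3-)
proof (induction "card (Basis - P)" arbitrary: L P rule: less_induct)
 case less
 note L = less.prems(1,2) and P = less.prems(3) and pr = less.prems(4)
 show ?case
 proof (cases "P = Basis")
  case True
  thus ?thesis using L pr by (intro exI[of _ L]) (auto simp: paired_basis_def)
 next
  case False
  then obtain b where b: "b \<in> Basis" "b \<notin> P" using P by blast
  have "L b ~= 0" using L b linear_injective_0[OF L(1)] nonzero_Basis by blast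
  then obtain v where v: "\<Omega> (L b) v ~= 0" using \<Omega>(2) unfolding nondeg_form_def by blast
  obtain w where w: "v = L w" using linear_inj_imp_surj[OF L] by (metis surjD)
  have "\<exists>c\<in>Basis. \<Omega> (L b) (L c) ~= 0"
  proof (rule ccontr)
   assume "\<not> (\<exists>c\<in>Basis. \<Omega> (L b) (L c) ~= 0)"
   hence "\<Omega> (L b) (L w) = 0" using linear_expand[OF linear_compose[OF L(1) alt_linear(1)[OF \<Omega>(1), of "L b"]], of w] by (simp add: o_def)
   thus False using v w by simp
  qed
  then obtain c where c: "c \<in> Basis" "\<Omega> (L b) (L c) ~= 0" by blast
  define \<kappa> where "\<kappa> = \<Omega> (L b) (L c)"
  have \<kappa>: "\<kappa> ~= 0" using c by (simp add: \<kappa>_def)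
  have bc: "b ~= c" using c \<Omega>(1) by (auto simp: alt_form_def)
  \<comment> \<open>A member of P has its partner in P as well, so its image is orthogonal to L b,
    contrary to the choice of c.\<close>
  have cP: "c \<notin> P"
  proof
   assume "c \<in> P"
   then obtain a where a: "a \<in> P" "\<forall>d\<in>Basis - {a, c}. \<Omega> (L a) (L d) = 0 \<and> \<Omega> (L c) (L d) = 0" using pr by blast
   hence "b \<in> Basis - {a, c}" using b \<open>c \<in> P\<close> by blast
   hence "\<Omega> (L c) (L b) = 0" using a by blast
   thus False using c alt_form_skew[OF \<Omega>(1), of "L b" "L c"] by simp
  qed
  let ?S = "P \<union> {b, c}"
  \<comment> \<open>The coefficients solve \<Omega> (L b) (M d) = 0 and \<Omega> (L c) (M d) = 0 for
    unpaired d, and leave the vectors of \<open>?S\<close> alone.\<close>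
  define \<alpha> where "\<alpha> d = (if d \<in> ?S then 0 else - \<Omega> (L d) (L c) / \<kappa>)" for d
  define \<beta> where "\<beta> d = (if d \<in> ?S then 0 else \<Omega> (L d) (L b) / \<kappa>)" for d
  define M where "M v = L v + (\<Sum>d\<in>Basis. (v \<bullet> d) * \<alpha> d) *\<^sub>R L b + (\<Sum>d\<in>Basis. (v \<bullet> d) * \<beta> d) *\<^sub>R L c" for v
  have Md: "M d = L d + \<alpha> d *\<^sub>R L b + \<beta> d *\<^sub>R L c" if "d \<in> Basis" for d
  proof -
   have "(\<Sum>e\<in>Basis. (d \<bullet> e) * f e) = f d" for f :: "'e => real"
    using that by (subst sum.remove[of _ d]) (auto simp: inner_Basis intro!: sum.neutral split: if_splits)
   thus ?thesis by (simp add: M_def)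
  qed
  have MS: "M d = L d" if "d \<in> ?S" for d using Md[of d] that P b c by (auto simp: \<alpha>_def \<beta>_def)
  have Mlin: "linear M" unfolding M_def by (intro linear_compose_add L(1) linearI)
    (simp_all add: inner_add_left distrib_right sum.distrib scaleR_add_left sum_distrib_left mult.assoc)
  \<comment> \<open>M is L after a unitriangular map: the multiples of L b and L c depend only on
    coordinates other than those of b and c.\<close>
  have Minj: "inj M"
  proof (subst linear_injective_0[OF Mlin], intro allI impI)
   fix v assume v: "M v = 0"
   define s t where "s = (\<Sum>d\<in>Basis. (v \<bullet> d) * \<alpha> d)" and "t = (\<Sum>d\<in>Basis. (v \<bullet> d) * \<beta> d)"
   have "L (v + s *\<^sub>R b + t *\<^sub>R c) = 0" using v by (simp add: M_def s_def t_def linear_add[OF L(1)] linear_scale[OF L(1)])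
   hence v0: "v + s *\<^sub>R b + t *\<^sub>R c = 0" using L linear_injective_0[OF L(1)] by blast
   have vd: "v \<bullet> d = 0" if "d \<in> Basis - {b, c}" for d
   proof -
    have "(v + s *\<^sub>R b + t *\<^sub>R c) \<bullet> d = v \<bullet> d" using that b c by (auto simp add: inner_add_left inner_Basis)
    thus ?thesis using v0 by simp
   qed
   have "s = 0" unfolding s_def by (rule sum.neutral) (use vd in \<open>auto simp: \<alpha>_def\<close>)
   moreover have "t = 0" unfolding t_def by (rule sum.neutral) (use vd in \<open>auto simp: \<beta>_def\<close>)
   ultimately show "v = 0" using v0 by simp
  qed
  note lin1 = linear_add[OF alt_linear(1)[OF \<Omega>(1)]] linear_scale[OF alt_linear(1)[OF \<Omega>(1)]]
   linear_add[OF alt_linear(2)[OF \<Omega>(1)]] linear_scale[OF alt_linear(2)[OF \<Omega>(1)]]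
   linear_diff[OF alt_linear(1)[OF \<Omega>(1)]] linear_diff[OF alt_linear(2)[OF \<Omega>(1)]]
  have alt: "\<Omega> x x = 0" for x using \<Omega>(1) by (simp add: alt_form_def)
  have cb: "\<Omega> (L c) (L b) = - \<kappa>" using alt_form_skew[OF \<Omega>(1), of "L c" "L b"] by (simp add: \<kappa>_def)
  have new: "\<Omega> (L b) (M d) = 0" "\<Omega> (L c) (M d) = 0" if "d \<in> Basis - {b, c}" for d
  proof -
   have "\<Omega> (L b) (M d) = 0 \<and> \<Omega> (L c) (M d) = 0"
   proof (cases "d \<in> P")
    case True
    then obtain a where a: "a \<in> P" "\<forall>c\<in>Basis - {a, d}. \<Omega> (L a) (L c) = 0 \<and> \<Omega> (L d) (L c) = 0" using pr by blast
    hence "\<Omega> (L d) (L b) = 0" "\<Omega> (L d) (L c) = 0" using b c cP True by auto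
    thus ?thesis using MS[of d] True alt_form_skew[OF \<Omega>(1), of _ "L d"] by auto
   next
    case False
    have db: "\<Omega> (L b) (L d) = - \<Omega> (L d) (L b)" "\<Omega> (L c) (L d) = - \<Omega> (L d) (L c)" using alt_form_skew[OF \<Omega>(1)] by blast+
    show ?thesis using that False \<kappa> Md[of d] by (simp add: lin1 alt cb \<alpha>_def \<beta>_def db flip: \<kappa>_def)
   qed
   thus "\<Omega> (L b) (M d) = 0" "\<Omega> (L c) (M d) = 0" by auto
  qed
  show ?thesis
  proof (rule less.hyps[of ?S M])
   show "card (Basis - ?S) < card (Basis - P)" using b by (intro psubset_card_mono) auto
   show "?S \<subseteq> Basis" using P b c by auto
   fix d assume d: "d \<in> ?S"
   show "\<exists>a\<in>?S. \<Omega> (M a) (M d) ~= 0 \<and> (\<forall>c'\<in>Basis - {a, d}. \<Omega> (M a) (M c') = 0 \<and> \<Omega> (M d) (M c') = 0)"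
   proof (cases "d \<in> P")
    case True
    then obtain a where a: "a \<in> P" "\<Omega> (L a) (L d) ~= 0" "\<forall>c\<in>Basis - {a, d}. \<Omega> (L a) (L c) = 0 \<and> \<Omega> (L d) (L c) = 0" using pr by blast
    have z: "\<Omega> (L a) (L b) = 0" "\<Omega> (L a) (L c) = 0" "\<Omega> (L d) (L b) = 0" "\<Omega> (L d) (L c) = 0" using a b c cP True by auto
    have "\<Omega> (M a) (M e) = 0 \<and> \<Omega> (M d) (M e) = 0" if e: "e \<in> Basis - {a, d}" for e
     using a(3) e Md[of e] MS[of a] MS[of d] True a(1) by (simp add: lin1 z)
    thus ?thesis using a MS[of a] MS[of d] True by (intro bexI[of _ a]) auto
   next
    case False
    hence "d = b \<or> d = c" using d by blast
    thus ?thesis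
    proof
     assume "d = b"
     thus ?thesis using new MS[of b] MS[of c] cb \<kappa> by (intro bexI[of _ c]) auto
    next
     assume "d = c"
     thus ?thesis using new MS[of b] MS[of c] \<kappa> by (intro bexI[of _ b]) (auto simp: \<kappa>_def)
    qed
   qed
  qed (use Mlin Minj in auto)
 qed
qed

lemma paired_basis_exists:
 fixes \<Omega> :: "'e::euclidean_space => 'e => real"
 assumes "alt_form \<Omega>" "nondeg_form \<Omega>"
 obtains L :: "'e => 'e" where "linear L" "inj L" "paired_basis (%u v. \<Omega> (L u) (L v))"
 using paired_basis_step[OF assms, of "%x. x" "{}"] by (auto intro: linear_ident)

section \<open>Extension by zero and smooth inverses\<close>

lemma smooth_extend_zero:
 assumes f: "smooth W f" and K: "closed K" "K \<subseteq> W" and z: "!!x. x \<in> W - K ==> f x = 0"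
 shows "smooth UNIV (%x. if x \<in> W then f x else 0)"
proof (rule smooth_local)
 fix x
 show "\<exists>V. x \<in> V \<and> smooth V (%x. if x \<in> W then f x else 0)"
 proof (cases "x \<in> W")
  case True
  thus ?thesis using f by (intro exI[of _ W]) (auto intro: smooth_cong[of W f])
 next
  case False
  have "smooth (- K) (%x. if x \<in> W then f x else 0)" by (rule smooth_cong[of _ "%x. 0"]) (use z K in \<open>auto intro: smooth_const\<close>)
  thus ?thesis using False K by (intro exI[of _ "- K"]) auto
 qed
qed simp

lemma smooth_compact_support_lipschitz:
 fixes f :: "'a::euclidean_space => 'b::euclidean_space"
 assumes f: "smooth UNIV f" and K: "compact K" "!!x. x \<notin> K ==> f x = 0"
 obtains L where "L \<ge> 0" "!!x y. norm (f x - f y) \<le> L * norm (x - y)"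
proof -
 define D where "D x = Df f x" for x
 have D: "(f has_derivative D x) (at x)" for x unfolding D_def by (rule smooth_deriv[OF f UNIV_I])
 have D0: "D x v = 0" if "x \<notin> K" for x v
 proof -
  have "Df f x = Df (%x. 0) x" by (rule Df_cong[of "- K"]) (use K that in \<open>auto intro: compact_imp_closed\<close>)
  thus ?thesis by (simp add: D_def)
 qed
 have "\<exists>M\<ge>0. \<forall>x. norm (D x b) \<le> M" for b
 proof -
  have "compact ((%x. D x b) ` K)" unfolding D_def by (intro compact_continuous_image K continuous_on_subset[OF smooth_cont[OF smooth_frechet[OF f]]]) auto
  then obtain M where "\<forall>x\<in>K. norm (D x b) \<le> M" using compact_imp_bounded bounded_iff by (metis image_eqI)
  hence "\<forall>x. norm (D x b) \<le> max M 0" using D0 by (metis max.coboundedI1 max.coboundedI2 norm_zero order_refl)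
  thus ?thesis by (intro exI[of _ "max M 0"]) auto
 qed
 then obtain M where M: "!!b. M b \<ge> 0" "!!b x. norm (D x b) \<le> M b" by metis
 define L where "L = real DIM('a) * (\<Sum>b\<in>Basis. M b)"
 have L: "L \<ge> 0" unfolding L_def by (intro mult_nonneg_nonneg sum_nonneg M) auto
 have "norm (D x v) \<le> L * norm v" for x v unfolding L_def
 proof (rule norm_linear_le_Basis[OF has_derivative_linear[OF D]])
  fix b :: 'a assume "b \<in> Basis"
  hence "M b \<le> (\<Sum>b\<in>Basis. M b)" by (intro member_le_sum M) auto
  thus "norm (D x b) \<le> (\<Sum>b\<in>Basis. M b)" using M(2)[of x b] by linarith
 qed
 hence "onorm (D x) \<le> L" for x by (rule onorm_le)
 hence "norm (f x - f y) \<le> L * norm (x - y)" for x y by (intro differentiable_bound[of UNIV f D]) (use D in auto)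
 thus thesis using that L by blast
qed

text \<open>At a zero of one factor the other one may be merely continuous. In
  \<open>smooth_inverse_operator\<close> this gives a derivative of the inverse while only its
  continuity is known.\<close>

lemma has_derivative_mult_vanishing:
 fixes h :: "'a::real_normed_vector => real" and k :: "'a => 'b::real_normed_vector"
 assumes h: "continuous (at x) h" and k: "(k has_derivative k') (at x)" "k x = 0"
 shows "((%y. h y *\<^sub>R k y) has_derivative (%v. h x *\<^sub>R k' v)) (at x)"
proof -
 have bl: "bounded_linear k'" using k(1) has_derivative_bounded_linear by blast
 obtain B where B: "!!v. norm (k' v) \<le> norm v * B" "B \<ge> 0" using bounded_linear.nonneg_bounded[OF bl] by blast
 have "((%y. (h y - h x) *\<^sub>R k y) has_derivative (%v. 0)) (at x)" unfolding has_derivative_at_alt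
 proof (intro conjI allI impI)
  fix e :: real assume e: "e > 0"
  obtain d1 where d1: "d1 > 0" "!!y. norm (y - x) < d1 ==> norm (k y - k x - k' (y - x)) \<le> 1 * norm (y - x)"
   using k(1) unfolding has_derivative_at_alt by (metis zero_less_one)
  have "e / (B + 1) > 0" using e B by simp
  then obtain d2 where d2: "d2 > 0" "!!y. dist y x < d2 ==> dist (h y) (h x) < e / (B + 1)" using h unfolding continuous_at_eps_delta by metis
  have "norm ((h y - h x) *\<^sub>R k y - (h x - h x) *\<^sub>R k x - 0) \<le> e * norm (y - x)" if y: "norm (y - x) < min d1 d2" for y
  proof -
   have "norm (k y) \<le> norm (k y - k x - k' (y - x)) + norm (k' (y - x))" using norm_triangle_ineq[of "k y - k x - k' (y - x)" "k' (y - x)"] k(2) by simp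
   also have "... \<le> (B + 1) * norm (y - x)" using d1(2)[of y] B(1)[of "y - x"] y by (simp add: algebra_simps)
   finally have 1: "norm (k y) \<le> (B + 1) * norm (y - x)" .
   have "norm ((h y - h x) *\<^sub>R k y) \<le> e / (B + 1) * ((B + 1) * norm (y - x))" unfolding norm_scaleR using d2(2)[of y] y 1 e B(2)
    by (intro mult_mono) (auto simp: dist_norm less_imp_le)
   thus ?thesis using B(2) by simp
  qed
  thus "\<exists>d>0. \<forall>y. norm (y - x) < d --> norm ((h y - h x) *\<^sub>R k y - (h x - h x) *\<^sub>R k x - 0) \<le> e * norm (y - x)"
   using d1(1) d2(1) by (intro exI[of _ "min d1 d2"]) auto
 qed (rule bounded_linear_zero)
 from has_derivative_add[OF this has_derivative_scaleR_right[OF k(1), of "h x"]]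
 show ?thesis by (simp flip: scaleR_add_left)
qed

text \<open>The lower bound c makes the inverse continuous. Differentiability comes from R z w = R
  z0 w - R z0 ((A z - A z0) (R z w)), where the inner term is a continuous factor times one that
  vanishes at z0. The resulting derivative is polynomial in R and in derivatives of A, so the order
  can be raised step by step.\<close>

lemma smooth_inverse_operator:
 fixes A :: "'z::euclidean_space => 'e::euclidean_space => 'e"
 assumes W: "open W" and lin: "!!z. z \<in> W ==> linear (A z)" and sm: "!!w. smooth W (%z. A z w)"
  and c: "c > 0" "!!z w. z \<in> W ==> c * norm w \<le> norm (A z w)"
 obtains R where "!!w. smooth W (%z. R z w)" "!!z w. z \<in> W ==> A z (R z w) = w"
  "!!z. z \<in> W ==> linear (R z)"
proof -
 define R where "R z = inv (A z)" for z
 have inj: "inj (A z)" if "z \<in> W" for z unfolding linear_injective_0[OF lin[OF that]] using c(2)[OF that] c(1)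
  by (metis mult_eq_0_iff norm_eq_zero norm_ge_zero norm_zero order_antisym mult_nonneg_nonneg less_imp_le less_irrefl)
 have AR: "A z (R z w) = w" if "z \<in> W" for z w unfolding R_def using linear_inj_imp_surj[OF lin inj, OF that that] by (rule surj_f_inv_f)
 have Rlin: "linear (R z)" if "z \<in> W" for z using linear_inj_imp_surj[OF lin inj, OF that that] inj[OF that] lin[OF that] inj_linear_imp_inv_linear
  unfolding R_def by blast
 have cont: "continuous (at z0) (%z. R z w)" if z0: "z0 \<in> W" for z0 w unfolding continuous_at_eps_delta
 proof (intro allI impI)
  fix e :: real assume e: "e > 0"
  define x where "x = R z0 w"
  have "continuous (at z0) (%z. A z x)" using smooth_cont[OF sm] W z0 continuous_on_eq_continuous_at by blast
  moreover have "c * e > 0" using c e by simp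
  ultimately obtain d1 where d1: "d1 > 0" "!!z. dist z z0 < d1 ==> dist (A z x) (A z0 x) < c * e" unfolding continuous_at_eps_delta by metis
  obtain d2 where d2: "d2 > 0" "ball z0 d2 \<subseteq> W" using W z0 openE by blast
  have "dist (R z w) (R z0 w) < e" if z: "dist z z0 < min d1 d2" for z
  proof -
   have zW: "z \<in> W" using z d2 by (auto simp: dist_commute)
   have "c * norm (R z w - x) \<le> norm (A z (R z w - x))" by (rule c(2)[OF zW])
   also have "A z (R z w - x) = A z0 x - A z x" using AR[OF zW] AR[OF z0] by (simp add: linear_diff[OF lin[OF zW]] x_def)
   also have "norm ... < c * e" using d1(2)[of z] z by (simp add: dist_norm norm_minus_commute)
   finally show ?thesis using c(1) by (simp add: x_def dist_norm)
  qed
  thus "\<exists>d>0. \<forall>z. dist z z0 < d --> dist (R z w) (R z0 w) < e" using d1(1) d2(1) by (intro exI[of _ "min d1 d2"]) auto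
 qed
 define A' where "A' b z = Df (%z. A z b) z" for b z
 have A': "((%z. A z b) has_derivative A' b z) (at z)" if "z \<in> W" for b z unfolding A'_def by (rule smooth_deriv[OF sm that])
 define R' where "R' w z v = - R z (\<Sum>b\<in>Basis. (R z w \<bullet> b) *\<^sub>R A' b z v)" for w z v
 have der: "((%z. R z w) has_derivative R' w z0) (at z0)" if z0: "z0 \<in> W" for z0 w
 proof -
  define F where "F z = (\<Sum>b\<in>Basis. (R z w \<bullet> b) *\<^sub>R (A z b - A z0 b))" for z
  have k: "((%z. A z b - A z0 b) has_derivative A' b z0) (at z0)" for b using has_derivative_diff[OF A'[OF z0] has_derivative_const] by simp
  have "(F has_derivative (%v. \<Sum>b\<in>Basis. (R z0 w \<bullet> b) *\<^sub>R A' b z0 v)) (at z0)" unfolding F_def[abs_def]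
   by (intro has_derivative_sum has_derivative_mult_vanishing k continuous_inner cont[OF z0] continuous_const) simp
  hence "((%z. R z0 w - R z0 (F z)) has_derivative (%v. 0 - R z0 (\<Sum>b\<in>Basis. (R z0 w \<bullet> b) *\<^sub>R A' b z0 v))) (at z0)" using Rlin[OF z0]
   by (intro has_derivative_diff has_derivative_const bounded_linear.has_derivative[of "R z0"])
    (simp_all add: linear_conv_bounded_linear)
  hence "((%z. R z0 w - R z0 (F z)) has_derivative R' w z0) (at z0)" by (simp add: R'_def[abs_def])
  thus ?thesis
  proof (rule has_derivative_transform_within_open[OF _ W z0])
   fix z assume z: "z \<in> W"
   have "A z (R z w) - A z0 (R z w) = F z" unfolding F_def using linear_expand[OF lin[OF z], of "R z w"] linear_expand[OF lin[OF z0], of "R z w"]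
    by (simp add: scaleR_diff_right sum_subtractf)
   hence "A z0 (R z0 w - R z0 (F z)) = A z0 (R z w)"
    using AR[OF z] AR[OF z0] by (simp add: linear_diff[OF lin[OF z0]] flip: \<open>A z (R z w) - A z0 (R z w) = F z\<close>)
   thus "R z0 w - R z0 (F z) = R z w" using inj[OF z0] by (simp add: inj_eq)
  qed
 qed
 have "Ck k W (%z. R z w)" for k w
 proof (induction k arbitrary: w)
  case 0
  show ?case using cont by (simp add: continuous_at_imp_continuous_on)
 next
  case (Suc k)
  show ?case
  proof (rule Ck_SucI[OF der])
   fix v
   have "Ck k W (%z. - (\<Sum>c\<in>Basis. ((\<Sum>b\<in>Basis. (R z w \<bullet> b) *\<^sub>R A' b z v) \<bullet> c) *\<^sub>R R z c))"
    by (intro Ck_bounded_linear[OF bounded_linear_minus[OF bounded_linear_ident]] Ck_sum Ck_scaleR Ck_inner Ck_const Suc)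
     (use smooth_frechet[OF sm] in \<open>auto simp: A'_def smooth_Ck\<close>)
   thus "Ck k W (%z. R' w z v)"
   proof (rule Ck_cong[OF W, rotated])
    fix z assume z: "z \<in> W"
    show "- (\<Sum>c\<in>Basis. ((\<Sum>b\<in>Basis. (R z w \<bullet> b) *\<^sub>R A' b z v) \<bullet> c) *\<^sub>R R z c) = R' w z v"
     unfolding R'_def using linear_expand[OF Rlin[OF z], symmetric] by simp
   qed
  qed
 qed
 thus thesis using that[of R] W AR Rlin by (auto simp: smooth_Ck)
qed

section \<open>Darboux coordinates\<close>

lemma Df_eq: "(f has_derivative f') (at x) ==> Df f x v = f' v" using frechet_derivative_at[of f f' x] by simp

lemma frechet_form_expand:
 fixes \<omega> :: "'e::euclidean_space => 'e => 'e => real"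
 assumes U: "open U" and sm: "!!u v. smooth U (%y. \<omega> y u v)" and alt: "!!y. y \<in> U ==> alt_form (\<omega> y)"
  and y: "y \<in> U"
 shows "Df (%z. \<omega> z u v) y w = (\<Sum>b\<in>Basis. (u \<bullet> b) * Df (%z. \<omega> z b v) y w)"
  and "Df (%z. \<omega> z u v) y w = (\<Sum>b\<in>Basis. (v \<bullet> b) * Df (%z. \<omega> z u b) y w)"
proof -
 have d: "((%z. \<omega> z u v) has_derivative Df (%z. \<omega> z u v) y) (at y)" for u v by (rule smooth_deriv[OF sm y])
 have "((%z. \<Sum>b\<in>Basis. (u \<bullet> b) * \<omega> z b v) has_derivative
   (%w. \<Sum>b\<in>Basis. (u \<bullet> b) * Df (%z. \<omega> z b v) y w)) (at y)" by (intro has_derivative_sum has_derivative_mult_right d)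
 hence "((%z. \<omega> z u v) has_derivative
   (%w. \<Sum>b\<in>Basis. (u \<bullet> b) * Df (%z. \<omega> z b v) y w)) (at y)"
 proof (rule has_derivative_transform_within_open[OF _ U y])
  fix z assume "z \<in> U"
  thus "(\<Sum>b\<in>Basis. (u \<bullet> b) * \<omega> z b v) = \<omega> z u v" using linear_expand[OF alt_linear(2)[OF alt, of z v], of u] by simp
 qed
 thus "Df (%z. \<omega> z u v) y w = (\<Sum>b\<in>Basis. (u \<bullet> b) * Df (%z. \<omega> z b v) y w)" by (rule Df_eq)
 have "((%z. \<Sum>b\<in>Basis. (v \<bullet> b) * \<omega> z u b) has_derivative
   (%w. \<Sum>b\<in>Basis. (v \<bullet> b) * Df (%z. \<omega> z u b) y w)) (at y)" by (intro has_derivative_sum has_derivative_mult_right d)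
 hence "((%z. \<omega> z u v) has_derivative
   (%w. \<Sum>b\<in>Basis. (v \<bullet> b) * Df (%z. \<omega> z u b) y w)) (at y)"
 proof (rule has_derivative_transform_within_open[OF _ U y])
  fix z assume "z \<in> U"
  thus "(\<Sum>b\<in>Basis. (v \<bullet> b) * \<omega> z u b) = \<omega> z u v" using linear_expand[OF alt_linear(1)[OF alt, of z u], of v] by simp
 qed
 thus "Df (%z. \<omega> z u v) y w = (\<Sum>b\<in>Basis. (v \<bullet> b) * Df (%z. \<omega> z u b) y w)" by (rule Df_eq)
qed

text \<open>The radial primitive: \<sigma>(y)(v) is the integral of t \<beta>(t y)(y, v) over
  [0, 1]. It vanishes at the origin, which keeps the origin at rest in Moser's flow.\<close>

lemma poincare_two_form:
 fixes \<beta> :: "'e::euclidean_space => 'e => 'e => real"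
 assumes sm: "!!u v. smooth (ball 0 r) (%y. \<beta> y u v)" and alt: "!!y. y \<in> ball 0 r ==> alt_form (\<beta> y)"
  and closed: "!!y u v w. y \<in> ball 0 r ==> Df (%z. \<beta> z v w) y u
    - Df (%z. \<beta> z u w) y v + Df (%z. \<beta> z u v) y w = 0"
 obtains \<sigma> where "!!v. smooth (ball 0 r) (%y. \<sigma> y v)" "!!v. \<sigma> 0 v = 0"
  "!!y u v. y \<in> ball 0 r ==> Df (%z. \<sigma> z v) y u - Df (%z. \<sigma> z u) y v = \<beta> y u v"
  "!!y. y \<in> ball 0 r ==> linear (\<sigma> y)"
proof -
 define D where "D u v y w = Df (%z. \<beta> z u v) y w" for u v y w
 have Dd: "((%z. \<beta> z u v) has_derivative D u v y) (at y)" if "y \<in> ball 0 r" for u v y unfolding D_def by (rule smooth_deriv[OF sm that])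
 have Dexp: "D u v y w = (\<Sum>b\<in>Basis. (u \<bullet> b) * D b v y w)" if "y \<in> ball 0 r" for u v y w
  unfolding D_def by (rule frechet_form_expand(1)[OF open_ball sm alt that])
 \<comment> \<open>The vector y is expanded in the basis because smoothness of \<beta> is known in
   fixed directions.\<close>
 define g where "g v z = (\<Sum>b\<in>Basis. (fst z \<bullet> b) * (snd z * \<beta> (snd z *\<^sub>R fst z) b v))" for v and z :: "'e \<times> real"
 define W where "W = {z :: 'e \<times> real. snd z *\<^sub>R fst z \<in> ball 0 r}"
 have W: "open W"
 proof -
  have "open ((%z :: 'e \<times> real. snd z *\<^sub>R fst z) -` ball 0 r)" by (rule open_vimage[OF open_ball]) (intro continuous_intros)
  thus ?thesis by (simp add: W_def vimage_def)
 qed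
 have Wsub: "ball 0 r \<times> cbox 0 1 \<subseteq> W"
 proof
  fix z :: "'e \<times> real" assume "z \<in> ball 0 r \<times> cbox 0 1"
  hence "norm (fst z) < r" "0 \<le> snd z" "snd z \<le> 1" by auto
  hence "snd z * norm (fst z) < r" using mult_left_le_one_le[of "norm (fst z)" "snd z"] by simp
  thus "z \<in> W" using \<open>0 \<le> snd z\<close> by (simp add: W_def)
 qed
 have tyW: "(y, t) \<in> W" if "y \<in> ball 0 r" "t \<in> {0..1}" for y t using Wsub that by auto
 have tyb: "t *\<^sub>R y \<in> ball 0 r" if "y \<in> ball 0 r" "t \<in> {0..1}" for y :: 'e and t using tyW[OF that] unfolding W_def by simp
 have gs: "smooth W (g v)" for v unfolding g_def[abs_def] by (intro smooth_sum smooth_mult smooth_inner smooth_fst smooth_snd smooth_id smooth_const W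
    smooth_compose[OF sm] smooth_scaleR) (auto simp: W_def)
 define \<sigma> where "\<sigma> y v = integral (cbox 0 1) (%t. g v (y, t))" for y v
 have gexp: "g v (y, t) = t * \<beta> (t *\<^sub>R y) y v" if "t *\<^sub>R y \<in> ball 0 r" for v y t using linear_expand[OF alt_linear(2)[OF alt[OF that], of v], of y]
  by (simp add: g_def sum_distrib_left mult_ac)
 have gd: "Df (g v) (y, t) (u, 0) = t * (t * D y v (t *\<^sub>R y) u + \<beta> (t *\<^sub>R y) u v)"
  if y: "y \<in> ball 0 r" "t \<in> {0..1}" for v y t u
 proof -
  have ty: "(y, t) \<in> W" "t *\<^sub>R y \<in> ball 0 r" using tyW tyb y by blast+
  have "((%y. (y, t)) has_derivative (%u. (u, 0))) (at y)" by (intro has_derivative_Pair has_derivative_const has_derivative_ident)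
  from has_derivative_compose[OF this smooth_deriv[OF gs ty(1)]]
  have 1: "((%y. g v (y, t)) has_derivative (%u. Df (g v) (y, t) (u, 0))) (at y)" .
  have "((%y. \<beta> (t *\<^sub>R y) b v) has_derivative (%u. D b v (t *\<^sub>R y) (t *\<^sub>R u))) (at y)" for b
   by (rule has_derivative_compose[of "%y. t *\<^sub>R y" "%u. t *\<^sub>R u" y UNIV "%z. \<beta> z b v" "D b v (t *\<^sub>R y)",
      OF has_derivative_scaleR_right[OF has_derivative_ident] Dd[OF ty(2)]])
  hence 2: "((%y. g v (y, t)) has_derivative (%u. \<Sum>b\<in>Basis. (y \<bullet> b) * (t * D b v (t *\<^sub>R y) (t *\<^sub>R u)) + (u \<bullet> b) * (t * \<beta> (t *\<^sub>R y) b v))) (at y)"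
   unfolding g_def fst_conv snd_conv by (intro has_derivative_sum has_derivative_mult has_derivative_mult_right has_derivative_inner_left has_derivative_ident)
  have lin: "D b v (t *\<^sub>R y) (t *\<^sub>R u) = t * D b v (t *\<^sub>R y) u" for b using linear_scale[OF has_derivative_linear[OF Dd[OF ty(2)]]] by simp
  have "Df (g v) (y, t) (u, 0) = (\<Sum>b\<in>Basis. (y \<bullet> b) * (t * D b v (t *\<^sub>R y) (t *\<^sub>R u)) + (u \<bullet> b) * (t * \<beta> (t *\<^sub>R y) b v))"
   using has_derivative_unique[OF 1 2] by metis
  also have "... = t * (t * D y v (t *\<^sub>R y) u + \<beta> (t *\<^sub>R y) u v)"
   unfolding Dexp[OF ty(2), of y] lin using linear_expand[OF alt_linear(2)[OF alt[OF ty(2)], of v], of u] by (simp add: sum.distrib sum_distrib_left algebra_simps)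
  finally show ?thesis .
 qed
 have gfi: "(%t. Df (g v) (y, t) (u, 0)) integrable_on {0..1}" if y: "y \<in> ball 0 r" for v y u
 proof (rule integrable_continuous_interval, rule continuous_on_compose2[OF smooth_cont[OF smooth_frechet[OF gs]]])
  show "(%t. (y, t)) ` {0..1} \<subseteq> W" using Wsub y by auto
 qed (intro continuous_intros)
 show thesis
 proof (rule that[of \<sigma>])
  show "smooth (ball 0 r) (%y. \<sigma> y v)" for v unfolding \<sigma>_def by (rule smooth_param_integral[OF gs open_ball Wsub])
  show "\<sigma> 0 v = 0" for v by (simp add: \<sigma>_def g_def)
  show "linear (\<sigma> y)" if y: "y \<in> ball 0 r" for y
  proof -
   have ty: "t *\<^sub>R y \<in> ball 0 r" if "t \<in> {0..1}" for t by (rule tyb[OF y that])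
   have gi: "(%t. g v (y, t)) integrable_on {0..1}" for v
   proof (rule integrable_continuous_interval, rule continuous_on_compose2[OF smooth_cont[OF gs]])
    show "(%t. (y, t)) ` {0..1} \<subseteq> W" using Wsub y by auto
   qed (intro continuous_intros)
   show ?thesis
   proof (rule linearI)
    fix v w
    have "\<sigma> y (v + w) = integral {0..1} (%t. g v (y, t) + g w (y, t))" unfolding \<sigma>_def cbox_interval by (rule Henstock_Kurzweil_Integration.integral_cong)
      (use ty in \<open>auto simp: gexp linear_add[OF alt_linear(1)[OF alt]] algebra_simps\<close>)
    also have "... = \<sigma> y v + \<sigma> y w" unfolding \<sigma>_def cbox_interval by (simp add: Henstock_Kurzweil_Integration.integral_add gi)
    finally show "\<sigma> y (v + w) = \<sigma> y v + \<sigma> y w" .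
   next
    fix c v
    have "\<sigma> y (c *\<^sub>R v) = integral {0..1} (%t. c * g v (y, t))" unfolding \<sigma>_def cbox_interval by (rule Henstock_Kurzweil_Integration.integral_cong)
      (use ty in \<open>auto simp: gexp linear_scale[OF alt_linear(1)[OF alt]] algebra_simps\<close>)
    thus "\<sigma> y (c *\<^sub>R v) = c *\<^sub>R \<sigma> y v" unfolding \<sigma>_def by simp
   qed
  qed
  show "Df (%z. \<sigma> z v) y u - Df (%z. \<sigma> z u) y v = \<beta> y u v"
   if y: "y \<in> ball 0 r" for y u v
  proof -
   have ty: "t *\<^sub>R y \<in> ball 0 r" if "t \<in> {0..1}" for t by (rule tyb[OF y that])
   have "Df (%z. \<sigma> z v) y u = integral {0..1} (%t. Df (g v) (y, t) (u, 0))" for u v unfolding \<sigma>_def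
    using frechet_derivative_at[OF has_derivative_param_integral[OF gs open_ball Wsub y], of v, symmetric] by simp
   hence "Df (%z. \<sigma> z v) y u - Df (%z. \<sigma> z u) y v
    = integral {0..1} (%t. Df (g v) (y, t) (u, 0) - Df (g u) (y, t) (v, 0))" using gfi[OF y] by (simp add: Henstock_Kurzweil_Integration.integral_diff)
   \<comment> \<open>Closedness turns the integrand into the derivative of t^2 \<beta>(t y)(u, v)
     with respect to t.\<close>
   also have "... = integral {0..1} (%t. 2 * t * \<beta> (t *\<^sub>R y) u v + t\<^sup>2 * D u v (t *\<^sub>R y) y)"
   proof (rule Henstock_Kurzweil_Integration.integral_cong)
    fix t :: real assume t: "t \<in> {0..1}"
    have 1: "D u v (t *\<^sub>R y) y = D y v (t *\<^sub>R y) u - D y u (t *\<^sub>R y) v" using closed[OF ty[OF t], of u v y] by (simp add: D_def algebra_simps)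
    have 2: "\<beta> (t *\<^sub>R y) v u = - \<beta> (t *\<^sub>R y) u v" by (rule alt_form_skew[OF alt[OF ty[OF t]]])
    show "Df (g v) (y, t) (u, 0) - Df (g u) (y, t) (v, 0)
     = 2 * t * \<beta> (t *\<^sub>R y) u v + t\<^sup>2 * D u v (t *\<^sub>R y) y" unfolding gd[OF y t] 1 2 by (simp add: algebra_simps power2_eq_square)
   qed
   also have "... = 1\<^sup>2 * \<beta> (1 *\<^sub>R y) u v - 0\<^sup>2 * \<beta> (0 *\<^sub>R y) u v"
   proof (rule integral_unique, rule fundamental_theorem_of_calculus)
    fix t :: real assume t: "t \<in> {0..1}"
    have "((%t. \<beta> (t *\<^sub>R y) u v) has_derivative (%h. D u v (t *\<^sub>R y) (h *\<^sub>R y))) (at t)"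
     by (rule has_derivative_compose[of "%t. t *\<^sub>R y" "%h. h *\<^sub>R y" t UNIV "%z. \<beta> z u v" "D u v (t *\<^sub>R y)",
       OF has_derivative_scaleR_left[OF has_derivative_ident] Dd[OF ty[OF t]]])
    hence "((%t. \<beta> (t *\<^sub>R y) u v) has_real_derivative D u v (t *\<^sub>R y) y) (at t)"
     unfolding has_field_derivative_def using linear_scale[OF has_derivative_linear[OF Dd[OF ty[OF t]]]] by (simp add: mult_commute_abs)
    hence "((%t. t\<^sup>2 * \<beta> (t *\<^sub>R y) u v) has_real_derivative (2 * t * \<beta> (t *\<^sub>R y) u v + t\<^sup>2 * D u v (t *\<^sub>R y) y)) (at t)"
     by (auto intro!: derivative_eq_intros)
    thus "((%t. t\<^sup>2 * \<beta> (t *\<^sub>R y) u v) has_vector_derivative 2 * t * \<beta> (t *\<^sub>R y) u v + t\<^sup>2 * D u v (t *\<^sub>R y) y) (at t within {0..1})"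
     by (metis has_field_derivative_at_within has_real_derivative_iff_has_vector_derivative)
   qed simp
   finally show ?thesis by simp
  qed
 qed
qed

text \<open>The sum is the vector that represents the functional \<Omega> u. By nondegeneracy it is
  an injective linear function of u, hence bounded below.\<close>

lemma nondeg_lower_bound:
 fixes \<Omega> :: "'e::euclidean_space => 'e => real"
 assumes "alt_form \<Omega>" "nondeg_form \<Omega>"
 obtains c where "c > 0" "!!u. c * norm u \<le> norm (\<Sum>b\<in>Basis. \<Omega> u b *\<^sub>R b)"
proof -
 define A where "A u = (\<Sum>b\<in>Basis. \<Omega> u b *\<^sub>R b)" for u
 have lin: "linear A" unfolding A_def by (rule linearI) (simp_all add: linear_add[OF alt_linear(2)[OF assms(1)]] linear_scale[OF alt_linear(2)[OF assms(1)]]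
    scaleR_add_left sum.distrib scaleR_sum_right)
 have Ai: "A u \<bullet> b = \<Omega> u b" if "b \<in> Basis" for u b unfolding A_def using that by (simp add: inner_sum_left_Basis)
 have "inj A"
 proof (subst linear_injective_0[OF lin], intro allI impI)
  fix u assume "A u = 0"
  hence "\<Omega> u b = 0" if "b \<in> Basis" for b using Ai[OF that, of u] by simp
  hence "\<Omega> u v = 0" for v using linear_expand[OF alt_linear(1)[OF assms(1)], of u v] by simp
  thus "u = 0" using assms(2) unfolding nondeg_form_def by blast
 qed
 then obtain c where "c > 0" "\<forall>u. c * norm u \<le> norm (A u)" using linear_inj_bounded_below_pos[OF lin] by blast
 thus thesis using that unfolding A_def by blast
qed

text \<open>Moser's trick: the flow of \<open>X\<close> with \<open>\<omega>t t (X, -) = - \<sigma>\<close>, where \<open>\<sigma>\<close> is a primitive of \<open>\<omega> - \<omega> 0\<close>, cut off away from 0.\<close>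

lemma moser:
 fixes \<omega> :: "'e::euclidean_space => 'e => 'e => real"
 assumes r: "r > 0" and sm: "!!u v. smooth (ball 0 r) (%y. \<omega> y u v)" and alt: "!!y. y \<in> ball 0 r ==> alt_form (\<omega> y)"
  and closed: "!!y u v w. y \<in> ball 0 r ==> Df (%z. \<omega> z v w) y u
    - Df (%z. \<omega> z u w) y v + Df (%z. \<omega> z u v) y w = 0"
  and nd: "nondeg_form (\<omega> 0)"
 obtains r' \<Phi> \<Psi> where "r' > 0" "smooth UNIV \<Phi>" "smooth UNIV \<Psi>" "\<Phi> 0 = 0"
  "!!q. \<Psi> (\<Phi> q) = q" "!!q. \<Phi> (\<Psi> q) = q" "!!q. q \<in> ball 0 r' ==> \<Phi> q \<in> ball 0 r"
  "!!q u v. q \<in> ball 0 r' ==> \<omega> (\<Phi> q) (Df \<Phi> q u) (Df \<Phi> q v) = \<omega> 0 u v"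
proof -
 define \<Omega> where "\<Omega> = \<omega> 0"
 define \<beta> where "\<beta> y u v = \<omega> y u v - \<Omega> u v" for y u v
 have \<Omega>: "alt_form \<Omega>" unfolding \<Omega>_def using alt[of 0] r by simp
 have \<beta>s: "smooth (ball 0 r) (%y. \<beta> y u v)" for u v unfolding \<beta>_def by (intro smooth_diff sm smooth_const open_ball)
 have \<beta>a: "alt_form (\<beta> y)" if "y \<in> ball 0 r" for y unfolding alt_form_def bilinear_def
 proof (intro conjI allI)
  show "linear (%v. \<beta> y u v)" "linear (%u. \<beta> y u v)" for u v unfolding \<beta>_def by (intro linear_compose_sub alt_linear \<Omega> alt that)+
  show "\<beta> y v v = 0" for v using alt[OF that] \<Omega> by (simp add: \<beta>_def alt_form_def)
 qed
 define D where "D u v y w = Df (%z. \<beta> z u v) y w" for u v y w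
 have D\<omega>: "D u v y w = Df (%z. \<omega> z u v) y w" if "y \<in> ball 0 r" for u v y w unfolding D_def \<beta>_def
  using Df_eq[OF has_derivative_diff[OF smooth_deriv[OF sm that] has_derivative_const]] by simp
 have Dd: "((%z. \<beta> z u v) has_derivative D u v y) (at y)" if "y \<in> ball 0 r" for u v y unfolding D_def by (rule smooth_deriv[OF \<beta>s that])
 have Dexp: "D u v y w = (\<Sum>b\<in>Basis. (u \<bullet> b) * D b v y w)" "D u v y w = (\<Sum>b\<in>Basis. (v \<bullet> b) * D u b y w)"
  if "y \<in> ball 0 r" for u v y w unfolding D_def by (rule frechet_form_expand(1)[OF open_ball \<beta>s \<beta>a that], simp)
   (rule frechet_form_expand(2)[OF open_ball \<beta>s \<beta>a that], simp)
 have Dcl: "D v w y u - D u w y v + D u v y w = 0" if "y \<in> ball 0 r" for u v w y using closed[OF that] unfolding D\<omega>[OF that] .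
 have "Df (%z. \<beta> z v w) y u - Df (%z. \<beta> z u w) y v
    + Df (%z. \<beta> z u v) y w = 0" if "y \<in> ball 0 r" for u v w y using Dcl[OF that] unfolding D_def .
 note Dcl' = this
 obtain \<sigma> where \<sigma>s: "!!v. smooth (ball 0 r) (%y. \<sigma> y v)" and \<sigma>0: "!!v. \<sigma> 0 v = 0"
  and d\<sigma>: "!!y u v. y \<in> ball 0 r ==> Df (%z. \<sigma> z v) y u - Df (%z. \<sigma> z u) y v = \<beta> y u v"
  and \<sigma>l: "!!y. y \<in> ball 0 r ==> linear (\<sigma> y)" by (rule poincare_two_form[OF \<beta>s \<beta>a Dcl']) (assumption | rule that)+
 define \<omega>t where "\<omega>t t y u v = \<Omega> u v + t * \<beta> y u v" for t y u v
 have \<omega>ta: "alt_form (\<omega>t t y)" if "y \<in> ball 0 r" for t y unfolding alt_form_def bilinear_def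
 proof (intro conjI allI)
  have "linear (%v. \<Omega> u v + t *\<^sub>R \<beta> y u v)" "linear (%u. \<Omega> u v + t *\<^sub>R \<beta> y u v)" for u v
   by (intro linear_compose_add linear_compose_scale_right alt_linear \<Omega> \<beta>a that)+
  thus "linear (%v. \<omega>t t y u v)" "linear (%u. \<omega>t t y u v)" for u v by (simp_all add: \<omega>t_def)
  show "\<omega>t t y v v = 0" for v using \<beta>a[OF that] \<Omega> by (simp add: \<omega>t_def alt_form_def)
 qed
 have nd': "nondeg_form \<Omega>" using nd by (simp add: \<Omega>_def)
 obtain c where c: "c > 0" "!!u. c * norm u \<le> norm (\<Sum>b\<in>Basis. \<Omega> u b *\<^sub>R b)" using nondeg_lower_bound[OF \<Omega> nd'] by blast
 define B where "B y u = (\<Sum>b\<in>Basis. \<beta> y u b *\<^sub>R b)" for y u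
 have Bl: "linear (B y)" if "y \<in> ball 0 r" for y unfolding B_def
  by (rule linearI) (simp_all add: linear_add[OF alt_linear(2)[OF \<beta>a[OF that]]] linear_scale[OF alt_linear(2)[OF \<beta>a[OF that]]]
    scaleR_add_left sum.distrib scaleR_sum_right)
 \<comment> \<open>For |t| < 2 a \<beta> of this size changes \<Omega> by at most half of its lower
   bound c, so all forms \<open>\<omega>t t\<close> stay invertible with the common bound c /
   2.\<close>
 define \<eta> where "\<eta> = c / (4 * real DIM('e))"
 have \<eta>: "\<eta> > 0" using c by (simp add: \<eta>_def)
 define S where "S y = (\<Sum>u\<in>Basis. norm (B y u))" for y
 have Sc: "continuous_on (ball 0 r) S" unfolding S_def B_def by (intro continuous_intros smooth_cont[OF \<beta>s])
 have S0: "S 0 = 0" by (simp add: S_def B_def \<beta>_def \<Omega>_def)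
 have "0 \<in> ball (0::'e) r" using r by simp
 from Sc[unfolded continuous_on_iff, rule_format, OF this \<eta>]
 obtain \<rho>0 where \<rho>0': "\<rho>0 > 0" "\<forall>y\<in>ball 0 r. dist y 0 < \<rho>0 --> dist (S y) (S 0) < \<eta>" by blast
 have \<rho>0: "\<rho>0 > 0" "!!y. y \<in> ball 0 r ==> norm y < \<rho>0 ==> (\<Sum>u\<in>Basis. norm (B y u)) < \<eta>"
  using \<rho>0' S0 unfolding dist_norm S_def by (simp_all add: sum_nonneg)
 define \<rho> where "\<rho> = min r \<rho>0"
 have \<rho>: "\<rho> > 0" "!!y. y \<in> ball 0 \<rho> ==> y \<in> ball 0 r" "!!y. y \<in> ball 0 \<rho> ==> (\<Sum>u\<in>Basis. norm (B y u)) < \<eta>"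
  using r \<rho>0 by (auto simp: \<rho>_def)
 define W where "W = {-2<..<2::real} \<times> ball (0::'e) \<rho>"
 have W: "open W" unfolding W_def by (intro open_Times) auto
 define A where "A z u = (\<Sum>b\<in>Basis. \<omega>t (fst z) (snd z) u b *\<^sub>R b)" for z u
 have Wr: "snd z \<in> ball 0 r" "\<bar>fst z\<bar> < 2" "snd z \<in> ball 0 \<rho>" if "z \<in> W" for z using that by (auto simp: W_def \<rho>_def)
 have Al: "linear (A z)" if "z \<in> W" for z unfolding A_def by (rule linearI) (simp_all add: linear_add[OF alt_linear(2)[OF \<omega>ta[OF Wr(1)[OF that]]]]
    linear_scale[OF alt_linear(2)[OF \<omega>ta[OF Wr(1)[OF that]]]] scaleR_add_left sum.distrib scaleR_sum_right)
 have As: "smooth W (%z. A z u)" for u unfolding A_def \<omega>t_def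
  by (intro smooth_sum smooth_scaleR smooth_add smooth_mult smooth_const smooth_fst smooth_id W smooth_compose[OF \<beta>s] smooth_snd)
   (use Wr in auto)
 have Ac: "c / 2 * norm u \<le> norm (A z u)" if z: "z \<in> W" for z u
 proof -
  have "norm (B (snd z) u) \<le> real DIM('e) * \<eta> * norm u"
  proof (rule norm_linear_le_Basis[OF Bl[OF Wr(1)[OF z]]])
   fix b :: 'e assume "b \<in> Basis"
   hence "norm (B (snd z) b) \<le> (\<Sum>u\<in>Basis. norm (B (snd z) u))" by (intro member_le_sum) auto
   thus "norm (B (snd z) b) \<le> \<eta>" using \<rho>(3)[OF Wr(3)[OF z]] by linarith
  qed
  hence "norm (fst z *\<^sub>R B (snd z) u) \<le> 2 * (real DIM('e) * \<eta> * norm u)" unfolding norm_scaleR using Wr(2)[OF z] by (intro mult_mono) auto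
  also have "... = c / 2 * norm u" by (simp add: \<eta>_def)
  finally have 1: "norm (fst z *\<^sub>R B (snd z) u) \<le> c / 2 * norm u" .
  have "A z u = (\<Sum>b\<in>Basis. \<Omega> u b *\<^sub>R b) + fst z *\<^sub>R B (snd z) u"
   by (simp add: A_def B_def \<omega>t_def scaleR_add_left sum.distrib scaleR_sum_right)
  hence "norm (\<Sum>b\<in>Basis. \<Omega> u b *\<^sub>R b) \<le> norm (A z u) + norm (fst z *\<^sub>R B (snd z) u)"
   using norm_triangle_ineq4[of "A z u" "fst z *\<^sub>R B (snd z) u"] by simp
  thus ?thesis using c(2)[of u] 1 by linarith
 qed
 have c2: "c / 2 > 0" using c by simp
 obtain R where Rs: "!!w. smooth W (%z. R z w)" and AR: "!!z w. z \<in> W ==> A z (R z w) = w"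
  and Rl: "!!z. z \<in> W ==> linear (R z)" using smooth_inverse_operator[OF W Al As c2 Ac] by blast
 define X where "X z = (\<Sum>b\<in>Basis. (- \<sigma> (snd z) b) *\<^sub>R R z b)" for z
 have Xs: "smooth W X" unfolding X_def[abs_def] 
  by (intro smooth_sum smooth_scaleR smooth_minus W Rs smooth_compose[OF \<sigma>s] smooth_snd smooth_id) (use Wr in auto)
 have X\<omega>: "\<omega>t (fst z) (snd z) (X z) v = - \<sigma> (snd z) v" if z: "z \<in> W" for z v
 proof -
  have AX: "A z (X z) = (\<Sum>b\<in>Basis. (- \<sigma> (snd z) b) *\<^sub>R b)"
   unfolding X_def using AR[OF z] by (simp add: linear_sum[OF Al[OF z]] linear_scale[OF Al[OF z]] linear_neg[OF Al[OF z]])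
  have b: "\<omega>t (fst z) (snd z) (X z) b = - \<sigma> (snd z) b" if "b \<in> Basis" for b
  proof -
   have "A z (X z) \<bullet> b = \<omega>t (fst z) (snd z) (X z) b" unfolding A_def using that by (simp add: inner_sum_left_Basis)
   moreover have "A z (X z) \<bullet> b = - \<sigma> (snd z) b" unfolding AX using that by (simp only: inner_sum_left_Basis)
   ultimately show ?thesis by simp
  qed
  have "\<omega>t (fst z) (snd z) (X z) v = (\<Sum>b\<in>Basis. (v \<bullet> b) *\<^sub>R \<omega>t (fst z) (snd z) (X z) b)"
   by (rule linear_expand[OF alt_linear(1)[OF \<omega>ta[OF Wr(1)[OF z]]]])
  also have "... = - (\<Sum>b\<in>Basis. (v \<bullet> b) *\<^sub>R \<sigma> (snd z) b)" by (simp add: b sum_negf)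
  also have "... = - \<sigma> (snd z) v" using linear_expand[OF \<sigma>l[OF Wr(1)[OF z]], of v] by simp
  finally show ?thesis .
 qed
 \<comment> \<open>Equal to 1 for times in [0, 1] and |y| < \<rho> / 4, and supported in the compact
   K below. The cutoff makes the field Lipschitz on the whole space, so that its flow is
   global.\<close>
 define \<theta> where "\<theta> z = cut (1/2) 1 (fst z - 1/2) * cut (\<rho>\<^sup>2 / 16) (\<rho>\<^sup>2 / 4) (snd z \<bullet> snd z)" for z :: "real \<times> 'e"
 have \<theta>s: "smooth W \<theta>"
  unfolding \<theta>_def[abs_def] by (intro smooth_mult smooth_cut_compose smooth_diff smooth_fst smooth_snd smooth_id smooth_const smooth_inner W)
 define K where "K = {-1/2..3/2::real} \<times> cball (0::'e) (\<rho> / 2)"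
 have K: "compact K" "K \<subseteq> W" unfolding K_def W_def using \<rho>(1) by (auto intro!: compact_Times)
 have \<theta>0: "\<theta> z = 0" if "z \<notin> K" for z
 proof (cases "fst z \<in> {-1/2..3/2}")
  case True
  hence "norm (snd z) > \<rho> / 2" using that by (cases z) (auto simp: K_def)
  hence "(\<rho> / 2)\<^sup>2 \<le> (norm (snd z))\<^sup>2" using \<rho>(1) by (intro power_mono) auto
  hence "\<rho>\<^sup>2 / 4 \<le> \<bar>snd z \<bullet> snd z\<bar>" by (simp add: power2_norm_eq_inner power_divide)
  hence "cut (\<rho>\<^sup>2 / 16) (\<rho>\<^sup>2 / 4) (snd z \<bullet> snd z) = 0" using \<rho>(1) by (intro cut_eq_0) auto
  thus ?thesis by (simp add: \<theta>_def)
 next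
  case False
  hence "1 \<le> \<bar>fst z - 1/2\<bar>" by auto
  hence "cut (1/2) 1 (fst z - 1/2) = 0" by (intro cut_eq_0) auto
  thus ?thesis by (simp add: \<theta>_def)
 qed
 have \<theta>1: "\<theta> (t, y) = 1" if "t \<in> {0..1}" "y \<in> ball 0 (\<rho> / 4)" for t y
 proof -
  have "(norm y)\<^sup>2 \<le> (\<rho> / 4)\<^sup>2" using that by (intro power_mono) auto
  hence "\<bar>y \<bullet> y\<bar> \<le> \<rho>\<^sup>2 / 16" by (simp add: power2_norm_eq_inner power_divide)
  moreover have "\<bar>t - 1/2\<bar> \<le> 1/2" using that unfolding abs_le_iff by auto
  ultimately show ?thesis using \<rho>(1) by (simp add: \<theta>_def cut_eq_1)
 qed
 define Y where "Y z = (if z \<in> W then \<theta> z *\<^sub>R X z else 0)" for z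
 have Ys: "smooth UNIV Y" unfolding Y_def[abs_def]
  by (rule smooth_extend_zero[OF smooth_scaleR[OF \<theta>s Xs] compact_imp_closed[OF K(1)] K(2)]) (simp add: \<theta>0)
 have YK: "Y z = 0" if "z \<notin> K" for z using \<theta>0[OF that] by (simp add: Y_def)
 have Wt: "(t, y) \<in> W" if "t \<in> {0..1}" "y \<in> ball 0 (\<rho> / 4)" for t y using that \<rho>(1) by (auto simp: W_def)
 have YX: "Y (t, y) = X (t, y)" if "t \<in> {0..1}" "y \<in> ball 0 (\<rho> / 4)" for t y using \<theta>1[OF that] Wt[OF that] by (simp add: Y_def)
 obtain L where L: "L \<ge> 0" "!!x y. norm (Y x - Y y) \<le> L * norm (x - y)" using smooth_compact_support_lipschitz[OF Ys K(1) YK] by blast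
 have YL: "norm (Y (t, x) - Y (t, y)) \<le> L * norm (x - y)" for t x y using L(2)[of "(t, x)" "(t, y)"] by (simp add: norm_Pair)
 obtain \<phi> where \<phi>: "!!p. \<phi> (0, p) = p" "!!t p. ((%t. \<phi> (t, p)) has_vector_derivative Y (t, \<phi> (t, p))) (at t)"
  "smooth UNIV \<phi>" using smooth_flow_exists[OF Ys YL L(1)] by blast
 obtain \<Psi> where \<Psi>: "smooth UNIV \<Psi>" "!!p. \<Psi> (\<phi> (1, p)) = p" "!!q. \<phi> (1, \<Psi> q) = q"
  using flow_inverse_exists[OF Ys YL L(1) \<phi>(1) has_vector_derivative_at_within[OF \<phi>(2)]] by blast
 \<comment> \<open>The primitive \<sigma> vanishes at 0, so the origin is at rest, and trajectories
   starting nearby stay up to time 1 where the cutoff is 1.\<close>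
 have \<phi>0: "\<phi> (t, 0) = 0" if t: "t \<in> {0..1}" for t
 proof (rule ode_unique[where X="%t x. Y (t, x)" and a=0 and b=1 and ?t0.0=0, OF has_vector_derivative_at_within[OF \<phi>(2)] _ YL L(1) _ _ t])
  fix t :: real assume "t \<in> {0..1}"
  hence "Y (t, 0) = 0" using YX[of t 0] \<rho>(1) by (simp add: X_def \<sigma>0)
  thus "((%t. 0) has_vector_derivative Y (t, 0)) (at t within {0..1})" by simp
 qed (auto simp: \<phi>(1))
 have \<rho>4: "\<rho> / 4 > 0" using \<rho>(1) by simp
 obtain r' where r': "r' > 0" "!!t q. t \<in> {0..1} ==> dist q 0 < r' ==> dist (\<phi> (t, q)) (\<phi> (t, 0)) < \<rho> / 4"
  using compact_unif_close[OF smooth_cont[OF \<phi>(3)] compact_Icc \<rho>4] by metis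
 have near: "\<phi> (t, q) \<in> ball 0 (\<rho> / 4)" if "t \<in> {0..1}" "q \<in> ball 0 r'" for t q
  using r'(2)[OF that(1), of q] that \<phi>0[OF that(1)] by (simp add: dist_commute)
 have br: "y \<in> ball 0 r" if "y \<in> ball 0 (\<rho> / 4)" for y by (rule \<rho>(2)) (use that \<rho>(1) in simp)
 note fl = flow_Ck[OF Ys YL L(1) \<phi>(1,2)]
 define J where "J t q u = Df \<phi> (t, q) (0, u)" for t q u
 \<comment> \<open>The pullback of \<open>\<omega>t t\<close> along the flow is constant in t: its
   derivative is the pullback of \<beta> plus a Lie derivative, and the latter is d(- \<sigma>) = -
   \<beta>. The steps below are this computation in coordinates.\<close>
 have key: "\<omega>t 1 (\<phi> (1, q)) (J 1 q u) (J 1 q v) = \<Omega> u v" if q: "q \<in> ball 0 r'" for q u v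
 proof -
  define a where "a t = \<omega>t t (\<phi> (t, q)) (J t q u) (J t q v)" for t
  have "(a has_real_derivative 0) (at t within {0..1})" if t: "t \<in> {0..1}" for t
  proof -
   define y where "y = \<phi> (t, q)"
   define U where "U = J t q u"
   define V where "V = J t q v"
   define G where "G w = Df Y (t, y) (0, w)" for w
   define Z where "Z = X (t, y)"
   have y: "y \<in> ball 0 (\<rho> / 4)" "y \<in> ball 0 r" unfolding y_def using near[OF t q] br by blast+
   have dy: "((%s. \<phi> (s, q)) has_derivative (%h. h *\<^sub>R Z)) (at t within {0..1})"
    using has_vector_derivative_at_within[OF \<phi>(2)[of q t], of "{0..1}"] YX[OF t y(1)] unfolding has_vector_derivative_def y_def Z_def by simp
   have dJ: "((%s. J s q w) has_vector_derivative G (J t q w)) (at t within {0..1})" for w unfolding G_def y_def J_def by (rule has_vector_derivative_at_within[OF fl(2)])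
   have "((%y. (t, y)) has_derivative (%w. (0, w))) (at y)" by (intro has_derivative_Pair has_derivative_const has_derivative_ident)
   from has_derivative_compose[OF this smooth_deriv[OF Ys UNIV_I]]
   have "((%y. Y (t, y)) has_derivative G) (at y)" unfolding G_def[abs_def] .
   hence dX: "((%y. X (t, y)) has_derivative G) (at y)" by (rule has_derivative_transform_within_open[OF _ open_ball y(1)]) (rule YX[OF t])
   \<comment> \<open>The identity \<open>\<omega>t t\<close> (X, v') = - \<sigma>(v') differentiated
     in the direction w.\<close>
   have Gid: "\<omega>t t y (G w) v' + t * D Z v' y w = - Df (%z. \<sigma> z v') y w" for w v'
   proof -
    have 1: "((%z. \<Sum>b\<in>Basis. (X (t, z) \<bullet> b) * (\<Omega> b v' + t * \<beta> z b v')) has_derivative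
      (%w. \<Sum>b\<in>Basis. (X (t, y) \<bullet> b) * (0 + t * D b v' y w) + (G w \<bullet> b) * (\<Omega> b v' + t * \<beta> y b v'))) (at y)"
     by (intro has_derivative_sum has_derivative_mult has_derivative_add has_derivative_const has_derivative_mult_right
       has_derivative_inner_left dX Dd y(2))
    have 2: "((%z. - \<sigma> z v') has_derivative (%w. - Df (%z. \<sigma> z v') y w)) (at y)" by (intro has_derivative_minus smooth_deriv[OF \<sigma>s] y(2))
    have 3: "((%z. - \<sigma> z v') has_derivative
      (%w. \<Sum>b\<in>Basis. (X (t, y) \<bullet> b) * (0 + t * D b v' y w) + (G w \<bullet> b) * (\<Omega> b v' + t * \<beta> y b v'))) (at y)"
    proof (rule has_derivative_transform_within_open[OF 1 open_ball y(1)])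
     fix z :: 'e assume z: "z \<in> ball 0 (\<rho> / 4)"
     show "(\<Sum>b\<in>Basis. (X (t, z) \<bullet> b) * (\<Omega> b v' + t * \<beta> z b v')) = - \<sigma> z v'"
      using X\<omega>[OF Wt[OF t z], of v'] linear_expand[OF alt_linear(2)[OF \<omega>ta[OF br[OF z], of t], of v'], of "X (t, z)"] by (simp add: \<omega>t_def)
    qed
    have "(\<Sum>b\<in>Basis. (X (t, y) \<bullet> b) * (0 + t * D b v' y w) + (G w \<bullet> b) * (\<Omega> b v' + t * \<beta> y b v'))
      = - Df (%z. \<sigma> z v') y w" using has_derivative_unique[OF 3 2] by (rule fun_cong)
    moreover have "\<omega>t t y (G w) v' = (\<Sum>b\<in>Basis. (G w \<bullet> b) * (\<Omega> b v' + t * \<beta> y b v'))"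
     using linear_expand[OF alt_linear(2)[OF \<omega>ta[OF y(2), of t], of v'], of "G w"] by (simp add: \<omega>t_def)
    moreover have "t * D Z v' y w = (\<Sum>b\<in>Basis. (X (t, y) \<bullet> b) * (0 + t * D b v' y w))"
     unfolding Z_def using Dexp(1)[OF y(2), of "X (t, y)" v' w] by (simp add: sum_distrib_left mult_ac)
    ultimately show ?thesis by (simp add: sum.distrib)
   qed
   have dE: "((%s. \<Omega> b c + s * \<beta> (\<phi> (s, q)) b c) has_derivative (%h. h * (\<beta> y b c + t * D b c y Z))) (at t within {0..1})" for b c
   proof -
    have "((%s. \<beta> (\<phi> (s, q)) b c) has_derivative (%h. D b c y (h *\<^sub>R Z))) (at t within {0..1})"
     by (rule has_derivative_compose[OF dy, of "%z. \<beta> z b c" "D b c y"]) (use Dd[OF y(2), of b c] in \<open>simp add: y_def\<close>)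
    hence "((%s. \<beta> (\<phi> (s, q)) b c) has_derivative (%h. h * D b c y Z)) (at t within {0..1})"
     using linear_scale[OF has_derivative_linear[OF Dd[OF y(2)]]] by simp
    from has_derivative_add[OF has_derivative_const has_derivative_mult[OF has_derivative_ident this]]
    show ?thesis by (simp add: y_def algebra_simps)
   qed
   have aexp: "a s = (\<Sum>b\<in>Basis. \<Sum>c\<in>Basis. (J s q u \<bullet> b) * (J s q v \<bullet> c) * (\<Omega> b c + s * \<beta> (\<phi> (s, q)) b c))" if "s \<in> {0..1}" for s
    using alt_form_Basis[OF \<omega>ta[OF br[OF near[OF that q]], of s], of "J s q u" "J s q v"] by (simp add: a_def \<omega>t_def)
   have "((%s. \<Sum>b\<in>Basis. \<Sum>c\<in>Basis. (J s q u \<bullet> b) * (J s q v \<bullet> c) * (\<Omega> b c + s * \<beta> (\<phi> (s, q)) b c)) has_derivative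
    (%h. \<Sum>b\<in>Basis. \<Sum>c\<in>Basis. (U \<bullet> b) * (V \<bullet> c) * (h * (\<beta> y b c + t * D b c y Z))
     + ((U \<bullet> b) * ((h *\<^sub>R G V) \<bullet> c) + ((h *\<^sub>R G U) \<bullet> b) * (V \<bullet> c)) * (\<Omega> b c + t * \<beta> y b c))) (at t within {0..1})"
    unfolding U_def V_def y_def by (intro has_derivative_sum has_derivative_mult has_derivative_inner_left dJ[unfolded has_vector_derivative_def] dE[unfolded y_def])
   note as = this
   have "(a has_derivative
    (%h. \<Sum>b\<in>Basis. \<Sum>c\<in>Basis. (U \<bullet> b) * (V \<bullet> c) * (h * (\<beta> y b c + t * D b c y Z))
     + ((U \<bullet> b) * ((h *\<^sub>R G V) \<bullet> c) + ((h *\<^sub>R G U) \<bullet> b) * (V \<bullet> c)) * (\<Omega> b c + t * \<beta> y b c))) (at t within {0..1})"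
    by (rule has_derivative_transform[OF t _ as]) (rule aexp)
   moreover have "(\<Sum>b\<in>Basis. \<Sum>c\<in>Basis. (U \<bullet> b) * (V \<bullet> c) * (h * (\<beta> y b c + t * D b c y Z))
     + ((U \<bullet> b) * ((h *\<^sub>R G V) \<bullet> c) + ((h *\<^sub>R G U) \<bullet> b) * (V \<bullet> c)) * (\<Omega> b c + t * \<beta> y b c)) = 0 * h" for h
   proof -
    have "(\<Sum>b\<in>Basis. \<Sum>c\<in>Basis. (U \<bullet> b) * (V \<bullet> c) * (h * (\<beta> y b c + t * D b c y Z))
     + ((U \<bullet> b) * ((h *\<^sub>R G V) \<bullet> c) + ((h *\<^sub>R G U) \<bullet> b) * (V \<bullet> c)) * (\<Omega> b c + t * \<beta> y b c))
     = h * ((\<Sum>b\<in>Basis. \<Sum>c\<in>Basis. (U \<bullet> b) * (V \<bullet> c) * \<beta> y b c) + t * (\<Sum>b\<in>Basis. \<Sum>c\<in>Basis. (U \<bullet> b) * (V \<bullet> c) * D b c y Z)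
      + (\<Sum>b\<in>Basis. \<Sum>c\<in>Basis. (U \<bullet> b) * (G V \<bullet> c) * \<omega>t t y b c) + (\<Sum>b\<in>Basis. \<Sum>c\<in>Basis. (G U \<bullet> b) * (V \<bullet> c) * \<omega>t t y b c))"
     by (simp add: \<omega>t_def sum_distrib_left sum.distrib algebra_simps)
    also have "... = h * (\<beta> y U V + t * D U V y Z + \<omega>t t y U (G V) + \<omega>t t y (G U) V)"
    proof -
     have "D U V y Z = (\<Sum>b\<in>Basis. (U \<bullet> b) * (\<Sum>c\<in>Basis. (V \<bullet> c) * D b c y Z))"
      using Dexp(1)[OF y(2), of U V Z] Dexp(2)[OF y(2), of _ V Z] by simp
     hence "D U V y Z = (\<Sum>b\<in>Basis. \<Sum>c\<in>Basis. (U \<bullet> b) * (V \<bullet> c) * D b c y Z)" by (simp add: sum_distrib_left mult.assoc)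
     thus ?thesis unfolding alt_form_Basis[OF \<beta>a[OF y(2)], of U V] alt_form_Basis[OF \<omega>ta[OF y(2)], of t U "G V"]
       alt_form_Basis[OF \<omega>ta[OF y(2)], of t "G U" V] by simp
    qed
    also have "\<omega>t t y U (G V) = - \<omega>t t y (G V) U" by (rule alt_form_skew[OF \<omega>ta[OF y(2)]])
    \<comment> \<open>Substituting \<open>Gid\<close> twice leaves \<beta> minus the exterior
      derivative of \<sigma>, plus t times the exterior derivative of \<beta>; both contributions
      are 0.\<close>
    also have "\<beta> y U V + t * D U V y Z + - \<omega>t t y (G V) U + \<omega>t t y (G U) V = 0"
    proof -
     have "t * D U V y Z - t * D Z V y U + t * D Z U y V = t * 0" unfolding Dcl[OF y(2), of U V Z, symmetric] by (simp add: algebra_simps)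
     thus ?thesis using Gid[of U V] Gid[of V U] d\<sigma>[OF y(2), of V U] by simp
    qed
    finally show ?thesis by simp
   qed
   ultimately have "(a has_derivative (%h. 0 * h)) (at t within {0..1})" by simp
   thus ?thesis unfolding has_field_derivative_def .
  qed
  then obtain k where k: "!!t. t \<in> {0..1} ==> a t = k" using has_field_derivative_zero_constant[of "{0..1}" a] by auto
  have "a 1 = a 0" using k[of 0] k[of 1] by simp
  thus ?thesis unfolding a_def J_def fl(3) by (simp add: \<omega>t_def)
 qed
 show thesis
 proof (rule that[OF r'(1)])
  show "smooth UNIV (%q. \<phi> (1, q))" by (intro smooth_comp[OF \<phi>(3)] smooth_Pair smooth_const smooth_id open_UNIV)
  show "\<phi> (1, 0) = 0" by (rule \<phi>0) simp
  show "\<phi> (1, q) \<in> ball 0 r" if "q \<in> ball 0 r'" for q by (rule br[OF near[OF _ that]]) simp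
  have "Df (%q. \<phi> (1, q)) q u = J 1 q u" for q u
  proof -
   have "((%q. (1::real, q)) has_derivative (%u. (0, u))) (at q)" by (intro has_derivative_Pair has_derivative_const has_derivative_ident)
   from has_derivative_compose[OF this smooth_deriv[OF \<phi>(3) UNIV_I]]
   show ?thesis unfolding J_def by (rule Df_eq)
  qed
  thus "\<omega> (\<phi> (1, q)) (Df (%q. \<phi> (1, q)) q u) (Df (%q. \<phi> (1, q)) q v) = \<omega> 0 u v"
   if "q \<in> ball 0 r'" for q u v using key[OF that, of u v] by (simp add: \<omega>t_def \<beta>_def \<Omega>_def)
 qed (use \<Psi> in auto)
qed

section \<open>Hamiltonian flows in Euclidean space\<close>

definition cube :: "real => 'e::euclidean_space set" where
 "cube r = {q. \<forall>b\<in>Basis. \<bar>q \<bullet> b\<bar> \<le> r}"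

definition test_fun :: "real => ('e::euclidean_space => real) => bool" where
 "test_fun r g \<longleftrightarrow> smooth UNIV g \<and> (\<forall>q. q \<notin> cube r --> g q = 0)"

lemma cube_cbox: "cube r = cbox (- r *\<^sub>R One) (r *\<^sub>R One)"
proof -
 have "q \<in> cube r \<longleftrightarrow> q \<in> cbox (- r *\<^sub>R One) (r *\<^sub>R One)" for q :: 'a
  unfolding cube_def mem_box mem_Collect_eq by (intro ball_cong refl) auto
 thus ?thesis by blast
qed

lemma compact_cube: "compact (cube r)" by (simp add: cube_cbox)
lemma closed_cube: "closed (cube r)" by (simp add: cube_cbox closed_cbox)
lemma cube_mono: "r \<le> s ==> cube r \<subseteq> cube s" by (auto simp: cube_def)

text \<open>The velocity is described by the equation it satisfies rather than by a named vector
  field, so that its components can be read off from the derivatives of h, as in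
  \<open>ham_components\<close>.\<close>

definition ham_flow :: "('e::euclidean_space => 'e => real) => (real \<times> 'e => real) => (real \<times> 'e => 'e) => bool" where
 "ham_flow \<Omega> h \<phi> \<longleftrightarrow> (\<forall>q. \<phi> (0, q) = q) \<and> (\<forall>q. \<forall>t\<in>{0..1}. \<exists>X.
   (\<forall>v. \<Omega> X v = - Df h (t, \<phi> (t, q)) (0, v)) \<and>
   ((%s. \<phi> (s, q)) has_vector_derivative X) (at t within {0..1}))"

text \<open>What is used to carry a flow to the manifold: being at rest outside
  \<open>cube 3\<close> it extends by the identity, and preserving \<Omega> it preserves integrals.
  The map \<psi> is the inverse of the time-one map.\<close>

definition ham_iso :: "('e::euclidean_space => 'e => real) => (real \<times> 'e => real) => (real \<times> 'e => 'e) => ('e => 'e) => bool" where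
 "ham_iso \<Omega> h \<phi> \<psi> \<longleftrightarrow> smooth UNIV h \<and> (\<forall>t q. t \<notin> {-1..2} \<or> q \<notin> cube 3 --> h (t, q) = 0) \<and>
   ham_flow \<Omega> h \<phi> \<and> smooth UNIV \<phi> \<and> smooth UNIV \<psi> \<and> (\<forall>q. \<psi> (\<phi> (1, q)) = q) \<and> (\<forall>q. \<phi> (1, \<psi> q) = q) \<and>
   (\<forall>t\<in>{0..1}. \<forall>q. q \<notin> cube 3 --> \<phi> (t, q) = q) \<and> (\<forall>t\<in>{0..1}. \<forall>q\<in>cube 3. \<phi> (t, q) \<in> cube 3) \<and>
   (\<forall>q u v. \<Omega> (Df (%q. \<phi> (1, q)) q u) (Df (%q. \<phi> (1, q)) q v) = \<Omega> u v)"

lemma form_inverse: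
 fixes \<Omega> :: "'e::euclidean_space => 'e => real"
 assumes "alt_form \<Omega>" "nondeg_form \<Omega>"
 obtains S where "linear S" "!!w v. \<Omega> (S w) v = w \<bullet> v"
proof -
 \<comment> \<open>A family constant in z, so that \<open>smooth_inverse_operator\<close> simply
   inverts the map that represents \<Omega>.\<close>
 define A where "A z u = (\<Sum>b\<in>Basis. \<Omega> u b *\<^sub>R b)" for z :: 'e and u
 obtain c where c: "c > 0" "!!u. c * norm u \<le> norm (\<Sum>b\<in>Basis. \<Omega> u b *\<^sub>R b)" using nondeg_lower_bound[OF assms] by blast
 have lin: "linear (A z)" for z unfolding A_def by (rule linearI) (simp_all add: linear_add[OF alt_linear(2)[OF assms(1)]] linear_scale[OF alt_linear(2)[OF assms(1)]]
    scaleR_add_left sum.distrib scaleR_sum_right)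
 have sm: "smooth UNIV (%z. A z w)" for w unfolding A_def by (intro smooth_const) simp
 obtain R where R: "!!z w. A z (R z w) = w" "!!z. linear (R z)" using smooth_inverse_operator[OF open_UNIV lin sm c(1), of] c(2) unfolding A_def by (metis UNIV_I)
 have "\<Omega> (R 0 w) v = w \<bullet> v" for w v
 proof -
  have b: "\<Omega> (R 0 w) b = w \<bullet> b" if "b \<in> Basis" for b
  proof -
   have "A 0 (R 0 w) \<bullet> b = \<Omega> (R 0 w) b" unfolding A_def using that by (simp add: inner_sum_left_Basis)
   thus ?thesis by (simp add: R(1))
  qed
  have "\<Omega> (R 0 w) v = (\<Sum>b\<in>Basis. (v \<bullet> b) *\<^sub>R \<Omega> (R 0 w) b)" by (rule linear_expand[OF alt_linear(1)[OF assms(1)]])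
  also have "... = w \<bullet> v" by (simp add: b euclidean_inner[of w v] mult.commute)
  finally show ?thesis .
 qed
 thus thesis using that R(2) by blast
qed

lemma frechet_zero_outside:
 assumes "closed K" "!!x. x \<notin> K ==> f x = 0" "x \<notin> K"
 shows "Df f (x::'a::euclidean_space) v = (0::'b::euclidean_space)"
proof -
 have "Df f x = Df (%x. 0) x" by (rule Df_cong[of "- K"]) (use assms in auto)
 thus ?thesis by simp
qed

text \<open>Write f(y + s u) - f(y) as the integral of the derivative in the direction u along the
  segment, differentiate under the integral in the direction v, and take the derivative in s at
  0.\<close>

lemma second_derivative_symmetric:
 fixes f :: "'a::euclidean_space => real"
 assumes f: "smooth UNIV f"
 shows "iter_deriv [u, v] f x = iter_deriv [v, u] f x"
proof -
 define D where "D v y = Df f y v" for v y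
 define k where "k y = Df (D u) y v" for y
 have Ds: "smooth UNIV (D v)" for v unfolding D_def[abs_def] by (rule smooth_frechet[OF f])
 have ks: "smooth UNIV k" unfolding k_def[abs_def] by (rule smooth_frechet[OF Ds])
 have line: "((%r. g (y + r *\<^sub>R u)) has_vector_derivative Df g (y + r *\<^sub>R u) u) (at r within S)"
  if g: "smooth UNIV g" for g :: "'a => real" and r y S
 proof -
  have "((%r. y + r *\<^sub>R u) has_derivative (%h. h *\<^sub>R u)) (at r within S)" by (auto intro!: derivative_eq_intros)
  from has_derivative_compose[OF this smooth_deriv[OF g UNIV_I]]
  show ?thesis unfolding has_vector_derivative_def by (simp only: linear_scale[OF has_derivative_linear[OF smooth_deriv[OF g UNIV_I]]])
 qed
 have G: "smooth UNIV (%z::'a \<times> real. D u (fst z + snd z *\<^sub>R u))"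
  by (intro smooth_comp[OF Ds] smooth_add smooth_fst smooth_snd smooth_scaleR smooth_id smooth_const open_UNIV)
 have eq: "D v (x + s *\<^sub>R u) - D v x = integral {0..s} (%r. k (x + r *\<^sub>R u))" if s: "0 \<le> s" for s
 proof -
  have ft: "f (y + s *\<^sub>R u) - f y = integral (cbox 0 s) (%r. D u (y + r *\<^sub>R u))" for y
   using fundamental_theorem_of_calculus[OF s, of "%r. f (y + r *\<^sub>R u)" "%r. D u (y + r *\<^sub>R u)"] line[OF f] by (simp add: D_def integral_unique)
  have "((%y. y + s *\<^sub>R u) has_derivative (%h. h)) (at x)" by (auto intro!: derivative_eq_intros)
  from has_derivative_diff[OF has_derivative_compose[OF this smooth_deriv[OF f UNIV_I]] smooth_deriv[OF f UNIV_I]]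
  have 1: "((%y. integral (cbox 0 s) (%r. D u (y + r *\<^sub>R u))) has_derivative (%h. D h (x + s *\<^sub>R u) - D h x)) (at x)" unfolding ft by (simp add: D_def)
  have "((%y. integral (cbox 0 s) (%r. D u (fst (y, r) + snd (y, r) *\<^sub>R u))) has_derivative
    (%h. integral (cbox 0 s) (%r. Df (%z. D u (fst z + snd z *\<^sub>R u)) (x, r) (h, 0)))) (at x)" by (rule has_derivative_param_integral[OF G open_UNIV]) auto
  from has_derivative_unique[OF 1 this[unfolded fst_conv snd_conv]]
  have 2: "D v (x + s *\<^sub>R u) - D v x = integral (cbox 0 s) (%r. Df (%z. D u (fst z + snd z *\<^sub>R u)) (x, r) (v, 0))" by (rule fun_cong)
  have "Df (%z. D u (fst z + snd z *\<^sub>R u)) (x, r) (v, 0) = k (x + r *\<^sub>R u)" for r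
  proof -
   have "((%z::'a \<times> real. fst z + snd z *\<^sub>R u) has_derivative (%h. fst h + snd h *\<^sub>R u)) (at (x, r))" by (auto intro!: derivative_eq_intros)
   from Df_eq[OF has_derivative_compose[OF this smooth_deriv[OF Ds[of u] UNIV_I]], of "(v, 0)"]
   show ?thesis unfolding k_def by simp
  qed
  thus ?thesis using 2 by simp
 qed
 have "continuous_on {0..1} (%r. k (x + r *\<^sub>R u))" by (rule continuous_on_compose2[OF smooth_cont[OF ks]]) (auto intro!: continuous_intros)
 from integral_has_vector_derivative[OF this, of 0]
 have "((%s. integral {0..s} (%r. k (x + r *\<^sub>R u))) has_vector_derivative k x) (at 0 within {0..1})" by simp
 hence A: "((%s. D v (x + s *\<^sub>R u) - D v x) has_vector_derivative k x) (at 0 within {0..1})" by (rule has_vector_derivative_transform[rotated 2]) (use eq in auto)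
 have B: "((%s. D v (x + s *\<^sub>R u) - D v x) has_vector_derivative Df (D v) x u) (at 0 within {0..1})"
  using has_vector_derivative_diff[OF line[OF Ds, of v x 0 "{0..1}"] has_vector_derivative_const, of "D v x"] by simp
 have "Df (D v) x u = k x" by (rule vector_derivative_unique_within_closed_interval[OF _ _ B[folded box_real] A[folded box_real]]) auto
 thus ?thesis by (simp add: k_def D_def[abs_def])
qed

text \<open>The form is preserved because along the linearised flow the derivative of \<Omega> (J u)
  (J v) is the difference of two mixed second derivatives of h.\<close>

lemma ham_flow_exists:
 fixes \<Omega> :: "'e::euclidean_space => 'e => real"
 assumes \<Omega>: "alt_form \<Omega>" "nondeg_form \<Omega>"
  and h: "smooth UNIV h" and K: "compact K" and hK: "!!t q. t \<notin> {a..b} \<or> q \<notin> K ==> h (t, q) = 0"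
 obtains \<phi> \<psi> where "ham_flow \<Omega> h \<phi>" "smooth UNIV \<phi>" "smooth UNIV \<psi>"
  "!!q. \<psi> (\<phi> (1, q)) = q" "!!q. \<phi> (1, \<psi> q) = q"
  "!!t q. t \<in> {0..1} ==> q \<notin> K ==> \<phi> (t, q) = q" "!!t q. t \<in> {0..1} ==> q \<in> K ==> \<phi> (t, q) \<in> K"
  "!!q u v. \<Omega> (Df (%q. \<phi> (1, q)) q u) (Df (%q. \<phi> (1, q)) q v) = \<Omega> u v"
proof -
 obtain S where S: "linear S" "!!w v. \<Omega> (S w) v = w \<bullet> v" using form_inverse[OF \<Omega>] by blast
 define D where "D z v = Df h z (0, v)" for z v
 define X where "X z = S (\<Sum>b\<in>Basis. (- D z b) *\<^sub>R b)" for z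
 have Dl: "linear (D z)" for z
 proof -
  have "linear (%y::'e. (0::real, y))" by (simp add: linear_iff)
  from linear_compose[OF this has_derivative_linear[OF smooth_deriv[OF h UNIV_I]]]
  show ?thesis unfolding D_def[abs_def] by (simp add: o_def)
 qed
 have X\<Omega>: "\<Omega> (X z) v = - D z v" for z v
 proof -
  have "\<Omega> (X z) v = (\<Sum>b\<in>Basis. (- D z b) *\<^sub>R b) \<bullet> v" unfolding X_def by (rule S(2))
  also have "... = - (\<Sum>b\<in>Basis. (v \<bullet> b) *\<^sub>R D z b)" by (simp add: inner_sum_left inner_sum_right sum_negf inner_commute mult.commute)
  also have "... = - D z v" using linear_expand[OF Dl, of z v] by simp
  finally show ?thesis .
 qed
 have "smooth UNIV (%z. \<Sum>b\<in>Basis. (- D z b) *\<^sub>R b)"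
  unfolding D_def by (intro smooth_sum smooth_scaleR smooth_minus smooth_const smooth_frechet h open_UNIV)
 hence Xs: "smooth UNIV X" unfolding X_def[abs_def] using S(1) by (intro smooth_bounded_linear[of S]) (simp_all add: linear_conv_bounded_linear)
 have K2: "compact ({a..b} \<times> K)" using K by (intro compact_Times) auto
 have hK2: "h z = 0" if "z \<notin> {a..b} \<times> K" for z using hK that by (cases z) auto
 have XK: "X z = 0" if "z \<notin> {a..b} \<times> K" for z
  unfolding X_def D_def using frechet_zero_outside[OF compact_imp_closed[OF K2] hK2 that] by (simp add: linear_0[OF S(1)])
 obtain L where L: "L \<ge> 0" "!!x y. norm (X x - X y) \<le> L * norm (x - y)" using smooth_compact_support_lipschitz[OF Xs K2 XK] by blast
 have XL: "norm (X (t, x) - X (t, y)) \<le> L * norm (x - y)" for t x y using L(2)[of "(t, x)" "(t, y)"] by (simp add: norm_Pair)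
 obtain \<phi> where \<phi>: "!!p. \<phi> (0, p) = p" "!!t p. ((%t. \<phi> (t, p)) has_vector_derivative X (t, \<phi> (t, p))) (at t)"
  "smooth UNIV \<phi>" using smooth_flow_exists[OF Xs XL L(1)] by blast
 obtain \<psi> where \<psi>: "smooth UNIV \<psi>" "!!p. \<psi> (\<phi> (1, p)) = p" "!!q. \<phi> (1, \<psi> q) = q"
  using flow_inverse_exists[OF Xs XL L(1) \<phi>(1) has_vector_derivative_at_within[OF \<phi>(2)]] by blast
 \<comment> \<open>Outside K the field is 0 at all times, so a point there is at rest; by uniqueness
   no trajectory enters or leaves K.\<close>
 have const: "\<phi> (t, q) = \<phi> (s, q)" if st: "s \<in> {0..1}" "t \<in> {0..1}" and s: "\<phi> (s, q) \<notin> K" for s t q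
 proof (rule ode_unique[where X="%t x. X (t, x)" and a=0 and b=1 and ?t0.0=s
    and u="%t. \<phi> (t, q)" and v="%_. \<phi> (s, q)", OF has_vector_derivative_at_within[OF \<phi>(2)] _ XL L(1) st(1) refl st(2)])
  fix r :: real assume "r \<in> {0..1}"
  have "X (r, \<phi> (s, q)) = 0" using s by (intro XK) auto
  thus "((%t. \<phi> (s, q)) has_vector_derivative X (r, \<phi> (s, q))) (at r within {0..1})" by simp
 qed
 note fl = flow_Ck[OF Xs XL L(1) \<phi>(1,2)]
 define J where "J t q u = Df \<phi> (t, q) (0, u)" for t q u
 define G where "G z w = Df X z (0, w)" for z w
 have bl: "bounded_bilinear \<Omega>" using \<Omega>(1) by (simp add: alt_form_def bilinear_conv_bounded_bilinear)
 have G\<Omega>: "\<Omega> (G z w) v = - iter_deriv [(0, w), (0, v)] h z" for z w v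
 proof -
  have "((%z. \<Omega> (X z) v) has_derivative (%h. \<Omega> (Df X z h) v)) (at z)"
   using bounded_linear.has_derivative[OF bounded_bilinear.bounded_linear_left[OF bl] smooth_deriv[OF Xs UNIV_I]] .
  moreover have "((%z. - D z v) has_derivative (%k. - Df (%z. D z v) z k)) (at z)"
   unfolding D_def by (intro has_derivative_minus smooth_deriv[OF smooth_frechet[OF h] UNIV_I])
  ultimately have "(%h. \<Omega> (Df X z h) v) = (%k. - Df (%z. D z v) z k)" unfolding X\<Omega> by (rule has_derivative_unique)
  thus ?thesis unfolding G_def D_def by (simp add: fun_eq_iff)
 qed
 have J1: "Df (%q. \<phi> (1, q)) q u = J 1 q u" for q u
 proof -
  have "((%q. (1::real, q)) has_derivative (%u. (0, u))) (at q)" by (intro has_derivative_Pair has_derivative_const has_derivative_ident)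
  from has_derivative_compose[OF this smooth_deriv[OF \<phi>(3) UNIV_I]]
  show ?thesis unfolding J_def by (rule Df_eq)
 qed
 have symp: "\<Omega> (J 1 q u) (J 1 q v) = \<Omega> u v" for q u v
 proof -
  have "((%s. \<Omega> (J s q u) (J s q v)) has_derivative (%h. 0 * h)) (at t)" for t
  proof -
   define z where "z = (t, \<phi> (t, q))"
   have dJ: "((%s. J s q w) has_derivative (%h. h *\<^sub>R G z (J t q w))) (at t)" for w using fl(2)[of q w t] unfolding has_vector_derivative_def J_def G_def z_def .
   have "\<Omega> (G z (J t q u)) (J t q v) + \<Omega> (J t q u) (G z (J t q v)) = 0" unfolding G\<Omega> alt_form_skew[OF \<Omega>(1), of "J t q u" "G z (J t q v)"]
    using second_derivative_symmetric[OF h, of "(0, J t q u)" "(0, J t q v)" z] by simp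
   hence e: "\<Omega> (J t q u) (h *\<^sub>R G z (J t q v)) + \<Omega> (h *\<^sub>R G z (J t q u)) (J t q v) = 0 * h" for h
    unfolding bounded_bilinear.scaleR_left[OF bl] bounded_bilinear.scaleR_right[OF bl] by (simp add: add.commute flip: distrib_left)
   show ?thesis using bounded_bilinear.FDERIV[OF bl dJ[of u] dJ[of v]] unfolding e .
  qed
  hence "((%s. \<Omega> (J s q u) (J s q v)) has_real_derivative 0) (at t within {0..1})" for t unfolding has_field_derivative_def by (rule has_derivative_at_withinI)
  then obtain c where c: "!!t. t \<in> {0..1} ==> \<Omega> (J t q u) (J t q v) = c"
   using has_field_derivative_zero_constant[of "{0..1}" "%s. \<Omega> (J s q u) (J s q v)"] by auto
  show ?thesis using c[of 0] c[of 1] by (simp add: J_def fl(3))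
 qed
 show thesis
 proof (rule that[OF _ \<phi>(3) \<psi> _ _ symp[folded J1]])
  show "ham_flow \<Omega> h \<phi>" unfolding ham_flow_def using \<phi>(1) X\<Omega> has_vector_derivative_at_within[OF \<phi>(2)] unfolding D_def by blast
  show "\<phi> (t, q) = q" if "t \<in> {0..1}" "q \<notin> K" for t q using const[of 0 t q] that by (simp add: \<phi>(1))
  show "\<phi> (t, q) \<in> K" if "t \<in> {0..1}" "q \<in> K" for t q
  proof (rule ccontr)
   assume n: "\<phi> (t, q) \<notin> K"
   have "\<phi> (0, q) = \<phi> (t, q)" by (rule const[OF that(1) _ n]) simp
   thus False using n that(2) by (simp add: \<phi>(1))
  qed
 qed
qed

text \<open>Conservation is tested only along the given trajectory and on a subinterval, because the
  explicit formulas for h hold only while the trajectory stays in some region. The quantity f may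
  depend on time.\<close>

lemma ham_flow_conserved:
 assumes "ham_flow \<Omega> h \<phi>" and f: "!!t. t \<in> {t0..t1} ==> (f has_derivative f' t) (at (t, \<phi> (t, q)))"
  and t: "{t0..t1} \<subseteq> {0..1}" "s \<in> {t0..t1}" "s' \<in> {t0..t1}"
  and z: "!!t X. t \<in> {t0..t1} ==> (!!v. \<Omega> X v = - Df h (t, \<phi> (t, q)) (0, v))
   ==> f' t (1, X) = 0"
 shows "f (s, \<phi> (s, q)) = (f (s', \<phi> (s', q)) :: real)"
proof -
 have d: "((%t. f (t, \<phi> (t, q))) has_real_derivative 0) (at t within {t0..t1})" if t01: "t \<in> {t0..t1}" for t
 proof -
  obtain X where X: "!!v. \<Omega> X v = - Df h (t, \<phi> (t, q)) (0, v)"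
   "((%s. \<phi> (s, q)) has_vector_derivative X) (at t within {0..1})" using assms(1) t01 t(1) unfolding ham_flow_def by blast
  have "((%s. (s, \<phi> (s, q))) has_derivative (%h. (h, h *\<^sub>R X))) (at t within {t0..t1})"
   using has_vector_derivative_within_subset[OF X(2) t(1)] unfolding has_vector_derivative_def by (intro has_derivative_Pair has_derivative_ident)
  from has_derivative_compose[OF this f[OF t01]]
  have "((%t. f (t, \<phi> (t, q))) has_derivative (%h. f' t (h, h *\<^sub>R X))) (at t within {t0..t1})" .
  moreover have "f' t (h, h *\<^sub>R X) = 0 * h" for h
  proof -
   have "f' t (h *\<^sub>R (1, X)) = h *\<^sub>R f' t (1, X)" by (rule linear_scale[OF has_derivative_linear[OF f[OF t01]]])
   thus ?thesis using z[OF t01 X(1)] by simp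
  qed
  ultimately have "((%t. f (t, \<phi> (t, q))) has_derivative (%h. 0 * h)) (at t within {t0..t1})" by simp
  thus ?thesis unfolding has_field_derivative_def .
 qed
 obtain c where "!!t. t \<in> {t0..t1} ==> f (t, \<phi> (t, q)) = c" using has_field_derivative_zero_constant[OF _ d] by auto
 thus ?thesis using t by simp
qed

text \<open>Removes a circularity: formulas valid in O' confine the trajectory to the smaller K, and
  so it cannot have left O'. Otherwise consider the last time outside O'; afterwards the trajectory
  is in K, and closedness puts that point into K, too.\<close>

lemma trapped_backward:
 fixes \<gamma> :: "real => 'a::topological_space"
 assumes c: "continuous_on {0..1} \<gamma>" and KO: "closed K" "open O'" "K \<subseteq> O'" and 1: "\<gamma> 1 \<in> K"
  and step: "!!t. t \<in> {0..1} ==> (!!s. s \<in> {t..1} ==> \<gamma> s \<in> O') ==> \<gamma> t \<in> K"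
  and t: "t \<in> {0..1}"
 shows "\<gamma> t \<in> K"
proof -
 define A where "A = {t \<in> {0..1}. \<gamma> t \<notin> O'}"
 have "A = {}"
 proof (rule ccontr)
  assume ne: "A ~= {}"
  have "closedin (top_of_set {0..1}) ({0..1} \<inter> \<gamma> -` (- O'))" using c KO(2) by (intro continuous_closedin_preimage) auto
  hence "closed A" unfolding A_def using closedin_closed_trans[of "{0..1}"] by (auto simp: Int_def vimage_def)
  hence cA: "compact A" unfolding A_def using compact_Int_closed[OF compact_Icc] bounded_subset[of "{0..1}"] 
   by (auto simp: compact_eq_bounded_closed intro: bounded_subset[of "{0..1}"])
  then obtain m where m: "m \<in> A" "!!x. x \<in> A ==> x \<le> m" using compact_attains_sup[OF cA ne] by blast
  have m01: "m \<in> {0..1}" "\<gamma> m \<notin> O'" using m by (auto simp: A_def)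
  have in': "\<gamma> s \<in> K" if "s \<in> {m<..1}" for s
  proof (rule step)
   show "s \<in> {0..1}" using that m01 by auto
   fix s' assume "s' \<in> {s..1}"
   thus "\<gamma> s' \<in> O'" using m(2)[of s'] that m01 by (force simp: A_def)
  qed
  have m1: "m < 1" using m01 1 KO(3) by (cases "m = 1") auto
  have "closedin (top_of_set {0..1}) ({0..1} \<inter> \<gamma> -` K)" using c KO(1) by (rule continuous_closedin_preimage)
  hence cl: "closed ({0..1} \<inter> \<gamma> -` K)" using closedin_closed_trans[of "{0..1}"] by auto
  have "{m<..<1} \<subseteq> {0..1} \<inter> \<gamma> -` K" using in' m01 by auto
  hence "closure {m<..<1} \<subseteq> {0..1} \<inter> \<gamma> -` K" using cl by (rule closure_minimal)
  moreover have "m \<in> closure {m<..<1}" using m1 by simp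
  ultimately have "\<gamma> m \<in> K" by blast
  thus False using m01 KO(3) by blast
 qed
 thus ?thesis using step[OF t] t by (force simp: A_def)
qed

lemma trapped_forward:
 fixes \<gamma> :: "real => 'a::topological_space"
 assumes c: "continuous_on {0..1} \<gamma>" and KO: "closed K" "open O'" "K \<subseteq> O'" and 1: "\<gamma> 0 \<in> K"
  and step: "!!t. t \<in> {0..1} ==> (!!s. s \<in> {0..t} ==> \<gamma> s \<in> O') ==> \<gamma> t \<in> K"
  and t: "t \<in> {0..1}"
 shows "\<gamma> t \<in> K"
proof -
 have "(%s. \<gamma> (1 - s)) (1 - t) \<in> K"
 proof (rule trapped_backward[where \<gamma>="%s. \<gamma> (1 - s)", OF _ KO])
  show "continuous_on {0..1} (%s. \<gamma> (1 - s))" by (rule continuous_on_compose2[OF c]) (auto intro!: continuous_intros)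
  fix s :: real assume s: "s \<in> {0..1}" "!!s'. s' \<in> {s..1} ==> \<gamma> (1 - s') \<in> O'"
  show "\<gamma> (1 - s) \<in> K"
  proof (rule step)
   fix s' assume "s' \<in> {0..1 - s}"
   thus "\<gamma> s' \<in> O'" using s(2)[of "1 - s'"] by auto
  qed (use s in auto)
 qed (use 1 t in auto)
 thus ?thesis by simp
qed

section \<open>Invariant seminorms on test functions\<close>

lemma test_funD:
 assumes "test_fun r g"
 shows "smooth UNIV g" "!!q. q \<notin> cube r ==> g q = 0" using assms by (auto simp: test_fun_def)

lemma test_fun_add: "test_fun r f ==> test_fun r g ==> test_fun r (%q. f q + g q)" by (auto simp: test_fun_def intro: smooth_add)
lemma test_fun_diff: "test_fun r f ==> test_fun r g ==> test_fun r (%q. f q - g q)" by (auto simp: test_fun_def intro: smooth_diff)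
lemma test_fun_scale: "test_fun r f ==> test_fun r (%q. c * f q)" by (auto simp: test_fun_def intro!: smooth_mult smooth_const)
lemma test_fun_zero: "test_fun r (%q. 0)" by (auto simp: test_fun_def intro: smooth_const)
lemma test_fun_sum: "(!!i. i \<in> I ==> test_fun r (f i)) ==> test_fun r (%q. \<Sum>i\<in>I. f i q)"
 by (induction I rule: infinite_finite_induct) (auto intro: test_fun_zero test_fun_add)
lemma test_fun_mono: "test_fun r f ==> r \<le> s ==> test_fun s f" using cube_mono unfolding test_fun_def by blast

lemma iter_deriv_zero: "iter_deriv ws (%x::'a::euclidean_space. 0) x = (0 :: 'b::euclidean_space)"
proof -
 have "iter_deriv ws (%x::'a. 0::'b) = (%x. 0)" by (induction ws) auto
 thus ?thesis by simp
qed

lemma iter_deriv_zero_outside: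
 assumes "closed K" "!!x. x \<notin> K ==> f x = 0" "x \<notin> K"
 shows "iter_deriv ws f (x :: 'a::euclidean_space) = (0 :: 'b::euclidean_space)"
proof -
 have "iter_deriv ws f x = iter_deriv ws (%x. 0) x" by (rule iter_deriv_cong[of "- K"]) (use assms in auto)
 also have "... = 0" by (rule iter_deriv_zero)
 finally show ?thesis .
qed

lemma iter_deriv_affine:
 fixes g :: "'b::euclidean_space => 'c::euclidean_space" and L :: "'a::euclidean_space => 'b"
 assumes g: "smooth UNIV g" and L: "bounded_linear L"
 shows "iter_deriv ws (%q. g (c + L q)) q = iter_deriv (map L ws) g (c + L q)"
proof (induction ws arbitrary: q)
 case (Cons v ws)
 have eq: "iter_deriv ws (%q. g (c + L q)) = (%q. iter_deriv (map L ws) g (c + L q))" using Cons.IH by blast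
 have "((%q. c + L q) has_derivative L) (at q)" using has_derivative_add[OF has_derivative_const bounded_linear_imp_has_derivative[OF L]] by simp
 from has_derivative_compose[OF this smooth_deriv[OF smooth_iter_deriv[OF g, of "map L ws"] UNIV_I]]
 show ?case using Df_eq by (fastforce simp: eq)
qed simp

text \<open>The cubes are nested with room to spare: functions to be estimated live in
  \<open>cube 1\<close>, the rescaling flow in \<open>cube 2\<close>, cutoffs equal 1 on
  \<open>cube (5/2)\<close>, and whatever n is applied to vanishes outside
  \<open>cube 3\<close>.\<close>

locale inv_seminorm =
 fixes \<Omega> :: "'e::euclidean_space => 'e => real" and n :: "('e => real) => real"
  and W :: "'e list set" and C0 :: real
 assumes \<Omega>: "alt_form \<Omega>" "nondeg_form \<Omega>" "paired_basis \<Omega>"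
  and n_add: "test_fun 3 f ==> test_fun 3 g ==> n (%q. f q + g q) \<le> n f + n g"
  and n_scale: "test_fun 3 f ==> n (%q. r * f q) = \<bar>r\<bar> * n f"
  and W: "finite W"
  and n_bound: "test_fun 3 f ==> (!!ws q. ws \<in> W ==> \<bar>iter_deriv ws f q\<bar> \<le> M) ==> n f \<le> C0 * M"
  and n_inv: "ham_iso \<Omega> h \<phi> \<psi> ==> test_fun 3 f ==> n (%q. f (\<psi> q)) = n f"
begin

lemma n_zero: "n (%q. 0) = 0" using n_scale[OF test_fun_zero, of 0] by simp

lemma n_nonneg: "test_fun 3 f ==> 0 \<le> n f" using n_add[of f "%q. (-1) * f q"] n_scale[of f "-1"] test_fun_scale[of 3 f "-1"] n_zero by simp

lemma n_diff: "test_fun 3 f ==> test_fun 3 g ==> n (%q. f q - g q) \<le> n f + n g"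
 using n_add[of f "%q. (-1) * g q"] n_scale[of g "-1"] test_fun_scale[of 3 g "-1"] by simp

lemma n_sum: "(!!i. i \<in> I ==> test_fun 3 (f i)) ==> n (%q. \<Sum>i\<in>I. f i q) \<le> (\<Sum>i\<in>I. n (f i))"
proof (induction I rule: infinite_finite_induct)
 case (insert i I)
 have "n (%q. f i q + (\<Sum>i\<in>I. f i q)) \<le> n (f i) + n (%q. \<Sum>i\<in>I. f i q)" by (rule n_add) (use insert.prems in \<open>auto intro: test_fun_sum\<close>)
 thus ?case using insert by force
qed (simp_all add: n_zero)

lemma C0_nonneg_bound: "0 \<le> C0 * 1"
proof -
 have "n (%q. 0) \<le> C0 * 1" by (rule n_bound[OF test_fun_zero]) (simp add: iter_deriv_zero)
 thus ?thesis by (simp add: n_zero)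
qed

lemma n_limit:
 assumes g: "test_fun 3 g"
  and a: "!!e. e > 0 ==> \<exists>f. test_fun 3 f \<and> n f \<le> C \<and> (\<forall>ws\<in>W. \<forall>q. \<bar>iter_deriv ws g q - iter_deriv ws f q\<bar> \<le> e)"
 shows "n g \<le> C"
proof (rule field_le_epsilon)
 fix e :: real assume e: "e > 0"
 define d where "d = e / (C0 + 1)"
 have C0: "C0 \<ge> 0" using C0_nonneg_bound by simp
 have d: "d > 0" using e C0 by (simp add: d_def)
 obtain f where f: "test_fun 3 f" "n f \<le> C" "\<forall>ws\<in>W. \<forall>q. \<bar>iter_deriv ws g q - iter_deriv ws f q\<bar> \<le> d" using a[OF d] by blast
 have gf: "test_fun 3 (%q. g q - f q)" by (rule test_fun_diff[OF g f(1)])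
 have "n (%q. g q - f q) \<le> C0 * d"
 proof (rule n_bound[OF gf])
  fix ws q assume "ws \<in> W"
  thus "\<bar>iter_deriv ws (%q. g q - f q) q\<bar> \<le> d" using f(3) iter_deriv_diff[OF test_funD(1)[OF g] test_funD(1)[OF f(1)], of q ws] by simp
 qed
 also have "... \<le> e" using e C0 by (simp add: d_def field_simps)
 finally have 1: "n (%q. g q - f q) \<le> e" .
 have "n (%q. f q + (g q - f q)) \<le> n f + n (%q. g q - f q)" by (rule n_add[OF f(1) gf])
 thus "n g \<le> C + e" using 1 f(2) by simp
qed

text \<open>Riemann sums of the integral converge together with the finitely many derivatives in W,
  and for Riemann sums the bound is subadditivity.\<close>

lemma n_average:
 fixes g :: "'e \<times> 'p::euclidean_space => real"
 assumes g: "smooth UNIV g" and gt: "!!\<tau>. \<tau> \<in> cbox A B ==> test_fun 3 (%q. g (q, \<tau>))"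
  and gC: "!!\<tau>. \<tau> \<in> cbox A B ==> n (%q. g (q, \<tau>)) \<le> C"
 shows "test_fun 3 (%q. integral (cbox A B) (%\<tau>. g (q, \<tau>)))"
  and "n (%q. integral (cbox A B) (%\<tau>. g (q, \<tau>))) \<le> measure lborel (cbox A B) * C"
proof -
 have sub: "UNIV \<times> cbox A B \<subseteq> UNIV" by simp
 show t: "test_fun 3 (%q. integral (cbox A B) (%\<tau>. g (q, \<tau>)))" unfolding test_fun_def
 proof (intro conjI allI impI)
  fix q :: 'e assume "q \<notin> cube 3"
  hence "integral (cbox A B) (%\<tau>. g (q, \<tau>)) = integral (cbox A B) (%\<tau>. 0)"
   using gt by (intro Henstock_Kurzweil_Integration.integral_cong) (auto simp: test_fun_def)
  thus "integral (cbox A B) (%\<tau>. g (q, \<tau>)) = 0" by simp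
 qed (rule smooth_param_integral[OF g open_UNIV sub])
 define V where "V = measure lborel (cbox A B)"
 have V: "V \<ge> 0" by (simp add: V_def)
 show "n (%q. integral (cbox A B) (%\<tau>. g (q, \<tau>))) \<le> V * C"
 proof (rule n_limit[OF t])
  fix e :: real assume e: "e > 0"
  define d where "d = e / (V + 1)"
  have d: "d > 0" using e V by (simp add: d_def)
  define h where "h ws z = iter_deriv (map (%v. (v, 0)) ws) g z" for ws z
  have hs: "smooth UNIV (h ws)" for ws unfolding h_def by (rule smooth_iter_deriv[OF g])
  have hc: "continuous_on S (h ws)" for ws S by (rule continuous_on_subset[OF smooth_cont[OF hs]]) simp
  have "\<exists>\<eta>>0. \<forall>q\<in>cube 3. \<forall>\<tau>\<in>cbox A B. \<forall>\<tau>'\<in>cbox A B. dist \<tau> \<tau>' < \<eta> --> \<bar>h ws (q, \<tau>) - h ws (q, \<tau>')\<bar> < d" for ws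
  proof -
   have "uniformly_continuous_on (cube 3 \<times> cbox A B) (h ws)" by (intro compact_uniformly_continuous compact_Times compact_cube compact_cbox hc)
   then obtain \<eta> where \<eta>: "\<eta> > 0" "!!z z'. z \<in> cube 3 \<times> cbox A B ==> z' \<in> cube 3 \<times> cbox A B ==> dist z' z < \<eta> ==> dist (h ws z') (h ws z) < d"
    using d unfolding uniformly_continuous_on_def by metis
   show ?thesis
   proof (intro exI[of _ \<eta>] conjI ballI impI \<eta>(1))
    fix q :: 'e and \<tau> \<tau>' assume "q \<in> cube 3" "\<tau> \<in> cbox A B" "\<tau>' \<in> cbox A B" "dist \<tau> \<tau>' < \<eta>"
    thus "\<bar>h ws (q, \<tau>) - h ws (q, \<tau>')\<bar> < d" using \<eta>(2)[of "(q, \<tau>')" "(q, \<tau>)"] by (simp add: dist_Pair_Pair dist_real_def)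
   qed
  qed
  then obtain \<eta> where \<eta>: "!!ws. \<eta> ws > 0"
   "!!ws q \<tau> \<tau>'. q \<in> cube 3 ==> \<tau> \<in> cbox A B ==> \<tau>' \<in> cbox A B ==> dist \<tau> \<tau>' < \<eta> ws ==> \<bar>h ws (q, \<tau>) - h ws (q, \<tau>')\<bar> < d"
   by metis
  \<comment> \<open>The extra 1 keeps the set nonempty when W is empty.\<close>
  define \<eta>0 where "\<eta>0 = Min (insert 1 (\<eta> ` W))"
  have \<eta>0: "\<eta>0 > 0" "!!ws. ws \<in> W ==> \<eta>0 \<le> \<eta> ws" using W \<eta>(1) by (auto simp: \<eta>0_def)
  obtain p where p: "p tagged_division_of cbox A B" "(%x. ball x \<eta>0) fine p" using fine_division_exists[of "%x. ball x \<eta>0" A B] \<eta>0(1) gauge_ball by blast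
  have pf: "finite p" using p(1) by blast
  have pk: "x \<in> cbox A B" "x \<in> k" "k \<subseteq> cbox A B" "k \<subseteq> ball x \<eta>0" "\<exists>u v. k = cbox u v" if "(x, k) \<in> p" for x k
   using tagged_division_ofD(2,3,4)[OF p(1) that] p(2) that by (auto simp: fine_def)
  define R where "R q = (\<Sum>i\<in>p. measure lborel (snd i) * g (q, fst i))" for q
  have Rt: "test_fun 3 (%q. measure lborel (snd i) * g (q, fst i))" if "i \<in> p" for i using that pk(1) by (cases i) (auto intro!: test_fun_scale gt)
  have "n R \<le> (\<Sum>i\<in>p. n (%q. measure lborel (snd i) * g (q, fst i)))" unfolding R_def by (rule n_sum[OF Rt])
  also have "... \<le> (\<Sum>i\<in>p. measure lborel (snd i) * C)"
  proof (rule sum_mono)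
   fix i assume "i \<in> p"
   hence "fst i \<in> cbox A B" using pk(1)[of "fst i" "snd i"] by simp
   thus "n (%q. measure lborel (snd i) * g (q, fst i)) \<le> measure lborel (snd i) * C" using n_scale[OF gt] gC by (simp add: mult_left_mono)
  qed
  also have "... = V * C"
  proof -
   have "(\<Sum>i\<in>p. measure lborel (snd i)) = V" using additive_content_tagged_division[OF p(1)] by (simp add: V_def case_prod_beta)
   thus ?thesis by (simp flip: sum_distrib_right)
  qed
  finally have nR: "n R \<le> V * C" .
  have tR: "test_fun 3 R" unfolding R_def by (rule test_fun_sum[OF Rt])
  have "\<bar>iter_deriv ws (%q. integral (cbox A B) (%\<tau>. g (q, \<tau>))) q - iter_deriv ws R q\<bar> \<le> e" if ws: "ws \<in> W" for ws q
  proof (cases "q \<in> cube 3")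
   case False
   thus ?thesis using iter_deriv_zero_outside[OF closed_cube test_funD(2)[OF t] False] iter_deriv_zero_outside[OF closed_cube test_funD(2)[OF tR] False] e by simp
  next
   case True
   have slice: "iter_deriv ws (%q. g (q, \<tau>)) q = h ws (q, \<tau>)" for \<tau> q using iter_deriv_affine[OF g, of "%q. (q, 0)" ws "(0, \<tau>)" q]
    by (simp add: h_def bounded_linear_Pair bounded_linear_ident bounded_linear_zero)
   have gs: "smooth UNIV (%q. g (q, \<tau>))" for \<tau> by (intro smooth_comp[OF g] smooth_Pair smooth_const smooth_id open_UNIV)
   have "iter_deriv ws R q = (\<Sum>i\<in>p. measure lborel (snd i) * h ws (q, fst i))" unfolding R_def using pf
   proof (induction p)
    case empty
    thus ?case by (simp add: iter_deriv_zero)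
   next
    case (insert i p)
    have "iter_deriv ws (%q. measure lborel (snd i) * g (q, fst i) + (\<Sum>i\<in>p. measure lborel (snd i) * g (q, fst i))) q
     = iter_deriv ws (%q. measure lborel (snd i) * g (q, fst i)) q + iter_deriv ws (%q. \<Sum>i\<in>p. measure lborel (snd i) * g (q, fst i)) q"
     by (rule iter_deriv_add[of UNIV]) (auto intro!: smooth_mult smooth_sum smooth_const gs)
    also have "iter_deriv ws (%q. measure lborel (snd i) * g (q, fst i)) q = measure lborel (snd i) * h ws (q, fst i)"
     using iter_deriv_linear[OF bounded_linear_mult_right gs UNIV_I] by (simp add: slice)
    finally show ?case using insert by simp
   qed
   moreover have "iter_deriv ws (%q. integral (cbox A B) (%\<tau>. g (q, \<tau>))) q = integral (cbox A B) (%\<tau>. h ws (q, \<tau>))"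
    unfolding h_def by (rule iter_deriv_param_integral[OF g open_UNIV sub UNIV_I])
   moreover have hi: "(%\<tau>. h ws (q, \<tau>)) integrable_on cbox u v" for u v
    by (intro integrable_continuous continuous_on_compose2[OF hc[of UNIV]] continuous_intros) auto
   moreover have "integral (cbox A B) (%\<tau>. h ws (q, \<tau>)) = (\<Sum>i\<in>p. integral (snd i) (%\<tau>. h ws (q, \<tau>)))"
    using integral_combine_tagged_division_topdown[OF hi p(1)] by (simp add: case_prod_beta)
   ultimately have "iter_deriv ws (%q. integral (cbox A B) (%\<tau>. g (q, \<tau>))) q - iter_deriv ws R q
     = (\<Sum>i\<in>p. integral (snd i) (%\<tau>. h ws (q, \<tau>)) - measure lborel (snd i) * h ws (q, fst i))" by (simp add: sum_subtractf)
   also have "\<bar>...\<bar> \<le> (\<Sum>i\<in>p. d * measure lborel (snd i))"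
   proof (rule order_trans[OF sum_abs], rule sum_mono)
    fix i assume i: "i \<in> p"
    obtain x k where ik: "i = (x, k)" by (cases i)
    obtain u v where k: "k = cbox u v" using pk(5) i ik by blast
    have "integral k (%\<tau>. h ws (q, \<tau>)) - measure lborel k * h ws (q, x) = integral k (%\<tau>. h ws (q, \<tau>) - h ws (q, x))" unfolding k
     using Henstock_Kurzweil_Integration.integral_diff[OF hi integrable_const, of u v "h ws (q, x)"] by simp
    also have "norm ... \<le> d * measure lborel (cbox u v)" unfolding k
    proof (rule has_integral_bound[OF less_imp_le[OF d]])
     show "((%\<tau>. h ws (q, \<tau>) - h ws (q, x)) has_integral integral (cbox u v) (%\<tau>. h ws (q, \<tau>) - h ws (q, x))) (cbox u v)"
      by (intro integrable_integral integrable_diff hi integrable_const)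
     fix \<tau> assume \<tau>: "\<tau> \<in> cbox u v"
     hence "\<tau> \<in> cbox A B" "x \<in> cbox A B" "dist \<tau> x < \<eta>0" using pk(1,3,4)[of x k] i ik k by (auto simp: dist_commute)
     thus "norm (h ws (q, \<tau>) - h ws (q, x)) \<le> d" using \<eta>(2)[OF True, of \<tau> x ws] \<eta>0(2)[OF ws] by simp
    qed
    finally show "\<bar>integral (snd i) (%\<tau>. h ws (q, \<tau>)) - measure lborel (snd i) * h ws (q, fst i)\<bar> \<le> d * measure lborel (snd i)"
     by (simp add: ik k)
   qed
   also have "... = d * V" using additive_content_tagged_division[OF p(1)] by (simp add: V_def case_prod_beta flip: sum_distrib_left)
   also have "... \<le> e" using e V by (simp add: d_def field_simps)
   finally show ?thesis .
  qed
  thus "\<exists>f. test_fun 3 f \<and> n f \<le> V * C \<and> (\<forall>ws\<in>W. \<forall>q. \<bar>iter_deriv ws (%q. integral (cbox A B) (%\<tau>. g (q, \<tau>))) q - iter_deriv ws f q\<bar> \<le> e)"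
   using tR nR by blast
 qed
qed

end

text \<open>A differential equation whose right-hand side does not involve the unknown yields the
  antiderivative on both sides of the starting point at once.\<close>

lemma antiderivative_exists:
 fixes k :: "real => real"
 assumes k: "smooth UNIV k"
 obtains \<sigma> where "smooth UNIV \<sigma>" "!!x. (\<sigma> has_real_derivative k x) (at x)" "\<sigma> x0 = 0"
proof -
 have "continuous_on UNIV (%z::real \<times> real. k (fst z))" by (rule continuous_on_compose2[OF smooth_cont[OF k]]) (auto intro!: continuous_intros)
 hence "continuous_on UNIV (%(t, x::real). k t)" by (simp add: case_prod_beta)
 from ode_exists[OF this, of 0 0] obtain u where u: "!!t. (u has_vector_derivative k t) (at t)" by auto
 define \<sigma> where "\<sigma> x = u x - u x0" for x
 have d: "(\<sigma> has_real_derivative k x) (at x)" for x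
  unfolding \<sigma>_def[abs_def] using u[of x] by (auto intro!: derivative_eq_intros simp: has_real_derivative_iff_has_vector_derivative)
 have "smooth UNIV \<sigma>" by (rule smooth_derivI[where f'="%x h. k x * h"])
   (use d in \<open>auto simp: has_field_derivative_def intro!: smooth_mult k smooth_const\<close>)
 thus thesis using that d by (simp add: \<sigma>_def)
qed

lemma frechet_zero_invariant:
 fixes f :: "'e::euclidean_space => real"
 assumes f: "smooth UNIV f" and i: "!!q t. f (q + t *\<^sub>R v) = f q"
 shows "Df f q v = 0"
proof -
 have "((%t. q + t *\<^sub>R v) has_derivative (%h. h *\<^sub>R v)) (at 0)" by (auto intro!: derivative_eq_intros)
 from has_derivative_compose[OF this, of f "Df f q"] smooth_deriv[OF f UNIV_I]
 have 1: "((%t::real. f q) has_derivative (%h. Df f q (h *\<^sub>R v))) (at 0)" by (simp add: i)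
 have "(%h::real. Df f q (h *\<^sub>R v)) = (%h. 0)" by (rule has_derivative_unique[OF 1 has_derivative_const])
 hence "Df f q (1 *\<^sub>R v) = 0" by (rule fun_cong)
 thus ?thesis by simp
qed

lemma frechet_zero_min:
 fixes f :: "'e::euclidean_space => real"
 assumes f: "smooth UNIV f" and p: "!!q. 0 \<le> f q" and z: "f q = 0"
 shows "Df f q v = 0"
proof -
 have "Df f q = (%v. 0)" by (rule differential_zero_maxmin[of q UNIV f, OF _ open_UNIV smooth_deriv[OF f UNIV_I]]) (use p z in auto)
 thus ?thesis by simp
qed

text \<open>Reads off the spatial derivative of a cut-off Hamiltonian from the formula S that holds
  on an open set where the cutoffs are 1.\<close>

lemma frechet_slice:
 fixes h :: "'s::euclidean_space \<times> 'e::euclidean_space => 'f::euclidean_space"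
 assumes h: "smooth UNIV h" and O': "open O'" "q \<in> O'" and eq: "!!q'. q' \<in> O' ==> h (t, q') = S q'"
  and S: "(S has_derivative S') (at q)"
 shows "Df h (t, q) (0, v) = S' v"
proof -
 have "((%q. (t, q)) has_derivative (%v. (0, v))) (at q)" by (intro has_derivative_Pair has_derivative_const has_derivative_ident)
 from has_derivative_compose[OF this smooth_deriv[OF h UNIV_I]]
 have 1: "((%q. h (t, q)) has_derivative (%v. Df h (t, q) (0, v))) (at q)" .
 have 2: "((%q. h (t, q)) has_derivative S') (at q)" by (rule has_derivative_transform_within_open[OF S O']) (simp add: eq)
 show ?thesis using has_derivative_unique[OF 1 2] by (rule fun_cong)
qed

definition time_cut :: "real => real" where "time_cut t = cut (1/2) 1 (t - 1/2)"

lemma smooth_time_cut: "smooth U f ==> smooth U (%x. time_cut (f x))"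
 unfolding time_cut_def by (intro smooth_cut_compose smooth_diff smooth_const) (auto dest: smooth_open)
lemma time_cut_1: "t \<in> {0..1} ==> time_cut t = 1" unfolding time_cut_def by (rule cut_eq_1) (simp_all add: abs_if)
lemma time_cut_0: "t \<notin> {-1/2<..<3/2} ==> time_cut t = 0" unfolding time_cut_def by (rule cut_eq_0) (auto simp: abs_if)
lemma time_cut_bounds: "0 \<le> time_cut t" "time_cut t \<le> 1" unfolding time_cut_def by (rule cut_nonneg, rule cut_le_1)

definition cube_cut :: "'e::euclidean_space => real" where
 "cube_cut q = (\<Prod>c\<in>Basis. cut (5/2) 3 (q \<bullet> c))"

lemma smooth_cube_cut: "smooth UNIV cube_cut"
 unfolding cube_cut_def[abs_def] by (intro smooth_prod smooth_cut_compose smooth_inner smooth_id smooth_const open_UNIV)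
lemma cube_cut_0: "q \<notin> cube 3 ==> cube_cut q = 0"
proof -
 assume "q \<notin> cube 3"
 then obtain c where "c \<in> Basis" "3 \<le> \<bar>q \<bullet> c\<bar>" unfolding cube_def by force
 hence "\<exists>c\<in>Basis. cut (5/2) 3 (q \<bullet> c) = 0" by (intro bexI[of _ c] cut_eq_0) auto
 thus ?thesis unfolding cube_cut_def by (intro prod_zero finite_Basis)
qed
lemma cube_cut_1: "q \<in> cube (5/2) ==> cube_cut q = 1" unfolding cube_cut_def cube_def by (auto intro!: prod.neutral cut_eq_1)

section \<open>Conjugate coordinates and the shear\<close>

locale inv_seminorm_pair = inv_seminorm \<Omega> n W C0
 for \<Omega> :: "'e::euclidean_space => 'e => real" and n W C0 +
 fixes a b :: 'e
 assumes ab: "a \<in> Basis" "b \<in> Basis" "\<Omega> a b ~= 0"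
  "!!c. c \<in> Basis - {a, b} ==> \<Omega> a c = 0" "!!c. c \<in> Basis - {a, b} ==> \<Omega> b c = 0"
begin

definition \<kappa> :: real where "\<kappa> = \<Omega> a b"

lemma \<kappa>: "\<kappa> ~= 0" using ab by (simp add: \<kappa>_def)

lemma a_neq_b: "a ~= b" using ab(3) \<Omega>(1) by (auto simp: alt_form_def)

lemma inner_ab [simp]: "a \<bullet> b = 0" "b \<bullet> a = 0" "a \<bullet> a = 1" "b \<bullet> b = 1" using ab(1,2) a_neq_b by (auto simp: inner_Basis)

lemma inner_other: "c \<in> Basis - {a, b} ==> a \<bullet> c = 0" "c \<in> Basis - {a, b} ==> b \<bullet> c = 0" using ab(1,2) by (auto simp: inner_Basis)

lemma form_b: "\<Omega> X b = (X \<bullet> a) * \<kappa>"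
proof -
 have "\<Omega> X b = (\<Sum>c\<in>Basis. (X \<bullet> c) *\<^sub>R \<Omega> c b)" by (rule linear_expand[OF alt_linear(2)[OF \<Omega>(1)]])
 also have "... = (\<Sum>c\<in>Basis. if c = a then (X \<bullet> a) * \<kappa> else 0)"
 proof (rule sum.cong[OF refl])
  fix c ::'e assume c: "c \<in> Basis"
  have "\<Omega> b b = 0" using \<Omega>(1) by (simp add: alt_form_def)
  moreover have "\<Omega> c b = 0" if "c ~= a" "c ~= b" using ab(5)[of c] c that alt_form_skew[OF \<Omega>(1), of c b] by simp
  ultimately show "(X \<bullet> c) *\<^sub>R \<Omega> c b = (if c = a then (X \<bullet> a) * \<kappa> else 0)"
   by (cases "c = b") (use a_neq_b in \<open>auto simp: \<kappa>_def\<close>)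
 qed
 finally show ?thesis using ab(1) by simp
qed

lemma form_a: "\<Omega> X a = - (X \<bullet> b) * \<kappa>"
proof -
 have "\<Omega> X a = (\<Sum>c\<in>Basis. (X \<bullet> c) *\<^sub>R \<Omega> c a)" by (rule linear_expand[OF alt_linear(2)[OF \<Omega>(1)]])
 also have "... = (\<Sum>c\<in>Basis. if c = b then - (X \<bullet> b) * \<kappa> else 0)"
 proof (rule sum.cong[OF refl])
  fix c ::'e assume c: "c \<in> Basis"
  have "\<Omega> a a = 0" using \<Omega>(1) by (simp add: alt_form_def)
  moreover have "\<Omega> c a = 0" if "c ~= a" "c ~= b" using ab(4)[of c] c that alt_form_skew[OF \<Omega>(1), of c a] by simp
  moreover have "\<Omega> b a = - \<kappa>" using alt_form_skew[OF \<Omega>(1), of b a] by (simp add: \<kappa>_def)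
  ultimately show "(X \<bullet> c) *\<^sub>R \<Omega> c a = (if c = b then - (X \<bullet> b) * \<kappa> else 0)" by (cases "c = a") (use a_neq_b in auto)
 qed
 finally show ?thesis using ab(2) by simp
qed

text \<open>Hamilton's equations for the pair a, b, with \<kappa> as the value of the form on
  it.\<close>

lemma ham_components:
 assumes "!!v. \<Omega> X v = - D v"
 shows "X \<bullet> a = - D b / \<kappa>" "X \<bullet> b = D a / \<kappa>" using form_b[of X] form_a[of X] assms[of b] assms[of a] \<kappa> by (auto simp: field_simps)

lemma ham_component_zero:
 assumes X: "!!v. \<Omega> X v = - D v" and D: "!!c. c \<in> Basis - {a, b} ==> D c = 0"
 shows "X = (X \<bullet> a) *\<^sub>R a + (X \<bullet> b) *\<^sub>R b"
proof -
 define Z where "Z = X - (X \<bullet> a) *\<^sub>R a - (X \<bullet> b) *\<^sub>R b"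
 have lin: "\<Omega> Z v = \<Omega> X v - (X \<bullet> a) * \<Omega> a v - (X \<bullet> b) * \<Omega> b v" for v
  unfolding Z_def by (simp add: linear_diff[OF alt_linear(2)[OF \<Omega>(1)]] linear_scale[OF alt_linear(2)[OF \<Omega>(1)]])
 have "\<Omega> Z c = 0" if c: "c \<in> Basis" for c
 proof (cases "c = a \<or> c = b")
  case True
  thus ?thesis using lin[of c] form_a[of X] form_b[of X] form_a[of a] form_b[of a] form_a[of b] form_b[of b] by auto
 next
  case False
  thus ?thesis using lin[of c] X[of c] D[of c] ab(4,5) c by simp
 qed
 hence "\<Omega> Z v = 0" for v using linear_expand[OF alt_linear(1)[OF \<Omega>(1)], of Z v] by simp
 hence "Z = 0" using \<Omega>(2) unfolding nondeg_form_def by blast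
 thus ?thesis by (simp add: Z_def algebra_simps)
qed

definition F :: "'e => real" where "F q = (q \<bullet> b) * cube_cut q"

lemma test_F: "test_fun 3 F" unfolding test_fun_def F_def[abs_def] by (auto intro!: smooth_mult smooth_inner smooth_id smooth_const smooth_cube_cut simp: cube_cut_0)

text \<open>The Hamiltonian S = - \<kappa> \<sigma>(x) w(z) with \<sigma>' = k keeps x fixed and
  lowers y at the rate k(x) w(z), so F composed with the inverse \<psi> gains exactly k(x) w(z)
  where the cutoffs are 1. The z-coordinates may move fast, but w is conserved: trajectories stay in
  a level set of w, which is bounded in z if w is nonzero, and they are at rest where w = 0. The
  bound 1/4 on the shift keeps |y| below 9/4 when the end point lies in
  \<open>cube 2\<close>.\<close>

lemma shear_step:
 assumes k: "smooth UNIV (k :: real => real)" and w: "smooth UNIV w" "!!q. 0 \<le> w q"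
  and inv: "!!q t. w (q + t *\<^sub>R a) = w q" "!!q t. w (q + t *\<^sub>R b) = w q"
  and supp: "!!q c. w q ~= 0 ==> c \<in> Basis - {a, b} ==> \<bar>q \<bullet> c\<bar> \<le> 2"
  and bound: "!!x q. \<bar>k x * w q\<bar> \<le> 1/4"
 shows "\<exists>G. test_fun 3 G \<and> n G \<le> 2 * n F \<and> (\<forall>q\<in>cube 2. G q = k (q \<bullet> a) * w q)"
proof -
 obtain \<sigma> where \<sigma>: "smooth UNIV \<sigma>" "!!x. (\<sigma> has_real_derivative k x) (at x)" using antiderivative_exists[OF k, of 0] by blast
 define S where "S q = - \<kappa> * (\<sigma> (q \<bullet> a) * w q)" for q
 define h where "h z = time_cut (fst z) * (S (snd z) * cube_cut (snd z))" for z
 define Dw where "Dw q v = Df w q v" for q v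
 have Dw: "(w has_derivative Dw q) (at q)" for q unfolding Dw_def[abs_def] by (rule smooth_deriv[OF w(1) UNIV_I])
 have Dwab: "Dw q a = 0" "Dw q b = 0" for q unfolding Dw_def by (rule frechet_zero_invariant[OF w(1) inv(1)], rule frechet_zero_invariant[OF w(1) inv(2)])
 have Dwmin: "Dw q v = 0" if "w q = 0" for q v unfolding Dw_def by (rule frechet_zero_min[OF w(1,2) that])
 have Ss: "smooth UNIV S" unfolding S_def[abs_def] by (intro smooth_mult smooth_const smooth_comp[OF \<sigma>(1)] smooth_inner smooth_id w(1) open_UNIV)
 have hs: "smooth UNIV h" unfolding h_def[abs_def]
  by (intro smooth_mult smooth_time_cut smooth_comp[OF Ss] smooth_comp[OF smooth_cube_cut] smooth_fst smooth_snd smooth_id open_UNIV)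
 have h0: "h (t, q) = 0" if "t \<notin> {-1..2} \<or> q \<notin> cube 3" for t q using that time_cut_0[of t] cube_cut_0[of q] by (auto simp: h_def)
 define S' where "S' q v = - \<kappa> * (k (q \<bullet> a) * (v \<bullet> a) * w q + \<sigma> (q \<bullet> a) * Dw q v)" for q v
 have SD: "(S has_derivative S' q) (at q)" for q
 proof -
  have "((%q. \<sigma> (q \<bullet> a)) has_derivative (%v. k (q \<bullet> a) * (v \<bullet> a))) (at q)"
   using has_derivative_compose[OF has_derivative_inner_left[OF has_derivative_ident] \<sigma>(2)[unfolded has_field_derivative_def]] .
  from has_derivative_mult_right[OF has_derivative_mult[OF this Dw], of "- \<kappa>"]
  show ?thesis unfolding S_def[abs_def] S'_def[abs_def] by (simp add: algebra_simps)
 qed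
 define O' where "O' = {q::'e. \<forall>c\<in>Basis. \<bar>q \<bullet> c\<bar> < 5/2}"
 have O': "open O'"
 proof -
  have "O' = (\<Inter>c\<in>Basis. {q. \<bar>q \<bullet> c\<bar> < 5/2})" by (auto simp: O'_def)
  thus ?thesis by (simp add: open_INT open_Collect_less continuous_intros)
 qed
 have cO: "cube r \<subseteq> O'" if "r < 5/2" for r unfolding O'_def cube_def using le_less_trans[OF _ that] by blast
 have Dh: "Df h (t, q) (0, v) = S' q v" if "t \<in> {0..1}" "q \<in> O'" for t q v
 proof (rule frechet_slice[OF hs O' that(2) _ SD])
  fix q' assume "q' \<in> O'"
  hence "q' \<in> cube (5/2)" by (auto simp: O'_def cube_def less_imp_le)
  thus "h (t, q') = S q'" using time_cut_1[OF that(1)] by (simp add: h_def cube_cut_1)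
 qed
 obtain \<phi> \<psi> where \<phi>: "ham_flow \<Omega> h \<phi>" "smooth UNIV \<phi>" "smooth UNIV \<psi>"
  "!!q. \<psi> (\<phi> (1, q)) = q" "!!q. \<phi> (1, \<psi> q) = q"
  "!!t q. t \<in> {0..1} ==> q \<notin> cube 3 ==> \<phi> (t, q) = q" "!!t q. t \<in> {0..1} ==> q \<in> cube 3 ==> \<phi> (t, q) \<in> cube 3"
  "!!q u v. \<Omega> (Df (%q. \<phi> (1, q)) q u) (Df (%q. \<phi> (1, q)) q v) = \<Omega> u v"
  by (rule ham_flow_exists[OF \<Omega>(1,2) hs compact_cube h0]) (assumption | rule that)+
 define G where "G q = F (\<psi> q) - F q" for q
 have out: "\<psi> q = q" if "q \<notin> cube 3" for q using \<phi>(6)[of 1 q] that \<phi>(4)[of q] by simp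
 have tF\<psi>: "test_fun 3 (%q. F (\<psi> q))" unfolding test_fun_def using test_funD[OF test_F] out by (auto intro: smooth_comp \<phi>(3))
 have nG: "n G \<le> 2 * n F"
 proof -
  have "n G \<le> n (%q. F (\<psi> q)) + n F" unfolding G_def by (rule n_diff[OF tF\<psi> test_F])
  also have "n (%q. F (\<psi> q)) = n F"
  proof (rule n_inv[OF _ test_F])
   show "ham_iso \<Omega> h \<phi> \<psi>" unfolding ham_iso_def using hs h0 \<phi> by (intro conjI allI impI ballI) simp_all
  qed
  finally show ?thesis by simp
 qed
 have tG: "test_fun 3 G" unfolding G_def by (rule test_fun_diff[OF tF\<psi> test_F])
 have "G q = k (q \<bullet> a) * w q" if q: "q \<in> cube 2" for q
 proof -
  define \<gamma> where "\<gamma> t = \<phi> (t, \<psi> q)" for t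
  define e where "e = k (q \<bullet> a) * w q"
  have \<gamma>1: "\<gamma> 1 = q" by (simp add: \<gamma>_def \<phi>(5))
  have \<gamma>0: "\<gamma> 0 = \<psi> q" using \<phi>(1) by (simp add: \<gamma>_def ham_flow_def)
  have \<gamma>c: "continuous_on {0..1} \<gamma>" unfolding \<gamma>_def by (rule continuous_on_compose2[OF smooth_cont[OF \<phi>(2)]]) (auto intro!: continuous_intros)
  have X: "\<Omega> X v = - S' (\<gamma> s) v" if "s \<in> {0..1}" "\<gamma> s \<in> O'" "!!v. \<Omega> X v = - Df h (s, \<phi> (s, \<psi> q)) (0, v)" for s X v
   using that Dh[OF that(1), of "\<gamma> s"] by (simp add: \<gamma>_def)
  have cons_w: "w (\<gamma> t) = w q" and cons_x: "\<gamma> t \<bullet> a = q \<bullet> a"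
   if t: "t \<in> {0..1}" and tr: "!!s. s \<in> {t..1} ==> \<gamma> s \<in> O'" for t
  proof -
   have sub: "{t..1} \<subseteq> {0..1}" "1 \<in> {t..1}" "t \<in> {t..1}" using t by auto
   \<comment> \<open>S does not depend on y, hence x is at rest. From \<Omega> X X = 0 it follows
     that S is stationary along X, and then so is w, unless \<sigma> vanishes; in that case X points
     along b, and w does not depend on y.\<close>
   have Xa: "X \<bullet> a = 0" "Dw (\<gamma> s) X = 0" if s: "s \<in> {t..1}" and X': "!!v. \<Omega> X v = - Df h (s, \<phi> (s, \<psi> q)) (0, v)" for s X
   proof -
    have XS: "!!v. \<Omega> X v = - S' (\<gamma> s) v" using X[OF _ tr[OF s] X'] s sub by auto
    show xa: "X \<bullet> a = 0" using ham_components(1)[OF XS] by (simp add: S'_def Dwab)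
    show "Dw (\<gamma> s) X = 0"
    proof (cases "\<sigma> (\<gamma> s \<bullet> a) = 0")
     case True
     have "X = (X \<bullet> a) *\<^sub>R a + (X \<bullet> b) *\<^sub>R b"
      by (rule ham_component_zero[OF XS]) (use True ab(1) in \<open>auto simp: S'_def inner_Basis\<close>)
     hence "X = (X \<bullet> b) *\<^sub>R b" using xa by simp
     hence "Dw (\<gamma> s) X = Dw (\<gamma> s) ((X \<bullet> b) *\<^sub>R b)" by simp
     also have "... = 0" using linear_scale[OF has_derivative_linear[OF Dw]] by (simp add: Dwab)
     finally show ?thesis .
    next
     case False
     have "\<Omega> X X = 0" using \<Omega>(1) by (simp add: alt_form_def)
     hence "S' (\<gamma> s) X = 0" using XS[of X] by simp
     thus ?thesis using False \<kappa> xa by (simp add: S'_def)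
    qed
   qed
   have "(%z. w (snd z)) (t, \<phi> (t, \<psi> q)) = (%z. w (snd z)) (1::real, \<phi> (1, \<psi> q))"
    by (rule ham_flow_conserved[where f="%z. w (snd z)" and f'="%t h. Dw (\<phi> (t, \<psi> q)) (snd h)", OF \<phi>(1) _ sub(1,3,2)])
     (use Xa(2) has_derivative_compose[OF has_derivative_snd[OF has_derivative_ident] Dw] in \<open>auto simp: \<gamma>_def\<close>)
   thus "w (\<gamma> t) = w q" by (simp add: \<gamma>_def \<phi>(5))
   have "(%z. snd z \<bullet> a) (t, \<phi> (t, \<psi> q)) = (%z. snd z \<bullet> a) (1::real, \<phi> (1, \<psi> q))"
    by (rule ham_flow_conserved[where f="%z. snd z \<bullet> a" and f'="%t h. snd h \<bullet> a", OF \<phi>(1) _ sub(1,3,2)])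
     (use Xa(1) in \<open>auto intro!: derivative_intros\<close>)
   thus "\<gamma> t \<bullet> a = q \<bullet> a" by (simp add: \<gamma>_def \<phi>(5))
  qed
  have cons_y: "\<gamma> t \<bullet> b = q \<bullet> b + (1 - t) * e"
   if t: "t \<in> {0..1}" and tr: "!!s. s \<in> {t..1} ==> \<gamma> s \<in> O'" for t
  proof -
   have sub: "{t..1} \<subseteq> {0..1}" "1 \<in> {t..1}" "t \<in> {t..1}" using t by auto
   have "(%z. snd z \<bullet> b + fst z * e) (t, \<phi> (t, \<psi> q)) = (%z. snd z \<bullet> b + fst z * e) (1::real, \<phi> (1, \<psi> q))"
   proof (rule ham_flow_conserved[where f="%z. snd z \<bullet> b + fst z * e" and f'="%t h. snd h \<bullet> b + fst h * e", OF \<phi>(1) _ sub(1,3,2)])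
    fix s X assume s: "s \<in> {t..1}" and X': "!!v. \<Omega> X v = - Df h (s, \<phi> (s, \<psi> q)) (0, v)"
    have XS: "!!v. \<Omega> X v = - S' (\<gamma> s) v" using X[OF _ tr[OF s] X'] s sub by auto
    have "w (\<gamma> s) = w q" "\<gamma> s \<bullet> a = q \<bullet> a" using cons_w[of s] cons_x[of s] s sub tr by auto
    hence "X \<bullet> b = - e" using ham_components(2)[OF XS] \<kappa> by (simp add: S'_def Dwab e_def)
    thus "snd (1::real, X) \<bullet> b + fst (1::real, X) * e = 0" by simp
   qed (auto intro!: derivative_intros)
   thus ?thesis by (simp add: \<gamma>_def \<phi>(5) algebra_simps)
  qed
  have e: "\<bar>e\<bar> \<le> 1/4" unfolding e_def by (rule bound)
  have qb: "\<bar>q \<bullet> c\<bar> \<le> 2" if "c \<in> Basis" for c using q that by (auto simp: cube_def)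
  show ?thesis
  \<comment> \<open>If w q = 0, then w has a minimum there, its derivative vanishes and the point
    never moves. Otherwise the support condition bounds the z-coordinates along the whole
    trajectory.\<close>
  proof (cases "w q = 0")
   case True
   have "\<gamma> 0 \<in> {q}"
   proof (rule trapped_backward[OF \<gamma>c _ O'])
    have "(2::real) < 5/2" by simp
    thus "{q} \<subseteq> O'" using subsetD[OF cO q] by simp
    fix t assume t: "t \<in> {0..1}" and tr: "!!s. s \<in> {t..1} ==> \<gamma> s \<in> O'"
    have sub: "{t..1} \<subseteq> {0..1}" "1 \<in> {t..1}" "t \<in> {t..1}" using t by auto
    have "\<gamma> t \<bullet> c = q \<bullet> c" for c
    proof -
     have "(%z. snd z \<bullet> c) (t, \<phi> (t, \<psi> q)) = (%z. snd z \<bullet> c) (1::real, \<phi> (1, \<psi> q))"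
     proof (rule ham_flow_conserved[where f="%z. snd z \<bullet> c" and f'="%t h. snd h \<bullet> c", OF \<phi>(1) _ sub(1,3,2)])
      fix s X assume s: "s \<in> {t..1}" and X': "!!v. \<Omega> X v = - Df h (s, \<phi> (s, \<psi> q)) (0, v)"
      have XS: "!!v. \<Omega> X v = - S' (\<gamma> s) v" using X[OF _ tr[OF s] X'] s sub by auto
      have "w (\<gamma> s) = 0" using cons_w[of s] s sub tr True by auto
      hence "\<Omega> X v = 0" for v using XS[of v] by (simp add: S'_def Dwmin)
      hence "X = 0" using \<Omega>(2) unfolding nondeg_form_def by blast
      thus "snd (1::real, X) \<bullet> c = 0" by simp
     qed (auto intro!: derivative_intros)
     thus ?thesis by (simp add: \<gamma>_def \<phi>(5))
    qed
    hence "\<gamma> t = q" by (rule euclidean_eqI)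
    thus "\<gamma> t \<in> {q}" by simp
   qed (simp_all add: \<gamma>1)
   thus ?thesis using True by (simp add: G_def \<gamma>0)
  next
   case False
   have tr: "\<gamma> t \<in> cube (9/4)" if "t \<in> {0..1}" for t
   proof (rule trapped_backward[OF \<gamma>c closed_cube O' _ _ _ that])
    show "cube (9/4) \<subseteq> O'" by (rule cO) simp
    show "\<gamma> 1 \<in> cube (9/4)" using \<gamma>1 q subsetD[OF cube_mono, of 2 "9/4" q] by simp
    fix t assume t: "t \<in> {0..1}" and tr: "!!s. s \<in> {t..1} ==> \<gamma> s \<in> O'"
    show "\<gamma> t \<in> cube (9/4)" unfolding cube_def
    proof (intro CollectI ballI)
     fix c ::'e assume c: "c \<in> Basis"
     consider "c = a" | "c = b" | "c \<in> Basis - {a, b}" using c by blast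
     thus "\<bar>\<gamma> t \<bullet> c\<bar> \<le> 9/4"
     proof cases
      case 1 thus ?thesis using cons_x[OF t tr] qb[OF c] by simp
     next
      case 2
      have "\<bar>(1 - t) * e\<bar> \<le> 1 * (1/4)" unfolding abs_mult using t e by (intro mult_mono) auto
      thus ?thesis using cons_y[OF t tr] qb[OF c] abs_triangle_ineq[of "q \<bullet> b" "(1 - t) * e"] unfolding 2 by linarith
     next
      case 3
      have "w (\<gamma> t) ~= 0" using cons_w[OF t tr] False by simp
      from supp[OF this 3] show ?thesis by simp
     qed
    qed
   qed
   have trO: "\<gamma> s \<in> O'" if "s \<in> {0..1}" for s using tr[OF that] cO[of "9/4"] by auto
   have "\<gamma> 0 \<bullet> b = q \<bullet> b + e" using cons_y[of 0] trO by simp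
   moreover have "cube_cut (\<gamma> 0) = 1" "cube_cut q = 1" using tr[of 0] cube_mono[of "9/4" "5/2"] q cube_mono[of 2 "5/2"] by (auto intro!: cube_cut_1)
   ultimately show ?thesis unfolding G_def F_def \<gamma>0[symmetric] by (simp add: e_def)
  qed
 qed
 thus ?thesis using tG nG by blast
qed

end

text \<open>The margins, in units of \<delta>: a bump has radius 1/8; stretched by a factor of at
  most 3/2 it stays within 1/4; \<open>cell_cut\<close> is 1 up to 1/2 and 0 from 3/4 on; the
  lattice has spacing 2. They keep the cells apart and trap the flow inside them.\<close>

definition bump :: "real => real" where "bump = cut (1/16) (1/8)"

lemma smooth_bump: "smooth U f ==> smooth U (%x. bump (f x))" unfolding bump_def by (rule smooth_cut_compose)
lemma bump_nonneg: "0 \<le> bump x" by (simp add: bump_def cut_nonneg)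
lemma bump_nonzero: "bump x ~= 0 ==> \<bar>x\<bar> \<le> 1/8" unfolding bump_def using cut_eq_0[of "1/16" "1/8" x] by fastforce

text \<open>The supports have radius 1/8 and their centres are at least 2 apart, so at most one
  summand is nonzero.\<close>

lemma sum_bump_le_1:
 assumes "finite J"
 shows "(\<Sum>j\<in>J. bump (y - 2 * of_int j)) \<le> 1"
proof (cases "\<exists>j\<in>J. bump (y - 2 * of_int j) ~= 0")
 case True
 then obtain j where j: "j \<in> J" "bump (y - 2 * of_int j) ~= 0" by blast
 have "bump (y - 2 * of_int i) = (if i = j then bump (y - 2 * of_int j) else 0)" for i
 proof (cases "i = j")
  case False
  have "1 \<le> \<bar>i - j\<bar>" using False by simp
  hence "1 \<le> \<bar>real_of_int i - of_int j\<bar>" by linarith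
  hence "\<not> \<bar>y - 2 * of_int i\<bar> \<le> 1/8" using bump_nonzero[OF j(2)] by linarith
  thus ?thesis using bump_nonzero False by auto
 qed simp
 hence "(\<Sum>i\<in>J. bump (y - 2 * of_int i)) = (\<Sum>i\<in>J. if i = j then bump (y - 2 * of_int j) else 0)" by (rule sum.cong[OF refl])
 also have "... = bump (y - 2 * of_int j)" using j(1) assms by (simp only: sum.delta if_True)
 finally show ?thesis by (simp add: bump_def cut_le_1)
next
 case False
 hence "(\<Sum>j\<in>J. bump (y - 2 * of_int j)) = 0" by simp
 thus ?thesis by simp
qed

section \<open>Lattices of bumps and the rescaling flow\<close>

locale inv_cells = inv_seminorm_pair \<Omega> n W C0 a b
 for \<Omega> :: "'e::euclidean_space => 'e => real" and n W C0 a b +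
 fixes v :: "'e => real" and \<delta> :: real and J :: "int set" and \<tau> :: 'e
 assumes v: "test_fun 1 v" "!!q. \<bar>v q\<bar> \<le> 1/2"
  and v_int: "!!q. q \<bullet> b = 0 ==> integral {-1..1} (%y. v (q + y *\<^sub>R b)) = 0"
  and \<delta>: "0 < \<delta>" "\<delta> \<le> 1" and J: "finite J"
  and \<tau>: "!!j c. j \<in> J ==> c \<in> Basis ==> \<bar>\<tau> \<bullet> c + 2 * \<delta> * of_int j\<bar> \<le> 1"
begin

definition s :: "('e => int) => 'e => real" where "s m c = \<tau> \<bullet> c + 2 * \<delta> * of_int (m c)"
text \<open>The indices have no b-component: the cells are tubes along the y-direction.\<close>

definition M :: "('e => int) set" where "M = PiE (Basis - {b}) (%_. J)"
text \<open>v on the y-line through the centre of the cell. Freezing the other coordinates lets the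
  stretching factor in a cell depend on y alone.\<close>

definition vm :: "('e => int) => real => real" where
 "vm m y = v ((\<Sum>c\<in>Basis - {b}. s m c *\<^sub>R c) + y *\<^sub>R b)"
definition cell_bump :: "('e => int) => 'e => real" where
 "cell_bump m q = (\<Prod>c\<in>Basis - {b}. bump ((q \<bullet> c - s m c) / \<delta>))"
definition cell_term :: "('e => int) => 'e => real" where
 "cell_term m q = bump ((q \<bullet> a - s m a) / (\<delta> * (1 + vm m (q \<bullet> b)))) * (\<Prod>c\<in>Basis - {a, b}. bump ((q \<bullet> c - s m c) / \<delta>))"
definition cell_cut :: "('e => int) => 'e => real" where
 "cell_cut m q = (\<Prod>c\<in>Basis - {b}. cut (1/2) (3/4) ((q \<bullet> c - s m c) / \<delta>))"
definition cell :: "('e => int) => 'e set" where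
 "cell m = {q. \<forall>c\<in>Basis - {b}. \<bar>q \<bullet> c - s m c\<bar> < \<delta> / 2}"
definition V :: "('e => int) => real => real" where
 "V m = (SOME V. smooth UNIV V \<and> (\<forall>x. (V has_real_derivative vm m x) (at x)) \<and> V (-1) = 0)"
definition vd :: "('e => int) => real => real" where "vd m y = Df (vm m) y 1"
text \<open>In the cell with centre \<open>s m\<close> the flow of \<open>H\<close> conserves \<open>(q \<bullet> a - s m a) / (1 + t * vm m (q \<bullet> b))\<close>, so its time-one map
carries \<open>cell_bump m\<close> to \<open>cell_term m\<close>. As the integrals of v vanish, so does \<open>V m\<close> outside \<open>{-1..1}\<close>, and \<open>H\<close> has compact support.\<close>

definition H :: "real \<times> 'e => real" where
 "H z = time_cut (fst z) * (- \<kappa> * (\<Sum>m\<in>M. cell_cut m (snd z) * ((snd z \<bullet> a - s m a) *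
   (V m (snd z \<bullet> b) / (1 + fst z * time_cut (fst z) * vm m (snd z \<bullet> b))))))"

lemma finite_M: "finite M" unfolding M_def using J by (intro finite_PiE) auto

lemma smooth_vm: "smooth UNIV (vm m)" unfolding vm_def[abs_def]
 by (intro smooth_comp[OF test_funD(1)[OF v(1)]] smooth_add smooth_scaleR smooth_const smooth_id open_UNIV)

lemma vm_bound: "\<bar>vm m y\<bar> \<le> 1/2" unfolding vm_def by (rule v(2))

lemma vm_pos: "\<bar>t\<bar> \<le> 3/2 ==> 1/4 \<le> 1 + t * vm m y"
proof -
 assume t: "\<bar>t\<bar> \<le> 3/2"
 have "\<bar>t * vm m y\<bar> \<le> (3/2) * (1/2)" unfolding abs_mult by (rule mult_mono[OF t vm_bound]) simp_all
 thus ?thesis by linarith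
qed

lemma vm_zero: "1 < \<bar>y\<bar> ==> vm m y = 0"
proof -
 assume y: "1 < \<bar>y\<bar>"
 have "((\<Sum>c\<in>Basis - {b}. s m c *\<^sub>R c) + y *\<^sub>R b) \<bullet> b = y" using ab(2) by (simp add: inner_add_left inner_sum_left inner_Basis)
 hence "(\<Sum>c\<in>Basis - {b}. s m c *\<^sub>R c) + y *\<^sub>R b \<notin> cube 1" unfolding cube_def using y ab(2) by (intro notI) (auto dest!: bspec[of _ _ b])
 thus ?thesis unfolding vm_def using v(1) by (simp add: test_fun_def)
qed

lemma vm_deriv: "(vm m has_real_derivative vd m y) (at y)"
proof -
 have d: "(vm m has_derivative Df (vm m) y) (at y)" by (rule smooth_deriv[OF smooth_vm UNIV_I])
 have "Df (vm m) y h = vd m y * h" for h using linear_scale[OF has_derivative_linear[OF d], of h 1] by (simp add: vd_def)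
 hence "Df (vm m) y = (%h. vd m y * h)" by blast
 thus ?thesis using d unfolding has_field_derivative_def by simp
qed

lemma V: "smooth UNIV (V m)" "!!x. (V m has_real_derivative vm m x) (at x)" "V m (-1) = 0"
proof -
 have "\<exists>V. smooth UNIV V \<and> (\<forall>x. (V has_real_derivative vm m x) (at x)) \<and> V (-1) = 0"
  by (rule antiderivative_exists[OF smooth_vm, of m "-1"]) blast
 from someI_ex[OF this] show "smooth UNIV (V m)" "!!x. (V m has_real_derivative vm m x) (at x)" "V m (-1) = 0" unfolding V_def by auto
qed

lemma V_zero: "1 \<le> \<bar>y\<bar> ==> V m y = 0"
proof -
 assume y: "1 \<le> \<bar>y\<bar>"
 have c: "continuous_on S (V m)" for S by (rule DERIV_continuous_on) (rule has_field_derivative_at_within[OF V(2)])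
 have "(vm m has_integral (V m 1 - V m (-1))) {-1..1}" by (rule fundamental_theorem_of_calculus)
   (simp, rule has_field_derivative_at_within[OF V(2), unfolded has_real_derivative_iff_has_vector_derivative])
 hence V1: "V m 1 = 0" using v_int[of "\<Sum>c\<in>Basis - {b}. s m c *\<^sub>R c"] V(3) ab(2) by (simp add: vm_def[abs_def] integral_unique inner_sum_left inner_Basis)
 consider "y = 1" | "y = -1" | "1 < y" | "y < -1" using y by linarith
 thus ?thesis
 proof cases
  case 3
  have "V m y = V m 1"
  proof (rule DERIV_isconst_end[OF 3 c])
   fix x :: real assume "1 < x" "x < y"
   hence "vm m x = 0" by (intro vm_zero) simp
   thus "(V m has_real_derivative 0) (at x)" using V(2)[of m x] by simp
  qed
  thus ?thesis using V1 by simp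
 next
  case 4
  have "V m (-1) = V m y"
  proof (rule DERIV_isconst_end[OF 4 c])
   fix x :: real assume "y < x" "x < -1"
   hence "vm m x = 0" by (intro vm_zero) simp
   thus "(V m has_real_derivative 0) (at x)" using V(2)[of m x] by simp
  qed
  thus ?thesis using V(3) by simp
 qed (use V1 V(3) in auto)
qed

text \<open>The denominators in H contain \<open>t * time_cut t\<close>, which is t on [0, 1] and
  bounded for all t; by \<open>vm_pos\<close> they stay away from 0, and H is smooth at all
  times.\<close>

lemma time_bound: "\<bar>t * time_cut t\<bar> \<le> 3/2"
proof (cases "t \<in> {-1/2<..<3/2}")
 case True
 hence "\<bar>t * time_cut t\<bar> \<le> (3/2) * 1" unfolding abs_mult using time_cut_bounds[of t] by (intro mult_mono) auto
 thus ?thesis by simp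
qed (simp add: time_cut_0)

lemma H_smooth: "smooth UNIV H" unfolding H_def[abs_def] cell_cut_def divide_inverse
proof (intro smooth_mult smooth_sum smooth_prod smooth_inverse smooth_cut_compose smooth_time_cut smooth_fst smooth_snd smooth_add smooth_diff
  smooth_inner smooth_const smooth_id smooth_comp[OF V(1)] smooth_comp[OF smooth_vm] open_UNIV)
 fix z :: "real \<times> 'e" and m
 show "\<delta> ~= 0" using \<delta> by simp
 show "1 + fst z * time_cut (fst z) * vm m (snd z \<bullet> b) ~= 0" using vm_pos[OF time_bound, of "fst z" m "snd z \<bullet> b"] by linarith
qed

lemma s_bound: "m \<in> M ==> c \<in> Basis - {b} ==> \<bar>s m c\<bar> \<le> 1" unfolding s_def by (rule \<tau>) (auto simp: M_def PiE_def Pi_def)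

lemma H_zero: "t \<notin> {-1..2} \<or> q \<notin> cube 2 ==> H (t, q) = 0"
proof (elim disjE)
 assume "t \<notin> {-1..2}"
 thus ?thesis using time_cut_0[of t] by (auto simp: H_def)
next
 assume "q \<notin> cube 2"
 then obtain c where c: "c \<in> Basis" "\<bar>q \<bullet> c\<bar> > 2" unfolding cube_def by force
 have "cell_cut m q * ((q \<bullet> a - s m a) * (V m (q \<bullet> b) / (1 + t * time_cut t * vm m (q \<bullet> b)))) = 0" if m: "m \<in> M" for m
 proof (cases "c = b")
  case True
  thus ?thesis using V_zero[of "q \<bullet> b" m] c by simp
 next
  case False
  have "1 \<le> \<bar>q \<bullet> c - s m c\<bar>" using s_bound[OF m, of c] c False by simp
  hence "1 * \<delta> \<le> \<bar>q \<bullet> c - s m c\<bar>" using \<delta> by linarith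
  hence "1 \<le> \<bar>(q \<bullet> c - s m c) / \<delta>\<bar>" using \<delta> by (simp add: abs_divide le_divide_eq)
  hence "cut (1/2) (3/4) ((q \<bullet> c - s m c) / \<delta>) = 0" by (intro cut_eq_0) linarith+
  hence "\<exists>c\<in>Basis - {b}. cut (1/2) (3/4) ((q \<bullet> c - s m c) / \<delta>) = 0" using c False by blast
  hence "cell_cut m q = 0" unfolding cell_cut_def by (intro prod_zero) auto
  thus ?thesis by simp
 qed
 hence "(\<Sum>m\<in>M. cell_cut m q * ((q \<bullet> a - s m a) * (V m (q \<bullet> b) / (1 + t * time_cut t * vm m (q \<bullet> b))))) = 0" by (intro sum.neutral ballI)
 thus ?thesis unfolding H_def fst_conv snd_conv by (simp only: mult_zero_right)
qed

lemma H_cell: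
 assumes m: "m \<in> M" and t: "t \<in> {0..1}" and q: "q \<in> cell m"
 shows "H (t, q) = - \<kappa> * ((q \<bullet> a - s m a) * (V m (q \<bullet> b) / (1 + t * vm m (q \<bullet> b))))"
proof -
 have 1: "cell_cut m q = 1" unfolding cell_cut_def using q \<delta> by (intro prod.neutral ballI cut_eq_1) (auto simp: cell_def abs_divide divide_le_eq less_imp_le)
 \<comment> \<open>From another centre q is at distance at least 2 \<delta> - \<delta> / 2 in some
   coordinate, beyond the support of that cell's cutoff.\<close>
 have 0: "cell_cut m' q = 0" if m': "m' \<in> M" "m' ~= m" for m'
 proof -
  obtain c where c: "c \<in> Basis - {b}" "m' c ~= m c" using m m' PiE_ext[of m "Basis - {b}" "%_. J" m'] unfolding M_def by metis
  have "1 \<le> \<bar>m' c - m c\<bar>" using c by simp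
  hence i: "1 \<le> \<bar>real_of_int (m' c) - of_int (m c)\<bar>" by linarith
  have "s m' c - s m c = 2 * \<delta> * (of_int (m' c) - of_int (m c))" by (simp add: s_def algebra_simps)
  hence "\<bar>s m' c - s m c\<bar> = 2 * \<delta> * \<bar>of_int (m' c) - of_int (m c)\<bar>" using \<delta> by (simp add: abs_mult)
  moreover have "\<delta> * 1 \<le> \<delta> * \<bar>real_of_int (m' c) - of_int (m c)\<bar>" using i \<delta> by (intro mult_left_mono) auto
  ultimately have "2 * \<delta> \<le> \<bar>s m' c - s m c\<bar>" by linarith
  moreover have "\<bar>q \<bullet> c - s m c\<bar> < \<delta> / 2" using q c by (auto simp: cell_def)
  ultimately have "1 * \<delta> \<le> \<bar>q \<bullet> c - s m' c\<bar>" using \<delta> by linarith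
  hence "1 \<le> \<bar>(q \<bullet> c - s m' c) / \<delta>\<bar>" using \<delta> by (simp add: abs_divide le_divide_eq)
  hence "cut (1/2) (3/4) ((q \<bullet> c - s m' c) / \<delta>) = 0" by (intro cut_eq_0) linarith+
  hence "\<exists>c\<in>Basis - {b}. cut (1/2) (3/4) ((q \<bullet> c - s m' c) / \<delta>) = 0" using c by blast
  thus ?thesis unfolding cell_cut_def by (intro prod_zero) auto
 qed
 have "(\<Sum>m'\<in>M. cell_cut m' q * ((q \<bullet> a - s m' a) * (V m' (q \<bullet> b) / (1 + t * vm m' (q \<bullet> b)))))
  = (\<Sum>m'\<in>M. if m' = m then (q \<bullet> a - s m a) * (V m (q \<bullet> b) / (1 + t * vm m (q \<bullet> b))) else 0)" by (rule sum.cong) (auto simp: 0 1)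
 also have "... = (q \<bullet> a - s m a) * (V m (q \<bullet> b) / (1 + t * vm m (q \<bullet> b)))" using m finite_M by simp
 finally show ?thesis using time_cut_1[OF t] by (simp add: H_def)
qed

lemma open_cell: "open (cell m)"
proof -
 have "cell m = (\<Inter>c\<in>Basis - {b}. {q. \<bar>q \<bullet> c - s m c\<bar> < \<delta> / 2})" by (auto simp: cell_def)
 thus ?thesis by (simp add: open_INT open_Collect_less continuous_intros)
qed

definition Hd :: "('e => int) => real => 'e => 'e => real" where
 "Hd m t q u = - \<kappa> * ((u \<bullet> a) * (V m (q \<bullet> b) / (1 + t * vm m (q \<bullet> b))) + (q \<bullet> a - s m a) * ((u \<bullet> b) *
   ((vm m (q \<bullet> b) * (1 + t * vm m (q \<bullet> b)) - V m (q \<bullet> b) * (t * vd m (q \<bullet> b))) / (1 + t * vm m (q \<bullet> b))\<^sup>2)))"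

lemma H_deriv:
 assumes m: "m \<in> M" and t: "t \<in> {0..1}" and q: "q \<in> cell m"
 shows "Df H (t, q) (0, u) = Hd m t q u"
proof (rule frechet_slice[OF H_smooth open_cell q H_cell[OF m t]])
 have p: "1 + t * vm m (q \<bullet> b) ~= 0" using vm_pos[of t m "q \<bullet> b"] t by auto
 have g: "((%y. V m y / (1 + t * vm m y)) has_real_derivative
   (vm m (q \<bullet> b) * (1 + t * vm m (q \<bullet> b)) - V m (q \<bullet> b) * (t * vd m (q \<bullet> b))) / (1 + t * vm m (q \<bullet> b))\<^sup>2) (at (q \<bullet> b))"
  by (rule derivative_eq_intros V(2) vm_deriv refl p)+ (simp add: power2_eq_square)
 have "((%q. V m (q \<bullet> b) / (1 + t * vm m (q \<bullet> b))) has_derivative (%u.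
   (vm m (q \<bullet> b) * (1 + t * vm m (q \<bullet> b)) - V m (q \<bullet> b) * (t * vd m (q \<bullet> b))) / (1 + t * vm m (q \<bullet> b))\<^sup>2 * (u \<bullet> b))) (at q)"
  using has_derivative_compose[OF has_derivative_inner_left[OF has_derivative_ident] g[unfolded has_field_derivative_def]] .
 from has_derivative_mult_right[OF has_derivative_mult[OF has_derivative_diff[OF has_derivative_inner_left[OF has_derivative_ident] has_derivative_const] this], of "- \<kappa>" a "s m a"]
 show "((%q. - \<kappa> * ((q \<bullet> a - s m a) * (V m (q \<bullet> b) / (1 + t * vm m (q \<bullet> b))))) has_derivative Hd m t q) (at q)"
  by (rule has_derivative_eq_rhs) (auto simp: Hd_def fun_eq_iff algebra_simps)
qed

end

lemma bump_scaled: "bump (x / r) ~= 0 ==> 0 < r ==> \<bar>x\<bar> \<le> r / 8" using bump_nonzero[of "x / r"] by (simp add: abs_divide divide_le_eq)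

context inv_cells
begin

lemma vm_range: "t \<in> {0..1} ==> 1/4 \<le> 1 + t * vm m y" "t \<in> {0..1} ==> 1 + t * vm m y \<le> 3/2"
proof -
 assume t: "t \<in> {0..1}"
 have "\<bar>t * vm m y\<bar> \<le> 1 * (1/2)" unfolding abs_mult by (rule mult_mono) (use t vm_bound in auto)
 thus "1/4 \<le> 1 + t * vm m y" "1 + t * vm m y \<le> 3/2" by linarith+
qed

text \<open>Put P = 1 + t vm(y). Hamilton's equations read y' = - V / P and (x - s)' = (x - s) (vm P
  - t V vm') / P^2, and with them the derivative of (x - s) / P cancels. The remaining coordinates
  are at rest because inside the cell H depends on x and y only.\<close>

lemma cell_conserved:
 assumes fl: "ham_flow \<Omega> H \<phi>" and m: "m \<in> M" and sub: "{t0..t1} \<subseteq> {0..1}"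
  and cell: "!!t. t \<in> {t0..t1} ==> \<phi> (t, p) \<in> cell m" and i: "i \<in> {t0..t1}" "j \<in> {t0..t1}"
 shows "c \<in> Basis - {a, b} ==> \<phi> (i, p) \<bullet> c = \<phi> (j, p) \<bullet> c"
  and "(\<phi> (i, p) \<bullet> a - s m a) / (1 + i * vm m (\<phi> (i, p) \<bullet> b)) = (\<phi> (j, p) \<bullet> a - s m a) / (1 + j * vm m (\<phi> (j, p) \<bullet> b))"
proof -
 have X: "\<Omega> X u = - Hd m t (\<phi> (t, p)) u"
  if "t \<in> {t0..t1}" "!!u. \<Omega> X u = - Df H (t, \<phi> (t, p)) (0, u)" for t X u
  using that H_deriv[OF m _ cell[OF that(1)], of t u] subsetD[OF sub that(1)] by simp
 show "\<phi> (i, p) \<bullet> c = \<phi> (j, p) \<bullet> c" if c: "c \<in> Basis - {a, b}"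
 proof -
  have "(%z. snd z \<bullet> c) (i, \<phi> (i, p)) = (%z. snd z \<bullet> c) (j, \<phi> (j, p))"
  proof (rule ham_flow_conserved[where f="%z. snd z \<bullet> c" and f'="%t h. snd h \<bullet> c", OF fl _ sub i])
   fix t X assume t: "t \<in> {t0..t1}" and X': "!!v. \<Omega> X v = - Df H (t, \<phi> (t, p)) (0, v)"
   have "X = (X \<bullet> a) *\<^sub>R a + (X \<bullet> b) *\<^sub>R b"
   proof (rule ham_component_zero[OF X[OF t X']])
    fix c' :: 'e assume "c' \<in> Basis - {a, b}"
    thus "Hd m t (\<phi> (t, p)) c' = 0" using inner_other[of c'] by (simp add: Hd_def inner_commute)
   qed
   hence "X \<bullet> c = ((X \<bullet> a) *\<^sub>R a + (X \<bullet> b) *\<^sub>R b) \<bullet> c" by simp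
   thus "snd (1::real, X) \<bullet> c = 0" using inner_other[OF c] by (simp add: inner_add_left)
  qed (auto intro!: derivative_intros)
  thus ?thesis by simp
 qed
 define f where "f z = (snd z \<bullet> a - s m a) / (1 + fst z * vm m (snd z \<bullet> b))" for z
 define f' where "f' t h = (let q = \<phi> (t, p); P = 1 + t * vm m (q \<bullet> b) in
  ((snd h \<bullet> a) * P - (q \<bullet> a - s m a) * (t * (vd m (q \<bullet> b) * (snd h \<bullet> b)) + fst h * vm m (q \<bullet> b))) / (P * P))" for t h
 have "f (i, \<phi> (i, p)) = f (j, \<phi> (j, p))"
 proof (rule ham_flow_conserved[where f=f and f'=f', OF fl _ sub i])
  fix t assume t: "t \<in> {t0..t1}"
  define q where "q = \<phi> (t, p)"
  define P where "P = 1 + t * vm m (q \<bullet> b)"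
  have t1: "t \<in> {0..1}" using t sub by blast
  have P: "P > 0" unfolding P_def using vm_range(1)[OF t1, of m "q \<bullet> b"] by linarith
  have d1: "((%z::real \<times> 'e. snd z \<bullet> a - s m a) has_derivative (%h. snd h \<bullet> a)) (at (t, q))" by (auto intro!: derivative_eq_intros)
  have "((%z::real \<times> 'e. snd z \<bullet> b) has_derivative (%h. snd h \<bullet> b)) (at (t, q))" by (auto intro!: derivative_eq_intros)
  moreover have "(vm m has_derivative (%h. vd m (q \<bullet> b) * h)) (at (snd (t, q) \<bullet> b))"
   using vm_deriv[of m "q \<bullet> b"] by (simp add: has_field_derivative_def)
  ultimately have "((%z::real \<times> 'e. vm m (snd z \<bullet> b)) has_derivative (%h. vd m (q \<bullet> b) * (snd h \<bullet> b))) (at (t, q))"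
   by (rule has_derivative_compose)
  from has_derivative_add[OF has_derivative_const[of 1] has_derivative_mult[OF has_derivative_fst[OF has_derivative_ident] this]]
  have d2: "((%z::real \<times> 'e. 1 + fst z * vm m (snd z \<bullet> b)) has_derivative
    (%h. t * (vd m (q \<bullet> b) * (snd h \<bullet> b)) + fst h * vm m (q \<bullet> b))) (at (t, q))" by simp
  have "(f has_derivative (%h. ((snd h \<bullet> a) * P - (q \<bullet> a - s m a) * (t * (vd m (q \<bullet> b) * (snd h \<bullet> b)) + fst h * vm m (q \<bullet> b))) / (P * P))) (at (t, q))"
   using has_derivative_divide'[OF d1 d2] P unfolding f_def[abs_def] P_def by simp
  thus "(f has_derivative f' t) (at (t, \<phi> (t, p)))" unfolding f'_def[abs_def] Let_def q_def P_def .
  fix X assume X': "!!v. \<Omega> X v = - Df H (t, \<phi> (t, p)) (0, v)"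
  have Xab: "X \<bullet> a = (q \<bullet> a - s m a) * ((vm m (q \<bullet> b) * P - V m (q \<bullet> b) * (t * vd m (q \<bullet> b))) / P\<^sup>2)" "X \<bullet> b = - (V m (q \<bullet> b) / P)"
   using ham_components[OF X[OF t X']] \<kappa> by (simp_all add: Hd_def q_def P_def)
  have "(X \<bullet> a) * P - (q \<bullet> a - s m a) * (t * (vd m (q \<bullet> b) * (X \<bullet> b)) + vm m (q \<bullet> b)) = 0"
   unfolding Xab using P by (simp add: field_simps power2_eq_square)
  thus "f' t (1, X) = 0" by (simp add: f'_def Let_def flip: q_def P_def)
 qed
 thus "(\<phi> (i, p) \<bullet> a - s m a) / (1 + i * vm m (\<phi> (i, p) \<bullet> b)) = (\<phi> (j, p) \<bullet> a - s m a) / (1 + j * vm m (\<phi> (j, p) \<bullet> b))"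
  by (simp add: f_def)
qed

lemma Basis_minus_b: "Basis - {b} = insert a (Basis - {a, b})" using ab(1) a_neq_b by blast

lemma cell_bump_alt: "cell_bump m q = bump ((q \<bullet> a - s m a) / \<delta>) * (\<Prod>c\<in>Basis - {a, b}. bump ((q \<bullet> c - s m c) / \<delta>))"
 unfolding cell_bump_def Basis_minus_b by (subst prod.insert) auto

text \<open>The conservation laws hold only inside the cell, so the trajectory has to be trapped
  there: forwards from p if the right-hand side is nonzero, backwards from the end point if the
  left-hand side is. A ratio of at most \<delta> / 8 and a factor of at most 3/2 give a distance of
  at most \<delta> / 4, within the cell of half-width \<delta> / 2.\<close>

lemma cell_transport:
 assumes fl: "ham_flow \<Omega> H \<phi>" and sm: "smooth UNIV \<phi>" and m: "m \<in> M"
 shows "cell_term m (\<phi> (1, p)) = cell_bump m p"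
proof -
 define \<gamma> where "\<gamma> t = \<phi> (t, p)" for t
 define K where "K = {q. \<forall>c\<in>Basis - {b}. \<bar>q \<bullet> c - s m c\<bar> \<le> \<delta> / 4}"
 define R where "R t = (\<gamma> t \<bullet> a - s m a) / (1 + t * vm m (\<gamma> t \<bullet> b))" for t
 have \<gamma>0: "\<gamma> 0 = p" using fl by (simp add: \<gamma>_def ham_flow_def)
 have R01: "R 0 = p \<bullet> a - s m a" "R 1 = (\<gamma> 1 \<bullet> a - s m a) / (1 + vm m (\<gamma> 1 \<bullet> b))" by (simp_all add: R_def \<gamma>0)
 have \<gamma>c: "continuous_on {0..1} \<gamma>" unfolding \<gamma>_def by (rule continuous_on_compose2[OF smooth_cont[OF sm]]) (auto intro!: continuous_intros)
 have K: "closed K"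
 proof -
  have "K = (\<Inter>c\<in>Basis - {b}. {q. \<bar>q \<bullet> c - s m c\<bar> \<le> \<delta> / 4})" by (auto simp: K_def)
  thus ?thesis by (simp add: closed_INT closed_Collect_le continuous_intros)
 qed
 have KO: "K \<subseteq> cell m"
 proof
  fix q assume q: "q \<in> K"
  show "q \<in> cell m" unfolding cell_def
  proof (intro CollectI ballI)
   fix c assume "c \<in> Basis - {b}"
   hence "\<bar>q \<bullet> c - s m c\<bar> \<le> \<delta> / 4" using q unfolding K_def by blast
   thus "\<bar>q \<bullet> c - s m c\<bar> < \<delta> / 2" using \<delta>(1) by linarith
  qed
 qed
 have inK: "\<gamma> t \<in> K" if t: "t \<in> {0..1}" and Z: "!!c. c \<in> Basis - {a, b} ==> \<bar>\<gamma> t \<bullet> c - s m c\<bar> \<le> \<delta> / 8" and R: "\<bar>R t\<bar> \<le> \<delta> / 8" for t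
 proof -
  have P: "1/4 \<le> 1 + t * vm m (\<gamma> t \<bullet> b)" "1 + t * vm m (\<gamma> t \<bullet> b) \<le> 3/2" using vm_range[OF t] by auto
  have "\<gamma> t \<bullet> a - s m a = R t * (1 + t * vm m (\<gamma> t \<bullet> b))" using P by (simp add: R_def)
  also have "\<bar>...\<bar> \<le> (\<delta> / 8) * (3/2)" unfolding abs_mult using P R by (intro mult_mono) auto
  finally have "\<bar>\<gamma> t \<bullet> a - s m a\<bar> \<le> \<delta> / 4" using \<delta>(1) by linarith
  moreover have "\<bar>\<gamma> t \<bullet> c - s m c\<bar> \<le> \<delta> / 4" if "c \<in> Basis - {a, b}" for c using Z[OF that] \<delta>(1) by linarith
  ultimately show ?thesis unfolding K_def Basis_minus_b by blast
 qed
 have cZ: "\<gamma> i \<bullet> c = \<gamma> j \<bullet> c" if "{t0..t1} \<subseteq> {0..1}" "!!t. t \<in> {t0..t1} ==> \<gamma> t \<in> cell m" "i \<in> {t0..t1}" "j \<in> {t0..t1}" "c \<in> Basis - {a, b}" for t0 t1 i j c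
  using cell_conserved(1)[OF fl m that(1) _ that(3-5)] that(2) by (simp add: \<gamma>_def)
 have cR: "R i = R j" if "{t0..t1} \<subseteq> {0..1}" "!!t. t \<in> {t0..t1} ==> \<gamma> t \<in> cell m" "i \<in> {t0..t1}" "j \<in> {t0..t1}" for t0 t1 i j
  using cell_conserved(2)[OF fl m that(1) _ that(3-4)] that(2) by (simp add: \<gamma>_def R_def)
 have full: ?thesis if tr: "!!t. t \<in> {0..1} ==> \<gamma> t \<in> K"
 proof -
  have tc: "\<gamma> t \<in> cell m" if "t \<in> {0..1}" for t using tr[OF that] KO by blast
  have "R 1 = R 0" by (rule cR[OF order_refl tc]) auto
  hence "R 1 / \<delta> = R 0 / \<delta>" by (rule arg_cong)
  hence "(\<gamma> 1 \<bullet> a - s m a) / (\<delta> * (1 + vm m (\<gamma> 1 \<bullet> b))) = (p \<bullet> a - s m a) / \<delta>"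
   unfolding R01 divide_divide_eq_left by (simp only: mult.commute)
  moreover have "\<gamma> 1 \<bullet> c = p \<bullet> c" if "c \<in> Basis - {a, b}" for c using cZ[OF order_refl tc, of 1 0 c] that by (simp add: \<gamma>0)
  ultimately show ?thesis unfolding cell_bump_alt cell_term_def by (simp flip: \<gamma>_def)
 qed
 have prodZ: "\<bar>q \<bullet> c - s m c\<bar> \<le> \<delta> / 8" if "(\<Prod>c\<in>Basis - {a, b}. bump ((q \<bullet> c - s m c) / \<delta>)) ~= 0" "c \<in> Basis - {a, b}" for q c
 proof -
  have "bump ((q \<bullet> c - s m c) / \<delta>) ~= 0" using that by (simp add: prod_zero_iff)
  thus ?thesis by (rule bump_scaled[OF _ \<delta>(1)])
 qed
 consider "cell_bump m p ~= 0" | "cell_term m (\<phi> (1, p)) ~= 0" | "cell_term m (\<phi> (1, p)) = 0" "cell_bump m p = 0" by blast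
 thus ?thesis
 proof cases
  case 1
  have Z: "\<bar>\<gamma> 0 \<bullet> c - s m c\<bar> \<le> \<delta> / 8" if "c \<in> Basis - {a, b}" for c
   using prodZ[OF _ that, of p] 1 by (simp add: cell_bump_alt \<gamma>0)
  have R: "\<bar>R 0\<bar> \<le> \<delta> / 8" using 1 bump_scaled[OF _ \<delta>(1), of "R 0"] by (simp add: cell_bump_alt R01)
  show ?thesis
  proof (rule full, rule trapped_forward[OF \<gamma>c K open_cell KO])
   show "\<gamma> 0 \<in> K" by (rule inK[OF _ Z R]) auto
   fix t assume t: "t \<in> {0..1::real}" and tr: "!!r. r \<in> {0..t} ==> \<gamma> r \<in> cell m"
   have sub: "{0..t} \<subseteq> {0..1}" "0 \<in> {0..t}" "t \<in> {0..t}" using t by auto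
   show "\<gamma> t \<in> K"
   proof (rule inK[OF t])
    show "\<bar>\<gamma> t \<bullet> c - s m c\<bar> \<le> \<delta> / 8" if "c \<in> Basis - {a, b}" for c using Z[OF that] cZ[OF sub(1) tr sub(2,3) that] by simp
    show "\<bar>R t\<bar> \<le> \<delta> / 8" using R cR[OF sub(1) tr sub(2,3)] by simp
   qed
  qed
 next
  case 2
  have Z: "\<bar>\<gamma> 1 \<bullet> c - s m c\<bar> \<le> \<delta> / 8" if "c \<in> Basis - {a, b}" for c
   using prodZ[OF _ that, of "\<gamma> 1"] 2 by (simp add: cell_term_def \<gamma>_def)
  have "R 1 / \<delta> = (\<gamma> 1 \<bullet> a - s m a) / (\<delta> * (1 + vm m (\<gamma> 1 \<bullet> b)))" unfolding R01 divide_divide_eq_left by (simp only: mult.commute)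
  hence R: "\<bar>R 1\<bar> \<le> \<delta> / 8" using 2 bump_scaled[OF _ \<delta>(1), of "R 1"] by (simp add: cell_term_def flip: \<gamma>_def)
  show ?thesis
  proof (rule full, rule trapped_backward[OF \<gamma>c K open_cell KO])
   show "\<gamma> 1 \<in> K" by (rule inK[OF _ Z R]) auto
   fix t assume t: "t \<in> {0..1::real}" and tr: "!!r. r \<in> {t..1} ==> \<gamma> r \<in> cell m"
   have sub: "{t..1} \<subseteq> {0..1}" "1 \<in> {t..1}" "t \<in> {t..1}" using t by auto
   show "\<gamma> t \<in> K"
   proof (rule inK[OF t])
    show "\<bar>\<gamma> t \<bullet> c - s m c\<bar> \<le> \<delta> / 8" if "c \<in> Basis - {a, b}" for c using Z[OF that] cZ[OF sub(1) tr sub(2,3) that] by simp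
    show "\<bar>R t\<bar> \<le> \<delta> / 8" using R cR[OF sub(1) tr sub(2,3)] by simp
   qed
  qed
 qed simp
qed

text \<open>The sum of all cell bumps factorises into the form k(x) w(z) that
  \<open>shear_step\<close> produces. That lemma admits amplitude 1/4, whence the factor 4, and 16 n
  F is 4 times (2 n F + 2 n F).\<close>

lemma cell_step:
 "test_fun 3 (%q. \<Sum>m\<in>M. cell_term m q - cell_bump m q)"
 "n (%q. \<Sum>m\<in>M. cell_term m q - cell_bump m q) \<le> 16 * n F"
proof -
 define S where "S c q = (\<Sum>j\<in>J. bump (((q::'e) \<bullet> c - (\<tau> \<bullet> c + 2 * \<delta> * of_int j)) / \<delta>))" for c q
 define k where "k x = 1/4 * (\<Sum>j\<in>J. bump ((x - (\<tau> \<bullet> a + 2 * \<delta> * of_int j)) / \<delta>))" for x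
 define w where "w q = (\<Prod>c\<in>Basis - {a, b}. S c q)" for q
 have S01: "0 \<le> S c q" "S c q \<le> 1" for c q
 proof -
  show "0 \<le> S c q" unfolding S_def by (intro sum_nonneg bump_nonneg)
  have "(q \<bullet> c - (\<tau> \<bullet> c + 2 * \<delta> * of_int j)) / \<delta> = (q \<bullet> c - \<tau> \<bullet> c) / \<delta> - 2 * of_int j" for j
   using \<delta>(1) by (simp add: field_simps)
  thus "S c q \<le> 1" unfolding S_def using sum_bump_le_1[OF J, of "(q \<bullet> c - \<tau> \<bullet> c) / \<delta>"] by simp
 qed
 have kS: "k (q \<bullet> a) = 1/4 * S a q" for q by (simp add: k_def S_def)
 have k01: "0 \<le> k x" "k x \<le> 1/4" for x using S01[of a "x *\<^sub>R a"] kS[of "x *\<^sub>R a"] by simp_all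
 have w01: "0 \<le> w q" "w q \<le> 1" for q unfolding w_def using S01 by (intro prod_nonneg prod_le_1; simp)+
 have inv\<delta>: "x / \<delta> = x * inverse \<delta>" for x by (simp add: divide_inverse)
 have "\<exists>G. test_fun 3 G \<and> n G \<le> 2 * n F \<and> (\<forall>q\<in>cube 2. G q = k (q \<bullet> a) * w q)"
 proof (rule shear_step)
  show "smooth UNIV k" unfolding k_def[abs_def] inv\<delta> by (intro smooth_mult smooth_const smooth_sum smooth_bump smooth_diff smooth_id open_UNIV)
  show "smooth UNIV w" unfolding w_def[abs_def] S_def inv\<delta>
   by (intro smooth_mult smooth_const smooth_sum smooth_prod smooth_bump smooth_diff smooth_inner smooth_id open_UNIV)
  show "w (q + t *\<^sub>R a) = w q" "w (q + t *\<^sub>R b) = w q" for q t unfolding w_def S_def by (intro prod.cong refl; simp add: inner_add_left inner_other)+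
  show "\<bar>q \<bullet> c\<bar> \<le> 2" if "w q ~= 0" "c \<in> Basis - {a, b}" for q c
  proof -
   have "S c q ~= 0" using that unfolding w_def by (simp add: prod_zero_iff)
   then obtain j where j: "j \<in> J" "bump ((q \<bullet> c - (\<tau> \<bullet> c + 2 * \<delta> * of_int j)) / \<delta>) ~= 0"
    unfolding S_def by (rule sum.not_neutral_contains_not_neutral)
   have "\<bar>q \<bullet> c - (\<tau> \<bullet> c + 2 * \<delta> * of_int j)\<bar> \<le> \<delta> / 8" by (rule bump_scaled[OF j(2) \<delta>(1)])
   moreover have "\<bar>\<tau> \<bullet> c + 2 * \<delta> * of_int j\<bar> \<le> 1" using \<tau>[OF j(1), of c] that(2) by simp
   ultimately show ?thesis using \<delta> by linarith
  qed
  show "\<bar>k x * w q\<bar> \<le> 1/4" for x q using mult_mono[OF k01(2)[of x] w01(2)[of q]] k01(1)[of x] w01(1)[of q] by (simp add: abs_mult)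
 qed (rule w01)
 then obtain G where G: "test_fun 3 G" "n G \<le> 2 * n F" "!!q. q \<in> cube 2 ==> G q = k (q \<bullet> a) * w q" by blast
 have kw: "k (q \<bullet> a) * w q = 1/4 * (\<Sum>m\<in>M. cell_bump m q)" for q
 proof -
  have "S a q * w q = (\<Prod>c\<in>Basis - {b}. S c q)" unfolding w_def Basis_minus_b by (subst prod.insert) auto
  also have "... = (\<Sum>m\<in>M. cell_bump m q)" unfolding S_def M_def cell_bump_def s_def by (rule prod_sum_PiE) (use J in auto)
  finally show ?thesis by (simp add: kS)
 qed
 have c23: "q \<notin> cube 2" if "q \<notin> cube 3" for q :: 'e using that cube_mono[of 2 3] by auto
 obtain \<phi> \<psi> where \<phi>: "ham_flow \<Omega> H \<phi>" "smooth UNIV \<phi>" "smooth UNIV \<psi>"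
  "!!q. \<psi> (\<phi> (1, q)) = q" "!!q. \<phi> (1, \<psi> q) = q"
  "!!t q. t \<in> {0..1} ==> q \<notin> cube 2 ==> \<phi> (t, q) = q" "!!t q. t \<in> {0..1} ==> q \<in> cube 2 ==> \<phi> (t, q) \<in> cube 2"
  "!!q u v. \<Omega> (Df (%q. \<phi> (1, q)) q u) (Df (%q. \<phi> (1, q)) q v) = \<Omega> u v"
  by (rule ham_flow_exists[OF \<Omega>(1,2) H_smooth compact_cube H_zero]) (assumption | rule that)+
 have out: "\<psi> q = q" if "q \<notin> cube 2" for q using \<phi>(6)[of 1 q] that \<phi>(4)[of q] by simp
 have ins: "\<psi> q \<in> cube 2" if "q \<in> cube 2" for q using \<phi>(6)[of 1 "\<psi> q"] \<phi>(5)[of q] that by fastforce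
 have transport: "cell_term m q = cell_bump m (\<psi> q)" if "m \<in> M" for m q using cell_transport[OF \<phi>(1,2) that, of "\<psi> q"] by (simp add: \<phi>(5))
 have tG: "test_fun 3 (%q. G (\<psi> q))" unfolding test_fun_def using test_funD[OF G(1)] out c23 by (auto intro: smooth_comp \<phi>(3))
 have tD: "test_fun 3 (%q. G (\<psi> q) - G q)" by (rule test_fun_diff[OF tG G(1)])
 have "n (%q. G (\<psi> q) - G q) \<le> n (%q. G (\<psi> q)) + n G" by (rule n_diff[OF tG G(1)])
 also have "n (%q. G (\<psi> q)) = n G"
 proof (rule n_inv[OF _ G(1)])
  have "\<phi> (t, q) \<in> cube 3" if "t \<in> {0..1}" "q \<in> cube 3" for t q using \<phi>(6,7)[OF that(1), of q] that(2) c23 by metis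
  thus "ham_iso \<Omega> H \<phi> \<psi>" unfolding ham_iso_def using H_smooth H_zero c23 \<phi> by (intro conjI allI impI ballI) simp_all
 qed
 finally have nD: "n (%q. G (\<psi> q) - G q) \<le> 4 * n F" using G(2) by simp
 \<comment> \<open>G is the sum of bumps only on \<open>cube 2\<close>. Outside, \<psi> is the
   identity and both sides vanish.\<close>
 have eq: "(%q. \<Sum>m\<in>M. cell_term m q - cell_bump m q) = (%q. 4 * (G (\<psi> q) - G q))"
 proof
  fix q show "(\<Sum>m\<in>M. cell_term m q - cell_bump m q) = 4 * (G (\<psi> q) - G q)"
  proof (cases "q \<in> cube 2")
   case True
   thus ?thesis using G(3)[OF True] G(3)[OF ins[OF True]] kw[of q] kw[of "\<psi> q"] transport by (simp add: sum_subtractf algebra_simps)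
  next
   case False
   thus ?thesis using transport by (simp add: out)
  qed
 qed
 show "test_fun 3 (%q. \<Sum>m\<in>M. cell_term m q - cell_bump m q)" unfolding eq by (rule test_fun_scale[OF tD])
 show "n (%q. \<Sum>m\<in>M. cell_term m q - cell_bump m q) \<le> 16 * n F" unfolding eq using n_scale[OF tD, of 4] nD by simp
qed

end

section \<open>Averaging over the offset of the lattice\<close>

lemma has_integral_UNIV_affine:
 fixes f :: "'a::euclidean_space => 'b::banach"
 assumes f: "(f has_integral i) (cbox A B)" and m: "m ~= 0" and z: "!!x. x \<notin> cbox A B ==> f x = 0"
 shows "((%x. f (m *\<^sub>R x + c)) has_integral (1 / \<bar>m\<bar> ^ DIM('a)) *\<^sub>R i) UNIV"
proof (rule has_integral_on_superset[OF has_integral_affinity[OF f m]])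
 fix x assume x: "x \<notin> (%x. (1 / m) *\<^sub>R x + - ((1 / m) *\<^sub>R c)) ` cbox A B"
 have "x = (1 / m) *\<^sub>R (m *\<^sub>R x + c) + - ((1 / m) *\<^sub>R c)" using m by (simp add: scaleR_add_right)
 hence "m *\<^sub>R x + c \<notin> cbox A B" using x by blast
 thus "f (m *\<^sub>R x + c) = 0" by (rule z)
qed simp

lemma test_fun_zero_inner: "test_fun 1 v ==> v q ~= 0 ==> c \<in> Basis ==> \<bar>q \<bullet> c\<bar> \<le> 1" by (auto simp: test_fun_def cube_def)

text \<open>The right end point y = 2 L + 1 is special: rounding gives L + 1 there, and L serves
  instead.\<close>

lemma nearest_even:
 fixes y :: real
 assumes "\<bar>y\<bar> \<le> 2 * of_int L + 1"
 obtains j where "- L \<le> j" "j \<le> L" "\<bar>y - 2 * of_int j\<bar> \<le> 1"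
proof -
 define k where "k = \<lfloor>(y + 1) / 2\<rfloor>"
 have k: "of_int k \<le> (y + 1) / 2" "(y + 1) / 2 < of_int k + 1" unfolding k_def by linarith+
 have y: "- (2 * of_int L + 1) \<le> y" "y \<le> 2 * of_int L + 1" using assms by (simp_all add: abs_le_iff)
 show thesis
 proof (cases "k \<le> L")
  case True
  have "of_int (- L) < (of_int (k + 1) :: real)" using k y by simp
  hence "- L \<le> k" unfolding of_int_less_iff by simp
  moreover have "\<bar>y - 2 * of_int k\<bar> \<le> 1" using k unfolding abs_le_iff by (simp add: field_simps)
  ultimately show thesis using that True by blast
 next
  case False
  hence "of_int (L + 1) \<le> (of_int k :: real)" unfolding of_int_le_iff by simp
  hence "y = 2 * of_int L + 1" "(-1 :: real) < of_int L" using k y by (simp_all add: field_simps)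
  moreover from this(2) have "0 \<le> L" by linarith
  ultimately show thesis using that[of L] by simp
 qed
qed

context inv_seminorm_pair
begin

text \<open>\<open>cell_kern v \<delta> q l\<close> is the contribution at q of the cell with centre l to the change of the bumps, in coordinates rescaled by
\<open>\<delta>\<close> about q. The dummy factor \<open>bump (\<xi> \<bullet> b)\<close> lets the offset of the lattice range over a full cube.\<close>

definition wbump :: "'e => real" where
 "wbump \<xi> = bump (\<xi> \<bullet> b) * (\<Prod>c\<in>Basis - {a, b}. bump (\<xi> \<bullet> c))"
definition kern :: "('e => real) => 'e => real => 'e => real" where
 "kern v q \<delta> \<xi> = wbump \<xi> * (bump ((\<xi> \<bullet> a) / (1 + v (q - \<delta> *\<^sub>R (\<xi> - (\<xi> \<bullet> b) *\<^sub>R b)))) - bump (\<xi> \<bullet> a))"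
definition cell_kern :: "('e => real) => real => 'e => 'e => real" where
 "cell_kern v \<delta> q l = kern v q \<delta> ((- 1 / \<delta>) *\<^sub>R l + (1 / \<delta>) *\<^sub>R (q - (q \<bullet> b) *\<^sub>R b))"
definition bump_const :: real where "bump_const = integral (cube 1) (%\<xi>. wbump \<xi> * bump (\<xi> \<bullet> a))"

lemma smooth_wbump: "smooth U f ==> smooth U (%x. wbump (f x))"
 unfolding wbump_def by (intro smooth_mult smooth_prod smooth_bump smooth_inner smooth_const smooth_open)

lemma smooth_kern:
 assumes v: "test_fun 1 v" "!!q. \<bar>v q\<bar> \<le> 1/2"
  and s: "smooth U f" "smooth U d" "smooth U g"
 shows "smooth U (%x. kern v (f x) (d x) (g x))" unfolding kern_def
proof (intro smooth_mult smooth_diff smooth_bump smooth_wbump smooth_divide smooth_add smooth_comp[OF test_funD(1)[OF v(1)]] smooth_scaleR smooth_inner smooth_const s smooth_open[OF s(1)])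
 fix x
 show "1 + v (f x - d x *\<^sub>R (g x - (g x \<bullet> b) *\<^sub>R b)) ~= 0" using v(2)[of "f x - d x *\<^sub>R (g x - (g x \<bullet> b) *\<^sub>R b)"] by linarith
qed

lemma smooth_cell_kern:
 assumes "test_fun 1 v" "!!q. \<bar>v q\<bar> \<le> 1/2" "smooth U f" "smooth U g"
 shows "smooth U (%x. cell_kern v \<delta> (f x) (g x))" unfolding cell_kern_def
 by (intro smooth_kern assms smooth_add smooth_diff smooth_scaleR smooth_inner smooth_const smooth_open[OF assms(3)])

lemma wbump_nonzero:
 assumes "wbump \<xi> ~= 0" "c \<in> Basis - {a}" shows "\<bar>\<xi> \<bullet> c\<bar> \<le> 1/8"
proof -
 have "bump (\<xi> \<bullet> b) ~= 0" "(\<Prod>c\<in>Basis - {a, b}. bump (\<xi> \<bullet> c)) ~= 0" using assms(1) by (auto simp: wbump_def)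
 hence "bump (\<xi> \<bullet> c) ~= 0" using assms(2) by (cases "c = b") (simp_all add: prod_zero_iff)
 thus ?thesis by (rule bump_nonzero)
qed

lemma kern_nonzero:
 assumes v: "!!q. \<bar>v q\<bar> \<le> 1/2" and k: "kern v q \<delta> \<xi> ~= 0" and c: "c \<in> Basis"
 shows "\<bar>\<xi> \<bullet> c\<bar> \<le> 1/4"
proof (cases "c = a")
 case False
 thus ?thesis using wbump_nonzero[of \<xi> c] k c by (auto simp: kern_def)
next
 case True
 define P where "P = 1 + v (q - \<delta> *\<^sub>R (\<xi> - (\<xi> \<bullet> b) *\<^sub>R b))"
 have P: "1/2 \<le> P" "P \<le> 3/2" unfolding P_def using v[of "q - \<delta> *\<^sub>R (\<xi> - (\<xi> \<bullet> b) *\<^sub>R b)"] by linarith+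
 have "bump ((\<xi> \<bullet> a) / P) ~= 0 \<or> bump (\<xi> \<bullet> a) ~= 0" using k by (auto simp: kern_def P_def)
 thus ?thesis
 proof
  assume "bump ((\<xi> \<bullet> a) / P) ~= 0"
  from bump_nonzero[OF this] have "\<bar>\<xi> \<bullet> a\<bar> \<le> P / 8" using P by (simp add: abs_divide divide_le_eq)
  thus ?thesis using P unfolding True by linarith
 next
  assume "bump (\<xi> \<bullet> a) ~= 0"
  from bump_nonzero[OF this] show ?thesis unfolding True by linarith
 qed
qed

lemma kern_outside: "(!!q. \<bar>v q\<bar> \<le> 1/2) ==> \<xi> \<notin> cube 1 ==> kern v q \<delta> \<xi> = 0"
proof (rule ccontr)
 assume v: "!!q. \<bar>v q\<bar> \<le> 1/2" and \<xi>: "\<xi> \<notin> cube 1" and k: "kern v q \<delta> \<xi> ~= 0"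
 have "\<bar>\<xi> \<bullet> c\<bar> \<le> 1" if "c \<in> Basis" for c using kern_nonzero[OF v k that] by linarith
 thus False using \<xi> by (simp add: cube_def)
qed

text \<open>Undoes the rescaling: up to the dummy factor in the b-direction, what remains is
  \<open>cell_term\<close> minus \<open>cell_bump\<close> for the cell with centre l.\<close>

lemma cell_kern_alt:
 assumes \<delta>: "\<delta> > 0"
 shows "cell_kern v \<delta> q l = bump (- (l \<bullet> b) / \<delta>) * ((\<Prod>c\<in>Basis - {a, b}. bump ((q \<bullet> c - l \<bullet> c) / \<delta>)) *
  (bump ((q \<bullet> a - l \<bullet> a) / \<delta> / (1 + v (l + (q \<bullet> b - l \<bullet> b) *\<^sub>R b))) - bump ((q \<bullet> a - l \<bullet> a) / \<delta>)))"
proof -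
 define \<xi> where "\<xi> = (- 1 / \<delta>) *\<^sub>R l + (1 / \<delta>) *\<^sub>R (q - (q \<bullet> b) *\<^sub>R b)"
 have b: "\<xi> \<bullet> b = - (l \<bullet> b) / \<delta>" by (simp add: \<xi>_def inner_add_left inner_diff_left)
 have a: "\<xi> \<bullet> a = (q \<bullet> a - l \<bullet> a) / \<delta>" by (simp add: \<xi>_def inner_add_left inner_diff_left diff_divide_distrib)
 have c: "\<xi> \<bullet> c = (q \<bullet> c - l \<bullet> c) / \<delta>" if "c \<in> Basis - {a, b}" for c
  using inner_other[OF that] by (simp add: \<xi>_def inner_add_left inner_diff_left diff_divide_distrib)
 have "\<delta> *\<^sub>R \<xi> = (q - (q \<bullet> b) *\<^sub>R b) - l" using \<delta> by (simp add: \<xi>_def scaleR_diff_right scaleR_add_right)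
 moreover have "(\<delta> * (\<xi> \<bullet> b)) *\<^sub>R b = - (l \<bullet> b) *\<^sub>R b" using \<delta> by (simp add: b)
 ultimately have "q - \<delta> *\<^sub>R (\<xi> - (\<xi> \<bullet> b) *\<^sub>R b) = l + (q \<bullet> b - l \<bullet> b) *\<^sub>R b"
  by (simp add: scaleR_diff_right algebra_simps)
 thus ?thesis unfolding cell_kern_def \<xi>_def[symmetric] kern_def wbump_def a b using c by (simp add: mult.assoc)
qed

lemma cell_kern_nonzero:
 assumes v: "test_fun 1 v" and \<delta>: "\<delta> > 0" and k: "cell_kern v \<delta> q l ~= 0"
 shows "\<bar>l \<bullet> b\<bar> \<le> \<delta>" "c \<in> Basis - {b} ==> \<bar>l \<bullet> c\<bar> \<le> 1"
proof -
 have "bump (- (l \<bullet> b) / \<delta>) ~= 0" using k unfolding cell_kern_alt[OF \<delta>] by auto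
 from bump_scaled[OF this \<delta>] show "\<bar>l \<bullet> b\<bar> \<le> \<delta>" using \<delta> by simp
 assume c: "c \<in> Basis - {b}"
 have "v (l + (q \<bullet> b - l \<bullet> b) *\<^sub>R b) ~= 0" using k unfolding cell_kern_alt[OF \<delta>] by auto
 from test_fun_zero_inner[OF v this, of c] show "\<bar>l \<bullet> c\<bar> \<le> 1" using c ab(2) by (auto simp: inner_add_left inner_Basis split: if_splits)
qed

definition shift :: "real => ('e => int) => 'e" where
 "shift \<delta> m = (\<Sum>c\<in>Basis - {b}. (2 * \<delta> * of_int (m c)) *\<^sub>R c)"

lemma shift_inner: "c \<in> Basis - {b} ==> shift \<delta> m \<bullet> c = 2 * \<delta> * of_int (m c)" "shift \<delta> m \<bullet> b = 0"
 unfolding shift_def using ab(2) by (auto simp: inner_sum_left inner_Basis if_distrib[of "(*) _"] cong: if_cong)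

text \<open>With \<delta> = 1 / (2 L + 1) the intervals of length 2 \<delta> around the points of
  the lattice fill [-1, 1] exactly. Hence every offset in \<open>cube \<delta>\<close> keeps the
  centres within [-1, 1], as \<open>inv_cells\<close> demands.\<close>

lemma averaged_cells:
 assumes v: "test_fun 1 v" "!!q. \<bar>v q\<bar> \<le> 1/2" and v_int: "!!q. q \<bullet> b = 0 ==> integral {-1..1} (%y. v (q + y *\<^sub>R b)) = 0"
  and L: "L \<ge> 0" and \<delta>: "\<delta> = 1 / (2 * of_int L + 1)"
  and M: "M = PiE (Basis - {b}) (%_. {- L..L})"
 shows "test_fun 3 (%q. integral (cube \<delta>) (%\<tau>. \<Sum>m\<in>M. cell_kern v \<delta> q (\<tau> + shift \<delta> m)))"
  and "n (%q. integral (cube \<delta>) (%\<tau>. \<Sum>m\<in>M. cell_kern v \<delta> q (\<tau> + shift \<delta> m))) \<le> (2 * \<delta>) ^ DIM('e) * (16 * n F)"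
proof -
 have \<delta>0: "0 < \<delta>" "\<delta> \<le> 1" and \<delta>L: "\<delta> * (2 * of_int L + 1) = 1" using L by (auto simp: \<delta> field_simps)
 have cells: "inv_cells \<Omega> n W C0 a b v \<delta> {- L..L} \<tau>" if \<tau>: "\<tau> \<in> cube \<delta>" for \<tau>
 proof (unfold_locales)
  fix j and c :: 'e assume j: "j \<in> {- L..L}" and c: "c \<in> Basis"
  have "\<bar>\<tau> \<bullet> c\<bar> \<le> \<delta>" using \<tau> c by (simp add: cube_def)
  moreover have "\<delta> * \<bar>of_int j\<bar> \<le> \<delta> * of_int L"
  proof (rule mult_left_mono)
   have "\<bar>j\<bar> \<le> L" using j by auto
   thus "\<bar>real_of_int j\<bar> \<le> of_int L" by linarith
  qed (use \<delta>0 in simp)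
  moreover have "\<bar>2 * \<delta> * of_int j\<bar> = 2 * (\<delta> * \<bar>of_int j\<bar>)" using \<delta>0 by (simp add: abs_mult)
  ultimately show "\<bar>\<tau> \<bullet> c + 2 * \<delta> * of_int j\<bar> \<le> 1"
   using \<delta>L abs_triangle_ineq[of "\<tau> \<bullet> c" "2 * \<delta> * of_int j"] by (simp add: algebra_simps)
 qed (use v v_int \<delta>0 in auto)
 define g where "g z = (\<Sum>m\<in>M. cell_kern v \<delta> (fst z) (snd z + shift \<delta> m))" for z
 have gs: "smooth UNIV g" unfolding g_def[abs_def] by (intro smooth_sum smooth_cell_kern v smooth_add smooth_fst smooth_snd smooth_id smooth_const open_UNIV)
 have geq: "(%q. g (q, \<tau>)) = (%q. bump (- (\<tau> \<bullet> b) / \<delta>) * (\<Sum>m\<in>M. inv_cells.cell_term a b v \<delta> \<tau> m q - inv_cells.cell_bump b \<delta> \<tau> m q))"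
  if \<tau>: "\<tau> \<in> cube \<delta>" for \<tau>
 proof
  fix q
  interpret inv_cells \<Omega> n W C0 a b v \<delta> "{- L..L}" \<tau> by (rule cells[OF \<tau>])
  have "cell_kern v \<delta> q (\<tau> + shift \<delta> m) = bump (- (\<tau> \<bullet> b) / \<delta>) * (cell_term m q - cell_bump m q)" for m
  proof -
   have sc: "(\<tau> + shift \<delta> m) \<bullet> c = s m c" if "c \<in> Basis - {b}" for c using shift_inner(1)[OF that] by (simp add: inner_add_left s_def)
   have sb: "(\<tau> + shift \<delta> m) \<bullet> b = \<tau> \<bullet> b" by (simp add: inner_add_left shift_inner)
   have "\<tau> + shift \<delta> m + (q \<bullet> b - \<tau> \<bullet> b) *\<^sub>R b = (\<Sum>c\<in>Basis - {b}. s m c *\<^sub>R c) + (q \<bullet> b) *\<^sub>R b"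
   proof (rule euclidean_eqI)
    fix c :: 'e assume c: "c \<in> Basis"
    show "(\<tau> + shift \<delta> m + (q \<bullet> b - \<tau> \<bullet> b) *\<^sub>R b) \<bullet> c = ((\<Sum>c\<in>Basis - {b}. s m c *\<^sub>R c) + (q \<bullet> b) *\<^sub>R b) \<bullet> c"
    proof (cases "c = b")
     case True
     have "(\<Sum>c\<in>Basis - {b}. s m c *\<^sub>R c) \<bullet> b = 0" using ab(2) by (simp add: inner_sum_left inner_Basis)
     thus ?thesis using True by (simp add: inner_add_left shift_inner)
    next
     case False
     have "(\<Sum>c\<in>Basis - {b}. s m c *\<^sub>R c) \<bullet> c = (\<Sum>c'\<in>Basis - {b}. if c' = c then s m c' else 0)"
      unfolding inner_sum_left using c by (intro sum.cong) (auto simp: inner_Basis)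
     also have "... = s m c" using c False by simp
     finally have "(\<Sum>c\<in>Basis - {b}. s m c *\<^sub>R c) \<bullet> c = s m c" .
     moreover have "b \<bullet> c = 0" using False c ab(2) by (simp add: inner_Basis)
     ultimately show ?thesis using sc[of c] c False by (simp add: inner_add_left)
    qed
   qed
   hence vv: "v (\<tau> + shift \<delta> m + (q \<bullet> b - \<tau> \<bullet> b) *\<^sub>R b) = vm m (q \<bullet> b)" by (simp add: vm_def)
   have "(\<Prod>c\<in>Basis - {a, b}. bump ((q \<bullet> c - (\<tau> + shift \<delta> m) \<bullet> c) / \<delta>)) = (\<Prod>c\<in>Basis - {a, b}. bump ((q \<bullet> c - s m c) / \<delta>))"
    by (rule prod.cong) (use sc in auto)
   moreover have "(\<tau> + shift \<delta> m) \<bullet> a = s m a" by (rule sc) (use ab(1) a_neq_b in auto)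
   ultimately show ?thesis unfolding cell_kern_alt[OF \<delta>0(1)] cell_term_def cell_bump_alt sb vv by (simp add: divide_divide_eq_left algebra_simps)
  qed
  thus "g (q, \<tau>) = bump (- (\<tau> \<bullet> b) / \<delta>) * (\<Sum>m\<in>M. cell_term m q - cell_bump m q)" by (simp add: g_def sum_distrib_left)
 qed
 have gt: "test_fun 3 (%q. g (q, \<tau>))" and gn: "n (%q. g (q, \<tau>)) \<le> 16 * n F" if \<tau>: "\<tau> \<in> cube \<delta>" for \<tau>
 proof -
  interpret ic: inv_cells \<Omega> n W C0 a b v \<delta> "{- L..L}" \<tau> by (rule cells[OF \<tau>])
  have M': "M = ic.M" by (simp add: M ic.M_def)
  show "test_fun 3 (%q. g (q, \<tau>))" unfolding geq[OF \<tau>] M' by (rule test_fun_scale[OF ic.cell_step(1)])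
  have "n (%q. g (q, \<tau>)) = bump (- (\<tau> \<bullet> b) / \<delta>) * n (%q. \<Sum>m\<in>M. ic.cell_term m q - ic.cell_bump m q)"
   unfolding geq[OF \<tau>] M' using n_scale[OF ic.cell_step(1)] bump_nonneg[of "- (\<tau> \<bullet> b) / \<delta>"] by simp
  also have "... \<le> 1 * (16 * n F)" unfolding M' by (rule mult_mono[OF _ ic.cell_step(2) _ n_nonneg[OF ic.cell_step(1)]]) (auto simp: bump_def cut_le_1)
  finally show "n (%q. g (q, \<tau>)) \<le> 16 * n F" by simp
 qed
 have gI: "(%\<tau>. \<Sum>m\<in>M. cell_kern v \<delta> q (\<tau> + shift \<delta> m)) = (%\<tau>. g (q, \<tau>))" for q by (simp add: g_def)
 show "test_fun 3 (%q. integral (cube \<delta>) (%\<tau>. \<Sum>m\<in>M. cell_kern v \<delta> q (\<tau> + shift \<delta> m)))"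
  unfolding gI cube_cbox by (rule n_average(1)[OF gs, where C="16 * n F"]) (use gt gn in \<open>auto simp: cube_cbox\<close>)
 have "measure lborel (cube \<delta> :: 'e set) = (2 * \<delta>) ^ DIM('e)" unfolding cube_cbox using \<delta>0 by (subst content_cbox) auto
 thus "n (%q. integral (cube \<delta>) (%\<tau>. \<Sum>m\<in>M. cell_kern v \<delta> q (\<tau> + shift \<delta> m))) \<le> (2 * \<delta>) ^ DIM('e) * (16 * n F)"
  using n_average(2)[OF gs, of "- \<delta> *\<^sub>R One" "\<delta> *\<^sub>R One" "16 * n F"] gt gn unfolding gI cube_cbox by simp
qed

end

lemma uniform_slice_limit:
 fixes \<Gamma> :: "'e::euclidean_space \<times> real => real"
 assumes \<Gamma>: "smooth UNIV \<Gamma>" and W: "finite W" and e: "e > 0" and K: "compact K"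
 shows "\<exists>\<eta>>0. \<forall>ws\<in>W. \<forall>q\<in>K. \<forall>d. 0 \<le> d \<and> d < \<eta> \<and> d \<le> 1 --> \<bar>iter_deriv ws (%q. \<Gamma> (q, 0)) q - iter_deriv ws (%q. \<Gamma> (q, d)) q\<bar> \<le> e"
proof -
 define h where "h ws z = iter_deriv (map (%v. (v, 0)) ws) \<Gamma> z" for ws z
 have hc: "continuous_on S (h ws)" for ws S unfolding h_def by (rule continuous_on_subset[OF smooth_cont[OF smooth_iter_deriv[OF \<Gamma>]]]) simp
 have slice: "iter_deriv ws (%q. \<Gamma> (q, d)) q = h ws (q, d)" for ws d q using iter_deriv_affine[OF \<Gamma>, of "%q. (q, 0)" ws "(0, d)" q]
  by (simp add: h_def bounded_linear_Pair bounded_linear_ident bounded_linear_zero)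
 have "\<exists>\<eta>>0. \<forall>q\<in>K. \<forall>d. 0 \<le> d \<and> d < \<eta> \<and> d \<le> 1 --> \<bar>h ws (q, 0) - h ws (q, d)\<bar> < e" for ws
 proof -
  have "uniformly_continuous_on (K \<times> {0..1}) (h ws)" by (intro compact_uniformly_continuous compact_Times K compact_Icc hc)
  then obtain \<eta> where \<eta>: "\<eta> > 0" "!!z z'. z \<in> K \<times> {0..1} ==> z' \<in> K \<times> {0..1} ==> dist z' z < \<eta> ==> dist (h ws z') (h ws z) < e"
   using e unfolding uniformly_continuous_on_def by metis
  show ?thesis
  proof (intro exI[of _ \<eta>] conjI ballI allI impI \<eta>(1))
   fix q :: 'e and d :: real assume "q \<in> K" "0 \<le> d \<and> d < \<eta> \<and> d \<le> 1"
   thus "\<bar>h ws (q, 0) - h ws (q, d)\<bar> < e" using \<eta>(2)[of "(q, d)" "(q, 0)"] by (simp add: dist_Pair_Pair dist_real_def)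
  qed
 qed
 then obtain \<eta> where \<eta>: "!!ws. \<eta> ws > 0"
  "!!ws q d. q \<in> K ==> 0 \<le> d \<and> d < \<eta> ws \<and> d \<le> 1 ==> \<bar>h ws (q, 0) - h ws (q, d)\<bar> < e" by metis
 define \<eta>0 where "\<eta>0 = Min (insert 1 (\<eta> ` W))"
 have \<eta>0: "\<eta>0 > 0" "!!ws. ws \<in> W ==> \<eta>0 \<le> \<eta> ws" using W \<eta>(1) by (auto simp: \<eta>0_def)
 show ?thesis
 proof (intro exI[of _ \<eta>0] conjI ballI allI impI \<eta>0(1))
  fix ws q d assume "ws \<in> W" "q \<in> K" and d: "0 \<le> d \<and> d < \<eta>0 \<and> d \<le> 1"
  hence "\<bar>h ws (q, 0) - h ws (q, d)\<bar> < e" using \<eta>0(2)[of ws] by (intro \<eta>(2)) auto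
  thus "\<bar>iter_deriv ws (%q. \<Gamma> (q, 0)) q - iter_deriv ws (%q. \<Gamma> (q, d)) q\<bar> \<le> e" by (simp add: slice)
 qed
qed

context inv_seminorm_pair
begin

lemma cube_shift: "(%x. x + d) ` cbox (- r *\<^sub>R One) (r *\<^sub>R One :: 'e) = {x. \<forall>c\<in>Basis. \<bar>x \<bullet> c - d \<bullet> c\<bar> \<le> r}"
proof -
 have "x \<in> (%x. x + d) ` cube r \<longleftrightarrow> (\<forall>c\<in>Basis. \<bar>x \<bullet> c - d \<bullet> c\<bar> \<le> r)" for x
 proof -
  have "x \<in> (%x. x + d) ` cube r \<longleftrightarrow> x - d \<in> cube r" by (auto simp: image_iff intro: bexI[of _ "x - d"])
  thus ?thesis by (simp add: cube_def inner_diff_left)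
 qed
 thus ?thesis unfolding cube_cbox by blast
qed

text \<open>Summing over the lattice and integrating over the offset amounts to integrating over all
  centres l, because the translates of \<open>cube \<delta>\<close> tile the region where the kernel
  is nonzero. The substitution that rescales by 1 / \<delta> about q then gives the Jacobian factor
  and a kernel in which \<delta> is a smooth parameter.\<close>

lemma unfold_cells:
 assumes v: "test_fun 1 v" "!!q. \<bar>v q\<bar> \<le> 1/2" and L: "L \<ge> 0" and \<delta>: "\<delta> = 1 / (2 * of_int L + 1)"
  and M: "M = PiE (Basis - {b}) (%_. {- L..L})"
 shows "integral (cube \<delta>) (%\<tau>. \<Sum>m\<in>M. cell_kern v \<delta> q (\<tau> + shift \<delta> m)) = \<delta> ^ DIM('e) * integral (cube 1) (kern v q \<delta>)"
proof -
 have \<delta>0: "0 < \<delta>" and \<delta>L: "\<delta> * (2 * of_int L + 1) = 1" using L by (auto simp: \<delta> field_simps)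
 define f where "f l = cell_kern v \<delta> q l" for l
 have fs: "smooth UNIV f" unfolding f_def[abs_def] by (intro smooth_cell_kern v smooth_const smooth_id open_UNIV)
 have fc: "continuous_on S f" for S by (rule continuous_on_subset[OF smooth_cont[OF fs]]) simp
 have fi: "(%\<tau>. f (\<tau> + d)) integrable_on cbox A B" for d A B by (intro integrable_continuous continuous_on_compose2[OF fc[of UNIV]] continuous_intros) auto
 define T where "T m = (%x. x + shift \<delta> m) ` cbox (- \<delta> *\<^sub>R One) (\<delta> *\<^sub>R One)" for m
 have T: "T m = {x. \<forall>c\<in>Basis. \<bar>x \<bullet> c - shift \<delta> m \<bullet> c\<bar> \<le> \<delta>}" for m unfolding T_def by (rule cube_shift)
 have fin: "finite M" unfolding M by (intro finite_PiE) auto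
 have hT: "(f has_integral integral (cube \<delta>) (%\<tau>. f (\<tau> + shift \<delta> m))) (T m)" for m
 proof -
  have "((%\<tau>. f (\<tau> + shift \<delta> m)) has_integral integral (cube \<delta>) (%\<tau>. f (\<tau> + shift \<delta> m))) (cbox (- \<delta> *\<^sub>R One) (\<delta> *\<^sub>R One))"
   using integrable_integral[OF fi] by (simp only: cube_cbox)
  from has_integral_affinity[OF this, of 1 "- shift \<delta> m"] show ?thesis by (simp add: T_def)
 qed
 \<comment> \<open>Two different tiles meet at most in the hyperplane midway between their
   centres.\<close>
 have "pairwise (%i i'. negligible (T i \<inter> T i')) M"
 proof (rule pairwiseI)
  fix i i' assume i: "i \<in> M" "i' \<in> M" "i ~= i'"
  then obtain c where c: "c \<in> Basis - {b}" "i c ~= i' c" using PiE_ext[of i "Basis - {b}" "%_. {- L..L}" i'] unfolding M by metis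
  have "T i \<inter> T i' \<subseteq> {x. x \<bullet> c = \<delta> * of_int (i c + i' c)}"
  proof
   fix x assume x: "x \<in> T i \<inter> T i'"
   hence "\<bar>x \<bullet> c - 2 * \<delta> * of_int (i c)\<bar> \<le> \<delta>" "\<bar>x \<bullet> c - 2 * \<delta> * of_int (i' c)\<bar> \<le> \<delta>"
    using c shift_inner(1)[OF c(1)] by (auto simp: T)
   moreover have "\<bar>x \<bullet> c - 2 * \<delta> * of_int j\<bar> = \<delta> * \<bar>x \<bullet> c / \<delta> - 2 * of_int j\<bar>" for j
    using \<delta>0 by (simp add: abs_mult_pos'[symmetric] field_simps)
   ultimately have "\<bar>x \<bullet> c / \<delta> - 2 * of_int (i c)\<bar> \<le> 1" "\<bar>x \<bullet> c / \<delta> - 2 * of_int (i' c)\<bar> \<le> 1" using \<delta>0 by simp_all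
   moreover have "of_int (i c) + 1 \<le> (of_int (i' c) :: real) \<or> of_int (i' c) + 1 \<le> (of_int (i c) :: real)" using c(2) by linarith
   ultimately have "x \<bullet> c / \<delta> = of_int (i c) + of_int (i' c)" by linarith
   thus "x \<in> {x. x \<bullet> c = \<delta> * of_int (i c + i' c)}" using \<delta>0 by (simp add: field_simps)
  qed
  thus "negligible (T i \<inter> T i')" using negligible_standard_hyperplane[of c] c(1) negligible_subset by blast
 qed
 from has_integral_UN[OF fin hT this]
 have "(f has_integral (\<Sum>m\<in>M. integral (cube \<delta>) (%\<tau>. f (\<tau> + shift \<delta> m)))) (\<Union>m\<in>M. T m)" .
 moreover have "(\<Sum>m\<in>M. integral (cube \<delta>) (%\<tau>. f (\<tau> + shift \<delta> m))) = integral (cube \<delta>) (%\<tau>. \<Sum>m\<in>M. f (\<tau> + shift \<delta> m))"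
  unfolding cube_cbox by (rule Henstock_Kurzweil_Integration.integral_sum[symmetric, OF fin fi])
 ultimately have "(f has_integral integral (cube \<delta>) (%\<tau>. \<Sum>m\<in>M. f (\<tau> + shift \<delta> m))) (\<Union>m\<in>M. T m)" by simp
 hence 1: "(f has_integral integral (cube \<delta>) (%\<tau>. \<Sum>m\<in>M. f (\<tau> + shift \<delta> m))) UNIV"
 proof (rule has_integral_on_superset)
  fix l assume l: "l \<notin> (\<Union>m\<in>M. T m)"
  show "f l = 0"
  proof (rule ccontr)
   assume "f l ~= 0"
   hence lb: "\<bar>l \<bullet> b\<bar> \<le> \<delta>" and lc: "!!c. c \<in> Basis - {b} ==> \<bar>l \<bullet> c\<bar> \<le> 1"
    unfolding f_def using cell_kern_nonzero[OF v(1) \<delta>0] by blast+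
   have ex: "\<exists>j. - L \<le> j \<and> j \<le> L \<and> \<bar>l \<bullet> c - 2 * \<delta> * of_int j\<bar> \<le> \<delta>" if c: "c \<in> Basis - {b}" for c
   proof -
    have "\<bar>l \<bullet> c / \<delta>\<bar> \<le> 2 * of_int L + 1" using lc[OF c] \<delta>0 \<delta>L by (simp add: abs_divide divide_le_eq mult.commute)
    then obtain j where j: "- L \<le> j" "j \<le> L" "\<bar>l \<bullet> c / \<delta> - 2 * of_int j\<bar> \<le> 1" by (rule nearest_even)
    have "\<bar>l \<bullet> c - 2 * \<delta> * of_int j\<bar> = \<delta> * \<bar>l \<bullet> c / \<delta> - 2 * of_int j\<bar>"
     using \<delta>0 by (simp add: abs_mult_pos'[symmetric] field_simps)
    also have "... \<le> \<delta>" using j(3) \<delta>0 by simp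
    finally show ?thesis using j by blast
   qed
   then obtain j where j: "!!c. c \<in> Basis - {b} ==> - L \<le> j c \<and> j c \<le> L \<and> \<bar>l \<bullet> c - 2 * \<delta> * of_int (j c)\<bar> \<le> \<delta>" by metis
   define m where "m = restrict j (Basis - {b})"
   have mM: "m \<in> M" unfolding M m_def using j by auto
   have "l \<in> T m" unfolding T
   proof (intro CollectI ballI)
    fix c :: 'e assume c: "c \<in> Basis"
    show "\<bar>l \<bullet> c - shift \<delta> m \<bullet> c\<bar> \<le> \<delta>"
    proof (cases "c = b")
     case True thus ?thesis using lb by (simp add: shift_inner)
    next
     case False thus ?thesis using j[of c] c shift_inner(1)[of c \<delta> m] by (simp add: m_def)
    qed
   qed
   thus False using l mM by blast
  qed
 qed simp
 have kc: "continuous_on S (kern v q \<delta>)" for S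
  by (rule continuous_on_subset[OF smooth_cont[OF smooth_kern[OF v smooth_const[OF open_UNIV] smooth_const[OF open_UNIV] smooth_id[OF open_UNIV]]]]) simp
 have "(kern v q \<delta> has_integral integral (cube 1) (kern v q \<delta>)) (cbox (- 1 *\<^sub>R One) (1 *\<^sub>R One))"
  unfolding cube_cbox by (rule integrable_integral[OF integrable_continuous[OF kc]])
 moreover have "kern v q \<delta> x = 0" if "x \<notin> cbox (- 1 *\<^sub>R One) (1 *\<^sub>R One)" for x
  using kern_outside[of v x q \<delta>] v(2) that unfolding cube_cbox by blast
 ultimately have "((%x. kern v q \<delta> ((- 1 / \<delta>) *\<^sub>R x + (1 / \<delta>) *\<^sub>R (q - (q \<bullet> b) *\<^sub>R b))) has_integral
  (1 / \<bar>- 1 / \<delta>\<bar> ^ DIM('e)) *\<^sub>R integral (cube 1) (kern v q \<delta>)) UNIV" by (intro has_integral_UNIV_affine) (use \<delta>0 in auto)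
 hence "(f has_integral (1 / \<bar>- 1 / \<delta>\<bar> ^ DIM('e)) *\<^sub>R integral (cube 1) (kern v q \<delta>)) UNIV" unfolding f_def[abs_def] cell_kern_def .
 from has_integral_unique[OF 1 this] show ?thesis using \<delta>0 by (simp add: f_def abs_divide power_divide)
qed

lemma bump_const_pos: "bump_const > 0"
proof -
 have s: "smooth UNIV (%\<xi>. wbump \<xi> * bump (\<xi> \<bullet> a))"
  by (intro smooth_mult smooth_wbump smooth_bump smooth_inner smooth_id smooth_const open_UNIV)
 have c: "continuous_on S (%\<xi>. wbump \<xi> * bump (\<xi> \<bullet> a))" for S by (rule continuous_on_subset[OF smooth_cont[OF s]]) simp
 have i: "(%\<xi>. wbump \<xi> * bump (\<xi> \<bullet> a)) integrable_on cube r" for r unfolding cube_cbox by (rule integrable_continuous[OF c])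
 have "0 < measure lborel (cube (1/16) :: 'e set)" unfolding cube_cbox by (subst content_cbox) (auto intro!: prod_pos)
 also have "... = integral (cube (1/16)) (%\<xi>::'e. 1::real)" unfolding cube_cbox by simp
 also have "... = integral (cube (1/16)) (%\<xi>. wbump \<xi> * bump (\<xi> \<bullet> a))"
 proof (rule Henstock_Kurzweil_Integration.integral_cong)
  fix \<xi> :: 'e assume \<xi>: "\<xi> \<in> cube (1/16)"
  have "bump (\<xi> \<bullet> c) = 1" if "c \<in> Basis" for c unfolding bump_def using \<xi> that by (intro cut_eq_1) (auto simp: cube_def)
  thus "1 = wbump \<xi> * bump (\<xi> \<bullet> a)" unfolding wbump_def using ab by simp
 qed
 also have "... \<le> bump_const" unfolding bump_const_def
  by (rule integral_subset_le[OF cube_mono i i]) (auto intro!: mult_nonneg_nonneg prod_nonneg simp: wbump_def bump_nonneg)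
 finally show ?thesis .
qed

text \<open>For \<delta> = 0 the stretching factor is the constant P = 1 + v q. Stretching the
  a-coordinate multiplies the integral of the bump by P, and P - 1 = v q.\<close>

lemma kern_limit:
 assumes v: "test_fun 1 v" "!!q. \<bar>v q\<bar> \<le> 1/2"
 shows "integral (cube 1) (kern v q 0) = bump_const * v q"
proof -
 define P where "P = 1 + v q"
 have P: "1/2 \<le> P" "P \<le> 3/2" using v(2)[of q] by (auto simp: P_def abs_le_iff)
 define f where "f \<xi> = wbump \<xi> * bump (\<xi> \<bullet> a)" for \<xi>
 define g where "g \<xi> = wbump \<xi> * bump ((\<xi> \<bullet> a) / P)" for \<xi>
 have s: "smooth UNIV f" "smooth UNIV g" unfolding f_def[abs_def] g_def[abs_def] divide_inverse
  by (intro smooth_mult smooth_wbump smooth_bump smooth_inner smooth_id smooth_const open_UNIV)+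
 have fi: "f integrable_on cbox A B" and gi: "g integrable_on cbox A B" for A B
  by (intro integrable_continuous continuous_on_subset[OF smooth_cont[OF s(1)]] continuous_on_subset[OF smooth_cont[OF s(2)]]; simp)+
 have fz: "f \<xi> = 0" and gz: "g \<xi> = 0" if \<xi>: "\<xi> \<notin> cube 1" for \<xi>
 proof -
  obtain c where c: "c \<in> Basis" "\<not> \<bar>\<xi> \<bullet> c\<bar> \<le> 1" using \<xi> unfolding cube_def mem_Collect_eq by blast
  have w: "wbump \<xi> = 0" if "c ~= a" using wbump_nonzero[of \<xi> c] c that by auto
  have "bump (\<xi> \<bullet> a) = 0" "bump ((\<xi> \<bullet> a) / P) = 0" if "c = a"
  proof -
   show "bump (\<xi> \<bullet> a) = 0" using bump_nonzero[of "\<xi> \<bullet> a"] c that by auto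
   have "\<not> \<bar>\<xi> \<bullet> a\<bar> \<le> P / 8" using P c(2) unfolding that by linarith
   thus "bump ((\<xi> \<bullet> a) / P) = 0" using bump_scaled[of "\<xi> \<bullet> a" P] P by auto
  qed
  thus "f \<xi> = 0" "g \<xi> = 0" using w by (cases "c = a"; simp add: f_def g_def)+
 qed
 define mm where "mm c = (if c = a then 1 / P else 1)" for c
 have st: "(\<Sum>c\<in>Basis. (mm c * (\<xi> \<bullet> c)) *\<^sub>R c) \<bullet> c = mm c * (\<xi> \<bullet> c)" if "c \<in> Basis" for \<xi> c
  using that by (simp add: inner_sum_left_Basis)
 have gf: "f (\<Sum>c\<in>Basis. (mm c * (\<xi> \<bullet> c)) *\<^sub>R c) = g \<xi>" for \<xi>
 proof -
  have "(\<Prod>c\<in>Basis - {a, b}. bump (mm c * (\<xi> \<bullet> c))) = (\<Prod>c\<in>Basis - {a, b}. bump (\<xi> \<bullet> c))"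
   by (rule prod.cong) (auto simp: mm_def)
  moreover have "(\<Prod>c\<in>Basis - {a, b}. bump ((\<Sum>c\<in>Basis. (mm c * (\<xi> \<bullet> c)) *\<^sub>R c) \<bullet> c)) = (\<Prod>c\<in>Basis - {a, b}. bump (mm c * (\<xi> \<bullet> c)))"
   by (rule prod.cong) (use st in auto)
  ultimately show ?thesis unfolding f_def g_def wbump_def st[OF ab(1)] st[OF ab(2)] using a_neq_b by (simp add: mm_def)
 qed
 have "prod mm Basis = (\<Prod>c\<in>Basis. if c = a then 1 / P else 1)" by (simp add: mm_def)
 also have "... = 1 / P" using ab(1) by simp
 finally have pm: "prod mm Basis = 1 / P" .
 have fh: "(f has_integral bump_const) (cbox (- 1 *\<^sub>R One) (1 *\<^sub>R One))"
  unfolding bump_const_def cube_cbox f_def[symmetric] by (rule integrable_integral[OF fi])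
 have "((%\<xi>. f (\<Sum>c\<in>Basis. (mm c * (\<xi> \<bullet> c)) *\<^sub>R c)) has_integral (1 / \<bar>prod mm Basis\<bar>) *\<^sub>R bump_const)
  ((%x. \<Sum>k\<in>Basis. (1 / mm k * (x \<bullet> k)) *\<^sub>R k) ` cbox (- 1 *\<^sub>R One) (1 *\<^sub>R One))"
  by (rule has_integral_stretch[OF fh]) (use P in \<open>auto simp: mm_def\<close>)
 hence "(g has_integral P * bump_const) ((%x. \<Sum>k\<in>Basis. (1 / mm k * (x \<bullet> k)) *\<^sub>R k) ` cbox (- 1 *\<^sub>R One) (1 *\<^sub>R One))"
  unfolding gf pm using P by simp
 hence "(g has_integral P * bump_const) UNIV"
 proof (rule has_integral_on_superset)
  fix \<xi> assume \<xi>: "\<xi> \<notin> (%x. \<Sum>k\<in>Basis. (1 / mm k * (x \<bullet> k)) *\<^sub>R k) ` cbox (- 1 *\<^sub>R One) (1 *\<^sub>R One)"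
  have "\<xi> = (\<Sum>k\<in>Basis. (1 / mm k * ((\<Sum>c\<in>Basis. (mm c * (\<xi> \<bullet> c)) *\<^sub>R c) \<bullet> k)) *\<^sub>R k)"
  proof -
   have "(\<Sum>k\<in>Basis. (1 / mm k * ((\<Sum>c\<in>Basis. (mm c * (\<xi> \<bullet> c)) *\<^sub>R c) \<bullet> k)) *\<^sub>R k) = (\<Sum>k\<in>Basis. (\<xi> \<bullet> k) *\<^sub>R k)"
    by (rule sum.cong[OF refl]) (use P in \<open>auto simp: st mm_def\<close>)
   thus ?thesis by (simp add: euclidean_representation)
  qed
  hence "(\<Sum>c\<in>Basis. (mm c * (\<xi> \<bullet> c)) *\<^sub>R c) \<notin> cube 1" using \<xi> unfolding cube_cbox by blast
  from fz[OF this] show "g \<xi> = 0" by (simp add: gf)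
 qed simp
 moreover have "(g has_integral integral (cube 1) g) UNIV"
  by (rule has_integral_on_superset[OF _ gz]) (use integrable_integral[OF gi] in \<open>simp_all add: cube_cbox\<close>)
 ultimately have ig: "integral (cube 1) g = P * bump_const" by (rule has_integral_unique[symmetric])
 have "kern v q 0 = (%\<xi>. g \<xi> - f \<xi>)" by (auto simp: kern_def f_def g_def P_def algebra_simps)
 hence "integral (cube 1) (kern v q 0) = integral (cube 1) g - integral (cube 1) f"
  unfolding cube_cbox using Henstock_Kurzweil_Integration.integral_diff[OF gi fi] by simp
 also have "integral (cube 1) f = bump_const" by (simp add: bump_const_def f_def[abs_def])
 finally show ?thesis by (simp add: ig P_def algebra_simps)
qed

text \<open>\<Gamma> is smooth in (q, \<delta>) up to \<delta> = 0, so the averaged changes converge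
  to \<open>bump_const * v\<close> with the derivatives in W. Their n is bounded independently of
  \<delta>, because the power of \<delta> from unfolding cancels the one in the volume of the offset
  cube.\<close>

lemma n_line_zero_small:
 assumes v: "test_fun 1 v" "!!q. \<bar>v q\<bar> \<le> 1/2" and v_int: "!!q. q \<bullet> b = 0 ==> integral {-1..1} (%y. v (q + y *\<^sub>R b)) = 0"
 shows "n v \<le> 2 ^ DIM('e) * (16 * n F) / bump_const"
proof -
 define \<Gamma> where "\<Gamma> z = integral (cube 1) (%\<xi>. kern v (fst z) (snd z) \<xi>)" for z
 have ks: "smooth UNIV (%z::('e \<times> real) \<times> 'e. kern v (fst (fst z)) (snd (fst z)) (snd z))"
  by (intro smooth_kern v smooth_fst smooth_snd smooth_id open_UNIV)
 have \<Gamma>s: "smooth UNIV \<Gamma>" using smooth_param_integral[OF ks open_UNIV] unfolding \<Gamma>_def[abs_def] cube_cbox by simp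
 have \<Gamma>0: "(%q. \<Gamma> (q, 0)) = (%q. bump_const * v q)" by (simp add: \<Gamma>_def kern_limit[OF v])
 have t0: "test_fun 3 (%q. bump_const * v q)" by (rule test_fun_scale[OF test_fun_mono[OF v(1)]]) simp
 have cells: "test_fun 3 (%q. \<Gamma> (q, \<delta>)) \<and> n (%q. \<Gamma> (q, \<delta>)) \<le> 2 ^ DIM('e) * (16 * n F)"
  if L: "L \<ge> 0" and \<delta>: "\<delta> = 1 / (2 * of_int L + 1)" for L \<delta>
 proof -
  have \<delta>0: "\<delta> > 0" using L by (simp add: \<delta>)
  define h where "h q = \<delta> ^ DIM('e) * \<Gamma> (q, \<delta>)" for q
  have h: "test_fun 3 h" "n h \<le> (2 * \<delta>) ^ DIM('e) * (16 * n F)"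
   using averaged_cells[OF v v_int L \<delta> refl] unfolding unfold_cells[OF v L \<delta> refl] by (simp_all add: h_def[abs_def] \<Gamma>_def)
  have e: "(%q. \<Gamma> (q, \<delta>)) = (%q. (1 / \<delta> ^ DIM('e)) * h q)" using \<delta>0 by (simp add: h_def)
  have "n (%q. \<Gamma> (q, \<delta>)) = (1 / \<delta> ^ DIM('e)) * n h" unfolding e n_scale[OF h(1)] using \<delta>0 by simp
  also have "... \<le> (1 / \<delta> ^ DIM('e)) * ((2 * \<delta>) ^ DIM('e) * (16 * n F))" using h(2) \<delta>0 by (intro mult_left_mono) auto
  also have "... = 2 ^ DIM('e) * (16 * n F)" using \<delta>0 by (simp add: power_mult_distrib)
  finally show ?thesis using test_fun_scale[OF h(1)] unfolding e by blast
 qed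
 have "n (%q. bump_const * v q) \<le> 2 ^ DIM('e) * (16 * n F)"
 proof (rule n_limit[OF t0])
  fix e :: real assume e: "e > 0"
  obtain \<eta> where \<eta>: "\<eta> > 0" "!!ws q d. ws \<in> W ==> q \<in> cube 3 ==> 0 \<le> d ==> d < \<eta> ==> d \<le> 1 ==>
   \<bar>iter_deriv ws (%q. bump_const * v q) q - iter_deriv ws (%q. \<Gamma> (q, d)) q\<bar> \<le> e"
   using uniform_slice_limit[OF \<Gamma>s W e compact_cube, of 3] unfolding \<Gamma>0 by blast
  define L where "L = \<lceil>1 / \<eta>\<rceil>"
  define \<delta> where "\<delta> = 1 / (2 * of_int L + 1 :: real)"
  have "1 / \<eta> \<le> of_int L" "0 < 1 / \<eta>" using \<eta>(1) by (simp_all add: L_def)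
  hence L: "1 / \<eta> \<le> of_int L" "L \<ge> 0" by linarith+
  have "\<delta> < \<eta>"
  proof -
   have "1 / \<eta> < 2 * of_int L + 1" using L \<eta>(1) by linarith
   thus ?thesis using \<eta>(1) L(2) by (simp add: \<delta>_def field_simps)
  qed
  moreover have "0 \<le> \<delta>" "\<delta> \<le> 1" using L(2) by (simp_all add: \<delta>_def)
  ultimately have cl: "\<bar>iter_deriv ws (%q. bump_const * v q) q - iter_deriv ws (%q. \<Gamma> (q, \<delta>)) q\<bar> \<le> e" if "ws \<in> W" for ws q
  proof (cases "q \<in> cube 3")
   case False
   have t\<delta>: "test_fun 3 (%q. \<Gamma> (q, \<delta>))" using cells[OF L(2) \<delta>_def] by blast
   show ?thesis using iter_deriv_zero_outside[OF closed_cube test_funD(2)[OF t0] False] iter_deriv_zero_outside[OF closed_cube test_funD(2)[OF t\<delta>] False] e by simp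
  qed (use \<eta>(2) that in blast)
  show "\<exists>f. test_fun 3 f \<and> n f \<le> 2 ^ DIM('e) * (16 * n F) \<and> (\<forall>ws\<in>W. \<forall>q. \<bar>iter_deriv ws (%q. bump_const * v q) q - iter_deriv ws f q\<bar> \<le> e)"
   using cells[OF L(2) \<delta>_def] cl by blast
 qed
 moreover have "test_fun 3 v" by (rule test_fun_mono[OF v(1)]) simp
 ultimately have "\<bar>bump_const\<bar> * n v \<le> 2 ^ DIM('e) * (16 * n F)" by (simp only: n_scale)
 thus ?thesis using bump_const_pos by (simp add: field_simps)
qed

lemma n_line_zero:
 obtains C where "C \<ge> 0" "!!v B. test_fun 1 v ==> (!!q. q \<bullet> b = 0 ==> integral {-1..1} (%y. v (q + y *\<^sub>R b)) = 0) ==> (!!q. \<bar>v q\<bar> \<le> B) ==> B > 0 ==> n v \<le> C * B"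
proof -
 define C where "C = 2 ^ DIM('e) * (16 * n F) / bump_const"
 have C: "C \<ge> 0" using n_nonneg[OF test_F] bump_const_pos by (simp add: C_def)
 have "n v \<le> (2 * C) * B" if v: "test_fun 1 v" and i: "!!q. q \<bullet> b = 0 ==> integral {-1..1} (%y. v (q + y *\<^sub>R b)) = 0" and B: "!!q. \<bar>v q\<bar> \<le> B" "B > 0" for v B
 proof -
  \<comment> \<open>Scaled to the size 1/2 for which the rescaling factors 1 + v are under
    control.\<close>
  have "n (%q. (1 / (2 * B)) * v q) \<le> C" unfolding C_def
  proof (rule n_line_zero_small[OF test_fun_scale[OF v]])
   show "\<bar>1 / (2 * B) * v q\<bar> \<le> 1/2" for q using B(1)[of q] B(2) by (simp add: abs_mult field_simps)
   show "integral {-1..1} (%y. 1 / (2 * B) * v (q + y *\<^sub>R b)) = 0" if "q \<bullet> b = 0" for q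
    unfolding Henstock_Kurzweil_Integration.integral_mult_right i[OF that] by simp
  qed
  moreover have "test_fun 3 v" by (rule test_fun_mono[OF v]) simp
  ultimately have "\<bar>1 / (2 * B)\<bar> * n v \<le> C" by (simp only: n_scale)
  thus ?thesis using B(2) by (simp add: field_simps)
 qed
 moreover have "2 * C \<ge> 0" using C by simp
 ultimately show thesis by (rule that[rotated])
qed

end

section \<open>Averages along coordinate lines\<close>

definition fibre_bump :: "real => real" where "fibre_bump x = bump x / integral {-1..1} bump"

text \<open>The line integral of f, spread out along the same line by a bump of integral 1: the
  difference to f then has vanishing line integrals, and the support stays in
  \<open>cube 1\<close>.\<close>

definition fibre_average :: "'e => ('e::euclidean_space => real) => 'e => real" where
 "fibre_average b f q = fibre_bump (q \<bullet> b) * integral {-1..1} (%y. f (q - (q \<bullet> b) *\<^sub>R b + y *\<^sub>R b))"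

lemma bump_continuous: "continuous_on S bump" by (rule continuous_on_subset[OF smooth_cont[OF smooth_bump[OF smooth_id[OF open_UNIV]]]]) simp

lemma bump_integral_pos: "integral {-1..1} bump > 0"
proof -
 have i: "bump integrable_on {u..v}" for u v by (rule integrable_continuous_interval[OF bump_continuous])
 have "0 < integral {-1/16..1/16} (%x::real. 1::real)" by simp
 also have "... = integral {-1/16..1/16} bump" unfolding bump_def by (intro Henstock_Kurzweil_Integration.integral_cong cut_eq_1[symmetric]) (auto simp: abs_le_iff)
 also have "... \<le> integral {-1..1} bump" by (rule integral_subset_le[OF _ i i]) (auto simp: bump_nonneg)
 finally show ?thesis .
qed

lemma fibre_bump: "smooth U f ==> smooth U (%x. fibre_bump (f x))"
  "0 \<le> fibre_bump x" "fibre_bump x \<le> fibre_bump 0" "0 < fibre_bump 0" "1 < \<bar>x\<bar> ==> fibre_bump x = 0"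
  "integral {-1..1} fibre_bump = 1"
proof -
 show "smooth U (%x. fibre_bump (f x))" if "smooth U f"
  unfolding fibre_bump_def divide_inverse by (intro smooth_mult smooth_bump smooth_const that smooth_open[OF that])
 have b0: "bump 0 = 1" unfolding bump_def by (rule cut_eq_1) auto
 show "0 \<le> fibre_bump x" "fibre_bump x \<le> fibre_bump 0" "0 < fibre_bump 0"
  using bump_integral_pos bump_nonneg[of x] cut_le_1[of "1/16" "1/8" x] b0 by (simp_all add: fibre_bump_def bump_def divide_right_mono)
 show "fibre_bump x = 0" if "1 < \<bar>x\<bar>" using bump_nonzero[of x] that by (auto simp: fibre_bump_def)
 show "integral {-1..1} fibre_bump = 1" using bump_integral_pos by (simp add: fibre_bump_def[abs_def])
qed

lemma fibre_average:
 assumes f: "test_fun 1 f" and B: "!!q. \<bar>f q\<bar> \<le> B" and b: "b \<in> Basis"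
 shows "test_fun 1 (fibre_average b f)" "\<bar>fibre_average b f q\<bar> \<le> 2 * fibre_bump 0 * B"
  "q0 \<bullet> b = 0 ==> integral {-1..1} (%y. f (q0 + y *\<^sub>R b) - fibre_average b f (q0 + y *\<^sub>R b)) = 0"
proof -
 have bb: "b \<bullet> b = 1" using b by (simp add: inner_Basis)
 have fs: "smooth UNIV f" by (rule test_funD(1)[OF f])
 have g: "smooth UNIV (%z::'a \<times> real. f (fst z - (fst z \<bullet> b) *\<^sub>R b + snd z *\<^sub>R b))"
  by (intro smooth_comp[OF fs] smooth_add smooth_diff smooth_scaleR smooth_inner smooth_fst smooth_snd smooth_id smooth_const open_UNIV)
 have fc: "continuous_on S (%y. f (q + y *\<^sub>R b))" for S q by (rule continuous_on_compose2[OF smooth_cont[OF fs]]) (auto intro!: continuous_intros)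
 show t: "test_fun 1 (fibre_average b f)" unfolding test_fun_def
 proof (intro conjI allI impI)
  show "smooth UNIV (fibre_average b f)" unfolding fibre_average_def[abs_def]  using smooth_param_integral[OF g open_UNIV, of "-1" 1]
   by (intro smooth_mult fibre_bump(1) smooth_inner smooth_id smooth_const open_UNIV) (simp_all add: cbox_interval)
  fix q :: 'a assume "q \<notin> cube 1"
  then obtain c where c: "c \<in> Basis" "1 < \<bar>q \<bullet> c\<bar>" unfolding cube_def by force
  show "fibre_average b f q = 0"
  proof (cases "c = b")
   case True thus ?thesis using c by (simp add: fibre_average_def fibre_bump(5))
  next
   case False
   have "f (q - (q \<bullet> b) *\<^sub>R b + y *\<^sub>R b) = 0" for y
   proof (rule test_funD(2)[OF f])
    have "(q - (q \<bullet> b) *\<^sub>R b + y *\<^sub>R b) \<bullet> c = q \<bullet> c" using False b c by (simp add: inner_add_left inner_diff_left inner_Basis)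
    thus "q - (q \<bullet> b) *\<^sub>R b + y *\<^sub>R b \<notin> cube 1" using c unfolding cube_def by (metis (mono_tags, lifting) mem_Collect_eq not_le)
   qed
   thus ?thesis by (simp add: fibre_average_def)
  qed
 qed
 have "\<bar>integral {-1..1} (%y. f (q - (q \<bullet> b) *\<^sub>R b + y *\<^sub>R b))\<bar> \<le> B * (1 - (-1))"
  using integral_bound[of "-1" 1 "%y. f (q - (q \<bullet> b) *\<^sub>R b + y *\<^sub>R b)" B] fc B by simp
 hence "\<bar>fibre_average b f q\<bar> \<le> fibre_bump 0 * (2 * B)"
  unfolding fibre_average_def abs_mult using fibre_bump(2,3)[of "q \<bullet> b"] by (intro mult_mono) auto
 thus "\<bar>fibre_average b f q\<bar> \<le> 2 * fibre_bump 0 * B" by simp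
 assume q0: "q0 \<bullet> b = 0"
 have pc: "continuous_on S (%y. fibre_average b f (q0 + y *\<^sub>R b))" for S
  by (rule continuous_on_compose2[OF smooth_cont[OF test_funD(1)[OF t]]]) (auto intro!: continuous_intros)
 have "fibre_average b f (q0 + y *\<^sub>R b) = fibre_bump y * integral {-1..1} (%y. f (q0 + y *\<^sub>R b))" for y by (simp add: fibre_average_def inner_add_left q0 bb)
 hence "integral {-1..1} (%y. fibre_average b f (q0 + y *\<^sub>R b)) = integral {-1..1} (%y. f (q0 + y *\<^sub>R b))" by (simp add: fibre_bump(6))
 thus "integral {-1..1} (%y. f (q0 + y *\<^sub>R b) - fibre_average b f (q0 + y *\<^sub>R b)) = 0"
  by (subst Henstock_Kurzweil_Integration.integral_diff) (auto intro: integrable_continuous_interval fc pc)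
qed

text \<open>Records the directions T that have been averaged already: f depends on these coordinates
  through the bumps alone. For T = Basis the factor h is constant.\<close>

definition fibre_product :: "'e set => ('e::euclidean_space => real) => bool" where
 "fibre_product T f \<longleftrightarrow> (\<exists>h. (\<forall>q. f q = (\<Prod>c\<in>T. fibre_bump (q \<bullet> c)) * h q) \<and>
   (\<forall>q q'. (\<forall>c\<in>Basis - T. q \<bullet> c = q' \<bullet> c) --> h q = h q'))"

lemma fibre_product_average:
 assumes f: "fibre_product T f" and T: "T \<subseteq> Basis" and b: "b \<in> Basis - T"
 shows "fibre_product (insert b T) (fibre_average b f)"
proof -
 obtain h where h: "!!q. f q = (\<Prod>c\<in>T. fibre_bump (q \<bullet> c)) * h q" "!!q q'. \<forall>c\<in>Basis - T. q \<bullet> c = q' \<bullet> c ==> h q = h q'"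
  using f unfolding fibre_product_def by blast
 define h' where "h' q = integral {-1..1} (%y. h (q - (q \<bullet> b) *\<^sub>R b + y *\<^sub>R b))" for q
 have bb: "b \<bullet> b = 1" "!!c. c \<in> Basis ==> c ~= b ==> b \<bullet> c = 0" using b by (auto simp: inner_Basis)
 have fin: "finite T" by (rule finite_subset[OF T finite_Basis])
 have "fibre_average b f q = (\<Prod>c\<in>insert b T. fibre_bump (q \<bullet> c)) * h' q" for q
 proof -
  have "(q - (q \<bullet> b) *\<^sub>R b + y *\<^sub>R b) \<bullet> c = q \<bullet> c" if "c \<in> T" for c y
   using bb(2)[of c] that T b by (auto simp: inner_add_left inner_diff_left)
  hence "(\<Prod>c\<in>T. fibre_bump ((q - (q \<bullet> b) *\<^sub>R b + y *\<^sub>R b) \<bullet> c)) = (\<Prod>c\<in>T. fibre_bump (q \<bullet> c))" for y by simp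
  thus ?thesis using b fin by (simp add: fibre_average_def h(1) h'_def)
 qed
 moreover have "h' q = h' q'" if e: "!!c. c \<in> Basis - insert b T ==> q \<bullet> c = q' \<bullet> c" for q q'
 proof -
  have "h (q - (q \<bullet> b) *\<^sub>R b + y *\<^sub>R b) = h (q' - (q' \<bullet> b) *\<^sub>R b + y *\<^sub>R b)" for y
  proof (rule h(2), rule ballI)
   fix c assume c: "c \<in> Basis - T"
   show "(q - (q \<bullet> b) *\<^sub>R b + y *\<^sub>R b) \<bullet> c = (q' - (q' \<bullet> b) *\<^sub>R b + y *\<^sub>R b) \<bullet> c"
    using e[of c] c bb by (cases "c = b") (auto simp: inner_add_left inner_diff_left)
  qed
  thus ?thesis by (simp add: h'_def)
 qed
 ultimately show ?thesis unfolding fibre_product_def by blast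
qed

context inv_seminorm
begin

text \<open>T holds the directions still to be averaged. The partner a of b comes from
  \<open>paired_basis\<close>, so each coordinate in turn plays the role of y, and n is applied to
  the difference through \<open>n_line_zero\<close> for the pair (a, b).\<close>

lemma n_product_bound:
 assumes "T \<subseteq> Basis"
 shows "\<exists>C\<ge>0. \<forall>f B. test_fun 1 f \<and> fibre_product (Basis - T) f \<and> (\<forall>q. \<bar>f q\<bar> \<le> B) \<and> B > 0 --> n f \<le> C * B"
 using finite_subset[OF assms finite_Basis] assms
proof (induction T rule: finite_induct)
 case empty
 define p where "p q = (\<Prod>c\<in>Basis. fibre_bump (q \<bullet> c))" for q :: 'e
 have p: "test_fun 3 p"
 proof (rule test_fun_mono[of 1])
  show "test_fun 1 p" unfolding test_fun_def
  proof (intro conjI allI impI)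
   show "smooth UNIV p" unfolding p_def[abs_def] by (intro smooth_prod fibre_bump(1) smooth_inner smooth_id smooth_const open_UNIV)
   fix q :: 'e assume "q \<notin> cube 1"
   then obtain c where c: "c \<in> Basis" "1 < \<bar>q \<bullet> c\<bar>" unfolding cube_def by force
   hence "\<exists>c\<in>Basis. fibre_bump (q \<bullet> c) = 0" using fibre_bump(5) by blast
   thus "p q = 0" unfolding p_def by (intro prod_zero finite_Basis)
  qed
 qed simp
 define C where "C = n p / fibre_bump 0 ^ DIM('e)"
 have "n f \<le> C * B" if f: "test_fun 1 f" "fibre_product (Basis - {}) f" "!!q. \<bar>f q\<bar> \<le> B" "B > 0" for f B
 proof -
  obtain h where h: "!!q. f q = p q * h q" "!!q q'. h q = h q'" using f(2) unfolding fibre_product_def p_def by auto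
  have feq: "f = (%q. h 0 * p q)"
  proof
   fix q show "f q = h 0 * p q" using h(1)[of q] h(2)[of q 0] by simp
  qed
  \<comment> \<open>The value of f at the origin controls the coefficient, since p is a power of
    \<open>fibre_bump 0\<close> there.\<close>
  have "\<bar>h 0\<bar> * fibre_bump 0 ^ DIM('e) \<le> B" using f(3)[of 0] fibre_bump(4) by (simp add: feq p_def abs_mult)
  hence "\<bar>h 0\<bar> \<le> B / fibre_bump 0 ^ DIM('e)" using fibre_bump(4) by (simp add: field_simps)
  hence "\<bar>h 0\<bar> * n p \<le> B / fibre_bump 0 ^ DIM('e) * n p" using n_nonneg[OF p] by (rule mult_right_mono)
  thus ?thesis unfolding feq n_scale[OF p] by (simp add: C_def mult.commute)
 qed
 moreover have "C \<ge> 0" using n_nonneg[OF p] fibre_bump(4) by (simp add: C_def)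
 ultimately show ?case by blast
next
 case (insert b T)
 hence b: "b \<in> Basis" and T: "T \<subseteq> Basis" by auto
 obtain C1 where C1: "C1 \<ge> 0" "!!f B. test_fun 1 f ==> fibre_product (Basis - T) f ==> (!!q. \<bar>f q\<bar> \<le> B) ==> B > 0 ==> n f \<le> C1 * B"
  using insert.IH[OF T] by blast
 obtain a where a: "a \<in> Basis" "\<Omega> a b ~= 0" "\<forall>c\<in>Basis - {a, b}. \<Omega> a c = 0 \<and> \<Omega> b c = 0"
  using \<Omega>(3) b unfolding paired_basis_def by blast
 interpret pr: inv_seminorm_pair \<Omega> n W C0 a b by unfold_locales (use a b in auto)
 obtain C2 where C2: "C2 \<ge> 0" "!!v B. test_fun 1 v ==> (!!q. q \<bullet> b = 0 ==> integral {-1..1} (%y. v (q + y *\<^sub>R b)) = 0) ==> (!!q. \<bar>v q\<bar> \<le> B) ==> B > 0 ==> n v \<le> C2 * B"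
  using pr.n_line_zero by blast
 define R where "R = 2 * fibre_bump 0"
 have R: "R > 0" using fibre_bump(4) by (simp add: R_def)
 have "n f \<le> (C2 * (1 + R) + C1 * R) * B"
  if f: "test_fun 1 f" "fibre_product (Basis - insert b T) f" "!!q. \<bar>f q\<bar> \<le> B" "B > 0" for f B
 proof -
  have ins: "insert b (Basis - insert b T) = Basis - T" using b insert.hyps by auto
  note fa = fibre_average[OF f(1,3) b]
  have fp: "fibre_product (Basis - T) (fibre_average b f)" using fibre_product_average[OF f(2), of b] b unfolding ins by simp
  have fb: "\<bar>fibre_average b f q\<bar> \<le> R * B" for q using fa(2)[of q] by (simp add: R_def)
  have 1: "n (fibre_average b f) \<le> C1 * (R * B)" by (rule C1(2)[OF fa(1) fp fb]) (use R f(4) in simp)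
  have 2: "n (%q. f q - fibre_average b f q) \<le> C2 * ((1 + R) * B)"
  proof (rule C2(2)[OF test_fun_diff[OF f(1) fa(1)] fa(3)])
   show "\<bar>f q - fibre_average b f q\<bar> \<le> (1 + R) * B" for q
    using f(3)[of q] fb[of q] abs_triangle_ineq4[of "f q" "fibre_average b f q"] by (simp add: algebra_simps)
   show "0 < (1 + R) * B" using R f(4) by simp
  qed
  have t3: "test_fun 3 f" "test_fun 3 (fibre_average b f)" by (rule test_fun_mono[OF f(1)], simp) (rule test_fun_mono[OF fa(1)], simp)
  have "n (%q. (f q - fibre_average b f q) + fibre_average b f q) \<le> n (%q. f q - fibre_average b f q) + n (fibre_average b f)"
   by (rule n_add[OF test_fun_diff[OF t3] t3(2)])
  thus ?thesis using 1 2 by (simp add: algebra_simps)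
 qed
 moreover have "C2 * (1 + R) + C1 * R \<ge> 0" using C1(1) C2(1) R by simp
 ultimately show ?case by blast
qed

theorem n_sup_bound:
 obtains C where "C \<ge> 0" "!!f B. test_fun 1 f ==> (!!q. \<bar>f q\<bar> \<le> B) ==> B > 0 ==> n f \<le> C * B"
proof -
 have "fibre_product (Basis - Basis) f" for f :: "'e => real" unfolding fibre_product_def
 proof (intro exI[of _ f] conjI allI impI)
  fix q q' :: 'e assume *: "\<forall>c\<in>Basis - (Basis - Basis). q \<bullet> c = q' \<bullet> c"
  have "q \<bullet> c = q' \<bullet> c" if "c \<in> Basis" for c using * that by blast
  hence "q = q'" by (rule euclidean_eqI)
  thus "f q = f q'" by simp
 qed simp
 then obtain C where "C \<ge> 0" "!!f B. test_fun 1 f ==> (!!q. \<bar>f q\<bar> \<le> B) ==> B > 0 ==> n f \<le> C * B" using n_product_bound[OF order_refl] by blast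
 thus thesis by (rule that)
qed

end

section \<open>Darboux charts of a closed symplectic manifold\<close>

locale symplectic_manifold =
 fixes \<A> :: "('a::t2_space, 'e::euclidean_space) chart set" and \<omega> :: "('a, 'e) two_form"
 assumes M: "closed_symplectic_manifold \<A> \<omega>"
begin

lemma atlas: "\<forall>c\<in>\<A>. is_chart c" "(\<Union>c\<in>\<A>. fst c) = UNIV"
  "\<forall>c\<in>\<A>. \<forall>d\<in>\<A>. smooth_on (snd c ` (fst c \<inter> fst d)) (transition c d)"
 using M by (simp_all add: closed_symplectic_manifold_def closed_manifold_def smooth_atlas_def)

lemma chart:
 assumes "c \<in> \<A>"
 shows "open (fst c)" "open (chart_image c)" "continuous_on (fst c) (snd c)" "continuous_on (chart_image c) (chart_inv c)"
  "x \<in> fst c ==> chart_inv c (snd c x) = x" "x \<in> fst c ==> snd c x \<in> chart_image c"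
  "y \<in> chart_image c ==> snd c (chart_inv c y) = y" "y \<in> chart_image c ==> chart_inv c y \<in> fst c"
proof -
 note h = bspec[OF atlas(1) assms, unfolded is_chart_def homeomorphism_def]
 show "open (fst c)" "open (chart_image c)" "continuous_on (fst c) (snd c)" "continuous_on (chart_image c) (chart_inv c)"
  "x \<in> fst c ==> chart_inv c (snd c x) = x" "x \<in> fst c ==> snd c x \<in> chart_image c"
  "y \<in> chart_image c ==> snd c (chart_inv c y) = y" "y \<in> chart_image c ==> chart_inv c y \<in> fst c" using h by blast+
qed

lemma chart_cover: "\<exists>c\<in>\<A>. x \<in> fst c" using atlas(2) by blast

definition overlap :: "('a, 'e) chart => ('a, 'e) chart => 'e set" where
 "overlap c d = {y \<in> chart_image c. chart_inv c y \<in> fst d}"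

lemma overlap_alt:
 assumes c: "c \<in> \<A>" shows "overlap c d = snd c ` (fst c \<inter> fst d)"
proof (rule set_eqI, rule iffI)
 fix y assume "y \<in> overlap c d"
 thus "y \<in> snd c ` (fst c \<inter> fst d)" using chart(7,8)[OF c, of y] by (intro image_eqI[of _ _ "chart_inv c y"]) (simp_all add: overlap_def)
next
 fix y assume "y \<in> snd c ` (fst c \<inter> fst d)"
 then obtain x where "x \<in> fst c" "x \<in> fst d" "y = snd c x" by blast
 thus "y \<in> overlap c d" using chart(5,6)[OF c, of x] by (simp add: overlap_def)
qed

lemma open_preimage: "c \<in> \<A> ==> open V ==> open {y \<in> chart_image c. chart_inv c y \<in> V}"
 using continuous_open_preimage[OF chart(4) chart(2), of c V] by (simp add: vimage_def Int_def)

lemma transition: "c \<in> \<A> ==> d \<in> \<A> ==> smooth (overlap c d) (transition c d)"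
proof -
 assume c: "c \<in> \<A>" "d \<in> \<A>"
 have "smooth_on (snd c ` (fst c \<inter> fst d)) (transition c d)" by (rule bspec[OF bspec[OF atlas(3) c(1)] c(2)])
 moreover have "open (overlap c d)" unfolding overlap_def by (rule open_preimage[OF c(1) chart(1)[OF c(2)]])
 ultimately show ?thesis unfolding overlap_alt[OF c(1)] by (rule smooth_on_open_set[THEN iffD1, rotated])
qed

lemma transition_apply: "transition c d y = snd d (chart_inv c y)" by (simp add: transition_def)

lemma form_parts: "smooth_two_form \<A> \<omega>" "closed_two_form \<A> \<omega>" "nondegenerate_two_form \<A> \<omega>"
 using M by (simp_all add: closed_symplectic_manifold_def)

lemma form:
 assumes "c \<in> \<A>" "y \<in> chart_image c"
 shows "alt_form (\<omega> c y)" "nondeg_form (\<omega> c y)" "smooth (chart_image c) (%y. \<omega> c y u v)"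
proof -
 note A = form_parts(1)[unfolded smooth_two_form_def, THEN conjunct1]
  form_parts(1)[unfolded smooth_two_form_def, THEN conjunct2, THEN conjunct1]
 show "alt_form (\<omega> c y)" unfolding alt_form_def by (rule bspec[OF bspec[OF A(1) assms(1)] assms(2)])
 show "nondeg_form (\<omega> c y)"  unfolding nondeg_form_def by (rule bspec[OF bspec[OF form_parts(3)[unfolded nondegenerate_two_form_def] assms(1)] assms(2)])
 show "smooth (chart_image c) (%y. \<omega> c y u v)" by (rule smooth_on_open_set[THEN iffD1, OF chart(2)[OF assms(1)] A(2)[rule_format, OF assms(1)]])
qed

lemma form_transition:
 assumes "c \<in> \<A>" "d \<in> \<A>" "y \<in> overlap c d"
 shows "\<omega> c y u v = \<omega> d (transition c d y) (Df (transition c d) y u) (Df (transition c d) y v)"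
proof -
 have "\<forall>c\<in>\<A>. \<forall>d\<in>\<A>. \<forall>x\<in>fst c \<inter> fst d. \<forall>u v. \<omega> c (snd c x) u v =
   \<omega> d (snd d x) (Df (transition c d) (snd c x) u) (Df (transition c d) (snd c x) v)" using form_parts(1) unfolding smooth_two_form_def by (elim conjE)
 from this[rule_format, OF assms(1,2), of "chart_inv c y" u v] show ?thesis using assms(3) chart(7,8)[OF assms(1), of y] by (simp add: overlap_def transition_apply)
qed

lemma smooth_fun_iff: "smooth_fun \<A> f \<longleftrightarrow> (\<forall>c\<in>\<A>. smooth (chart_image c) (%y. f (chart_inv c y)))"
 unfolding smooth_fun_def o_def by (intro ball_cong refl smooth_on_open_set chart(2))

lemma smooth_funD: "smooth_fun \<A> f ==> c \<in> \<A> ==> smooth (chart_image c) (%y. f (chart_inv c y))" by (simp add: smooth_fun_iff)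

lemma smooth_fun_intros:
 "smooth_fun \<A> (%x. r)"
 "smooth_fun \<A> f ==> smooth_fun \<A> g ==> smooth_fun \<A> (%x. f x + g x)"
 "smooth_fun \<A> f ==> smooth_fun \<A> g ==> smooth_fun \<A> (%x. f x - g x)"
 "smooth_fun \<A> f ==> smooth_fun \<A> g ==> smooth_fun \<A> (%x. f x * g x)"
 "smooth_fun \<A> f ==> smooth_fun \<A> g ==> (!!x. g x ~= 0) ==> smooth_fun \<A> (%x. f x / g x)"
 "(!!i. i \<in> I ==> smooth_fun \<A> (F i)) ==> smooth_fun \<A> (%x. \<Sum>i\<in>I. F i x)" unfolding smooth_fun_iff
 by (intro ballI smooth_const smooth_add smooth_diff smooth_mult smooth_divide smooth_sum chart(2); simp)+

lemma smooth_fun_cont: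
 assumes "smooth_fun \<A> f" shows "continuous_on UNIV f"
proof -
 have "isCont f x" for x
 proof -
  obtain c where c: "c \<in> \<A>" "x \<in> fst c" using chart_cover by blast
  have "continuous_on (fst c) (%x. f (chart_inv c (snd c x)))"
   by (rule continuous_on_compose2[OF smooth_cont[OF smooth_funD[OF assms c(1)]] chart(3)[OF c(1)]]) (rule image_subsetI, rule chart(6)[OF c(1)])
  hence "continuous_on (fst c) f" by (rule continuous_on_eq) (rule arg_cong[of _ _ f], rule chart(5)[OF c(1)])
  thus ?thesis using c chart(1)[OF c(1)] by (simp add: continuous_on_eq_continuous_at)
 qed
 thus ?thesis by (simp add: continuous_on_eq_continuous_at)
qed

end

definition open_cube :: "'e::euclidean_space set" where "open_cube = {q. \<forall>b\<in>Basis. \<bar>q \<bullet> b\<bar> < 4}"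

lemma open_cube: "open (open_cube :: 'e::euclidean_space set)" "cube 3 \<subseteq> (open_cube :: 'e set)" "open_cube \<subseteq> (cube 4 :: 'e set)"
proof -
 have "open_cube = (\<Inter>b\<in>Basis. {q::'e. \<bar>q \<bullet> b\<bar> < 4})" by (auto simp: open_cube_def)
 moreover have "open (\<Inter>b\<in>Basis. {q::'e. \<bar>q \<bullet> b\<bar> < 4})" by (intro open_INT ballI finite_Basis open_Collect_less continuous_intros)
 ultimately show "open (open_cube :: 'e set)" by (rule ssubst)
 show "cube 3 \<subseteq> (open_cube :: 'e set)" by (force simp: cube_def open_cube_def)
 show "open_cube \<subseteq> (cube 4 :: 'e set)" by (force simp: cube_def open_cube_def)
qed

text \<open>\<Theta> is a diffeomorphism of the whole model space, so its inverse is available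
  everywhere; only on \<open>cube 4\<close> is it tied to the chart and to the form.\<close>

locale darboux = symplectic_manifold \<A> \<omega>
 for \<A> :: "('a::t2_space, 'e::euclidean_space) chart set" and \<omega> :: "('a, 'e) two_form" +
 fixes c0 :: "('a, 'e) chart" and \<Theta> \<Theta>' :: "'e => 'e" and \<Omega> :: "'e => 'e => real"
 assumes c0: "c0 \<in> \<A>" and \<Theta>: "smooth UNIV \<Theta>" "smooth UNIV \<Theta>'" "!!q. \<Theta>' (\<Theta> q) = q" "!!y. \<Theta> (\<Theta>' y) = y"
  and \<Theta>_chart: "!!q. q \<in> cube 4 ==> \<Theta> q \<in> chart_image c0"
  and \<Omega>: "alt_form \<Omega>" "nondeg_form \<Omega>" "paired_basis \<Omega>"
  and \<Theta>_form: "!!q u v. q \<in> cube 4 ==> \<omega> c0 (\<Theta> q) (Df \<Theta> q u) (Df \<Theta> q v) = \<Omega> u v"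

context symplectic_manifold
begin

text \<open>Moser's map after translating the coordinates of x to the origin, precomposed with a
  scaled linear map that pairs the standard basis.\<close>

lemma darboux_exists:
 obtains c0 \<Theta> \<Theta>' \<Omega> where "darboux \<A> \<omega> c0 \<Theta> \<Theta>' \<Omega>" "x \<in> fst c0" "\<Theta>' (snd c0 x) = 0"
proof -
 obtain c where c: "c \<in> \<A>" "x \<in> fst c" using chart_cover by blast
 define y0 where "y0 = snd c x"
 have y0: "y0 \<in> chart_image c" unfolding y0_def by (rule chart(6)[OF c])
 then obtain r where r: "r > 0" "ball y0 r \<subseteq> chart_image c" using chart(2)[OF c(1)] openE by blast
 define \<omega>' where "\<omega>' y = \<omega> c (y0 + y)" for y
 have in': "y0 + y \<in> chart_image c" if "y \<in> ball 0 r" for y using r(2) that by (auto simp: dist_norm)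
 have sm: "smooth (ball 0 r) (%y. \<omega>' y u v)" for u v
  unfolding \<omega>'_def by (rule smooth_compose[OF form(3)[OF c(1) y0] smooth_add[OF smooth_const smooth_id]]) (rule open_ball, rule open_ball, use in' in blast)
 have alt: "alt_form (\<omega>' y)" if "y \<in> ball 0 r" for y unfolding \<omega>'_def by (rule form(1)[OF c(1) in'[OF that]])
 have nd: "nondeg_form (\<omega>' 0)" unfolding \<omega>'_def using form(2)[OF c(1) in'[of 0]] r by simp
 have fr: "Df (%z. \<omega>' z u v) y w = Df (%z. \<omega> c z u v) (y0 + y) w" if "y \<in> ball 0 r" for u v w y
 proof (rule Df_eq)
  have "((%y. y0 + y) has_derivative (%h. h)) (at y)" by (auto intro!: derivative_eq_intros)
  from has_derivative_compose[OF this smooth_deriv[OF form(3)[OF c(1) in'[OF that]] in'[OF that]]]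
  show "((%z. \<omega>' z u v) has_derivative (%w. Df (%z. \<omega> c z u v) (y0 + y) w)) (at y)" by (simp add: \<omega>'_def)
 qed
 have cl: "Df (%z. \<omega>' z v w) y u - Df (%z. \<omega>' z u w) y v + Df (%z. \<omega>' z u v) y w = 0"
  if "y \<in> ball 0 r" for y u v w unfolding fr[OF that] using form_parts(2)[unfolded closed_two_form_def, rule_format, OF c(1) in'[OF that]] .
 obtain r' \<Phi> \<Psi> where \<Phi>: "r' > 0" "smooth UNIV \<Phi>" "smooth UNIV \<Psi>" "\<Phi> 0 = 0"
  "!!q. \<Psi> (\<Phi> q) = q" "!!q. \<Phi> (\<Psi> q) = q" "!!q. q \<in> ball 0 r' ==> \<Phi> q \<in> ball 0 r"
  "!!q u v. q \<in> ball 0 r' ==> \<omega>' (\<Phi> q) (Df \<Phi> q u) (Df \<Phi> q v) = \<omega>' 0 u v" by (rule moser[OF r(1) sm alt cl nd]) (assumption | rule that)+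
 have alt0: "alt_form (\<omega>' 0)" using alt[of 0] r by simp
 have "\<exists>L :: 'e => 'e. linear L \<and> inj L \<and> paired_basis (%u v. \<omega>' 0 (L u) (L v))" by (rule paired_basis_exists[OF alt0 nd]) blast
 then obtain L :: "'e => 'e" where L: "linear L" "inj L" "paired_basis (%u v. \<omega>' 0 (L u) (L v))" by blast
 obtain L' where L': "linear L'" "!!x. L' (L x) = x" "!!y. L (L' y) = y" using linear_injective_isomorphism[OF L(1,2)] by blast
 have bL: "bounded_linear L" "bounded_linear L'" using L(1) L'(1) by (simp_all add: linear_conv_bounded_linear)
 obtain B where B: "B > 0" "!!q. norm (L q) \<le> B * norm q"  using bounded_linear.pos_bounded[OF bL(1)] unfolding mult.commute[of "norm (_ :: 'e)"] by blast
 obtain K where K: "K > 0" "!!q. q \<in> cube 4 ==> norm (q :: 'e) \<le> K" using compact_imp_bounded[OF compact_cube] unfolding bounded_pos by blast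
 \<comment> \<open>Small enough for the image of \<open>cube 4\<close> to lie in the ball where
   Moser's map straightens the form. Scaling \<Omega> by \<epsilon>^2 preserves
   \<open>paired_basis\<close>, which asks only which values vanish.\<close>
 define \<epsilon> where "\<epsilon> = r' / (2 * (B * K))"
 have \<epsilon>: "\<epsilon> > 0" using \<Phi>(1) B K by (simp add: \<epsilon>_def)
 have small: "\<epsilon> *\<^sub>R L q \<in> ball 0 r'" if "q \<in> cube 4" for q
 proof -
  have "norm (\<epsilon> *\<^sub>R L q) = \<epsilon> * norm (L q)" using \<epsilon> by simp
  also have "... \<le> \<epsilon> * (B * K)" using \<epsilon> B K(2)[OF that] by (intro mult_left_mono order_trans[OF B(2)]) auto
  also have "... < r'" using \<Phi>(1) B K by (simp add: \<epsilon>_def)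
  finally show ?thesis by simp
 qed
 define \<Theta> where "\<Theta> q = y0 + \<Phi> (\<epsilon> *\<^sub>R L q)" for q
 define \<Theta>' where "\<Theta>' y = (1 / \<epsilon>) *\<^sub>R L' (\<Psi> (y - y0))" for y
 define \<Omega> where "\<Omega> u v = \<omega>' 0 (\<epsilon> *\<^sub>R L u) (\<epsilon> *\<^sub>R L v)" for u v
 have \<Omega>s: "\<Omega> u v = \<epsilon> * (\<epsilon> * \<omega>' 0 (L u) (L v))" for u v
  unfolding \<Omega>_def by (simp add: linear_scale[OF alt_linear(1)[OF alt0]] linear_scale[OF alt_linear(2)[OF alt0]])
 have "darboux \<A> \<omega> c \<Theta> \<Theta>' \<Omega>"
 proof (unfold_locales)
  show "smooth UNIV \<Theta>" "smooth UNIV \<Theta>'" unfolding \<Theta>_def[abs_def] \<Theta>'_def[abs_def]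
   by (intro smooth_add smooth_diff smooth_const smooth_id smooth_scaleR smooth_comp[OF \<Phi>(2)] smooth_comp[OF \<Phi>(3)]
     smooth_bounded_linear[OF bL(1)] smooth_bounded_linear[OF bL(2)] open_UNIV)+
  show "\<Theta>' (\<Theta> q) = q" for q using \<epsilon> by (simp add: \<Theta>_def \<Theta>'_def \<Phi>(5) linear_scale[OF L'(1)] L'(2))
  show "\<Theta> (\<Theta>' y) = y" for y using \<epsilon> by (simp add: \<Theta>_def \<Theta>'_def \<Phi>(6) linear_scale[OF L(1)] L'(3))
  show "\<Theta> q \<in> chart_image c" if "q \<in> cube 4" for q unfolding \<Theta>_def by (rule in'[OF \<Phi>(7)[OF small[OF that]]])
  show "alt_form \<Omega>" unfolding alt_form_def bilinear_def
  proof (intro conjI allI)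
   show "linear (\<Omega> u)" "linear (%u. \<Omega> u v)" for u v unfolding \<Omega>_def
    using linear_compose[OF linear_compose_scale_right[OF L(1), of \<epsilon>] alt_linear(1)[OF alt0]]
     linear_compose[OF linear_compose_scale_right[OF L(1), of \<epsilon>] alt_linear(2)[OF alt0]] by (simp_all add: o_def)
   show "\<Omega> v v = 0" for v using alt0 by (simp add: \<Omega>_def alt_form_def)
  qed
  show "nondeg_form \<Omega>" unfolding nondeg_form_def
  proof (intro allI impI)
   fix u assume u: "\<forall>v. \<Omega> u v = 0"
   have "\<omega>' 0 (L u) v = 0" for v using u[rule_format, of "L' v"] \<epsilon> by (simp add: \<Omega>s L'(3))
   hence "L u = 0" using nd unfolding nondeg_form_def by blast
   hence "L' (L u) = 0" by (simp add: linear_0[OF L'(1)])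
   thus "u = 0" by (simp add: L'(2))
  qed
  show "paired_basis \<Omega>" using L(3) \<epsilon> unfolding paired_basis_def \<Omega>s by simp
  fix q u v :: 'e assume q: "q \<in> cube 4"
  have "((%q. \<epsilon> *\<^sub>R L q) has_derivative (%h. \<epsilon> *\<^sub>R L h)) (at q)"
   by (rule bounded_linear_imp_has_derivative[OF bounded_linear_const_scaleR[OF bL(1)]])
  from has_derivative_add[OF has_derivative_const has_derivative_compose[OF this smooth_deriv[OF \<Phi>(2) UNIV_I]], of y0]
  have "Df \<Theta> q w = Df \<Phi> (\<epsilon> *\<^sub>R L q) (\<epsilon> *\<^sub>R L w)" for w unfolding \<Theta>_def[abs_def] by (subst Df_eq) auto
  thus "\<omega> c (\<Theta> q) (Df \<Theta> q u) (Df \<Theta> q v) = \<Omega> u v"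
   using \<Phi>(8)[OF small[OF q], of "\<epsilon> *\<^sub>R L u" "\<epsilon> *\<^sub>R L v"] by (simp add: \<Theta>_def \<Omega>_def \<omega>'_def)
 qed (rule c)
 moreover have "\<Theta>' (snd c x) = 0" using \<Phi>(4) \<Phi>(5)[of 0] by (simp add: \<Theta>'_def linear_0[OF L'(1)] flip: y0_def)
 ultimately show thesis using that c(2) by blast
qed

end

text \<open>The coefficient a makes the shape a times g o S stable under differentiation: the
  derivative is (D a) times g o S, plus a sum over basis vectors b of new coefficients times (D_b g)
  o S.\<close>

definition chain_bound :: "'e set => ('e::euclidean_space => 'e) => 'e list => ('e => real) => 'e list set => real => bool" where
 "chain_bound K S vs a W C \<longleftrightarrow> finite W \<and> 0 \<le> C \<and> (\<forall>g M y. smooth UNIV g -->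
   (\<forall>ws\<in>W. \<forall>q. \<bar>iter_deriv ws g q\<bar> \<le> M) --> y \<in> K --> \<bar>iter_deriv vs (%y. a y * g (S y)) y\<bar> \<le> C * M)"

lemma chain_boundD:
 assumes "chain_bound K S vs a W C"
 shows "finite W" "0 \<le> C" "smooth UNIV g ==> (!!ws q. ws \<in> W ==> \<bar>iter_deriv ws g q\<bar> \<le> M) ==> y \<in> K
  ==> \<bar>iter_deriv vs (%y. a y * g (S y)) y\<bar> \<le> C * M" using assms by (simp_all add: chain_bound_def)

text \<open>Reverse induction on the list, because its last entry is the innermost derivative, the
  one that acts on the product first.\<close>

lemma chain_bound_exists:
 assumes S: "smooth U S"
 shows "smooth U a ==> compact K ==> K \<subseteq> U ==> \<exists>W C. chain_bound K S vs a W C"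
proof (induction vs arbitrary: a rule: rev_induct)
 case Nil
 have "compact (a ` K)" using Nil by (intro compact_continuous_image continuous_on_subset[OF smooth_cont[OF Nil(1)]])
 then obtain C where C: "C > 0" "!!y. y \<in> K ==> \<bar>a y\<bar> \<le> C" using compact_imp_bounded[of "a ` K"] unfolding bounded_pos by auto
 have "\<bar>a y * g (S y)\<bar> \<le> C * M" if "!!q. \<bar>g q\<bar> \<le> M" "y \<in> K" for g M y unfolding abs_mult using C that by (intro mult_mono) auto
 hence "chain_bound K S [] a {[]} C" using C(1) by (simp add: chain_bound_def)
 thus ?case by blast
next
 case (snoc v vs)
 note a = snoc(2)
 have U: "open U" by (rule smooth_open[OF S])
 define a0 where "a0 y = Df a y v" for y
 define a1 where "a1 b y = a y * (Df S y v \<bullet> b)" for b y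
 have as: "smooth U a0" "smooth U (a1 b)" for b
  unfolding a0_def[abs_def] a1_def[abs_def] by (intro smooth_frechet a smooth_mult smooth_inner S smooth_const U)+
 obtain W0 C0 where W0: "chain_bound K S vs a0 W0 C0" using snoc.IH[OF as(1) snoc(3,4)] by blast
 have "\<forall>b. \<exists>W C. chain_bound K S vs (a1 b) W C" using snoc.IH[OF as(2) snoc(3,4)] by blast
 then obtain W1 C1 where W1: "!!b. chain_bound K S vs (a1 b) (W1 b) (C1 b)" unfolding choice_iff by blast
 define W where "W = W0 \<union> (\<Union>b\<in>Basis. (%ws. ws @ [b]) ` W1 b)"
 define C where "C = C0 + (\<Sum>b\<in>Basis. C1 b)"
 have "\<bar>iter_deriv (vs @ [v]) (%y. a y * g (S y)) y\<bar> \<le> C * M"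
  if g: "smooth UNIV g" and M: "!!ws q. ws \<in> W ==> \<bar>iter_deriv ws g q\<bar> \<le> M" and y: "y \<in> K" for g M y
 proof -
  have yU: "y \<in> U" using y snoc(4) by blast
  define G where "G b = iter_deriv [b] g" for b
  have Gs: "smooth UNIV (G b)" for b unfolding G_def by (rule smooth_iter_deriv[OF g])
  have s0: "smooth U (%y. a0 y * g (S y))" and s1: "smooth U (%y. a1 b y * G b (S y))" for b
   by (intro smooth_mult as smooth_comp[OF g] smooth_comp[OF Gs] S)+
  have "iter_deriv [v] (%y. a y * g (S y)) z = a0 z * g (S z) + (\<Sum>b\<in>Basis. a1 b z * G b (S z))" if z: "z \<in> U" for z
  proof -
   have gl: "linear (Df g (S z))" by (rule has_derivative_linear[OF smooth_deriv[OF g UNIV_I]])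
   have "iter_deriv [v] (%y. a y * g (S y)) z = a z * Df g (S z) (Df S z v) + a0 z * g (S z)" unfolding a0_def
    by (simp add: Df_eq[OF has_derivative_mult[OF smooth_deriv[OF a z]
       has_derivative_compose[OF smooth_deriv[OF S z] smooth_deriv[OF g UNIV_I]]]])
   also have "Df g (S z) (Df S z v)
    = (\<Sum>b\<in>Basis. (Df S z v \<bullet> b) *\<^sub>R Df g (S z) b)" by (rule linear_expand[OF gl])
   finally show ?thesis by (simp add: a1_def G_def sum_distrib_left mult.assoc)
  qed
  hence "iter_deriv vs (iter_deriv [v] (%y. a y * g (S y))) y = iter_deriv vs (%z. a0 z * g (S z) + (\<Sum>b\<in>Basis. a1 b z * G b (S z))) y"
   by (rule iter_deriv_cong[OF U _ yU])
  also have "... = iter_deriv vs (%z. a0 z * g (S z)) y + iter_deriv vs (%z. \<Sum>b\<in>Basis. a1 b z * G b (S z)) y"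
   by (rule iter_deriv_add[OF s0 smooth_sum[OF U s1] yU])
  also have "iter_deriv vs (%z. \<Sum>b\<in>Basis. a1 b z * G b (S z)) y = (\<Sum>b\<in>Basis. iter_deriv vs (%z. a1 b z * G b (S z)) y)" using finite_Basis
  proof (induction rule: finite_induct)
   case empty thus ?case by (simp add: iter_deriv_zero)
  next
   case (insert b B)
   have "smooth U (%z. \<Sum>b\<in>B. a1 b z * G b (S z))" by (rule smooth_sum[OF U s1])
   from iter_deriv_add[OF s1 this yU] show ?case using insert by simp
  qed
  finally have eq: "iter_deriv (vs @ [v]) (%y. a y * g (S y)) y
   = iter_deriv vs (%z. a0 z * g (S z)) y + (\<Sum>b\<in>Basis. iter_deriv vs (%z. a1 b z * G b (S z)) y)" by (simp only: iter_deriv_append)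
  have 0: "\<bar>iter_deriv vs (%z. a0 z * g (S z)) y\<bar> \<le> C0 * M" by (rule chain_boundD(3)[OF W0 g M y]) (simp add: W_def)
  have 1: "\<bar>iter_deriv vs (%z. a1 b z * G b (S z)) y\<bar> \<le> C1 b * M" if b: "b \<in> Basis" for b
  proof (rule chain_boundD(3)[OF W1 Gs _ y])
   fix ws q assume "ws \<in> W1 b"
   hence "ws @ [b] \<in> W" unfolding W_def using b by blast
   from M[OF this] show "\<bar>iter_deriv ws (G b) q\<bar> \<le> M" by (simp only: G_def iter_deriv_append)
  qed
  have "\<bar>\<Sum>b\<in>Basis. iter_deriv vs (%z. a1 b z * G b (S z)) y\<bar> \<le> (\<Sum>b\<in>Basis. C1 b * M)" by (rule order_trans[OF sum_abs sum_mono[OF 1]])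
  hence "\<bar>\<Sum>b\<in>Basis. iter_deriv vs (%z. a1 b z * G b (S z)) y\<bar> \<le> (\<Sum>b\<in>Basis. C1 b) * M" by (simp only: sum_distrib_right)
  thus ?thesis unfolding eq C_def using 0 by (simp only: distrib_right)
 qed
 moreover have "finite W" unfolding W_def using chain_boundD(1)[OF W0] chain_boundD(1)[OF W1] by simp
 moreover have "0 \<le> C" unfolding C_def using chain_boundD(2)[OF W0] chain_boundD(2)[OF W1] by (simp add: sum_nonneg)
 ultimately have "chain_bound K S (vs @ [v]) a W C" by (simp add: chain_bound_def)
 thus ?case by blast
qed

context symplectic_manifold
begin

lemma ham_vector_field_eq:
 assumes "c \<in> \<A>" "y \<in> chart_image c" "!!v. \<omega> c y u v = - Df (h \<circ> chart_inv c) y v"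
 shows "ham_vector_field \<omega> h c y = u" unfolding ham_vector_field_def
proof (rule the_equality)
 fix w assume w: "\<forall>v. \<omega> c y w v = - Df (h \<circ> chart_inv c) y v"
 have "\<omega> c y (w - u) v = 0" for v using w assms(3) by (simp add: linear_diff[OF alt_linear(2)[OF form(1)[OF assms(1,2)]]])
 hence "w - u = 0" using form(2)[OF assms(1,2)] unfolding nondeg_form_def by blast
 thus "w = u" by simp
qed (use assms(3) in blast)

end

section \<open>Transport of test functions and flows to the manifold\<close>

context darboux
begin

definition P :: "'e => 'a" where "P q = chart_inv c0 (\<Theta> q)"
definition Q :: "'a => 'e" where "Q x = \<Theta>' (snd c0 x)"
definition push :: "('e => real) => 'a => real" where "push g x = (if x \<in> fst c0 then g (Q x) else 0)"
definition T :: "('a, 'e) chart => 'e => 'e" where "T c q = snd c (P q)"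
definition S :: "('a, 'e) chart => 'e => 'e" where "S c y = Q (chart_inv c y)"
text \<open>The open cube makes this domain open, while P is controlled on the closed
  \<open>cube 4\<close> around it.\<close>

definition D :: "('a, 'e) chart => 'e set" where "D c = {q \<in> open_cube. P q \<in> fst c}"

lemma P: "q \<in> cube 4 ==> P q \<in> fst c0" "q \<in> cube 4 ==> Q (P q) = q" "x \<in> fst c0 ==> P (Q x) = x"
 using chart(5,7,8)[OF c0] \<Theta>_chart \<Theta>(3,4) by (simp_all add: P_def Q_def)

lemma cube34: "q \<in> cube 3 ==> q \<in> cube (4 :: real)" for q :: "'b::euclidean_space" using cube_mono[of 3 4] by auto

lemma P_continuous: "continuous_on (cube 4) P"
 unfolding P_def by (rule continuous_on_compose2[OF chart(4)[OF c0] continuous_on_subset[OF smooth_cont[OF \<Theta>(1)]]]) (use \<Theta>_chart in auto)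

lemma compact_P: "r \<le> 4 ==> compact (P ` cube r)" by (intro compact_continuous_image compact_cube continuous_on_subset[OF P_continuous] cube_mono)

lemma closed_P: "closed (P ` cube 3)" using compact_P[of 3] compact_imp_closed by simp

lemma in_P: "x \<in> P ` cube 3 \<longleftrightarrow> x \<in> fst c0 \<and> Q x \<in> cube 3" using P cube34 by (auto simp: image_iff intro!: bexI[of _ "Q x"])

lemma push_P: "q \<in> cube 4 ==> push g (P q) = g q" by (simp add: push_def P)

lemma smooth_S: "c \<in> \<A> ==> smooth (overlap c c0) (S c)"
 unfolding S_def Q_def transition_apply[symmetric] by (intro smooth_comp[OF \<Theta>(2)] transition c0)

lemma open_D: "c \<in> \<A> ==> open (D c)"
proof -
 assume c: "c \<in> \<A>"
 have "D c = open_cube \<inter> \<Theta> -` overlap c0 c" using \<Theta>_chart open_cube(3) by (auto simp: D_def overlap_def P_def)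
 moreover have "open (\<Theta> -` overlap c0 c)" by (rule continuous_open_vimage[OF smooth_open[OF transition[OF c0 c]]])
   (use smooth_cont[OF \<Theta>(1)] in \<open>simp add: continuous_on_eq_continuous_at\<close>)
 ultimately show ?thesis by (simp add: open_Int open_cube(1))
qed

lemma D_cube: "q \<in> D c ==> q \<in> cube 4" using open_cube(3) by (auto simp: D_def)

lemma D_overlap: "q \<in> D c ==> \<Theta> q \<in> overlap c0 c" using \<Theta>_chart[OF D_cube] by (simp add: D_def overlap_def P_def)

lemma smooth_T: "c \<in> \<A> ==> smooth (D c) (T c)" unfolding T_def P_def transition_apply[symmetric]
 by (rule smooth_compose[OF transition[OF c0] smooth_subset[OF \<Theta>(1) subset_UNIV open_D]])
  (assumption | (rule image_subsetI, rule D_overlap, assumption))+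

lemma T_overlap: "c \<in> \<A> ==> q \<in> D c ==> T c q \<in> overlap c c0" "c \<in> \<A> ==> q \<in> D c ==> S c (T c q) = q"
 "c \<in> \<A> ==> q \<in> D c ==> chart_inv c (T c q) = P q" using chart(5,6)[of c "P q"] P(1,2)[OF D_cube, of q c] by (simp_all add: overlap_def T_def S_def D_def)

lemma T_S: "c \<in> \<A> ==> y \<in> overlap c c0 ==> T c (S c y) = y" using chart(7)[of c y] P(3)[of "chart_inv c y"] by (simp add: overlap_def T_def S_def)

text \<open>Combines the normal form of \<omega> in the chart \<open>c0\<close> with the
  transformation law of \<omega> between charts.\<close>

lemma T_form:
 assumes c: "c \<in> \<A>" and q: "q \<in> D c"
 shows "\<omega> c (T c q) (Df (T c) q u) (Df (T c) q v) = \<Omega> u v"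
proof -
 have "Df (T c) q w = Df (transition c0 c) (\<Theta> q) (Df \<Theta> q w)" for w unfolding T_def[abs_def] P_def transition_apply[symmetric]
  by (rule Df_eq[OF has_derivative_compose[OF smooth_deriv[OF \<Theta>(1) UNIV_I]
     smooth_deriv[OF transition[OF c0 c] D_overlap[OF q]]]])
 moreover have "T c q = transition c0 c (\<Theta> q)" by (simp add: T_def P_def transition_apply)
 ultimately show ?thesis using form_transition[OF c0 c D_overlap[OF q]] \<Theta>_form[OF D_cube[OF q]] by simp
qed

text \<open>M is covered by the domain of \<open>c0\<close> and the complement of the image of
  \<open>cube 3\<close>, which is compact and hence closed; on the second set the function is 0.
  Time is carried along as a variable because Hamiltonians depend on it.\<close>

lemma smooth_push_time:
 assumes c: "c \<in> \<A>" and g: "smooth UNIV g" and z: "!!t q. q \<notin> cube 3 ==> g (t, q) = 0"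
 shows "smooth (chart_image c \<times> (UNIV :: real set)) (%(y, t). push (%q. g (t, q) :: real) (chart_inv c y))"
proof (rule smooth_local)
 fix p assume "p \<in> chart_image c \<times> (UNIV :: real set)"
 then obtain y t where p: "p = (y, t)" "y \<in> chart_image c" by auto
 show "\<exists>V. p \<in> V \<and> smooth V (%(y, t). push (%q. g (t, q)) (chart_inv c y))"
 proof (cases "chart_inv c y \<in> fst c0")
  case True
  define V where "V = overlap c c0 \<times> (UNIV :: real set)"
  have V: "open V" unfolding V_def by (intro open_Times open_UNIV smooth_open[OF smooth_S[OF c]])
  have "smooth V (%z. g (snd z, S c (fst z)))"
   by (intro smooth_comp[OF g] smooth_Pair smooth_snd smooth_id V smooth_compose[OF smooth_S[OF c] smooth_fst]) (auto simp: V_def)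
  hence "smooth V (%(y, t). push (%q. g (t, q)) (chart_inv c y))" by (rule smooth_cong[rotated]) (auto simp: V_def overlap_def push_def S_def)
  thus ?thesis using True p by (intro exI[of _ V]) (simp add: V_def overlap_def)
 next
  case False
  define V where "V = {y \<in> chart_image c. chart_inv c y \<in> - (P ` cube 3)} \<times> (UNIV :: real set)"
  have V: "open V" unfolding V_def by (intro open_Times open_UNIV open_preimage c open_Compl closed_P)
  have "smooth V (%(y, t). push (%q. g (t, q)) (chart_inv c y))" by (rule smooth_cong[OF _ smooth_const[OF V, of 0]]) (auto simp: V_def push_def z in_P)
  thus ?thesis using False p by (intro exI[of _ V]) (simp add: V_def in_P)
 qed
qed (intro open_Times chart(2) c open_UNIV)

lemma smooth_push:
 assumes g: "test_fun 3 g" shows "smooth_fun \<A> (push g)" unfolding smooth_fun_iff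
proof
 fix c assume c: "c \<in> \<A>"
 have "smooth (chart_image c \<times> (UNIV :: real set)) (%(y, t). push (%q. g (snd (t, q))) (chart_inv c y))"
  by (rule smooth_push_time[OF c smooth_comp[OF test_funD(1)[OF g] smooth_snd[OF smooth_id[OF open_UNIV]]]])
   (simp add: test_funD(2)[OF g])
 from smooth_compose[OF this smooth_Pair[OF smooth_id smooth_const], of "chart_image c" 0]
 show "smooth (chart_image c) (%y. push g (chart_inv c y))" using chart(2)[OF c] by auto
qed

text \<open>The part K' of K over the image of \<open>cube 3\<close> is compact inside the overlap,
  and there the chain rule applies; near every other point of K the pushed function
  vanishes.\<close>

lemma push_bound:
 assumes c: "c \<in> \<A>" and K: "compact K" "K \<subseteq> chart_image c"
 obtains W C where "finite W" "0 \<le> C" "!!g M y. test_fun 3 g ==> (!!ws q. ws \<in> W ==> \<bar>iter_deriv ws g q\<bar> \<le> M)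
   ==> y \<in> K ==> \<bar>iter_deriv vs (%y. push g (chart_inv c y)) y\<bar> \<le> C * M"
proof -
 define K' where "K' = chart_inv c -` (P ` cube 3) \<inter> K"
 have "closed K'" unfolding K'_def using continuous_on_closed_vimage[OF compact_imp_closed[OF K(1)], of "chart_inv c"]
   continuous_on_subset[OF chart(4)[OF c] K(2)] closed_P by blast
 hence "compact (K' \<inter> K)" by (rule closed_Int_compact[OF _ K(1)])
 moreover have "K' \<inter> K = K'" by (auto simp: K'_def)
 ultimately have K': "compact K'" by simp
 have sub: "K' \<subseteq> overlap c c0" unfolding K'_def overlap_def using K(2) in_P by blast
 have U: "open (overlap c c0)" by (rule smooth_open[OF smooth_S[OF c]])
 obtain W C where W: "chain_bound K' (S c) vs (%y. 1) W C" using chain_bound_exists[OF smooth_S[OF c] smooth_const[OF U] K' sub] by blast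
 have "\<bar>iter_deriv vs (%y. push g (chart_inv c y)) y\<bar> \<le> C * M"
  if g: "test_fun 3 g" and M: "!!ws q. ws \<in> insert [] W ==> \<bar>iter_deriv ws g q\<bar> \<le> M" and y: "y \<in> K" for g M y
 proof (cases "y \<in> K'")
  case True
  have "iter_deriv vs (%y. push g (chart_inv c y)) y = iter_deriv vs (%y. 1 * g (S c y)) y"
   by (rule iter_deriv_cong[OF U]) (use sub True in \<open>auto simp: push_def S_def overlap_def\<close>)
  thus ?thesis using chain_boundD(3)[OF W test_funD(1)[OF g] M True] by simp
 next
  case False
  have "iter_deriv vs (%y. push g (chart_inv c y)) y = iter_deriv vs (%y. 0) y"
  proof (rule iter_deriv_cong)
   show "open {y \<in> chart_image c. chart_inv c y \<in> - (P ` cube 3)}" by (intro open_preimage c open_Compl closed_P)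
   show "y \<in> {y \<in> chart_image c. chart_inv c y \<in> - (P ` cube 3)}" using False y K(2) by (auto simp: K'_def)
   show "push g (chart_inv c z) = 0" if "z \<in> {y \<in> chart_image c. chart_inv c y \<in> - (P ` cube 3)}" for z
    using that test_funD(2)[OF g] by (simp add: push_def in_P)
  qed
  \<comment> \<open>The empty list was added to W for this: M bounds an absolute value.\<close>
  moreover have "0 \<le> M" using M[of "[]" undefined] abs_ge_zero[of "g undefined"] by simp
  ultimately show ?thesis using chain_boundD(2)[OF W] by (simp add: iter_deriv_zero)
 qed
 moreover have "finite (insert [] W)" using chain_boundD(1)[OF W] by simp
 ultimately show thesis using that[of "insert [] W" C] chain_boundD(2)[OF W] by blast
qed

text \<open>The Euclidean flow, extended by the identity, is the flow of the pushed Hamiltonian; the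
  equation of motion is checked in every chart of the atlas.\<close>

lemma ham_transport:
 assumes hi: "ham_iso \<Omega> h \<phi> \<psi>"
 obtains \<Phi> where "\<Phi> \<in> Ham \<A> \<omega>" "!!g. test_fun 3 g ==> push g \<circ> inv \<Phi> = push (%q. g (\<psi> q))" "!!g. (%x. g) \<circ> inv \<Phi> = (%x. g :: real)"
proof -
 have h: "smooth UNIV h" "!!t q. q \<notin> cube 3 ==> h (t, q) = 0" and fl: "ham_flow \<Omega> h \<phi>"
  and inv: "!!q. \<psi> (\<phi> (1, q)) = q" "!!q. \<phi> (1, \<psi> q) = q" and smooth_\<phi>: "smooth UNIV \<phi>"
  and out: "!!t q. t \<in> {0..1} ==> q \<notin> cube 3 ==> \<phi> (t, q) = q" and ins: "!!t q. t \<in> {0..1} ==> q \<in> cube 3 ==> \<phi> (t, q) \<in> cube 3"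
  using hi by (simp_all add: ham_iso_def)
 define H where "H t = push (%q. h (t, q))" for t
 define F where "F t x = (if x \<in> P ` cube 3 then P (\<phi> (t, Q x)) else x)" for t x
 have Hs: "smooth (chart_image c \<times> UNIV) (%(y, t). H t (chart_inv c y))" if "c \<in> \<A>" for c unfolding H_def by (rule smooth_push_time[OF that h])
 have 1: "smooth_time_fun \<A> H" unfolding smooth_time_fun_def smooth_on_def
 proof (intro ballI)
  fix c and x :: "'e \<times> real" assume c: "c \<in> \<A>" and x: "x \<in> chart_image c \<times> {0..1}"
  show "\<exists>U g. x \<in> U \<and> smooth U g \<and> (\<forall>y\<in>U \<inter> chart_image c \<times> {0..1}. g y = (case y of (y, t) => H t (chart_inv c y)))"
   using Hs[OF c] x by (intro exI[of _ "chart_image c \<times> UNIV"] exI[of _ "%(y, t). H t (chart_inv c y)"]) auto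
 qed
 have F_in: "Q x \<in> cube 3" "x \<in> fst c0" if "x \<in> P ` cube 3" for x using that by (simp_all add: in_P)
 have 2: "is_ham_flow \<A> \<omega> H F" unfolding is_ham_flow_def
 proof (intro allI conjI ballI impI)
  fix x
  show "F 0 x = x" using fl P(3) F_in by (simp add: F_def ham_flow_def)
  show "continuous_on {0..1} (%t. F t x)"
  proof (cases "x \<in> P ` cube 3")
   case True
   have "continuous_on {0..1} (%t. P (\<phi> (t, Q x)))"
   proof (rule continuous_on_compose2[OF P_continuous])
    show "continuous_on {0..1} (%t. \<phi> (t, Q x))" by (rule continuous_on_compose2[OF smooth_cont[OF smooth_\<phi>]]) (auto intro!: continuous_intros)
   qed (use ins F_in[OF True] cube34 in blast)
   thus ?thesis using True by (simp add: F_def)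
  qed (simp add: F_def)
 next
  fix x t c assume t: "t \<in> {0..1::real}" and c: "c \<in> \<A>" and Fc: "F t x \<in> fst c"
  define y where "y = snd c (F t x)"
  have y: "y \<in> chart_image c" "chart_inv c y = F t x" unfolding y_def by (rule chart(6)[OF c Fc], rule chart(5)[OF c Fc])
  show "((%s. snd c (F s x)) has_vector_derivative ham_vector_field \<omega> (H t) c (snd c (F t x))) (at t within {0..1})"
  proof (cases "x \<in> P ` cube 3")
   case False
   define V where "V = {y \<in> chart_image c. chart_inv c y \<in> - (P ` cube 3)}"
   have "Df (H t \<circ> chart_inv c) y = Df (%y. 0) y"
   proof (rule Df_cong)
    show "open V" unfolding V_def by (intro open_preimage c open_Compl closed_P)
    show "y \<in> V" using y False by (simp add: V_def F_def)
    show "(H t \<circ> chart_inv c) z = 0" if "z \<in> V" for z using that h(2) by (simp add: V_def H_def push_def in_P)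
   qed
   hence "ham_vector_field \<omega> (H t) c y = 0" by (intro ham_vector_field_eq[OF c y(1)]) (simp add: linear_0[OF alt_linear(2)[OF form(1)[OF c y(1)]]])
   thus ?thesis using False by (simp add: F_def y_def)
  next
   case True
   define p where "p = \<phi> (t, Q x)"
   have p3: "p \<in> cube 3" unfolding p_def by (rule ins[OF t F_in(1)[OF True]])
   have FT: "snd c (F s x) = T c (\<phi> (s, Q x))" for s using True by (simp add: F_def T_def)
   have pD: "p \<in> D c" using p3 open_cube(2) Fc True by (auto simp: D_def F_def p_def)
   have yp: "y = T c p" by (simp add: y_def FT p_def)
   obtain X where X: "!!v. \<Omega> X v = - Df h (t, p) (0, v)"
    "((%s. \<phi> (s, Q x)) has_vector_derivative X) (at t within {0..1})" using fl t unfolding ham_flow_def p_def by blast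
   define DT where "DT = Df (T c) p"
   have TD: "(T c has_derivative DT) (at p)" unfolding DT_def by (rule smooth_deriv[OF smooth_T[OF c] pD])
   have "((%s. T c (\<phi> (s, Q x))) has_derivative (%r. DT (r *\<^sub>R X))) (at t within {0..1})"
    by (rule has_derivative_compose[OF X(2)[unfolded has_vector_derivative_def]]) (use TD in \<open>simp add: p_def\<close>)
   hence der: "((%s. T c (\<phi> (s, Q x))) has_vector_derivative DT X) (at t within {0..1})"
    unfolding has_vector_derivative_def by (simp add: linear_scale[OF has_derivative_linear[OF TD]])
   define G where "G y = H t (chart_inv c y)" for y
   have Gs: "smooth (chart_image c) G"
    unfolding G_def using smooth_compose[OF Hs[OF c] smooth_Pair[OF smooth_id smooth_const], of "chart_image c" t] chart(2)[OF c] by auto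
   have GT: "G (T c q) = h (t, q)" if "q \<in> D c" for q using T_overlap(3)[OF c that] push_P[OF D_cube[OF that]] by (simp add: G_def H_def)
   have GD: "Df G y (DT w) = Df h (t, p) (0, w)" for w
   proof (rule frechet_slice[OF h(1) open_D[OF c] pD, symmetric])
    show "((%q. G (T c q)) has_derivative (%w. Df G y (DT w))) (at p)"
     by (rule has_derivative_compose[OF TD]) (use smooth_deriv[OF Gs y(1)] in \<open>simp add: yp\<close>)
   qed (simp add: GT)
   have "ham_vector_field \<omega> (H t) c y = DT X"
   proof (rule ham_vector_field_eq[OF c y(1)])
    fix v
    have yo: "y \<in> overlap c c0" unfolding yp by (rule T_overlap(1)[OF c pD])
    \<comment> \<open>Every tangent vector v in the chart c is an image DT w, since
      \<open>T c\<close> and \<open>S c\<close> are mutually inverse. This reduces the equation for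
      the vector field to the one in Darboux coordinates.\<close>
    define w where "w = Df (S c) y v"
    have "((%y. T c (S c y)) has_derivative (%v. DT (Df (S c) y v))) (at y)"
     by (rule has_derivative_compose[OF smooth_deriv[OF smooth_S[OF c] yo]]) (use TD T_overlap(2)[OF c pD] in \<open>simp add: yp\<close>)
    hence "((%y. y) has_derivative (%v. DT (Df (S c) y v))) (at y)"
     by (rule has_derivative_transform_within_open[OF _ smooth_open[OF smooth_S[OF c]] yo]) (rule T_S[OF c])
    from has_derivative_unique[OF this has_derivative_ident] have v: "v = DT w" by (simp add: w_def fun_eq_iff)
    have "\<omega> c y (DT X) v = \<Omega> X w" unfolding v yp DT_def by (rule T_form[OF c pD])
    also have "... = - Df G y v" unfolding X(1) v GD ..
    finally show "\<omega> c y (DT X) v = - Df (H t \<circ> chart_inv c) y v" by (simp add: G_def[abs_def] o_def)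
   qed
   thus ?thesis using der by (simp add: FT y_def)
  qed
 qed
 have \<psi>3: "\<psi> q \<in> cube 3" if "q \<in> cube 3" for q
 proof (rule ccontr)
  assume n: "\<psi> q \<notin> cube 3"
  have "\<phi> (1, \<psi> q) = \<psi> q" by (rule out[OF _ n]) simp
  thus False using n that by (simp add: inv(2))
 qed
 have \<phi>3: "\<phi> (1, q) \<in> cube 3" if "q \<in> cube 3" for q by (rule ins[OF _ that]) simp
 define G where "G x = (if x \<in> P ` cube 3 then P (\<psi> (Q x)) else x)" for x
 have "F 1 (G x) = x" "G (F 1 x) = x" for x unfolding F_def G_def using P(2)[OF cube34[OF \<psi>3]] P(2)[OF cube34[OF \<phi>3]] F_in P(3) \<psi>3 \<phi>3 inv by auto
 hence "inv (F 1) = G" by (intro inv_unique_comp ext) (simp_all add: o_def)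
 moreover have "push g \<circ> G = push (%q. g (\<psi> q))" if g: "test_fun 3 g" for g
 proof
  fix x
  show "(push g \<circ> G) x = push (%q. g (\<psi> q)) x"
  proof (cases "x \<in> P ` cube 3")
   case True
   thus ?thesis using F_in[OF True] push_P[OF cube34[OF \<psi>3]] by (simp add: G_def push_def)
  next
   case False
   have "\<psi> q = q" if "q \<notin> cube 3" for q using out[of 1 q] inv(1)[of q] that by simp
   thus ?thesis using False test_funD(2)[OF g] by (simp add: G_def push_def in_P)
  qed
 qed
 moreover have "F 1 \<in> Ham \<A> \<omega>" unfolding Ham_def using 1 2 by blast
 ultimately show thesis using that[of "F 1"] by (simp add: o_def)
qed

end

section \<open>Pfaffians and determinants\<close>

definition basis_enum :: "nat => 'e::euclidean_space" where
 "basis_enum = (SOME e. bij_betw e {..<DIM('e)} (Basis :: 'e set))"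

lemma basis_enum: "bij_betw basis_enum {..<DIM('e)} (Basis :: 'e::euclidean_space set)"
proof -
 have "\<exists>e. bij_betw e {..<DIM('e)} (Basis :: 'e set)" using ex_bij_betw_nat_finite[of "Basis :: 'e set"] by (simp add: atLeast0LessThan)
 thus ?thesis unfolding basis_enum_def by (rule someI_ex)
qed

text \<open>The determinant of the matrix c with columns selected by f, as it arises when a Pfaffian
  is expanded.\<close>

definition perm_sum :: "nat => (nat => nat => real) => (nat => nat) => real" where
 "perm_sum D c f = (\<Sum>p | p permutes {..<D}. of_int (sign p) * (\<Prod>j<D. c (p j) (f j)))"

lemma sign_compose_permutes: "p permutes {..<D::nat} ==> q permutes {..<D} ==> sign (p \<circ> q) = sign p * sign q"
 by (intro sign_compose) (auto simp: permutation_permutes)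

lemma perm_sum_permutes: "q permutes {..<D} ==> perm_sum D c q = of_int (sign q) * perm_sum D c (%j. j)"
proof -
 assume q: "q permutes {..<D}"
 have "perm_sum D c q = (\<Sum>p | p permutes {..<D}. of_int (sign (p \<circ> q)) * (\<Prod>j<D. c ((p \<circ> q) j) (q j)))"
  unfolding perm_sum_def by (rule sum_permutations_compose_right[OF q])
 also have "... = (\<Sum>p | p permutes {..<D}. of_int (sign q) * (of_int (sign p) * (\<Prod>j<D. c (p j) j)))"
 proof (rule sum.cong[OF refl])
  fix p assume "p \<in> {p. p permutes {..<D}}"
  hence "sign (p \<circ> q) = sign p * sign q" using q by (simp add: sign_compose_permutes)
  moreover have "(\<Prod>j<D. c ((p \<circ> q) j) (q j)) = (\<Prod>j<D. c (p j) j)" using prod.permute[OF q, of "%j. c (p j) j"] by (simp add: o_def)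
  ultimately show "of_int (sign (p \<circ> q)) * (\<Prod>j<D. c ((p \<circ> q) j) (q j)) = of_int (sign q) * (of_int (sign p) * (\<Prod>j<D. c (p j) j))" by simp
 qed
 finally show ?thesis by (simp only: perm_sum_def sum_distrib_left)
qed

text \<open>Two equal columns: composition with their transposition changes every sign and nothing
  else.\<close>

lemma perm_sum_eq:
 assumes "a < D" "b < D" "a ~= b" "f a = f b"
 shows "perm_sum D c f = 0"
proof -
 have t: "Transposition.transpose a b permutes {..<D}" using assms by (intro permutes_swap_id) auto
 have ft: "f (Transposition.transpose a b j) = f j" for j using assms(4) by (simp add: Transposition.transpose_def)
 have "perm_sum D c f = (\<Sum>p | p permutes {..<D}. of_int (sign (p \<circ> Transposition.transpose a b)) * (\<Prod>j<D. c ((p \<circ> Transposition.transpose a b) j) (f j)))"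
  unfolding perm_sum_def by (rule sum_permutations_compose_right[OF t])
 also have "... = (\<Sum>p | p permutes {..<D}. - (of_int (sign p) * (\<Prod>j<D. c (p j) (f j))))"
 proof (rule sum.cong[OF refl])
  fix p assume "p \<in> {p. p permutes {..<D}}"
  hence "sign (p \<circ> Transposition.transpose a b) = - sign p" using t assms(3) by (simp add: sign_compose_permutes sign_swap_id)
  moreover have "(\<Prod>j<D. c ((p \<circ> Transposition.transpose a b) j) (f j)) = (\<Prod>j<D. c (p j) (f j))"
   using prod.permute[OF t, of "%j. c (p j) (f j)"] by (simp add: o_def ft)
  ultimately show "of_int (sign (p \<circ> Transposition.transpose a b)) * (\<Prod>j<D. c ((p \<circ> Transposition.transpose a b) j) (f j)) = - (of_int (sign p) * (\<Prod>j<D. c (p j) (f j)))"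
   by simp
 qed
 finally have "perm_sum D c f = - perm_sum D c f" by (simp only: perm_sum_def sum_negf)
 thus ?thesis by simp
qed

lemma prod_pairs: "(\<Prod>j<2 * n. h j) = (\<Prod>i<n. h (2 * i) * h (2 * i + 1) :: real)" for n :: nat by (induction n) (simp_all add: mult.assoc)

text \<open>In dimension 2 n this is 2^n n! times the Pfaffian of the Gram matrix of \<Omega>, left
  unnormalised to match the sum in \<open>liouville_density\<close>.\<close>

definition pfaffian :: "('e::euclidean_space => 'e => real) => real" where
 "pfaffian \<Omega> = (\<Sum>p | p permutes {..<DIM('e)}. of_int (sign p) * (\<Prod>i<DIM('e) div 2. \<Omega> (basis_enum (p (2 * i))) (basis_enum (p (2 * i + 1)))))"

definition lin_det :: "('e::euclidean_space => 'e) => real" where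
 "lin_det A = perm_sum DIM('e) (%j k. A (basis_enum j) \<bullet> basis_enum k) (%j. j)"

lemma sum_basis_enum: "(\<Sum>b\<in>(Basis :: 'e::euclidean_space set). h b) = (\<Sum>k<DIM('e). h (basis_enum k))"
 using sum.reindex_bij_betw[OF basis_enum, of h] by simp

text \<open>Expanding every factor in the basis gives a sum over choices g of n index pairs, that is
  over maps of 2 n indices, each weighted by the determinant with columns selected by the map. Maps
  that are not permutations drop out; permutations contribute their sign times the determinant of
  A.\<close>

lemma pfaffian_pullback:
 fixes \<Omega> :: "'e::euclidean_space => 'e => real" and A :: "'e => 'e"
 assumes ev: "even DIM('e)" and \<Omega>: "alt_form \<Omega>"
 shows "pfaffian (%u v. \<Omega> (A u) (A v)) = lin_det A * pfaffian \<Omega>"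
proof -
 define D where "D = DIM('e)"
 define n where "n = D div 2"
 have Dn: "D = 2 * n" using ev by (simp add: D_def n_def)
 define e where "e = (basis_enum :: nat => 'e)"
 define c where "c j k = A (e j) \<bullet> e k" for j k
 define G where "G = PiE {..<n} (%_. {..<D} \<times> {..<D})"
 define w where "w g = (\<Prod>i<n. \<Omega> (e (fst (g i))) (e (snd (g i))))" for g :: "nat => nat \<times> nat"
 \<comment> \<open>\<open>fg\<close> reads n pairs as a map of the 2 n indices, continued by the
   identity so that it can be a permutation; \<open>gp\<close> packs a permutation into pairs
   again.\<close>
 define fg where "fg g j = (if j < D then (if even j then fst (g (j div 2)) else snd (g (j div 2))) else j)" for g :: "nat => nat \<times> nat" and j
 define gp where "gp q = restrict (%i. (q (2 * i), q (2 * i + 1))) {..<n}" for q :: "nat => nat"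
 have fgi: "fg g (2 * i) = fst (g i)" "fg g (Suc (2 * i)) = snd (g i)" if "i < n" for g i using that by (simp_all add: fg_def Dn)
 have ex: "\<Omega> (A u) (A v) = (\<Sum>kl\<in>{..<D} \<times> {..<D}. (A u \<bullet> e (fst kl)) * (A v \<bullet> e (snd kl)) * \<Omega> (e (fst kl)) (e (snd kl)))" for u v
 proof -
  have "\<Omega> (A u) (A v) = (\<Sum>k<D. \<Sum>l<D. (A u \<bullet> e k) * (A v \<bullet> e l) * \<Omega> (e k) (e l))"
   unfolding alt_form_Basis[OF \<Omega>, of "A u" "A v"] by (simp only: sum_basis_enum D_def e_def)
  thus ?thesis by (simp add: sum.cartesian_product case_prod_beta')
 qed
 have "pfaffian (%u v. \<Omega> (A u) (A v)) = (\<Sum>p | p permutes {..<D}. of_int (sign p) *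
   (\<Prod>i<n. \<Sum>kl\<in>{..<D} \<times> {..<D}. c (p (2 * i)) (fst kl) * c (p (2 * i + 1)) (snd kl) * \<Omega> (e (fst kl)) (e (snd kl))))"
  unfolding pfaffian_def ex by (simp add: D_def e_def n_def c_def)
 also have "... = (\<Sum>p | p permutes {..<D}. of_int (sign p) * (\<Sum>g\<in>G. (\<Prod>j<D. c (p j) (fg g j)) * w g))"
 proof (rule sum.cong[OF refl], rule arg_cong[of _ _ "(*) _"])
  fix p :: "nat => nat"
  have "(\<Prod>i<n. \<Sum>kl\<in>{..<D} \<times> {..<D}. c (p (2 * i)) (fst kl) * c (p (2 * i + 1)) (snd kl) * \<Omega> (e (fst kl)) (e (snd kl)))
   = (\<Sum>g\<in>G. \<Prod>i<n. c (p (2 * i)) (fst (g i)) * c (p (2 * i + 1)) (snd (g i)) * \<Omega> (e (fst (g i))) (e (snd (g i))))"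
   unfolding G_def by (rule prod_sum_PiE) auto
  also have "... = (\<Sum>g\<in>G. (\<Prod>j<D. c (p j) (fg g j)) * w g)"
   unfolding Dn prod_pairs w_def prod.distrib[symmetric] by (intro sum.cong prod.cong refl) (simp add: fgi)
  finally show "(\<Prod>i<n. \<Sum>kl\<in>{..<D} \<times> {..<D}. c (p (2 * i)) (fst kl) * c (p (2 * i + 1)) (snd kl) * \<Omega> (e (fst kl)) (e (snd kl)))
   = (\<Sum>g\<in>G. (\<Prod>j<D. c (p j) (fg g j)) * w g)" .
 qed
 also have "... = (\<Sum>g\<in>G. perm_sum D c (fg g) * w g)" unfolding perm_sum_def sum_distrib_left sum_distrib_right by (subst sum.swap) (simp only: mult.assoc)
 also have "... = (\<Sum>g\<in>gp ` {q. q permutes {..<D}}. perm_sum D c (fg g) * w g)"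
 proof (rule sum.mono_neutral_right)
  show "finite G" unfolding G_def by (intro finite_PiE) auto
  show "gp ` {q. q permutes {..<D}} \<subseteq> G"
  proof (rule image_subsetI)
   fix q assume "q \<in> {q. q permutes {..<D}}"
   hence "q j < D" if "j < D" for j using permutes_in_image[of q "{..<D}" j] that by simp
   thus "gp q \<in> G" by (auto simp: gp_def G_def Dn)
  qed
  show "\<forall>g\<in>G - gp ` {q. q permutes {..<D}}. perm_sum D c (fg g) * w g = 0"
  proof
   fix g assume g: "g \<in> G - gp ` {q. q permutes {..<D}}"
   have gD: "fst (g i) < D" "snd (g i) < D" if "i < n" for i using g PiE_mem[of g "{..<n}" "%_. {..<D} \<times> {..<D}" i] that by (auto simp: G_def)
   have into: "fg g j < D" if "j < D" for j using that gD[of "j div 2"] by (simp add: fg_def Dn)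
   have "\<not> inj_on (fg g) {..<D}"
   proof
    assume inj: "inj_on (fg g) {..<D}"
    have sub: "fg g ` {..<D} \<subseteq> {..<D}" using into by auto
    have "bij_betw (fg g) {..<D} {..<D}" using inj endo_inj_surj[OF _ sub inj] by (simp add: bij_betw_def)
    hence "fg g permutes {..<D}" by (rule bij_imp_permutes) (simp add: fg_def)
    moreover have "gp (fg g) = g"
    proof
     fix i show "gp (fg g) i = g i"
     proof (cases "i < n")
      case True thus ?thesis using fgi[OF True, of g] by (simp add: gp_def prod_eq_iff)
     next
      case False
      hence "g i = undefined" using g PiE_arb[of g "{..<n}" "%_. {..<D} \<times> {..<D}" i] by (simp add: G_def)
      thus ?thesis using False by (simp add: gp_def)
     qed
    qed
    ultimately show False using g by (metis DiffD2 image_eqI mem_Collect_eq)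
   qed
   then obtain x y where "x < D" "y < D" "x ~= y" "fg g x = fg g y" by (auto simp: inj_on_def)
   thus "perm_sum D c (fg g) * w g = 0" by (simp add: perm_sum_eq)
  qed
 qed
 also have "... = (\<Sum>q | q permutes {..<D}. perm_sum D c (fg (gp q)) * w (gp q))"
 proof (rule sum.reindex[unfolded o_def])
  have "q j = q' j" if "q permutes {..<D}" "q' permutes {..<D}" "gp q = gp q'" for q q' j
  proof (cases "j < D")
   case True
   have "gp q (j div 2) = gp q' (j div 2)" using that(3) by simp
   moreover have "j div 2 < n" using True by (simp add: Dn)
   ultimately have "q (2 * (j div 2)) = q' (2 * (j div 2))" "q (2 * (j div 2) + 1) = q' (2 * (j div 2) + 1)" by (simp_all add: gp_def)
   moreover have "j = 2 * (j div 2) \<or> j = 2 * (j div 2) + 1" by presburger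
   ultimately show ?thesis by metis
  next
   case False thus ?thesis using permutes_not_in[OF that(1), of j] permutes_not_in[OF that(2), of j] by simp
  qed
  thus "inj_on gp {q. q permutes {..<D}}" by (intro inj_onI ext) simp
 qed
 also have "... = (\<Sum>q | q permutes {..<D}. lin_det A * (of_int (sign q) * (\<Prod>i<n. \<Omega> (e (q (2 * i))) (e (q (2 * i + 1))))))"
 proof (rule sum.cong[OF refl])
  fix q assume "q \<in> {q. q permutes {..<D}}"
  hence q: "q permutes {..<D}" by simp
  have "fg (gp q) j = q j" for j
  proof (cases "j < D")
   case True
   hence "j div 2 < n" by (simp add: Dn)
   thus ?thesis using True by (auto simp: fg_def gp_def elim!: evenE oddE)
  next
   case False thus ?thesis using permutes_not_in[OF q, of j] by (simp add: fg_def)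
  qed
  hence "fg (gp q) = q" by blast
  moreover have "w (gp q) = (\<Prod>i<n. \<Omega> (e (q (2 * i))) (e (q (2 * i + 1))))" by (simp add: w_def gp_def)
  moreover have "lin_det A = perm_sum D c (%j. j)" by (simp add: lin_det_def D_def c_def[abs_def] e_def)
  ultimately show "perm_sum D c (fg (gp q)) * w (gp q) = lin_det A * (of_int (sign q) * (\<Prod>i<n. \<Omega> (e (q (2 * i))) (e (q (2 * i + 1)))))"
   by (simp add: perm_sum_permutes[OF q])
 qed
 finally show ?thesis by (simp only: pfaffian_def D_def n_def e_def sum_distrib_left)
qed

section \<open>Change of variables\<close>

text \<open>The change of variables formula of the library is only available for \<open>real ^ 'n\<close> with a well-ordered index type.\<close>

typedef (overloaded) ('e::euclidean_space) ix = "{..<DIM('e)}" by (rule exI[of _ 0]) simp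

instantiation ix :: (euclidean_space) wellorder
begin
definition "i \<le> j \<longleftrightarrow> Rep_ix i \<le> Rep_ix j"
definition "i < j \<longleftrightarrow> Rep_ix i < Rep_ix j"
instance
proof
 fix P :: "'a ix => bool" and a
 assume s: "!!x. (!!y. y < x ==> P y) ==> P x"
 show "P a"
 proof (induction "Rep_ix a" arbitrary: a rule: less_induct)
  case less
  show ?case by (rule s) (use less in \<open>auto simp: less_ix_def\<close>)
 qed
qed (auto simp: less_eq_ix_def less_ix_def Rep_ix_inject)
end

instance ix :: (euclidean_space) finite
proof
 have "(UNIV :: 'a ix set) = Abs_ix ` {..<DIM('a)}" by (rule type_definition.Abs_image[OF type_definition_ix, symmetric])
 thus "finite (UNIV :: 'a ix set)" by (rule ssubst) simp
qed

definition ix_basis :: "'e ix => 'e::euclidean_space" where "ix_basis i = basis_enum (Rep_ix i)"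
definition of_vec :: "real ^ 'e ix => 'e::euclidean_space" where "of_vec x = (\<Sum>i\<in>UNIV. (x $ i) *\<^sub>R ix_basis i)"
definition to_vec :: "'e::euclidean_space => real ^ 'e ix" where "to_vec y = (\<chi> i. y \<bullet> ix_basis i)"

lemma bij_Rep_ix: "bij_betw (Rep_ix :: 'e::euclidean_space ix => nat) UNIV {..<DIM('e)}"
 using type_definition.Rep_range[OF type_definition_ix[where 'e='e]] by (auto simp: bij_betw_def inj_on_def Rep_ix_inject)

lemma bij_ix_basis: "bij_betw (ix_basis :: 'e ix => 'e) UNIV (Basis :: 'e::euclidean_space set)"
 using bij_betw_trans[OF bij_Rep_ix basis_enum] by (simp add: o_def ix_basis_def[abs_def])

lemma ix_basis: "ix_basis i \<in> Basis" "ix_basis i \<bullet> ix_basis j = (if i = j then 1 else 0)"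
proof -
 have m: "ix_basis i \<in> Basis" for i :: "'a ix" using bij_betwE[OF bij_ix_basis] by blast
 thus "ix_basis i \<in> Basis" .
 have "ix_basis i = ix_basis j \<longleftrightarrow> i = j" by (rule inj_eq[OF bij_betw_imp_inj_on[OF bij_ix_basis]])
 thus "ix_basis i \<bullet> ix_basis j = (if i = j then 1 else 0)" using m[of i] m[of j] by (simp add: inner_Basis)
qed

lemma ball_ix_basis: "(\<forall>b\<in>(Basis :: 'e::euclidean_space set). R b) \<longleftrightarrow> (\<forall>i. R (ix_basis i))"
 using bij_ix_basis[where 'e='e] by (auto simp: bij_betw_def) (metis imageE)

lemma of_vec_inner: "of_vec x \<bullet> ix_basis i = x $ i"
proof -
 have "of_vec x \<bullet> ix_basis i = (\<Sum>j\<in>UNIV. if j = i then x $ j else 0)" unfolding of_vec_def inner_sum_left by (intro sum.cong) (simp_all add: ix_basis)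
 thus ?thesis by simp
qed

lemma to_vec_of_vec: "to_vec (of_vec x) = x" by (simp add: vec_eq_iff to_vec_def of_vec_inner)

lemma of_vec_to_vec: "of_vec (to_vec y) = y"
proof (rule euclidean_eqI)
 fix b :: 'a assume "b \<in> Basis"
 moreover have "\<forall>b\<in>Basis. of_vec (to_vec y) \<bullet> b = y \<bullet> b" unfolding ball_ix_basis of_vec_inner by (simp add: to_vec_def)
 ultimately show "of_vec (to_vec y) \<bullet> b = y \<bullet> b" by blast
qed

lemma linear_of_vec: "linear of_vec" "linear to_vec"
 by (auto intro!: linearI simp: of_vec_def to_vec_def scaleR_add_left sum.distrib scaleR_sum_right vec_eq_iff inner_add_left)

lemmas bounded_of_vec = linear_of_vec[unfolded linear_conv_bounded_linear]

lemma of_vec_cbox: "of_vec x \<in> cbox (of_vec u) (of_vec v) \<longleftrightarrow> x \<in> cbox u v"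
 unfolding mem_box_cart unfolding mem_box ball_ix_basis of_vec_inner ..

lemma of_vec_image: "of_vec ` cbox u v = cbox (of_vec u) (of_vec v :: 'e::euclidean_space)" "to_vec ` cbox a b = cbox (to_vec a) (to_vec b :: real ^ 'e ix)"
proof -
 have 1: "of_vec ` cbox u v = cbox (of_vec u) (of_vec v :: 'e)" for u v
 proof (rule set_eqI)
  fix y
  have "y \<in> of_vec ` cbox u v \<longleftrightarrow> to_vec y \<in> cbox u v" by (auto simp: to_vec_of_vec of_vec_to_vec intro!: image_eqI[where x="to_vec y"])
  thus "y \<in> of_vec ` cbox u v \<longleftrightarrow> y \<in> cbox (of_vec u) (of_vec v)" using of_vec_cbox[of "to_vec y" u v] by (simp only: of_vec_to_vec)
 qed
 show "of_vec ` cbox u v = cbox (of_vec u) (of_vec v :: 'e)" by (rule 1)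
 have "to_vec ` cbox a b = to_vec ` of_vec ` cbox (to_vec a) (to_vec b :: real ^ 'e ix)" by (simp only: 1 of_vec_to_vec)
 thus "to_vec ` cbox a b = cbox (to_vec a) (to_vec b :: real ^ 'e ix)" by (simp only: image_image to_vec_of_vec image_ident)
qed

lemma of_vec_content: "measure lborel (of_vec ` cbox u v) = measure lborel (cbox u v)"
proof (cases "cbox u v = {}")
 case False
 hence "cbox (of_vec u) (of_vec v) ~= {}" unfolding of_vec_image(1)[symmetric] by simp
 hence "measure lborel (of_vec ` cbox u v) = (\<Prod>b\<in>Basis. of_vec v \<bullet> b - of_vec u \<bullet> b)" unfolding of_vec_image by (rule content_cbox')
 also have "... = (\<Prod>i\<in>UNIV. of_vec v \<bullet> ix_basis i - of_vec u \<bullet> ix_basis i)" by (rule prod.reindex_bij_betw[OF bij_ix_basis, symmetric])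
 finally show ?thesis using content_cbox_cart[OF False] by (simp add: of_vec_inner)
qed simp

text \<open>\<open>of_vec\<close> only relabels coordinates: it carries boxes to boxes of the same
  content.\<close>

lemma integral_of_vec:
 fixes k :: "'e::euclidean_space => real"
 assumes k: "continuous_on UNIV k" "!!y. y \<notin> cube r ==> k y = 0"
 shows "integral UNIV (%x. k (of_vec x)) = integral UNIV k"
proof -
 have "k integrable_on cbox (- r *\<^sub>R One) (r *\<^sub>R One)" by (intro integrable_continuous continuous_on_subset[OF k(1)]) simp
 hence i: "(k has_integral integral (cube r) k) (cbox (- r *\<^sub>R One) (r *\<^sub>R One))" unfolding cube_cbox by (rule integrable_integral)
 have 1: "(k has_integral integral (cube r) k) UNIV" by (rule has_integral_on_superset[OF i]) (use k(2) in \<open>auto simp: cube_cbox\<close>)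
 have "((%x. k (of_vec x)) has_integral (1 / 1) *\<^sub>R integral (cube r) k) (to_vec ` cbox (- r *\<^sub>R One) (r *\<^sub>R One))"
 proof (rule has_integral_twiddle[OF _ to_vec_of_vec of_vec_to_vec _ _ _ _ i])
  show "continuous (at x) of_vec" for x :: "real ^ 'e ix" by (rule bounded_linear.continuous[OF bounded_of_vec(1) continuous_ident])
  show "\<exists>w z. of_vec ` cbox u v = cbox w (z :: 'e)" for u v unfolding of_vec_image by blast
  show "\<exists>w z. to_vec ` cbox u (v :: 'e) = cbox w z" for u v unfolding of_vec_image by blast
  show "measure lborel (of_vec ` cbox u v) = 1 * measure lborel (cbox u v)" for u v :: "real ^ 'e ix" by (simp add: of_vec_content)
 qed simp
 hence 2: "((%x. k (of_vec x)) has_integral (1 / 1) *\<^sub>R integral (cube r) k) UNIV"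
 proof (rule has_integral_on_superset)
  fix x assume "x \<notin> to_vec ` cbox (- r *\<^sub>R One) (r *\<^sub>R One :: 'e)"
  hence "of_vec x \<notin> cube r" unfolding cube_cbox by (metis image_eqI to_vec_of_vec)
  thus "k (of_vec x) = 0" by (rule k(2))
 qed simp
 show ?thesis using integral_unique[OF 1] integral_unique[OF 2] by simp
qed

text \<open>The bijection from the index type to an initial segment of the naturals carries
  permutations to permutations of the same sign.\<close>

lemma det_lin_det:
 fixes A :: "'e::euclidean_space => 'e"
 shows "det (matrix (%x. to_vec (A (of_vec x)))) = lin_det A"
proof -
 define R where "R = (Rep_ix :: 'e ix => nat)"
 have bR: "bij_betw R UNIV {..<DIM('e)}" unfolding R_def by (rule bij_Rep_ix)
 have ax: "of_vec (axis j 1) = ix_basis j" for j :: "'e ix"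
 proof -
  have "of_vec (axis j 1) = (\<Sum>i\<in>UNIV. if i = j then ix_basis j else 0)" unfolding of_vec_def by (intro sum.cong) (auto simp: axis_def)
  thus ?thesis by simp
 qed
 have m: "matrix (%x. to_vec (A (of_vec x))) $ i $ j = A (ix_basis j) \<bullet> ix_basis i" for i j by (simp add: matrix_def ax to_vec_def)
 have "det (matrix (%x. to_vec (A (of_vec x)))) =
  (\<Sum>p | p permutes (UNIV :: 'e ix set). of_int (sign p) * (\<Prod>i\<in>UNIV. A (ix_basis (p i)) \<bullet> ix_basis i))" unfolding det_def m by simp
 also have "... = (\<Sum>p | p permutes {..<DIM('e)}. of_int (sign p) * (\<Prod>j<DIM('e). A (basis_enum (p j)) \<bullet> basis_enum j))"
 proof (rule sum.reindex_bij_witness[of _ "map_permutation {..<DIM('e)} Abs_ix" "map_permutation UNIV R"])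
  fix p assume p: "p \<in> {p. p permutes (UNIV :: 'e ix set)}"
  thus "map_permutation {..<DIM('e)} Abs_ix (map_permutation UNIV R p) = p" by (intro map_permutation_compose_inv[OF bR]) (simp_all add: R_def Rep_ix_inverse)
  show "map_permutation UNIV R p \<in> {p. p permutes {..<DIM('e)}}" using p map_permutation_permutes[OF bR] by simp
  have a: "map_permutation UNIV R p (R i) = R (p i)" for i by (rule map_permutation_apply) (use bR in \<open>auto simp: bij_betw_def\<close>)
  have "sign (map_permutation UNIV R p) = sign p" by (rule sign_map_permutation) (use bR p in \<open>auto simp: bij_betw_def\<close>)
  moreover have "(\<Prod>j<DIM('e). A (basis_enum (map_permutation UNIV R p j)) \<bullet> basis_enum j) = (\<Prod>i\<in>UNIV. A (ix_basis (p i)) \<bullet> ix_basis i)"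
   using prod.reindex_bij_betw[OF bR, of "%j. A (basis_enum (map_permutation UNIV R p j)) \<bullet> basis_enum j"] by (simp add: a ix_basis_def flip: R_def)
  ultimately show "of_int (sign (map_permutation UNIV R p)) * (\<Prod>j<DIM('e). A (basis_enum (map_permutation UNIV R p j)) \<bullet> basis_enum j) =
    of_int (sign p) * (\<Prod>i\<in>UNIV. A (ix_basis (p i)) \<bullet> ix_basis i)" by simp
 next
  fix p assume p: "p \<in> {p. p permutes {..<DIM('e)}}"
  have bA: "bij_betw (Abs_ix :: nat => 'e ix) {..<DIM('e)} UNIV"
   by (rule bij_betw_byWitness[where f'=Rep_ix]) (auto simp: Abs_ix_inverse Rep_ix_inverse Rep_ix[simplified])
  show "map_permutation UNIV R (map_permutation {..<DIM('e)} Abs_ix p) = p"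
   by (rule map_permutation_compose_inv[OF bA]) (use p in \<open>auto simp: R_def Abs_ix_inverse\<close>)
  show "map_permutation {..<DIM('e)} (Abs_ix :: nat => 'e ix) p \<in> {p. p permutes UNIV}" using p map_permutation_permutes[OF bA] by simp
 qed
 finally show ?thesis by (simp add: lin_det_def perm_sum_def)
qed

text \<open>Continuity and compact support of k and l guarantee that all integrals exist over the
  whole space, so the formula for U and its image can be stated without domains.\<close>

lemma change_of_variables:
 fixes T :: "'e::euclidean_space => 'e" and k :: "'e => real"
 assumes U: "open U" and T: "!!q. q \<in> U ==> (T has_derivative DT q) (at q)" and inj: "inj_on T U" and TU: "open (T ` U)"
  and k: "continuous_on UNIV k" "!!y. y \<notin> cube r ==> k y = 0" "!!y. y \<notin> T ` U ==> k y = 0"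
  and l: "l = (%q. if q \<in> U then \<bar>lin_det (DT q)\<bar> * k (T q) else 0)" "continuous_on UNIV l" "!!y. y \<notin> cube r' ==> l y = 0"
 shows "integral UNIV k = integral UNIV l"
proof -
 define S where "S = of_vec -` U"
 define g where "g x = to_vec (T (of_vec x))" for x
 define g' where "g' x h = to_vec (DT (of_vec x) (of_vec h))" for x h
 \<comment> \<open>The values are wrapped in \<open>real ^ 1\<close>, the vector-valued form in
   which the formula is applied.\<close>
 define f where "f x = (vec (k (of_vec x)) :: real ^ 1)" for x
 have ov: "continuous_on A (of_vec :: real ^ 'e ix => 'e)" "continuous_on B (to_vec :: 'e => real ^ 'e ix)" for A B using linear_continuous_on bounded_of_vec by blast+
 have op: "open (of_vec -` V :: (real ^ 'e ix) set)" if "open V" for V :: "'e set"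
  using continuous_on_open_vimage[OF open_UNIV, of of_vec] ov(1) that by (metis Int_UNIV_right)
 have gS: "g ` S = of_vec -` (T ` U)"
 proof (rule set_eqI, rule iffI)
  fix x assume "x \<in> of_vec -` (T ` U)"
  then obtain q where q: "q \<in> U" "of_vec x = T q" by auto
  hence "x = g (to_vec q)" "to_vec q \<in> S" using to_vec_of_vec[of x] by (simp_all add: g_def S_def of_vec_to_vec)
  thus "x \<in> g ` S" by blast
 qed (auto simp: g_def S_def of_vec_to_vec)
 have fc: "continuous_on UNIV f" unfolding f_def vec_def by (intro continuous_on_vec_lambda continuous_on_compose2[OF k(1) ov(1)]) auto
 have ab: "f absolutely_integrable_on g ` S"
 proof -
  define C where "C = cbox (to_vec (- r *\<^sub>R One :: 'e)) (to_vec (r *\<^sub>R One))"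
  have "f x = 0" if "x \<notin> C" for x
  proof -
   have "of_vec x \<notin> cube r" using that of_vec_cbox[of x "to_vec (- r *\<^sub>R One)" "to_vec (r *\<^sub>R One)"]
    by (simp only: C_def cube_cbox of_vec_to_vec not_False_eq_True)
   thus ?thesis by (simp add: f_def k(2) vec_eq_iff)
  qed
  hence "(%x. if x \<in> C then f x else 0) = f" by auto
  moreover have "f absolutely_integrable_on C" unfolding C_def by (rule absolutely_integrable_continuous[OF continuous_on_subset[OF fc]]) simp
  ultimately have "f absolutely_integrable_on UNIV" using absolutely_integrable_restrict_UNIV[of C f] by simp
  moreover have "g ` S \<in> sets lebesgue" unfolding gS by (rule sets_completionI_sets) (simp add: borel_open op[OF TU])
  ultimately show ?thesis by (rule set_integrable_subset) simp
 qed
 have S: "S \<in> sets lebesgue" unfolding S_def by (rule sets_completionI_sets) (simp add: borel_open op[OF U])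
 have gd: "(g has_derivative g' x) (at x within S)" if "x \<in> S" for x
 proof -
  have "(T has_derivative DT (of_vec x)) (at (of_vec x))" using that by (intro T) (simp add: S_def)
  from has_derivative_compose[OF bounded_linear_imp_has_derivative[OF bounded_of_vec(1)] this]
  have "((%x. T (of_vec x)) has_derivative (%h. DT (of_vec x) (of_vec h))) (at x within S)" .
  from bounded_linear.has_derivative[OF bounded_of_vec(2) this] show ?thesis unfolding g_def[abs_def] g'_def[abs_def] .
 qed
 have gi: "inj_on g S"
 proof (rule inj_onI)
  fix x y assume xy: "x \<in> S" "y \<in> S" "g x = g y"
  have "T (of_vec x) = T (of_vec y)" using arg_cong[OF xy(3), of of_vec] by (simp add: g_def of_vec_to_vec)
  hence "of_vec x = of_vec y" using inj xy(1,2) by (auto simp: S_def inj_on_def)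
  thus "x = y" by (metis to_vec_of_vec)
 qed
 have det: "det (matrix (g' x)) = lin_det (DT (of_vec x))" for x unfolding g'_def[abs_def] by (rule det_lin_det)
 have ab2: "(%x. \<bar>det (matrix (g' x))\<bar> *\<^sub>R f (g x)) absolutely_integrable_on S" using absolutely_integrable_change_of_variables[OF S gd gi] ab by blast
 have eq: "integral (g ` S) f = integral S (%x. \<bar>det (matrix (g' x))\<bar> *\<^sub>R f (g x))" by (rule integral_change_of_variables[OF S gd gi]) (use ab in auto)
 have bl: "bounded_linear (%v :: real ^ 1. v $ 1)" by (rule bounded_linear_vec_nth)
 have "integral (g ` S) (%x. k (of_vec x)) = integral (g ` S) f $ 1" using integral_linear[OF set_lebesgue_integral_eq_integral(1)[OF ab] bl] by (simp add: o_def f_def)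
 moreover have "integral S (%x. \<bar>lin_det (DT (of_vec x))\<bar> * k (T (of_vec x))) = integral S (%x. \<bar>det (matrix (g' x))\<bar> *\<^sub>R f (g x)) $ 1"
  using integral_linear[OF set_lebesgue_integral_eq_integral(1)[OF ab2] bl] by (simp add: o_def f_def det g_def of_vec_to_vec)
 ultimately have "integral (g ` S) (%x. k (of_vec x)) = integral S (%x. \<bar>lin_det (DT (of_vec x))\<bar> * k (T (of_vec x)))" using eq by simp
 moreover have "integral (g ` S) (%x. k (of_vec x)) = integral UNIV (%x. k (of_vec x))"
  unfolding integral_restrict_UNIV[symmetric, of "g ` S"] by (rule arg_cong[of _ _ "integral UNIV"]) (auto simp: gS k(3))
 moreover have "integral S (%x. \<bar>lin_det (DT (of_vec x))\<bar> * k (T (of_vec x))) = integral UNIV (%x. l (of_vec x))"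
  unfolding integral_restrict_UNIV[symmetric, of S] by (rule arg_cong[of _ _ "integral UNIV"]) (auto simp: S_def l(1))
 ultimately show ?thesis using integral_of_vec[OF k(1,2)] integral_of_vec[OF l(2,3)] by simp
qed

section \<open>The Liouville integral\<close>

lemma continuous_extend_zero:
 fixes g :: "'b::topological_space => real"
 assumes "open V" "continuous_on V g" "closed K" "K \<subseteq> V" "!!y. y \<in> V - K ==> g y = 0"
 shows "continuous_on UNIV (%y. if y \<in> V then g y else 0)"
proof -
 have "continuous_on V (%y. if y \<in> V then g y else 0)" by (rule continuous_on_eq[OF assms(2)]) simp
 moreover have "continuous_on (- K) (%y. if y \<in> V then g y else 0)" by (rule continuous_on_eq[OF continuous_on_const[of _ 0]]) (use assms(5) in auto)
 ultimately have "continuous_on (V \<union> - K) (%y. if y \<in> V then g y else 0)" by (intro continuous_on_open_Un assms(1) open_Compl assms(3))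
 moreover have "V \<union> - K = UNIV" using assms(4) by blast
 ultimately show ?thesis by simp
qed

definition plateau :: "'e::euclidean_space => real" where "plateau q = (\<Prod>b\<in>Basis. cut (1/2) 1 (q \<bullet> b))"

lemma plateau:
 fixes q :: "'e::euclidean_space"
 shows "test_fun 1 (plateau :: 'e => real)" "0 \<le> plateau q" "0 < plateau (0 :: 'e)"
proof -
 show "test_fun 1 (plateau :: 'e => real)" unfolding test_fun_def
 proof (intro conjI allI impI)
  show "smooth UNIV (plateau :: 'e => real)"
   unfolding plateau_def[abs_def] by (intro smooth_prod smooth_cut_compose smooth_inner smooth_id smooth_const open_UNIV)
  fix q :: 'e assume "q \<notin> cube 1"
  then obtain c where c: "c \<in> Basis" "1 < \<bar>q \<bullet> c\<bar>" unfolding cube_def by force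
  hence "cut (1/2) 1 (q \<bullet> c) = 0" by (intro cut_eq_0) auto
  hence "\<exists>c\<in>Basis. cut (1/2) 1 (q \<bullet> c) = 0" using c by blast
  thus "plateau q = 0" unfolding plateau_def by (intro prod_zero finite_Basis)
 qed
 show "0 \<le> plateau q" unfolding plateau_def by (intro prod_nonneg cut_nonneg ballI)
 show "0 < plateau (0 :: 'e)" unfolding plateau_def by (intro prod_pos ballI cut_pos) auto
qed

context symplectic_manifold
begin

text \<open>Normalised plateaus of finitely many Darboux cubes, by compactness. They serve twice:
  they show that a partition of unity exists, so that the choice in
  \<open>liouville_integral\<close> is a genuine one, and they localise f in the final
  argument.\<close>

lemma darboux_partition:
 obtains X c \<Theta> \<Theta>' \<Omega> and \<rho> :: "'a => 'a => real" where "finite X" "!!x. darboux \<A> \<omega> (c x) (\<Theta> x) (\<Theta>' x) (\<Omega> x)" "!!x. smooth_fun \<A> (\<rho> x)"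
  "!!x y. 0 \<le> \<rho> x y" "!!y. (\<Sum>x\<in>X. \<rho> x y) = 1" "!!x y. \<rho> x y ~= 0 ==> y \<in> darboux.P (c x) (\<Theta> x) ` cube 1"
proof -
 have "\<forall>x. \<exists>d. darboux \<A> \<omega> (fst d) (fst (snd d)) (fst (snd (snd d))) (snd (snd (snd d))) \<and> x \<in> fst (fst d) \<and> fst (snd (snd d)) (snd (fst d) x) = 0"
 proof
  fix x
  obtain c \<Theta> \<Theta>' \<Omega> where "darboux \<A> \<omega> c \<Theta> \<Theta>' \<Omega>" "x \<in> fst c" "\<Theta>' (snd c x) = 0" by (rule darboux_exists)
  thus "\<exists>d. darboux \<A> \<omega> (fst d) (fst (snd d)) (fst (snd (snd d))) (snd (snd (snd d))) \<and> x \<in> fst (fst d) \<and> fst (snd (snd d)) (snd (fst d) x) = 0"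
   by (intro exI[of _ "(c, \<Theta>, \<Theta>', \<Omega>)"]) simp
 qed
 then obtain d where d: "!!x. darboux \<A> \<omega> (fst (d x)) (fst (snd (d x))) (fst (snd (snd (d x)))) (snd (snd (snd (d x))))"
  "!!x. x \<in> fst (fst (d x))" "!!x. fst (snd (snd (d x))) (snd (fst (d x)) x) = 0" unfolding choice_iff by blast
 define \<beta> where "\<beta> x = darboux.push (fst (d x)) (fst (snd (snd (d x)))) plateau" for x
 have t3: "test_fun 3 plateau" by (rule test_fun_mono[OF plateau(1)]) simp
 have \<beta>s: "smooth_fun \<A> (\<beta> x)" and \<beta>0: "0 \<le> \<beta> x y" and \<beta>p: "0 < \<beta> x x"
  and \<beta>P: "\<beta> x y ~= 0 ==> y \<in> darboux.P (fst (d x)) (fst (snd (d x))) ` cube 1" for x y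
 proof -
  interpret dx: darboux \<A> \<omega> "fst (d x)" "fst (snd (d x))" "fst (snd (snd (d x)))" "snd (snd (snd (d x)))" by (rule d(1))
  show "smooth_fun \<A> (\<beta> x)" unfolding \<beta>_def by (rule dx.smooth_push[OF t3])
  show "0 \<le> \<beta> x y" by (simp add: \<beta>_def dx.push_def plateau(2))
  show "0 < \<beta> x x" using d(2)[of x] d(3)[of x] by (simp add: \<beta>_def dx.push_def dx.Q_def plateau(3))
  show "y \<in> dx.P ` cube 1" if "\<beta> x y ~= 0"
  proof -
   have y: "y \<in> fst (fst (d x))" "plateau (dx.Q y) ~= 0" using that by (auto simp: \<beta>_def dx.push_def split: if_splits)
   hence "dx.Q y \<in> cube 1" using test_funD(2)[OF plateau(1)] by blast
   thus ?thesis using dx.P(3)[OF y(1)] by (intro image_eqI[of _ _ "dx.Q y"]) simp_all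
  qed
 qed
 have o: "open {y. 0 < \<beta> x y}" for x by (intro open_Collect_less continuous_on_const smooth_fun_cont[OF \<beta>s])
 have "compact (UNIV :: 'a set)" using M by (simp add: closed_symplectic_manifold_def closed_manifold_def)
 then obtain X where X: "finite X" "UNIV \<subseteq> (\<Union>x\<in>X. {y. 0 < \<beta> x y})"
  by (rule compactE_image[of UNIV UNIV "%x. {y. 0 < \<beta> x y}"]) (use o \<beta>p in auto)
 define \<sigma> where "\<sigma> y = (\<Sum>x\<in>X. \<beta> x y)" for y
 have \<sigma>p: "0 < \<sigma> y" for y
 proof -
  obtain x where "x \<in> X" "0 < \<beta> x y" using X(2) by blast
  thus ?thesis unfolding \<sigma>_def using X(1) \<beta>0 by (intro sum_pos2) auto
 qed
 have \<sigma>s: "smooth_fun \<A> \<sigma>" unfolding \<sigma>_def[abs_def] by (rule smooth_fun_intros(6)[OF \<beta>s])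
 show thesis
 proof (rule that[of X "%x. fst (d x)" "%x. fst (snd (d x))" "%x. fst (snd (snd (d x)))" "%x. snd (snd (snd (d x)))" "%x y. \<beta> x y / \<sigma> y", OF X(1) d(1)])
  show "smooth_fun \<A> (%y. \<beta> x y / \<sigma> y)" for x by (rule smooth_fun_intros(5)[OF \<beta>s \<sigma>s]) (use \<sigma>p in \<open>metis less_irrefl\<close>)
  show "0 \<le> \<beta> x y / \<sigma> y" for x y using \<beta>0[of x y] \<sigma>p[of y] by simp
  show "(\<Sum>x\<in>X. \<beta> x y / \<sigma> y) = 1" for y using \<sigma>p[of y] by (simp add: \<sigma>_def flip: sum_divide_distrib)
  show "y \<in> darboux.P (fst (d x)) (fst (snd (d x))) ` cube 1" if "\<beta> x y / \<sigma> y ~= 0" for x y using that \<beta>P by simp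
 qed
qed

definition PU :: "('a, 'e) chart set \<times> (('a, 'e) chart => 'a => real)" where
 "PU = (SOME (F, \<rho>). partition_of_unity \<A> F \<rho>)"

text \<open>\<open>partition_of_unity\<close> is indexed by charts, while several Darboux cubes may
  lie in one chart; the functions that share a chart are added up.\<close>

lemma PU: "partition_of_unity \<A> (fst PU) (snd PU)"
proof -
 obtain X c \<Theta> \<Theta>' \<Omega> and \<rho> :: "'a => 'a => real" where X: "finite X" and d: "!!x. darboux \<A> \<omega> (c x) (\<Theta> x) (\<Theta>' x) (\<Omega> x)" and \<rho>: "!!x. smooth_fun \<A> (\<rho> x)"
  "!!x y. 0 \<le> \<rho> x y" "!!y. (\<Sum>x\<in>X. \<rho> x y) = 1" "!!x y. \<rho> x y ~= 0 ==> y \<in> darboux.P (c x) (\<Theta> x) ` cube 1"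
  by (rule darboux_partition) (assumption | rule that)+
 define \<rho>' where "\<rho>' k y = (\<Sum>x\<in>{x \<in> X. c x = k}. \<rho> x y)" for k y
 have "partition_of_unity \<A> (c ` X) \<rho>'" unfolding partition_of_unity_def
 proof (intro conjI ballI allI)
  show "finite (c ` X)" using X by simp
  show "c ` X \<subseteq> \<A>" using darboux.c0[OF d] by blast
  show "smooth_fun \<A> (\<rho>' k)" for k unfolding \<rho>'_def[abs_def] by (rule smooth_fun_intros(6)[OF \<rho>(1)])
  show "0 \<le> \<rho>' k x" for k x unfolding \<rho>'_def by (rule sum_nonneg[OF \<rho>(2)])
  show "(\<Sum>k\<in>c ` X. \<rho>' k x) = 1" for x unfolding \<rho>'_def using sum.image_gen[OF X, of "%y. \<rho> y x" c] \<rho>(3) by simp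
  fix k
  have "closure {x. \<rho>' k x ~= 0} \<subseteq> (\<Union>x\<in>{x \<in> X. c x = k}. darboux.P (c x) (\<Theta> x) ` cube 1)"
  proof (rule closure_minimal)
   show "{x. \<rho>' k x ~= 0} \<subseteq> (\<Union>x\<in>{x \<in> X. c x = k}. darboux.P (c x) (\<Theta> x) ` cube 1)"
   proof
    fix y assume "y \<in> {x. \<rho>' k x ~= 0}"
    hence "(\<Sum>x\<in>{x \<in> X. c x = k}. \<rho> x y) ~= 0" by (simp add: \<rho>'_def)
    then obtain x where "x \<in> {x \<in> X. c x = k}" "\<rho> x y ~= 0" by (rule sum.not_neutral_contains_not_neutral)
    thus "y \<in> (\<Union>x\<in>{x \<in> X. c x = k}. darboux.P (c x) (\<Theta> x) ` cube 1)" using \<rho>(4) by blast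
   qed
   have "closed (darboux.P (c x) (\<Theta> x) ` cube 1)" for x by (rule compact_imp_closed[OF darboux.compact_P[OF d]]) simp
   thus "closed (\<Union>x\<in>{x \<in> X. c x = k}. darboux.P (c x) (\<Theta> x) ` cube 1)" using X by (intro closed_UN) auto
  qed
  also have "... \<subseteq> fst k"
  proof
   fix y assume "y \<in> (\<Union>x\<in>{x \<in> X. c x = k}. darboux.P (c x) (\<Theta> x) ` cube 1)"
   then obtain x q where x: "c x = k" "q \<in> cube 1" "y = darboux.P (c x) (\<Theta> x) q" by blast
   have "q \<in> cube 4" using x(2) cube_mono[of 1 4] by auto
   thus "y \<in> fst k" using darboux.P(1)[OF d, of q x] x by simp
  qed
  finally show "closure {x. \<rho>' k x ~= 0} \<subseteq> fst k" .
 qed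
 hence "\<exists>z. case z of (F, \<rho>) => partition_of_unity \<A> F \<rho>" by (intro exI[of _ "(c ` X, \<rho>')"]) simp
 hence "case PU of (F, \<rho>) => partition_of_unity \<A> F \<rho>" unfolding PU_def by (rule someI_ex)
 thus ?thesis by (simp add: case_prod_beta)
qed

lemma PUD: "finite (fst PU)" "c \<in> fst PU ==> c \<in> \<A>" "c \<in> fst PU ==> smooth_fun \<A> (snd PU c)" "c \<in> fst PU ==> 0 \<le> snd PU c x"
 "c \<in> fst PU ==> closure {x. snd PU c x ~= 0} \<subseteq> fst c" "(\<Sum>c\<in>fst PU. snd PU c x) = 1" using PU unfolding partition_of_unity_def by blast+

lemma liouville_density_pfaffian: "liouville_density \<omega> c y = \<bar>pfaffian (\<omega> c y) / 2 ^ (DIM('e) div 2)\<bar>"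
 by (simp add: liouville_density_def pfaffian_def basis_enum_def Let_def)

definition summand :: "('a, 'e) chart => ('a => real) => 'e => real" where
 "summand c f y = (if y \<in> chart_image c then snd PU c (chart_inv c y) * f (chart_inv c y) * liouville_density \<omega> c y else 0)"

abbreviation "Lint \<equiv> liouville_integral \<A> \<omega>"

lemma Lint: "Lint f = (\<Sum>c\<in>fst PU. integral UNIV (summand c f))"
 unfolding liouville_integral_def PU_def[symmetric] summand_def integral_restrict_UNIV by (simp add: case_prod_beta)

lemma compact_cube_bound: "compact (K :: 'e set) ==> \<exists>r. K \<subseteq> cube r"
proof -
 assume "compact K"
 then obtain r where r: "!!y. y \<in> K ==> norm y \<le> r" using compact_imp_bounded[of K] unfolding bounded_iff by blast
 have "K \<subseteq> cube r" unfolding cube_def using r Basis_le_norm order_trans by blast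
 thus ?thesis by blast
qed

text \<open>The support of the weight is compact and contained in the chart domain, so the
  coordinate expression extends continuously by 0.\<close>

lemma summand:
 assumes c: "c \<in> fst PU" and f: "continuous_on UNIV f"
 shows "continuous_on UNIV (summand c f)" "\<exists>r. \<forall>y. y \<notin> cube r --> summand c f y = 0"
proof -
 define K where "K = snd c ` closure {x. snd PU c x ~= 0}"
 have cA: "c \<in> \<A>" by (rule PUD(2)[OF c])
 have sub: "closure {x. snd PU c x ~= 0} \<subseteq> fst c" by (rule PUD(5)[OF c])
 have "compact (closure {x. snd PU c x ~= 0})"
  using closed_Int_compact[of "closure {x. snd PU c x ~= 0}" UNIV] M by (simp add: closed_symplectic_manifold_def closed_manifold_def)
 hence K: "compact K" unfolding K_def by (intro compact_continuous_image continuous_on_subset[OF chart(3)[OF cA] sub])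
 have Ksub: "K \<subseteq> chart_image c" unfolding K_def using sub chart(6)[OF cA] by blast
 have zero: "snd PU c (chart_inv c y) = 0" if "y \<in> chart_image c - K" for y
 proof (rule ccontr)
  assume "snd PU c (chart_inv c y) ~= 0"
  hence "chart_inv c y \<in> closure {x. snd PU c x ~= 0}" by (intro subsetD[OF closure_subset]) simp
  hence "snd c (chart_inv c y) \<in> K" unfolding K_def by blast
  thus False using that chart(7)[OF cA, of y] by simp
 qed
 have pc: "continuous_on (chart_image c) (%y. h (chart_inv c y))" if "continuous_on UNIV h" for h :: "'a => real"
  by (rule continuous_on_compose2[OF that chart(4)[OF cA]]) simp
 have wc: "continuous_on (chart_image c) (%y. \<omega> c y u v)" for u v
 proof (cases "chart_image c = {}")
  case False
  then obtain y where "y \<in> chart_image c" by blast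
  from smooth_cont[OF form(3)[OF cA this]] show ?thesis .
 qed simp
 have "continuous_on (chart_image c) (liouville_density \<omega> c)" unfolding liouville_density_pfaffian[abs_def] pfaffian_def
  by (intro continuous_on_rabs continuous_on_divide continuous_on_sum continuous_on_mult continuous_on_const continuous_on_prod wc) simp
 hence "continuous_on (chart_image c) (%y. snd PU c (chart_inv c y) * f (chart_inv c y) * liouville_density \<omega> c y)"
  by (intro continuous_on_mult pc f smooth_fun_cont PUD(3)[OF c])
 thus "continuous_on UNIV (summand c f)" unfolding summand_def[abs_def]
  by (rule continuous_extend_zero[OF chart(2)[OF cA] _ compact_imp_closed[OF K] Ksub]) (simp add: zero)
 obtain r where r: "K \<subseteq> cube r" using compact_cube_bound[OF K] by blast
 have "summand c f y = 0" if "y \<notin> cube r" for y using zero[of y] subsetD[OF r, of y] that by (auto simp: summand_def)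
 thus "\<exists>r. \<forall>y. y \<notin> cube r --> summand c f y = 0" by blast
qed

lemma integrable_compact_support:
 fixes k :: "'e => real"
 assumes "continuous_on UNIV k" "!!y. y \<notin> cube r ==> k y = 0"
 shows "k integrable_on UNIV"
proof -
 have "k integrable_on cbox (- r *\<^sub>R One) (r *\<^sub>R One)" by (intro integrable_continuous continuous_on_subset[OF assms(1)]) simp
 thus ?thesis by (rule integrable_on_superset) (use assms(2) in \<open>auto simp: cube_cbox\<close>)
qed

lemma summand_integrable: "c \<in> fst PU ==> continuous_on UNIV f ==> summand c f integrable_on UNIV" using summand[of c f] integrable_compact_support by blast

lemma Lint_linear:
 assumes f: "continuous_on UNIV f" and g: "continuous_on UNIV g"
 shows "Lint (%x. f x + g x) = Lint f + Lint g" "Lint (%x. r * f x) = r * Lint f"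
proof -
 have "summand c (%x. f x + g x) = (%y. summand c f y + summand c g y)" "summand c (%x. r * f x) = (%y. r * summand c f y)" for c
  by (auto simp: summand_def algebra_simps)
 thus "Lint (%x. f x + g x) = Lint f + Lint g" "Lint (%x. r * f x) = r * Lint f" unfolding Lint
  by (simp_all add: sum_distrib_left sum.distrib[symmetric] Henstock_Kurzweil_Integration.integral_add[OF summand_integrable[OF _ f] summand_integrable[OF _ g]])
qed

lemma Lint_bound:
 assumes f: "continuous_on UNIV f" and B: "!!x. \<bar>f x\<bar> \<le> B"
 shows "\<bar>Lint f\<bar> \<le> B * Lint (%x. 1)"
proof -
 have "\<bar>integral UNIV (summand c f)\<bar> \<le> integral UNIV (%y. B * summand c (%x. 1) y)" if c: "c \<in> fst PU" for c
 proof (rule Henstock_Kurzweil_Integration.integral_norm_bound_integral[OF summand_integrable[OF c f], unfolded real_norm_def])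
  show "(%y. B * summand c (%x. 1) y) integrable_on UNIV" by (intro integrable_on_mult_right summand_integrable[OF c] continuous_on_const)
  fix y
  have "\<bar>snd PU c (chart_inv c y) * f (chart_inv c y) * liouville_density \<omega> c y\<bar>
   = (snd PU c (chart_inv c y) * liouville_density \<omega> c y) * \<bar>f (chart_inv c y)\<bar>" using PUD(4)[OF c] by (simp add: abs_mult liouville_density_pfaffian)
  also have "... \<le> (snd PU c (chart_inv c y) * liouville_density \<omega> c y) * B"
   using B PUD(4)[OF c] by (intro mult_left_mono mult_nonneg_nonneg) (auto simp: liouville_density_pfaffian)
  finally show "\<bar>summand c f y\<bar> \<le> B * summand c (%x. 1) y" by (simp add: summand_def mult_ac)
 qed
 hence "\<bar>integral UNIV (summand c f)\<bar> \<le> B * integral UNIV (summand c (%x. 1))" if "c \<in> fst PU" for c using that by simp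
 thus ?thesis unfolding Lint sum_distrib_left by (intro order_trans[OF sum_abs sum_mono])
qed

end

context darboux
begin

text \<open>In Darboux coordinates the density is constant. Each summand is transformed by
  \<open>T c\<close>; by \<open>pfaffian_pullback\<close> the Jacobian determinant turns the density
  in c into that constant, and the weights add up to 1.\<close>

lemma Lint_push:
 assumes g: "test_fun 3 g"
 shows "Lint (push g) = \<bar>pfaffian \<Omega> / 2 ^ (DIM('e) div 2)\<bar> * integral UNIV g"
proof -
 define d where "d = \<bar>pfaffian \<Omega> / 2 ^ (DIM('e) div 2)\<bar>"
 have ev: "even DIM('e)" using M by (simp add: closed_symplectic_manifold_def)
 define l where "l c q = d * (snd PU c (P q) * g q)" for c q
 have gz: "g q = 0" if "q \<notin> cube 3" for q by (rule test_funD(2)[OF g that])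
 have gcont: "continuous_on A g" for A by (rule continuous_on_subset[OF smooth_cont[OF test_funD(1)[OF g]]]) simp
 have lc: "continuous_on UNIV (l c)" if c: "c \<in> fst PU" for c
 proof -
  have "continuous_on open_cube (l c)" unfolding l_def by (intro continuous_on_mult continuous_on_const gcont continuous_on_compose2[OF smooth_fun_cont[OF PUD(3)[OF c]]]
     continuous_on_subset[OF P_continuous] open_cube(3)) simp
  hence "continuous_on UNIV (%q. if q \<in> open_cube then l c q else 0)"
   by (rule continuous_extend_zero[OF open_cube(1) _ closed_cube open_cube(2)]) (simp add: l_def gz)
  moreover have "(%q. if q \<in> open_cube then l c q else 0) = l c" using gz open_cube(2) by (force simp: l_def)
  ultimately show ?thesis by (simp only:)
 qed
 have lz: "l c q = 0" if "q \<notin> cube 3" for c q using gz[OF that] by (simp add: l_def)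
 have int: "integral UNIV (summand c (push g)) = integral UNIV (l c)" if c: "c \<in> fst PU" for c
 proof -
  have cA: "c \<in> \<A>" by (rule PUD(2)[OF c])
  have pc: "continuous_on UNIV (push g)" by (rule smooth_fun_cont[OF smooth_push[OF g]])
  obtain r where r: "!!y. y \<notin> cube r ==> summand c (push g) y = 0" using summand(2)[OF c pc] by blast
  have TD: "T c ` D c = overlap c c0 \<inter> S c -` open_cube"
  proof (rule set_eqI, rule iffI)
   fix y assume "y \<in> T c ` D c"
   thus "y \<in> overlap c c0 \<inter> S c -` open_cube" using T_overlap(1,2)[OF cA] by (auto simp: D_def)
  next
   fix y assume y: "y \<in> overlap c c0 \<inter> S c -` open_cube"
   hence "P (S c y) = chart_inv c y" using P(3) by (simp add: S_def overlap_def)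
   hence "S c y \<in> D c" using y chart(8)[OF cA, of y] by (simp add: D_def overlap_def)
   thus "y \<in> T c ` D c" using T_S[OF cA, of y] y by (intro image_eqI[of _ _ "S c y"]) simp_all
  qed
  show ?thesis
  proof (rule change_of_variables[where U="D c" and T="T c" and DT="%q. Df (T c) q"])
   show "open (D c)" by (rule open_D[OF cA])
   show "(T c has_derivative Df (T c) q) (at q)" if "q \<in> D c" for q by (rule smooth_deriv[OF smooth_T[OF cA] that])
   show "inj_on (T c) (D c)" by (rule inj_on_inverseI[of _ "S c"]) (rule T_overlap(2)[OF cA])
   show "open (T c ` D c)" unfolding TD by (rule continuous_open_preimage[OF smooth_cont[OF smooth_S[OF cA]] smooth_open[OF smooth_S[OF cA]] open_cube(1)])
   show "continuous_on UNIV (summand c (push g))" by (rule summand(1)[OF c pc])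
   show "summand c (push g) y = 0" if "y \<notin> cube r" for y by (rule r[OF that])
   show "summand c (push g) y = 0" if "y \<notin> T c ` D c" for y
   proof (rule ccontr)
    assume "summand c (push g) y ~= 0"
    hence y: "y \<in> chart_image c" "chart_inv c y \<in> fst c0" "g (Q (chart_inv c y)) ~= 0" by (auto simp: summand_def push_def split: if_splits)
    hence "Q (chart_inv c y) \<in> cube 3" using gz by blast
    thus False using that y open_cube(2) unfolding TD by (auto simp: overlap_def S_def)
   qed
   show "l c = (%q. if q \<in> D c then \<bar>lin_det (Df (T c) q)\<bar> * summand c (push g) (T c q) else 0)"
   proof
    fix q
    show "l c q = (if q \<in> D c then \<bar>lin_det (Df (T c) q)\<bar> * summand c (push g) (T c q) else 0)"
    proof (cases "q \<in> D c")
     case True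
     have To: "T c q \<in> chart_image c" "chart_inv c (T c q) = P q" using T_overlap[OF cA True] by (simp_all add: overlap_def)
     have "pfaffian \<Omega> = lin_det (Df (T c) q) * pfaffian (\<omega> c (T c q))"
      using pfaffian_pullback[OF ev form(1)[OF cA To(1)], of "Df (T c) q"] by (simp add: T_form[OF cA True])
     hence "d = \<bar>lin_det (Df (T c) q)\<bar> * liouville_density \<omega> c (T c q)" by (simp add: d_def liouville_density_pfaffian abs_mult)
     thus ?thesis using True To push_P[OF D_cube[OF True]] by (simp add: l_def summand_def)
    next
     case False
     have "snd PU c (P q) * g q = 0"
     proof (cases "q \<in> open_cube")
      case True
      hence "P q \<notin> fst c" using False by (simp add: D_def)
      hence "P q \<notin> {x. snd PU c x ~= 0}"  using subsetD[OF PUD(5)[OF c], of "P q"] subsetD[OF closure_subset, of "P q" "{x. snd PU c x ~= 0}"] by blast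
      thus ?thesis by simp
     next
      case False
      thus ?thesis using gz[of q] open_cube(2) by auto
     qed
     thus ?thesis using False by (simp add: l_def)
    qed
   qed
  qed (rule lc[OF c], rule lz)
 qed
 have "Lint (push g) = (\<Sum>c\<in>fst PU. integral UNIV (l c))" unfolding Lint by (rule sum.cong[OF refl int])
 also have "... = integral UNIV (%q. \<Sum>c\<in>fst PU. l c q)"
  by (rule Henstock_Kurzweil_Integration.integral_sum[symmetric, OF PUD(1)]) (rule integrable_compact_support[OF lc lz])
 also have "(%q. \<Sum>c\<in>fst PU. l c q) = (%q. d * g q)" unfolding l_def using PUD(6) by (simp flip: sum_distrib_left sum_distrib_right)
 finally show ?thesis by (simp add: d_def)
qed

text \<open>Gives invariance of the mean under the transported flows. A linear map that preserves
  \<Omega> has determinant 1 or -1 by \<open>pfaffian_pullback\<close> if the Pfaffian is nonzero;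
  otherwise both integrals are 0.\<close>

lemma Lint_ham_iso:
 assumes hi: "ham_iso \<Omega> h \<phi> \<psi>" and g: "test_fun 3 g"
 shows "test_fun 3 (%q. g (\<psi> q))" "Lint (push (%q. g (\<psi> q))) = Lint (push g)"
proof -
 have sm: "smooth UNIV \<phi>" "smooth UNIV \<psi>" and inv: "!!q. \<psi> (\<phi> (1, q)) = q" "!!q. \<phi> (1, \<psi> q) = q"
  and out: "!!t q. t \<in> {0..1} ==> q \<notin> cube 3 ==> \<phi> (t, q) = q"
  and sy: "!!q u v. \<Omega> (Df (%q. \<phi> (1, q)) q u) (Df (%q. \<phi> (1, q)) q v) = \<Omega> u v" using hi by (simp_all add: ham_iso_def)
 have "\<psi> q = q" if "q \<notin> cube 3" for q using out[of 1 q] inv(1)[of q] that by simp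
 thus t: "test_fun 3 (%q. g (\<psi> q))" unfolding test_fun_def using smooth_comp[OF test_funD(1)[OF g] sm(2)] test_funD(2)[OF g] by simp
 define T where "T q = \<phi> (1, q)" for q
 define DT where "DT q = Df T q" for q
 define l where "l q = \<bar>lin_det (DT q)\<bar> * g q" for q
 have Ts: "smooth UNIV T" unfolding T_def[abs_def] by (intro smooth_comp[OF sm(1)] smooth_Pair smooth_const smooth_id open_UNIV)
 have ev: "even DIM('e)" using M by (simp add: closed_symplectic_manifold_def)
 have cont: "continuous_on UNIV f" if "smooth UNIV f" for f :: "'e => real" by (rule smooth_cont[OF that])
 have dc: "continuous_on UNIV (%q. DT q u \<bullet> v)" for u v unfolding DT_def by (intro cont smooth_inner smooth_frechet Ts smooth_const open_UNIV)
 have lc: "continuous_on UNIV l" unfolding l_def[abs_def] lin_det_def perm_sum_def by (intro continuous_intros dc cont[OF test_funD(1)[OF g]])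
 have lz: "l q = 0" if "q \<notin> cube 3" for q using test_funD(2)[OF g that] by (simp add: l_def)
 have surj: "T ` UNIV = UNIV" using inv(2) by (metis T_def surj_def)
 have "integral UNIV (%q. g (\<psi> q)) = integral UNIV l"
 proof (rule change_of_variables[where U=UNIV and T=T and DT=DT])
  show "(T has_derivative DT q) (at q)" for q unfolding DT_def by (rule smooth_deriv[OF Ts UNIV_I])
  show "inj_on T UNIV" by (rule inj_on_inverseI[of _ \<psi>]) (simp add: T_def inv)
  show "open (T ` UNIV)" unfolding surj by (rule open_UNIV)
  show "continuous_on UNIV (%q. g (\<psi> q))" by (rule cont[OF test_funD(1)[OF t]])
  show "g (\<psi> y) = 0" if "y \<notin> cube 3" for y by (rule test_funD(2)[OF t that])
  show "g (\<psi> y) = 0" if "y \<notin> T ` UNIV" for y using that surj by simp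
  show "l = (%q. if q \<in> UNIV then \<bar>lin_det (DT q)\<bar> * g (\<psi> (T q)) else 0)" by (simp add: l_def[abs_def] T_def inv)
 qed (rule open_UNIV, rule lc, rule lz)
 moreover have "\<bar>pfaffian \<Omega>\<bar> * integral UNIV l = \<bar>pfaffian \<Omega>\<bar> * integral UNIV g"
 proof (cases "pfaffian \<Omega> = 0")
  case False
  have "\<bar>lin_det (DT q)\<bar> = 1" for q
  proof -
   have "pfaffian \<Omega> = lin_det (DT q) * pfaffian \<Omega>" using pfaffian_pullback[OF ev \<Omega>(1), of "DT q"] sy by (simp add: DT_def T_def[abs_def])
   thus ?thesis using False by simp
  qed
  hence "l = g" by (simp add: l_def[abs_def])
  thus ?thesis by (simp only:)
 qed simp
 ultimately show "Lint (push (%q. g (\<psi> q))) = Lint (push g)" unfolding Lint_push[OF t] Lint_push[OF g] by (simp add: abs_divide)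
qed

end

section \<open>Invariant seminorms on the manifold\<close>

lemma iter_deriv_const_bound: "\<bar>iter_deriv vs (%x. m) (x :: 'a::euclidean_space)\<bar> \<le> \<bar>m :: real\<bar>"
proof (cases vs)
 case (Cons v ws)
 have "\<exists>r. iter_deriv ws (%x::'a. m) = (%x. r)" by (induction ws) auto
 then obtain r where "iter_deriv ws (%x::'a. m) = (%x. r)" by blast
 thus ?thesis by (simp add: Cons)
qed simp

lemma pseudo_norm_onD:
 assumes "pseudo_norm_on V N" "f \<in> V"
 shows "N (%x. r * f x) = \<bar>r\<bar> * N f" "g \<in> V ==> N (%x. f x + g x) \<le> N f + N g" using assms by (simp_all add: pseudo_norm_on_def)

text \<open>The margin makes room around 0 inside subbasic balls that are centred elsewhere.\<close>

lemma compact_strict_bound: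
 fixes h :: "'e::euclidean_space => real"
 assumes "compact K" "continuous_on K h" "!!y. y \<in> K ==> \<bar>h y\<bar> < \<epsilon>" "\<epsilon> > 0"
 shows "\<exists>\<delta>>0. \<forall>y\<in>K. \<bar>h y\<bar> \<le> \<epsilon> - \<delta>"
proof (cases "K = {}")
 case False
 obtain x where "x \<in> K" "!!y. y \<in> K ==> \<bar>h y\<bar> \<le> \<bar>h x\<bar>"
  using continuous_attains_sup[OF assms(1) False continuous_on_rabs[OF assms(2)]] by blast
 thus ?thesis using assms(3)[of x] by (intro exI[of _ "\<epsilon> - \<bar>h x\<bar>"]) simp
qed (use assms(4) in auto)

context symplectic_manifold
begin

abbreviation "Z \<equiv> zero_mean_functions \<A> \<omega>"

definition control :: "('a, 'e) chart \<times> 'e set \<times> 'e list => bool" where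
 "control k \<longleftrightarrow> fst k \<in> \<A> \<and> compact (fst (snd k)) \<and> fst (snd k) \<subseteq> chart_image (fst k)"

definition local_deriv :: "('a => real) => ('a, 'e) chart \<times> 'e set \<times> 'e list => 'e => real" where
 "local_deriv g k = iter_deriv (snd (snd k)) (%z. g (chart_inv (fst k) z))"

lemma local_deriv_add:
 assumes "smooth_fun \<A> f" "smooth_fun \<A> g" "control k" "y \<in> fst (snd k)"
 shows "local_deriv (%x. f x + g x) k y = local_deriv f k y + local_deriv g k y" "local_deriv (%x. r * f x) k y = r * local_deriv f k y"
proof -
 have k: "fst k \<in> \<A>" "y \<in> chart_image (fst k)" using assms(3,4) by (auto simp: control_def)
 show "local_deriv (%x. f x + g x) k y = local_deriv f k y + local_deriv g k y"
  unfolding local_deriv_def by (rule iter_deriv_add[OF smooth_funD[OF assms(1) k(1)] smooth_funD[OF assms(2) k(1)] k(2)])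
 show "local_deriv (%x. r * f x) k y = r * local_deriv f k y"
  unfolding local_deriv_def by (rule iter_deriv_linear[OF bounded_linear_mult_right smooth_funD[OF assms(1) k(1)] k(2)])
qed

text \<open>Subbasic balls have arbitrary centres f. If one contains 0, then by compactness of K the
  strict inequality leaves a margin \<delta>, and the functions of size less than \<delta> in the
  same seminorm belong to it.\<close>

lemma smooth_neighbourhood:
 assumes "generate_topology_on {smooth_ball \<A> c K vs f \<epsilon> | c K vs f \<epsilon>. c \<in> \<A> \<and> compact K \<and> K \<subseteq> chart_image c \<and> smooth_fun \<A> f \<and> 0 < \<epsilon>} T"
 shows "(%x. 0) \<in> T ==> \<exists>\<K> \<epsilon>. finite \<K> \<and> \<epsilon> > 0 \<and> (\<forall>k\<in>\<K>. control k) \<and>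
  (\<forall>g. smooth_fun \<A> g --> (\<forall>k\<in>\<K>. \<forall>y\<in>fst (snd k). \<bar>local_deriv g k y\<bar> < \<epsilon>) --> g \<in> T)" using assms
proof (induction rule: generate_topology_on.induct)
 case (Int a b)
 obtain Ka ea where a: "finite Ka" "ea > 0" "\<forall>k\<in>Ka. control k"
  "\<forall>g. smooth_fun \<A> g --> (\<forall>k\<in>Ka. \<forall>y\<in>fst (snd k). \<bar>local_deriv g k y\<bar> < ea) --> g \<in> a" using Int by blast
 obtain Kb eb where b: "finite Kb" "eb > 0" "\<forall>k\<in>Kb. control k"
  "\<forall>g. smooth_fun \<A> g --> (\<forall>k\<in>Kb. \<forall>y\<in>fst (snd k). \<bar>local_deriv g k y\<bar> < eb) --> g \<in> b" using Int by blast
 show ?case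
 proof (intro exI[of _ "Ka \<union> Kb"] exI[of _ "min ea eb"] conjI allI impI)
  fix g assume g: "smooth_fun \<A> g" "\<forall>k\<in>Ka \<union> Kb. \<forall>y\<in>fst (snd k). \<bar>local_deriv g k y\<bar> < min ea eb"
  have "g \<in> a" by (rule a(4)[rule_format, OF g(1)]) (use g(2) in auto)
  moreover have "g \<in> b" by (rule b(4)[rule_format, OF g(1)]) (use g(2) in auto)
  ultimately show "g \<in> a \<inter> b" by blast
 qed (use a b in auto)
next
 case (UN F)
 then obtain t where t: "t \<in> F" "(%x. 0) \<in> t" by blast
 obtain \<K> \<epsilon> where "finite \<K>" "\<epsilon> > 0" "\<forall>k\<in>\<K>. control k"
  "\<forall>g. smooth_fun \<A> g --> (\<forall>k\<in>\<K>. \<forall>y\<in>fst (snd k). \<bar>local_deriv g k y\<bar> < \<epsilon>) --> g \<in> t" using UN.IH[OF t] by blast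
 thus ?case using t(1) by (intro exI[of _ \<K>] exI[of _ \<epsilon>]) blast
next
 case (Basis T)
 then obtain c K vs f \<epsilon> where T: "T = smooth_ball \<A> c K vs f \<epsilon>" and c: "c \<in> \<A>" "compact K" "K \<subseteq> chart_image c"
  and f: "smooth_fun \<A> f" and e: "0 < \<epsilon>" by blast
 define k where "k = (c, K, vs)"
 have k: "control k" using c by (simp add: k_def control_def)
 have mf: "smooth_fun \<A> (%x. (-1) * f x)" by (intro smooth_fun_intros(4) smooth_fun_intros(1) f)
 have lk: "local_deriv (%x. g x + (-1) * f x) k y = iter_deriv vs (%z. g (chart_inv c z) - f (chart_inv c z)) y" for g y by (simp add: local_deriv_def k_def)
 have "\<bar>local_deriv (%x. (-1) * f x) k y\<bar> < \<epsilon>" if "y \<in> K" for y using Basis(2) that lk[of "%x. 0" y] by (simp add: T smooth_ball_def)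
 moreover have "continuous_on K (local_deriv (%x. (-1) * f x) k)" unfolding local_deriv_def k_def fst_conv snd_conv
  by (rule continuous_on_subset[OF smooth_cont[OF smooth_iter_deriv[OF smooth_funD[OF mf c(1)]]] c(3)])
 ultimately obtain \<delta> where \<delta>: "\<delta> > 0" "!!y. y \<in> K ==> \<bar>local_deriv (%x. (-1) * f x) k y\<bar> \<le> \<epsilon> - \<delta>"
  using compact_strict_bound[OF c(2) _ _ e] by blast
 have "g \<in> T" if g: "smooth_fun \<A> g" "\<forall>y\<in>K. \<bar>local_deriv g k y\<bar> < \<delta>" for g unfolding T smooth_ball_def
 proof (intro CollectI conjI ballI g(1))
  fix y assume y: "y \<in> K"
  have "local_deriv (%x. g x + (-1) * f x) k y = local_deriv g k y + local_deriv (%x. (-1) * f x) k y" by (rule local_deriv_add(1)[OF g(1) mf k]) (simp add: k_def y)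
  thus "\<bar>iter_deriv vs (%z. g (chart_inv c z) - f (chart_inv c z)) y\<bar> < \<epsilon>"
   using \<delta>(2)[OF y] g(2)[rule_format, OF y] unfolding lk[symmetric] by linarith
 qed
 thus ?case using k \<delta>(1) by (intro exI[of _ "{k}"] exI[of _ \<delta>]) (simp add: k_def)
qed simp

lemma Z_iff: "f \<in> Z \<longleftrightarrow> smooth_fun \<A> f \<and> Lint f = 0" by (simp add: zero_mean_functions_def)

lemma Lint_zero: "Lint (%x. 0) = 0" using Lint_linear(2)[of "%x. 0" "%x. 0" 0] by simp

text \<open>The set where N < 1 is a neighbourhood of 0, so it contains all functions in Z for which
  finitely many local derivatives are small; homogeneity turns this into a linear bound.\<close>

lemma continuous_seminorm_bound:
 assumes pn: "pseudo_norm_on Z N" and cont: "continuous_map (subtopology (smooth_topology \<A>) Z) euclideanreal N"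
 obtains \<K> C where "finite \<K>" "C \<ge> 0" "!!k. k \<in> \<K> ==> control k"
  "!!f M. f \<in> Z ==> M > 0 ==> (!!k y. k \<in> \<K> ==> y \<in> fst (snd k) ==> \<bar>local_deriv f k y\<bar> \<le> M) ==> N f \<le> C * M"
proof -
 have 0: "(%x. 0) \<in> Z" by (simp add: Z_iff smooth_fun_intros(1) Lint_zero)
 have scale: "N (%x. r * f x) = \<bar>r\<bar> * N f" if "f \<in> Z" for r f by (rule pseudo_norm_onD(1)[OF pn that])
 have N0: "N (%x. 0) = 0" using scale[OF 0, of 0] by simp
 have "openin (subtopology (smooth_topology \<A>) Z) {f \<in> topspace (subtopology (smooth_topology \<A>) Z). N f \<in> {..<1}}"
  by (rule openin_continuous_map_preimage[OF cont]) simp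
 then obtain T where T: "openin (smooth_topology \<A>) T" "{f \<in> topspace (subtopology (smooth_topology \<A>) Z). N f \<in> {..<1}} = T \<inter> Z"
  unfolding openin_subtopology by blast
 obtain c where c: "c \<in> \<A>" using chart_cover by blast
 have "(%x. 0) \<in> topspace (smooth_topology \<A>)" unfolding smooth_topology_def topology_generated_by_topspace
 proof (rule UnionI)
  show "smooth_ball \<A> c {} [] (%x. 0) 1 \<in> {smooth_ball \<A> c K vs f \<epsilon> | c K vs f \<epsilon>. c \<in> \<A> \<and> compact K \<and> K \<subseteq> chart_image c \<and> smooth_fun \<A> f \<and> 0 < \<epsilon>}"
   using c smooth_fun_intros(1)[of 0] by (intro CollectI exI[of _ c] exI[of _ "{}"] exI[of _ "[]"] exI[of _ "%x. 0"] exI[of _ "1 :: real"]) simp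
  show "(%x. 0) \<in> smooth_ball \<A> c {} [] (%x. 0) 1" using smooth_fun_intros(1)[of 0] by (simp add: smooth_ball_def)
 qed
 hence "(%x. 0) \<in> {f \<in> topspace (subtopology (smooth_topology \<A>) Z). N f \<in> {..<1}}" using 0 N0 by simp
 hence 0: "(%x. 0) \<in> T" unfolding T(2) by blast
 have "generate_topology_on {smooth_ball \<A> c K vs f \<epsilon> | c K vs f \<epsilon>. c \<in> \<A> \<and> compact K \<and> K \<subseteq> chart_image c \<and> smooth_fun \<A> f \<and> 0 < \<epsilon>} T"
  using T(1) unfolding smooth_topology_def openin_topology_generated_by_iff .
 from smooth_neighbourhood[OF this 0]
 obtain \<K> \<epsilon> where k: "finite \<K>" "\<epsilon> > 0" "\<forall>k\<in>\<K>. control k"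
  "\<forall>g. smooth_fun \<A> g --> (\<forall>k\<in>\<K>. \<forall>y\<in>fst (snd k). \<bar>local_deriv g k y\<bar> < \<epsilon>) --> g \<in> T" by blast
 have "N f \<le> (2 / \<epsilon>) * M" if f: "f \<in> Z" and M: "M > 0" and b: "!!k y. k \<in> \<K> ==> y \<in> fst (snd k) ==> \<bar>local_deriv f k y\<bar> \<le> M" for f M
 proof -
  have fs: "smooth_fun \<A> f" using f by (simp add: Z_iff)
  \<comment> \<open>The factor 1/2 makes the bounds on the derivatives strict.\<close>
  define g where "g x = (\<epsilon> / (2 * M)) * f x" for x
  have gs: "smooth_fun \<A> g" unfolding g_def[abs_def] by (intro smooth_fun_intros(4) smooth_fun_intros(1) fs)
  have gZ: "g \<in> Z" using f Lint_linear(2)[OF smooth_fun_cont[OF fs] smooth_fun_cont[OF fs], of "\<epsilon> / (2 * M)"] gs by (simp add: Z_iff g_def[abs_def])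
  have "\<bar>local_deriv g k y\<bar> < \<epsilon>" if ky: "k \<in> \<K>" "y \<in> fst (snd k)" for k y
  proof -
   have "local_deriv g k y = (\<epsilon> / (2 * M)) * local_deriv f k y" unfolding g_def[abs_def] by (rule local_deriv_add(2)[OF fs fs k(3)[rule_format, OF ky(1)] ky(2)])
   also have "\<bar>...\<bar> = (\<epsilon> / (2 * M)) * \<bar>local_deriv f k y\<bar>" using k(2) M by (simp add: abs_mult)
   also have "... \<le> (\<epsilon> / (2 * M)) * M" using b[OF ky] k(2) M by (intro mult_left_mono) auto
   also have "... < \<epsilon>" using k(2) M by simp
   finally show ?thesis .
  qed
  hence "g \<in> T" using k(4)[rule_format, OF gs] by simp
  hence "g \<in> T \<inter> Z" using gZ by simp
  hence "N g < 1" unfolding T(2)[symmetric] by simp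
  hence "\<epsilon> / (2 * M) * N f < 1" using scale[OF f, of "\<epsilon> / (2 * M)"] k(2) M by (simp add: g_def[abs_def])
  thus ?thesis using k(2) M by (simp add: field_simps)
 qed
 moreover have "2 / \<epsilon> \<ge> 0" using k(2) by simp
 ultimately show thesis by (intro that[OF k(1), of "2 / \<epsilon>"]) (use k(3) in auto)
qed

text \<open>No positivity of the volume is needed: if it were 0, then \<open>mean f = 0\<close> by division by zero, and \<open>Lint f = 0\<close> anyway.\<close>

definition mean :: "('a => real) => real" where "mean f = Lint f / Lint (%x. 1)"

lemma mean:
 assumes f: "smooth_fun \<A> f" and g: "smooth_fun \<A> g"
 shows "mean (%x. f x + g x) = mean f + mean g" "mean (%x. r * f x) = r * mean f"
 using Lint_linear[OF smooth_fun_cont[OF f] smooth_fun_cont[OF g]] by (simp_all add: mean_def add_divide_distrib)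

lemma mean_bound:
 assumes f: "smooth_fun \<A> f" and B: "!!x. \<bar>f x\<bar> \<le> B"
 shows "\<bar>mean f\<bar> \<le> B"
proof -
 have B0: "0 \<le> B" using B[of undefined] by simp
 have "0 \<le> Lint (%x. 1)" using Lint_bound[of "%x. 1" 1] by simp
 thus ?thesis using Lint_bound[OF smooth_fun_cont[OF f] B] B0 by (cases "Lint (%x. 1) = 0") (simp_all add: mean_def abs_divide divide_le_eq)
qed

lemma bounded_smooth_fun:
 assumes f: "smooth_fun \<A> f" obtains B where "!!x. \<bar>f x\<bar> \<le> B"
proof -
 have "compact (range f)" using M by (intro compact_continuous_image[OF smooth_fun_cont[OF f]]) (simp add: closed_symplectic_manifold_def closed_manifold_def)
 then obtain B where "!!y. y \<in> range f ==> \<bar>y\<bar> \<le> B" using compact_imp_bounded[of "range f"] unfolding bounded_iff by auto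
 thus thesis using that by blast
qed

lemma minus_mean:
 assumes f: "smooth_fun \<A> f" shows "(%x. f x - mean f) \<in> Z"
proof -
 have "Lint (%x. (- mean f) * 1) = (- mean f) * Lint (%x. 1)" by (rule Lint_linear(2)[OF continuous_on_const continuous_on_const])
 hence "Lint (%x. f x + (- mean f) * 1) = Lint f + (- mean f) * Lint (%x. 1)"
  using Lint_linear(1)[OF smooth_fun_cont[OF f] continuous_on_const, of "(- mean f) * 1"] by simp
 also have "... = 0"
 proof (cases "Lint (%x. 1) = 0")
  case True
  obtain B where B: "!!x. \<bar>f x\<bar> \<le> B" by (rule bounded_smooth_fun[OF f]) blast
  have "Lint f = 0" using Lint_bound[OF smooth_fun_cont[OF f] B] True by simp
  thus ?thesis using True by simp
 qed (simp add: mean_def)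
 finally show ?thesis using smooth_fun_intros(3)[OF f smooth_fun_intros(1)] by (simp add: Z_iff)
qed

end

context darboux
begin

lemma push_linear: "push (%q. f q + g q) = (%x. push f x + push g x)" "push (%q. r * f q) = (%x. r * push f x)" by (auto simp: push_def)

text \<open>N is defined to be a seminorm on mean-zero functions only, so the mean of the pushed
  function is subtracted first; invariance then requires that the transported flows preserve the
  mean.\<close>

lemma invariant_seminorm:
 assumes pn: "pseudo_norm_on Z N" and inv: "\<forall>f\<in>Z. \<forall>\<phi>\<in>Ham \<A> \<omega>. N (f \<circ> inv \<phi>) = N f"
  and cont: "continuous_map (subtopology (smooth_topology \<A>) Z) euclideanreal N"
 obtains W C where "inv_seminorm \<Omega> (%g. N (%x. push g x - mean (push g))) W C"
proof -
 define n where "n g = N (%x. push g x - mean (push g))" for g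
 obtain \<K> C where k: "finite \<K>" "C \<ge> 0" "!!k. k \<in> \<K> ==> control k"
  "!!f M. f \<in> Z ==> M > 0 ==> (!!k y. k \<in> \<K> ==> y \<in> fst (snd k) ==> \<bar>local_deriv f k y\<bar> \<le> M) ==> N f \<le> C * M"
  by (rule continuous_seminorm_bound[OF pn cont]) blast
 have "\<forall>k\<in>\<K>. \<exists>z. finite (fst z) \<and> 0 \<le> snd z \<and> (\<forall>g M y. test_fun 3 g --> (\<forall>ws\<in>fst z. \<forall>q. \<bar>iter_deriv ws g q\<bar> \<le> M) --> y \<in> fst (snd k)
   --> \<bar>local_deriv (push g) k y\<bar> \<le> snd z * M)"
 proof
  fix k assume "k \<in> \<K>"
  hence "fst k \<in> \<A>" "compact (fst (snd k))" "fst (snd k) \<subseteq> chart_image (fst k)" using k(3) by (auto simp: control_def)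
  then obtain W' C' where "finite W'" "0 \<le> C'" "!!g M y. test_fun 3 g ==> (!!ws q. ws \<in> W' ==> \<bar>iter_deriv ws g q\<bar> \<le> M)
   ==> y \<in> fst (snd k) ==> \<bar>iter_deriv (snd (snd k)) (%y. push g (chart_inv (fst k) y)) y\<bar> \<le> C' * M" by (rule push_bound) blast
  thus "\<exists>z. finite (fst z) \<and> 0 \<le> snd z \<and> (\<forall>g M y. test_fun 3 g --> (\<forall>ws\<in>fst z. \<forall>q. \<bar>iter_deriv ws g q\<bar> \<le> M) --> y \<in> fst (snd k)
   --> \<bar>local_deriv (push g) k y\<bar> \<le> snd z * M)" unfolding local_deriv_def by (intro exI[of _ "(W', C')"]) simp
 qed
 then obtain z where z: "!!k. k \<in> \<K> ==> finite (fst (z k))" "!!k. k \<in> \<K> ==> 0 \<le> snd (z k)"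
  "!!k g M y. k \<in> \<K> ==> test_fun 3 g ==> \<forall>ws\<in>fst (z k). \<forall>q. \<bar>iter_deriv ws g q\<bar> \<le> M ==> y \<in> fst (snd k) ==> \<bar>local_deriv (push g) k y\<bar> \<le> snd (z k) * M"
  unfolding bchoice_iff by blast
 \<comment> \<open>The empty list makes M a bound for the values as well, and thereby for the
   mean.\<close>
 define W where "W = insert [] (\<Union>k\<in>\<K>. fst (z k))"
 \<comment> \<open>The 1 accounts for the derivatives of the constant
   \<open>mean (push g)\<close>.\<close>
 define C1 where "C1 = (\<Sum>k\<in>\<K>. snd (z k)) + 1"
 have C1: "C1 \<ge> 1" unfolding C1_def using z(2) by (simp add: sum_nonneg)
 have bound: "n g \<le> C * (C1 * M)" if g: "test_fun 3 g" and M: "!!ws q. ws \<in> W ==> \<bar>iter_deriv ws g q\<bar> \<le> M" "M > 0" for g M unfolding n_def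
 proof (rule k(4)[OF minus_mean[OF smooth_push[OF g]]])
  show "C1 * M > 0" using C1 M(2) by simp
  fix k y assume ky: "k \<in> \<K>" "y \<in> fst (snd k)"
  have "\<bar>push g x\<bar> \<le> M" for x using M(1)[of "[]" "Q x"] M(2) by (simp add: push_def W_def)
  hence m: "\<bar>mean (push g)\<bar> \<le> M" by (rule mean_bound[OF smooth_push[OF g]])
  have "local_deriv (%x. push g x + (- mean (push g))) k y = local_deriv (push g) k y + local_deriv (%x. - mean (push g)) k y"
   by (rule local_deriv_add(1)[OF smooth_push[OF g] smooth_fun_intros(1) k(3)[OF ky(1)] ky(2)])
  moreover have "\<bar>local_deriv (%x. - mean (push g)) k y\<bar> \<le> M"
   unfolding local_deriv_def using iter_deriv_const_bound[of "snd (snd k)" "- mean (push g)" y] m by simp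
  moreover have "\<bar>local_deriv (push g) k y\<bar> \<le> snd (z k) * M" by (rule z(3)[OF ky(1) g _ ky(2)]) (use M(1) ky(1) in \<open>auto simp: W_def\<close>)
  moreover have "snd (z k) * M \<le> (\<Sum>k\<in>\<K>. snd (z k)) * M" using M(2) by (intro mult_right_mono member_le_sum ky(1) k(1) z(2)) auto
  ultimately show "\<bar>local_deriv (%x. push g x - mean (push g)) k y\<bar> \<le> C1 * M" by (simp add: C1_def algebra_simps)
 qed
 have "inv_seminorm \<Omega> n W (C * C1)"
 proof (unfold_locales)
  show "finite W" unfolding W_def using k(1) z(1) by auto
 next
  fix f g :: "'e => real" assume f: "test_fun 3 f" and g: "test_fun 3 g"
  have "N (%x. (push f x - mean (push f)) + (push g x - mean (push g))) \<le> n f + n g"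
   unfolding n_def by (rule pseudo_norm_onD(2)[OF pn minus_mean[OF smooth_push[OF f]] minus_mean[OF smooth_push[OF g]]])
  moreover have "(%x. (push f x - mean (push f)) + (push g x - mean (push g))) = (%x. push (%q. f q + g q) x - mean (push (%q. f q + g q)))"
   unfolding push_linear by (simp add: mean[OF smooth_push[OF f] smooth_push[OF g]] algebra_simps fun_eq_iff)
  ultimately show "n (%q. f q + g q) \<le> n f + n g" unfolding n_def by simp
 next
  fix f :: "'e => real" and r assume f: "test_fun 3 f"
  have "N (%x. r * (push f x - mean (push f))) = \<bar>r\<bar> * n f" unfolding n_def by (rule pseudo_norm_onD(1)[OF pn minus_mean[OF smooth_push[OF f]]])
  moreover have "(%x. r * (push f x - mean (push f))) = (%x. push (%q. r * f q) x - mean (push (%q. r * f q)))"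
   unfolding push_linear by (simp add: mean[OF smooth_push[OF f] smooth_push[OF f]] algebra_simps)
  ultimately show "n (%q. r * f q) = \<bar>r\<bar> * n f" unfolding n_def by simp
 next
  fix f :: "'e => real" and M assume f: "test_fun 3 f" and M: "!!ws q. ws \<in> W ==> \<bar>iter_deriv ws f q\<bar> \<le> M"
  have M0: "0 \<le> M" using M[of "[]" 0] by (simp add: W_def)
  show "n f \<le> C * C1 * M"
  \<comment> \<open>\<open>bound\<close> is stated for positive M; the case M = 0 is reached as a
    limit.\<close>
  proof (rule field_le_epsilon)
   fix e :: real assume e: "e > 0"
   define \<eta> where "\<eta> = e / (C * C1 + 1)"
   have CC: "0 \<le> C * C1" using k(2) C1 by simp
   have \<eta>: "\<eta> > 0" using e CC by (simp add: \<eta>_def)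
   have "n f \<le> C * (C1 * (M + \<eta>))"
   proof (rule bound[OF f])
    show "\<bar>iter_deriv ws f q\<bar> \<le> M + \<eta>" if "ws \<in> W" for ws q using M[OF that, of q] \<eta> by simp
   qed (use M0 \<eta> in simp)
   also have "... = C * C1 * M + C * C1 * \<eta>" by (simp add: algebra_simps)
   also have "C * C1 * \<eta> \<le> e" using e CC by (simp add: \<eta>_def field_simps)
   finally show "n f \<le> C * C1 * M + e" by simp
  qed
 next
  fix h \<phi> \<psi> and f :: "'e => real" assume hi: "ham_iso \<Omega> h \<phi> \<psi>" and f: "test_fun 3 f"
  obtain \<Phi> where \<Phi>: "\<Phi> \<in> Ham \<A> \<omega>" "!!g. test_fun 3 g ==> push g \<circ> inv \<Phi> = push (%q. g (\<psi> q))" "!!g. (%x. g) \<circ> inv \<Phi> = (%x. g :: real)"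
   by (rule ham_transport[OF hi]) blast
  have "mean (push (%q. f (\<psi> q))) = mean (push f)" by (simp add: mean_def Lint_ham_iso(2)[OF hi f])
  moreover have "push f (inv \<Phi> x) = push (%q. f (\<psi> q)) x" for x using fun_cong[OF \<Phi>(2)[OF f], of x] by simp
  ultimately have "(%x. push (%q. f (\<psi> q)) x - mean (push (%q. f (\<psi> q)))) = (%x. push f x - mean (push f)) \<circ> inv \<Phi>" by (simp add: fun_eq_iff)
  thus "n (%q. f (\<psi> q)) = n f" unfolding n_def using inv \<Phi>(1) minus_mean[OF smooth_push[OF f]] by simp
 qed (rule \<Omega>)+
 thus thesis using that unfolding n_def by blast
qed

text \<open>P is injective on \<open>cube 4\<close>, so h o P vanishes on the part of the open cube
  outside \<open>cube 1\<close> and extends smoothly by 0.\<close>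

lemma pull:
 assumes h: "smooth_fun \<A> h" and supp: "!!y. h y ~= 0 ==> y \<in> P ` cube 1" and B: "!!y. \<bar>h y\<bar> \<le> B"
 obtains g where "test_fun 1 g" "push g = h" "!!q. \<bar>g q\<bar> \<le> B"
proof -
 define g where "g q = (if q \<in> open_cube then h (P q) else 0)" for q
 have c14: "q \<in> cube 4" if "q \<in> cube 1" for q :: 'e using that cube_mono[of 1 4] by auto
 have c1o: "cube 1 \<subseteq> (open_cube :: 'e set)" using open_cube(2) cube_mono[of 1 3] by auto
 have hz: "h (P q) = 0" if "q \<in> open_cube" "q \<notin> cube 1" for q
 proof (rule ccontr)
  assume "h (P q) ~= 0"
  then obtain q' where "q' \<in> cube 1" "P q = P q'" using supp by blast
  hence "q = q'" using P(2)[of q] P(2)[OF c14, of q'] that(1) open_cube(3) by auto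
  thus False using \<open>q' \<in> cube 1\<close> that(2) by simp
 qed
 have "smooth open_cube (%q. h (P q))" unfolding P_def
  by (rule smooth_compose[OF smooth_funD[OF h c0] smooth_subset[OF \<Theta>(1) subset_UNIV open_cube(1)]]) (use \<Theta>_chart open_cube(3) in auto)
 hence "smooth UNIV g" unfolding g_def[abs_def] by (rule smooth_extend_zero[OF _ closed_cube c1o]) (simp add: hz)
 hence "test_fun 1 g" using hz by (simp add: test_fun_def g_def)
 moreover have "push g = h"
 proof
  fix y
  show "push g y = h y"
  proof (cases "y \<in> fst c0 \<and> Q y \<in> open_cube")
   case True
   thus ?thesis using P(3)[of y] by (simp add: push_def g_def)
  next
   case False
   have "h y = 0"
   proof (rule ccontr)
    assume "h y ~= 0"
    then obtain q where q: "q \<in> cube 1" "y = P q" using supp by blast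
    thus False using False P(1,2)[OF c14[OF q(1)]] c1o by auto
   qed
   thus ?thesis using False by (auto simp: push_def g_def)
  qed
 qed
 moreover have "\<bar>g q\<bar> \<le> B" for q using B[of "P q"] order_trans[OF abs_ge_zero B[of "P q"]] by (simp add: g_def)
 ultimately show thesis by (rule that)
qed

end

section \<open>Gluing the local bounds\<close>

theorem theorem1p3:
  fixes \<A> :: "('a::t2_space, 'e::euclidean_space) chart set"
    and \<omega> :: "('a, 'e) two_form"
    and N :: "('a \<Rightarrow> real) \<Rightarrow> real"
  assumes "closed_symplectic_manifold \<A> \<omega>"
    and "pseudo_norm_on (zero_mean_functions \<A> \<omega>) N"
    and "\<forall>f\<in>zero_mean_functions \<A> \<omega>. \<forall>\<phi>\<in>Ham \<A> \<omega>. N (f \<circ> inv \<phi>) = N f"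
    and "continuous_map (subtopology (smooth_topology \<A>) (zero_mean_functions \<A> \<omega>))
           euclideanreal N"
  shows "\<exists>C. \<forall>f\<in>zero_mean_functions \<A> \<omega>. N f \<le> C * sup_norm f"
proof -
 interpret symplectic_manifold \<A> \<omega> by unfold_locales (rule assms(1))
 obtain X c \<Theta> \<Theta>' \<Omega> and \<rho> :: "'a => 'a => real" where X: "finite X" and d: "!!x. darboux \<A> \<omega> (c x) (\<Theta> x) (\<Theta>' x) (\<Omega> x)" and \<rho>: "!!x. smooth_fun \<A> (\<rho> x)"
  "!!x y. 0 \<le> \<rho> x y" "!!y. (\<Sum>x\<in>X. \<rho> x y) = 1" "!!x y. \<rho> x y ~= 0 ==> y \<in> darboux.P (c x) (\<Theta> x) ` cube 1"
  by (rule darboux_partition) (assumption | rule that)+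
 have "\<exists>C\<ge>0. \<forall>g B. smooth_fun \<A> g --> (\<forall>y. g y ~= 0 --> y \<in> darboux.P (c x) (\<Theta> x) ` cube 1) --> (\<forall>y. \<bar>g y\<bar> \<le> B) --> B > 0 --> N (%y. g y - mean g) \<le> C * B" for x
 proof -
  interpret dx: darboux \<A> \<omega> "c x" "\<Theta> x" "\<Theta>' x" "\<Omega> x" by (rule d)
  obtain W C0 where "inv_seminorm (\<Omega> x) (%g. N (%y. dx.push g y - mean (dx.push g))) W C0" by (rule dx.invariant_seminorm[OF assms(2-4)])
  then interpret inv_seminorm "\<Omega> x" "%g. N (%y. dx.push g y - mean (dx.push g))" W C0 .
  obtain C where C: "C \<ge> 0" "!!f B. test_fun 1 f ==> (!!q. \<bar>f q\<bar> \<le> B) ==> B > 0 ==> N (%y. dx.push f y - mean (dx.push f)) \<le> C * B"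
   using n_sup_bound by blast
  have "N (%y. g y - mean g) \<le> C * B" if g: "smooth_fun \<A> g" "!!y. g y ~= 0 ==> y \<in> dx.P ` cube 1" "!!y. \<bar>g y\<bar> \<le> B" "B > 0" for g B
  proof -
   obtain f where f: "test_fun 1 f" "dx.push f = g" "!!q. \<bar>f q\<bar> \<le> B" using dx.pull[OF g(1-3)] by blast
   show ?thesis using C(2)[OF f(1,3) g(4)] by (simp add: f(2))
  qed
  thus ?thesis using C(1) by blast
 qed
 then obtain C where C: "!!x. C x \<ge> 0" "!!x g B. smooth_fun \<A> g ==> (!!y. g y ~= 0 ==> y \<in> darboux.P (c x) (\<Theta> x) ` cube 1) ==> (!!y. \<bar>g y\<bar> \<le> B) ==> B > 0
   ==> N (%y. g y - mean g) \<le> C x * B" by metis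
 have "N f \<le> (\<Sum>x\<in>X. C x) * sup_norm f" if f: "f \<in> Z" for f
 proof (rule field_le_epsilon)
  fix e :: real assume e: "e > 0"
  have fs: "smooth_fun \<A> f" and f0: "Lint f = 0" using f by (simp_all add: Z_iff)
  obtain b where b: "!!x. \<bar>f x\<bar> \<le> b" by (rule bounded_smooth_fun[OF fs]) blast
  define K where "K = (\<Sum>x\<in>X. C x)"
  have K: "K \<ge> 0" unfolding K_def by (rule sum_nonneg[OF C(1)])
  \<comment> \<open>The local bounds ask for B > 0, also when f = 0. The excess over the norm is
    chosen so that K times it is at most e.\<close>
  define B where "B = sup_norm f + e / (K + 1)"
  have sup: "\<bar>f x\<bar> \<le> sup_norm f" for x unfolding sup_norm_def by (rule cSUP_upper) (auto intro: bdd_aboveI2[where M=b] b)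
  have B: "\<bar>f x\<bar> \<le> B" "B > 0" for x using sup[of x] e K abs_ge_zero[of "f x"] divide_pos_pos[of e "K + 1"] unfolding B_def by linarith+
  define g where "g x y = \<rho> x y * f y" for x y
  have gs: "smooth_fun \<A> (g x)" for x unfolding g_def[abs_def] by (rule smooth_fun_intros(4)[OF \<rho>(1) fs])
  have gB: "N (%y. g x y - mean (g x)) \<le> C x * B" if x: "x \<in> X" for x
  proof (rule C(2)[OF gs])
   show "y \<in> darboux.P (c x) (\<Theta> x) ` cube 1" if "g x y ~= 0" for y using that \<rho>(4)[of x y] by (simp add: g_def)
   show "\<bar>g x y\<bar> \<le> B" for y
   proof -
    have "\<rho> x y \<le> (\<Sum>x\<in>X. \<rho> x y)" by (rule member_le_sum[OF x _ X]) (rule \<rho>(2))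
    hence "\<bar>\<rho> x y\<bar> \<le> 1" using \<rho>(2,3) by simp
    hence "\<bar>g x y\<bar> \<le> 1 * B" unfolding g_def abs_mult using B by (intro mult_mono) auto
    thus ?thesis by simp
   qed
  qed (rule B)
  \<comment> \<open>One induction for all three claims: membership in Z feeds the triangle
    inequality for N, and additivity of the mean is used to recover f.\<close>
  have sum: "(%y. \<Sum>x\<in>Y. g x y - mean (g x)) \<in> Z \<and> N (%y. \<Sum>x\<in>Y. g x y - mean (g x)) \<le> (\<Sum>x\<in>Y. N (%y. g x y - mean (g x)))
    \<and> mean (%y. \<Sum>x\<in>Y. g x y) = (\<Sum>x\<in>Y. mean (g x))" if "finite Y" for Y using that
  proof induction
   case empty
   have Z0: "(%x. 0) \<in> Z" by (simp add: Z_iff smooth_fun_intros(1) Lint_zero)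
   from pseudo_norm_onD(1)[OF assms(2) Z0, of 0] show ?case using Z0 by (simp add: mean_def Lint_zero)
  next
   case (insert x Y)
   have Zx: "(%y. g x y - mean (g x)) \<in> Z" by (rule minus_mean[OF gs])
   have ZY: "(%y. \<Sum>x\<in>Y. g x y - mean (g x)) \<in> Z" using insert.IH by blast
   have "N (%y. (g x y - mean (g x)) + (\<Sum>x\<in>Y. g x y - mean (g x))) \<le> N (%y. g x y - mean (g x)) + N (%y. \<Sum>x\<in>Y. g x y - mean (g x))"
    by (rule pseudo_norm_onD(2)[OF assms(2) Zx ZY])
   moreover have "(%y. (g x y - mean (g x)) + (\<Sum>x\<in>Y. g x y - mean (g x))) \<in> Z"
    using Zx ZY smooth_fun_intros(2) Lint_linear(1)[OF smooth_fun_cont smooth_fun_cont] by (simp add: Z_iff)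
   moreover have "mean (%y. g x y + (\<Sum>x\<in>Y. g x y)) = mean (g x) + mean (%y. \<Sum>x\<in>Y. g x y)" by (rule mean(1)[OF gs smooth_fun_intros(6)[OF gs]])
   ultimately show ?case using insert by simp
  qed
  have fg: "(%y. \<Sum>x\<in>X. g x y) = f" using \<rho>(3) by (simp add: g_def flip: sum_distrib_right)
  \<comment> \<open>The means of the pieces add up to the mean of f, which is 0; subtracting them
    piece by piece therefore leaves f unchanged.\<close>
  have "(\<Sum>x\<in>X. mean (g x)) = 0" using sum[OF X] f0 unfolding fg by (simp add: mean_def)
  hence "(%y. \<Sum>x\<in>X. g x y - mean (g x)) = f" using fun_cong[OF fg] by (simp add: sum_subtractf)
  hence "N f \<le> (\<Sum>x\<in>X. N (%y. g x y - mean (g x)))" using sum[OF X] by simp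
  also have "... \<le> (\<Sum>x\<in>X. C x * B)" by (rule sum_mono[OF gB])
  also have "... = K * B" by (simp add: K_def sum_distrib_right)
  also have "... \<le> K * sup_norm f + e" using e K by (simp add: B_def field_simps)
  finally show "N f \<le> (\<Sum>x\<in>X. C x) * sup_norm f + e" by (simp add: K_def)
 qed
 thus ?thesis by blast
qed

end
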